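(* The covering number of the Janko group $J_1$ satisfies $5281\leq \sigma(J_1)\leq 5414$.
   Context: For a group $G$, a cover of $G$ is a finite collection $\{A_1,\dots,A_n\}$ of proper subgroups of $G$ with $G=\bigcup_{i=1}^n A_i$. The covering number $\sigma(G)$ is the smallest number of members in a cover of $G$. $J_1$ denotes the first Janko group, the sporadic simple group of order $175560$. *)

theory Defs
  imports "HOL-Analysis.Analysis" "HOL-Algebra.Elementary_Groups" "HOL-Library.Extended_Nat"
begin

text \<open>
  Covers of a group \<open>G\<close> by proper subgroups.  The covering number takes values in
  \<^typ>\<open>enat\<close>, so that it is \<open>\<infinity>\<close> (the infimum of the empty set) for groups without a cover,
  e.g. for cyclic groups.
\<close>

definition is_cover :: "('a, 'b) monoid_scheme \<Rightarrow> 'a set set \<Rightarrow> bool" where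
  "is_cover G C \<longleftrightarrow>
     finite C \<and> (\<forall>H\<in>C. subgroup H G \<and> H \<noteq> carrier G) \<and> \<Union>C = carrier G"

definition covering_number :: "('a, 'b) monoid_scheme \<Rightarrow> enat" where
  "covering_number G = (INF C \<in> {C. is_cover G C}. enat (card C))"

text \<open>
  The numeral type \<^typ>\<open>11\<close> of \<open>HOL-Library.Numeral_Type\<close>, with its arithmetic modulo 11, is
  the field with 11 elements.
\<close>

definition GL_7_11 :: "(11 ^ 7 ^ 7) monoid" where
  "GL_7_11 = \<lparr>carrier = {A. invertible A}, mult = (**), one = mat 1\<rparr>"

text \<open>
  The first Janko group, as originally defined by Janko: the subgroup of \<open>GL(7,11)\<close> generated by
  the matrices \<open>Y\<close> (of order 7) and \<open>Z\<close> (of order 5) below.  It is a simple group of order 175560,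
  and up to isomorphism the only one.
  The index type \<^typ>\<open>7\<close> consists of the residues modulo 7; the function \<^const>\<open>vector\<close> puts the
  members of a list at the positions \<open>1, \<dots>, 7\<close>, where \<open>7 = 0\<close>.
\<close>

definition janko_Y :: "11 ^ 7 ^ 7" where
  "janko_Y = vector
    [vector [0, 1, 0, 0, 0, 0, 0],
     vector [0, 0, 1, 0, 0, 0, 0],
     vector [0, 0, 0, 1, 0, 0, 0],
     vector [0, 0, 0, 0, 1, 0, 0],
     vector [0, 0, 0, 0, 0, 1, 0],
     vector [0, 0, 0, 0, 0, 0, 1],
     vector [1, 0, 0, 0, 0, 0, 0]]"

definition janko_Z :: "11 ^ 7 ^ 7" where
  "janko_Z = vector
    [vector [-3,  2, -1, -1, -3, -1, -3],
     vector [-2,  1,  1,  3,  1,  3,  3],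
     vector [-1, -1, -3, -1, -3, -3,  2],
     vector [-1, -3, -1, -3, -3,  2, -1],
     vector [-3, -1, -3, -3,  2, -1, -1],
     vector [ 1,  3,  3, -2,  1,  1,  3],
     vector [ 3,  3, -2,  1,  1,  3,  1]]"

definition J1 :: "(11 ^ 7 ^ 7) monoid" where
  "J1 = subgroup_generated GL_7_11 {janko_Y, janko_Z}"

end

theory Submission
  imports Defs "HOL-Number_Theory.Cong" "HOL-Algebra.Sylow"
begin

text \<open>
  The maximal subgroups of order 114 and 60 (normalizers of Sylow 19- and 3-subgroups) are forced by the elements of
  order 19 and 15: counting elements shows that a proper subgroup contains at most one of the relevant cyclic groups.
  The elements of order 11 and 7 are covered most cheaply by conjugates of a subgroup \<open>L\<close> of order 660 and
  of \<open>K = 2\<^sup>3:7:3\<close>.  Each Sylow 11-subgroup lies in exactly two conjugates of \<open>L\<close>, and each Sylow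
  7-subgroup in exactly two conjugates of \<open>K\<close>; so the conjugates that are not used form an independent set in
  a graph on the 266 cosets of \<open>L\<close>, respectively on the 1045 cosets of \<open>K\<close>.  The spectrum of the first graph
  bounds its independent sets by 78, and pentagons in the second graph bound its independent sets by 418, which gives
  the lower bound \<open>1540 + 2926 + 188 + 627\<close>.  Independent sets of sizes 70 and 294, found as unions of orbits of an
  element of order 7, give the upper bound \<open>1540 + 2926 + 196 + 751\<close>.
\<close>

text \<open>Only two matrices are given, and the maximal subgroups are never classified. The order
  of the group is squeezed: matrix identities show that five double cosets of \<open>L\<close> fill
  the group, which gives at most 175560 elements, and explicit subgroups make 175560 a divisor of
  the order. In place of a classification, every divisor m of the order is combined with every
  choice of Sylow numbers that Sylow's theorem and the orders of the normalizers allow, and a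
  subgroup of order m must have room for the elements so forced. The survivors show that no proper
  subgroup serves two of the four families of elements, and that all Sylow 11- or 7-subgroups of a
  proper subgroup lie in one conjugate of \<open>L\<close> or \<open>K\<close>. Hence each member of
  a cover can be charged to one coset. A Sylow subgroup lies in exactly two such conjugates because
  half of its normalizer lies in \<open>L\<close> or \<open>K\<close>. The number 78 is 266 * 5/17
  rounded down, from valency 12 and the estimate -5 for the smallest eigenvalue (-3 - 3 sqrt 5)/2;
  418 is 2/5 of 1045.\<close>

class grp = monoid_mult + inverse +
  assumes left_inverse_grp: "inverse a * a = 1"
    and divide_grp: "a / b = a * inverse b"
begin

sublocale grp: Groups.group "(*)" 1 inverse
  by standard (simp_all add: left_inverse_grp)

end

lemmas grp_simps = grp.left_inverse grp.right_inverse grp.inverse_inverse grp.inverse_distrib_swap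
  grp.inverse_neutral

lemma inv_cancel [simp]:
  fixes a b :: "'a::grp"
  shows "inverse a * a = 1" "a * inverse a = 1" "inverse a * (a * b) = b" "a * (inverse a * b) = b"
    "inverse (inverse a) = a" "inverse (1::'a) = 1" "inverse (a * b) = inverse b * inverse a"
  by (simp_all add: grp_simps mult.assoc [symmetric])

lemma grp_cancel [simp]:
  fixes a b c :: "'a::grp"
  shows "a * b = a * c \<longleftrightarrow> b = c" "b * a = c * a \<longleftrightarrow> b = c"
  by (rule grp.left_cancel, rule grp.right_cancel)

lemma inv_eq_iff:
  fixes a b :: "'a::grp"
  shows "inverse a = inverse b \<longleftrightarrow> a = b"
  by (metis inv_cancel(5))

lemma mult_eq_one_inv:
  fixes a b :: "'a::grp"
  shows "a * b = 1 \<longleftrightarrow> b = inverse a"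
  by (metis grp_cancel(1) inv_cancel(2))

subsection \<open>Subgroups and conjugation\<close>

text \<open>Subgroups are bare sets in a type that is itself the group, so intersection, inclusion
  and cardinality are those of sets.\<close>

definition sbg :: "'a::grp set \<Rightarrow> bool" where
  "sbg H \<longleftrightarrow> 1 \<in> H \<and> (\<forall>a\<in>H. \<forall>b\<in>H. a * b \<in> H) \<and> (\<forall>a\<in>H. inverse a \<in> H)"

lemma sbgI: "1 \<in> H \<Longrightarrow> (\<And>a b. a \<in> H \<Longrightarrow> b \<in> H \<Longrightarrow> a * b \<in> H) \<Longrightarrow> (\<And>a. a \<in> H \<Longrightarrow> inverse a \<in> H) \<Longrightarrow> sbg H"
  by (auto simp: sbg_def)

lemma sbgD:
  assumes "sbg H"
  shows "1 \<in> H" "a \<in> H \<Longrightarrow> b \<in> H \<Longrightarrow> a * b \<in> H" "a \<in> H \<Longrightarrow> inverse a \<in> H"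
  using assms by (auto simp: sbg_def)

lemma sbg_pow: "sbg H \<Longrightarrow> a \<in> H \<Longrightarrow> a ^ n \<in> H"
  by (induction n) (auto simp: sbgD)

lemma sbg_UNIV: "sbg UNIV"
  by (simp add: sbg_def)

lemma sbg_Int: "sbg H \<Longrightarrow> sbg K \<Longrightarrow> sbg (H \<inter> K)"
  by (auto simp: sbg_def)

lemma sbg_mult_iff:
  assumes "sbg H" "a \<in> H"
  shows "a * b \<in> H \<longleftrightarrow> b \<in> H" "b * a \<in> H \<longleftrightarrow> b \<in> H"
proof -
  show "a * b \<in> H \<longleftrightarrow> b \<in> H"
    using assms sbgD[OF assms(1)] by (metis inv_cancel(3))
  show "b * a \<in> H \<longleftrightarrow> b \<in> H"
    using assms sbgD[OF assms(1)] by (metis inv_cancel(2) mult.assoc mult.right_neutral)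
qed

lemma sbg_inverse_iff: "sbg H \<Longrightarrow> inverse a \<in> H \<longleftrightarrow> a \<in> H"
  by (metis inv_cancel(5) sbgD(3))

definition cj :: "'a::grp \<Rightarrow> 'a set \<Rightarrow> 'a set" where
  "cj g H = (\<lambda>h. g * h * inverse g) ` H"

lemma cj_iff: "a \<in> cj g H \<longleftrightarrow> inverse g * a * g \<in> H"
proof
  assume "a \<in> cj g H"
  then show "inverse g * a * g \<in> H" by (auto simp: cj_def mult.assoc)
next
  assume "inverse g * a * g \<in> H"
  moreover have "a = g * (inverse g * a * g) * inverse g" by (simp add: mult.assoc)
  ultimately show "a \<in> cj g H" unfolding cj_def by blast
qed

lemma cj_mult: "cj (g * h) H = cj g (cj h H)"
  by (auto simp: cj_iff mult.assoc)

lemma cj_one [simp]: "cj 1 H = H"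
  by (auto simp: cj_def)

lemma cj_inverse [simp]: "cj (inverse g) (cj g H) = H" "cj g (cj (inverse g) H) = H"
  by (simp_all add: cj_mult [symmetric])

lemma cj_mono_iff: "cj g A \<subseteq> cj g B \<longleftrightarrow> A \<subseteq> B"
  by (auto simp: cj_def)

lemma cj_inj: "cj g A = cj g B \<longleftrightarrow> A = B"
  by (metis cj_inverse(1))

lemma cj_eq_iff: "cj g A = B \<longleftrightarrow> A = cj (inverse g) B"
  by (metis cj_inverse)

lemma cj_subset_iff: "cj g A \<subseteq> B \<longleftrightarrow> A \<subseteq> cj (inverse g) B"
  by (metis cj_inverse(2) cj_mono_iff)

lemma card_cj [simp]: "card (cj g H) = card H"
  unfolding cj_def by (rule card_image) (auto simp: inj_on_def)

lemma sbg_cj: "sbg H \<Longrightarrow> sbg (cj g H)"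
proof (rule sbgI, unfold cj_iff)
  fix a b assume H: "sbg H" and ab: "inverse g * a * g \<in> H" "inverse g * b * g \<in> H"
  have "inverse g * (a * b) * g = (inverse g * a * g) * (inverse g * b * g)" by (simp add: mult.assoc)
  then show "inverse g * (a * b) * g \<in> H" using ab sbgD(2)[OF H] by metis
next
  fix a assume H: "sbg H" and a: "inverse g * a * g \<in> H"
  have "inverse g * inverse a * g = inverse (inverse g * a * g)" by (simp add: mult.assoc)
  then show "inverse g * inverse a * g \<in> H" using a sbgD(3)[OF H] by metis
qed (simp add: sbgD)

lemma cj_subset_self:
  assumes "sbg H" "A \<subseteq> H" "g \<in> H"
  shows "cj g A \<subseteq> H"
  using assms by (auto simp: cj_def sbg_def)

lemma cj_Int: "cj g (A \<inter> B) = cj g A \<inter> cj g B"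
  by (auto simp: cj_iff)

definition nrm :: "'a::grp set \<Rightarrow> 'a set" where
  "nrm H = {g. cj g H = H}"

lemma sbg_nrm: "sbg (nrm H)"
proof (rule sbgI)
  fix a assume "a \<in> nrm H"
  then have "cj a H = H" by (simp add: nrm_def)
  then have "cj (inverse a) H = cj (inverse a) (cj a H)" by simp
  then show "inverse a \<in> nrm H" by (simp add: nrm_def)
qed (simp_all add: nrm_def cj_mult)

lemma nrm_cj: "nrm (cj g H) = cj g (nrm H)"
proof -
  have "cj x (cj g H) = cj g H \<longleftrightarrow> cj (inverse g * x * g) H = H" for x
    by (simp only: cj_mult cj_eq_iff[of "inverse g"] inv_cancel(5))
  then have "x \<in> nrm (cj g H) \<longleftrightarrow> inverse g * x * g \<in> nrm H" for x by (simp only: nrm_def mem_Collect_eq)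
  then show ?thesis by (simp only: set_eq_iff cj_iff) simp
qed

lemma subset_nrm: "sbg H \<Longrightarrow> H \<subseteq> nrm H"
proof
  fix g assume H: "sbg H" and g: "g \<in> H"
  have "cj g H \<subseteq> H" using cj_subset_self[OF H _ g] by auto
  moreover
  have "cj (inverse g) H \<subseteq> H" using cj_subset_self[OF H _ sbgD(3)[OF H g]] by auto
  then have "H \<subseteq> cj g H" using cj_subset_iff[of "inverse g" H H] by simp
  ultimately show "g \<in> nrm H" unfolding nrm_def by blast
qed

lemma nrmI_finite: "finite H \<Longrightarrow> cj g H \<subseteq> H \<Longrightarrow> g \<in> nrm H"
  unfolding nrm_def by (simp add: card_subset_eq)

subsection \<open>Orbits\<close>

definition acts :: "'a::grp set \<Rightarrow> ('a \<Rightarrow> 'x \<Rightarrow> 'x) \<Rightarrow> bool" where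
  "acts P f \<longleftrightarrow> (\<forall>x. f 1 x = x) \<and> (\<forall>g\<in>P. \<forall>h\<in>P. \<forall>x. f (g * h) x = f g (f h x))"

text \<open>Every fibre of the map from g to \<open>f g x\<close> is a left translate of the
  stabilizer, so all fibres have the same size.\<close>

lemma orbit_stab:
  fixes P :: "'a::{grp,finite} set"
  assumes P: "sbg P" and f: "acts P f"
  shows "card ((\<lambda>g. f g x) ` P) * card {g\<in>P. f g x = x} = card P"
proof -
  have f1: "f 1 x = x" for x using f by (simp add: acts_def)
  have fm: "g \<in> P \<Longrightarrow> h \<in> P \<Longrightarrow> f (g * h) x = f g (f h x)" for g h x using f by (simp add: acts_def)
  have fib: "card {g\<in>P. f g x = y} = card {g\<in>P. f g x = x}" if y: "y \<in> (\<lambda>g. f g x) ` P" for y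
  proof -
    obtain g0 where g0: "g0 \<in> P" "y = f g0 x" using y by auto
    have "{g\<in>P. f g x = y} = (*) g0 ` {g\<in>P. f g x = x}"
    proof (intro equalityI subsetI)
      fix g assume "g \<in> {g\<in>P. f g x = y}"
      then have g: "g \<in> P" "f g x = f g0 x" using g0 by auto
      have "f (inverse g0 * g) x = f (inverse g0 * g0) x"
        using g g0 P by (metis fm sbgD(3))
      then have "inverse g0 * g \<in> {g\<in>P. f g x = x}" using g g0 P by (simp add: f1 sbgD)
      then show "g \<in> (*) g0 ` {g\<in>P. f g x = x}" by (metis image_eqI inv_cancel(4))
    qed (use g0 P fm in \<open>auto simp: sbgD\<close>)
    then show ?thesis by (simp add: card_image inj_on_def)
  qed
  have "card P = (\<Sum>y\<in>(\<lambda>g. f g x) ` P. card {g\<in>P. f g x = y})"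
    using sum.image_gen[of P "\<lambda>_. 1::nat" "\<lambda>g. f g x"] by simp
  also have "\<dots> = card ((\<lambda>g. f g x) ` P) * card {g\<in>P. f g x = x}"
    using fib by simp
  finally show ?thesis by simp
qed

lemma coset_eq_iff:
  assumes "sbg H"
  shows "(*) a ` H = (*) b ` H \<longleftrightarrow> inverse a * b \<in> H"
proof
  assume e: "(*) a ` H = (*) b ` H"
  have "b * 1 \<in> (*) b ` H" by (rule imageI) (rule sbgD(1)[OF assms])
  then have "b * 1 \<in> (*) a ` H" using e by simp
  then show "inverse a * b \<in> H" by (auto simp: mult.assoc [symmetric])
next
  assume i: "inverse a * b \<in> H"
  have "a * h = b * (inverse (inverse a * b) * h)" for h by (simp add: mult.assoc)
  moreover have "b * h = a * ((inverse a * b) * h)" for h by (simp add: mult.assoc)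
  ultimately show "(*) a ` H = (*) b ` H"
    using sbgD[OF assms] i by (intro equalityI subsetI) (metis (no_types, lifting) image_iff)+
qed

lemma acts_coset: "acts P (\<lambda>g A. (*) g ` A)"
  by (auto simp: acts_def image_image mult.assoc)

lemma acts_cj: "acts P cj"
  by (auto simp: acts_def cj_mult)

lemma card_cosets:
  fixes M :: "'a::{grp,finite} set"
  assumes "sbg H" "sbg M" "H \<subseteq> M"
  shows "card ((\<lambda>g. (*) g ` H) ` M) * card H = card M"
proof -
  have "{g\<in>M. (*) g ` H = H} = H"
    using coset_eq_iff[OF assms(1), of _ 1] assms sbg_inverse_iff by auto
  then show ?thesis using orbit_stab[OF assms(2) acts_coset, of H] by simp
qed

lemma lagrange_sbg:
  fixes M :: "'a::{grp,finite} set"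
  assumes "sbg H" "sbg M" "H \<subseteq> M"
  shows "card H dvd card M"
  using card_cosets[OF assms] by (metis dvd_triv_right)

lemma card_sbg_pos: "sbg (H::'a::{grp,finite} set) \<Longrightarrow> card H > 0"
  by (metis card_gt_0_iff empty_iff finite sbgD(1))

text \<open>Existence is taken from the Sylow theorem for group records; M is repackaged as such a
  record, and the record inverse has to be identified with \<open>inverse\<close>.\<close>

lemma sylow_exists:
  fixes M :: "'a::{grp,finite} set"
  assumes M: "sbg M" and p: "prime (p::nat)" and d: "p ^ k dvd card M"
  obtains H where "sbg H" "H \<subseteq> M" "card H = p ^ k"
proof -
  let ?G = "\<lparr>carrier = M, mult = (*), one = 1\<rparr>"
  have G: "Group.group ?G"
  proof (rule groupI)
    fix x assume "x \<in> carrier ?G"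
    then show "\<exists>y\<in>carrier ?G. y \<otimes>\<^bsub>?G\<^esub> x = \<one>\<^bsub>?G\<^esub>"
      using sbgD(3)[OF M] by (auto intro!: bexI[of _ "inverse x"])
  qed (use sbgD[OF M] in \<open>auto simp: mult.assoc\<close>)
  obtain m where "card M = p ^ k * m" using d by (auto simp: dvd_def)
  then obtain H where H: "subgroup H ?G" "card H = p ^ k"
    using sylow_thm[OF p G, of k m] by (auto simp: Coset.order_def)
  have "inverse a \<in> H" if "a \<in> H" for a
  proof -
    have "a \<in> M" using subgroup.subset[OF H(1)] that by auto
    have "inv\<^bsub>?G\<^esub> a \<in> H" using subgroup.m_inv_closed[OF H(1)] that by simp
    moreover have "inv\<^bsub>?G\<^esub> a = inverse a"
      by (rule group.inv_equality[OF G]) (use \<open>a \<in> M\<close> sbgD[OF M] in auto)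
    ultimately show ?thesis by simp
  qed
  then have "sbg H" using subgroup.one_closed[OF H(1)] subgroup.m_closed[OF H(1)] by (auto simp: sbg_def)
  then show thesis using that H subgroup.subset[OF H(1)] by auto
qed

lemma card_dvd_prime_power_orbit:
  fixes P :: "'a::{grp,finite} set"
  assumes P: "sbg P" "card P = p ^ k" "prime p" and f: "acts P f"
    and ne: "(\<lambda>g. f g x) ` P \<noteq> {x}"
  shows "p dvd card ((\<lambda>g. f g x) ` P)"
proof -
  have "card ((\<lambda>g. f g x) ` P) dvd p ^ k"
    using orbit_stab[OF P(1) f, of x] P(2) by (metis dvd_triv_left)
  then obtain i where i: "card ((\<lambda>g. f g x) ` P) = p ^ i"
    using P(3) divides_primepow_nat by blast
  have "x \<in> (\<lambda>g. f g x) ` P" by (rule image_eqI[of _ _ 1]) (use sbgD(1)[OF P(1)] f in \<open>auto simp: acts_def\<close>)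
  then have "card ((\<lambda>g. f g x) ` P) \<noteq> 1" using ne by (metis card_1_singletonE singletonD)
  then show ?thesis using i by (cases i) auto
qed

text \<open>An orbit that is not a single fixed point has size a positive power of p. This
  congruence is the common source of the Sylow theorems and of all later arguments that find
  commuting elements.\<close>

lemma fixed_points_mod:
  fixes P :: "'a::{grp,finite} set"
  assumes P: "sbg P" "card P = p ^ k" "prime p" and f: "acts P f"
    and X: "finite X" "\<And>g x. g \<in> P \<Longrightarrow> x \<in> X \<Longrightarrow> f g x \<in> X"
  shows "[card X = card {x\<in>X. \<forall>g\<in>P. f g x = x}] (mod p)"
proof -
  let ?o = "\<lambda>x. (\<lambda>g. f g x) ` P" and ?F = "{x\<in>X. \<forall>g\<in>P. f g x = x}"
  have f1: "f 1 x = x" for x using f by (simp add: acts_def)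
  have fm: "g \<in> P \<Longrightarrow> h \<in> P \<Longrightarrow> f (g * h) x = f g (f h x)" for g h x using f by (simp add: acts_def)
  have x_in: "x \<in> ?o x" for x by (rule image_eqI[of _ _ 1]) (use sbgD(1)[OF P(1)] f1 in auto)
  have oeq: "?o y = ?o x" if y: "y \<in> ?o x" for x y
  proof -
    obtain g where g: "g \<in> P" "y = f g x" using y by auto
    have 1: "f h y = f (h * g) x" if "h \<in> P" for h
      using fm[OF that g(1)] g(2) by simp
    have 2: "f h x = f (h * inverse g) y" if "h \<in> P" for h
    proof -
      have "h * inverse g \<in> P" using that g(1) sbgD[OF P(1)] by simp
      then show ?thesis using fm[OF _ g(1), of "h * inverse g" x] g(2) by (simp add: mult.assoc)
    qed
    show ?thesis
    proof (intro equalityI subsetI)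
      fix u assume "u \<in> ?o y"
      then obtain h where "h \<in> P" "u = f (h * g) x" using 1 by auto
      then show "u \<in> ?o x" using sbgD(2)[OF P(1)] g(1) by auto
    next
      fix u assume "u \<in> ?o x"
      then obtain h where "h \<in> P" "u = f (h * inverse g) y" using 2 by auto
      then show "u \<in> ?o y" using sbgD(2,3)[OF P(1)] g(1) by auto
    qed
  qed
  have part: "card Y = (\<Sum>S\<in>?o ` Y. card S)" if Y: "finite Y" "\<And>g x. g \<in> P \<Longrightarrow> x \<in> Y \<Longrightarrow> f g x \<in> Y" for Y
  proof -
    have "card Y = (\<Sum>S\<in>?o ` Y. card {x\<in>Y. ?o x = S})"
      using sum.image_gen[of Y "\<lambda>_. 1::nat" ?o] Y(1) by simp
    also have "\<dots> = (\<Sum>S\<in>?o ` Y. card S)"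
    proof (rule sum.cong[OF refl])
      fix S assume "S \<in> ?o ` Y"
      then obtain y where y: "y \<in> Y" "S = ?o y" by auto
      have "{x\<in>Y. ?o x = S} = S"
      proof (intro equalityI subsetI)
        fix x assume "x \<in> {x\<in>Y. ?o x = S}"
        then show "x \<in> S" using x_in[of x] by simp
      next
        fix x assume x: "x \<in> S"
        then have "x \<in> Y" using y Y(2) by auto
        moreover have "?o x = S" using oeq[of x y] x y(2) by simp
        ultimately show "x \<in> {x\<in>Y. ?o x = S}" by simp
      qed
      then show "card {x\<in>Y. ?o x = S} = card S" by simp
    qed
    finally show ?thesis .
  qed
  have "card (X - ?F) = (\<Sum>S\<in>?o ` (X - ?F). card S)"
  proof (rule part)
    fix g x assume g: "g \<in> P" and x: "x \<in> X - ?F"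
    have "f g x \<notin> ?F"
    proof
      assume "f g x \<in> ?F"
      then have "f (inverse g) (f g x) = f g x" using sbgD(3)[OF P(1) g] by auto
      moreover have "f (inverse g) (f g x) = x" using fm[OF sbgD(3)[OF P(1) g] g, of x] f1 by simp
      ultimately show False using x \<open>f g x \<in> ?F\<close> by simp
    qed
    then show "f g x \<in> X - ?F" using X(2) g x by auto
  qed (use X in auto)
  moreover have "p dvd (\<Sum>S\<in>?o ` (X - ?F). card S)"
  proof (rule dvd_sum)
    fix S assume "S \<in> ?o ` (X - ?F)"
    then obtain x where x: "x \<in> X - ?F" "S = ?o x" by auto
    then have "?o x \<noteq> {x}" by blast
    then show "p dvd card S" using card_dvd_prime_power_orbit[OF P f] x by simp
  qed
  ultimately have "p dvd card (X - ?F)" by simp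
  then obtain k where k: "card (X - ?F) = p * k" by (auto simp: dvd_def)
  have "card X = card ((X - ?F) \<union> ?F)" by (rule arg_cong[of _ _ card]) auto
  also have "\<dots> = card (X - ?F) + card ?F" by (rule card_Un_disjoint) (use X(1) in auto)
  finally show ?thesis using k by (simp add: cong_def)
qed

subsection \<open>Element orders\<close>

text \<open>Nonnegative exponents already give inverses, because the groups considered are
  finite.\<close>

definition cyc :: "'a::grp \<Rightarrow> 'a set" where
  "cyc a = range (\<lambda>n::nat. a ^ n)"

definition gord :: "'a::grp \<Rightarrow> nat" where
  "gord a = card (cyc a)"

lemma pow_one_exists:
  fixes a :: "'a::{grp,finite}"
  obtains n :: nat where "n > 0" "a ^ n = 1"
proof -
  have "\<not> inj (\<lambda>n::nat. a ^ n)"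
    by (metis finite finite_imageD infinite_UNIV_nat)
  then obtain i j :: nat where ij: "i < j" "a ^ i = a ^ j"
    unfolding inj_def by (metis linorder_neqE_nat)
  have "a ^ i * a ^ (j - i) = a ^ j" using ij(1) by (simp only: power_add [symmetric]) simp
  then have "a ^ i * a ^ (j - i) = a ^ i * 1" using ij by simp
  then have "a ^ (j - i) = 1" by (simp only: grp_cancel)
  then show thesis using that[of "j - i"] ij by simp
qed

lemma cyc_facts:
  fixes a :: "'a::{grp,finite}"
  shows gord_pos: "gord a > 0" and pow_gord [simp]: "a ^ gord a = 1"
    and cyc_eq: "cyc a = (\<lambda>i. a ^ i) ` {..<gord a}"
    and pow_eq_1_iff: "a ^ n = 1 \<longleftrightarrow> gord a dvd n"
    and sbg_cyc: "sbg (cyc a)"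
proof -
  \<comment> \<open>The period is introduced as the least positive exponent; only afterwards does it
    turn out to be the number of powers, that is \<open>gord a\<close>.\<close>
  define k where "k = (LEAST n. n > 0 \<and> a ^ n = 1)"
  have k: "k > 0" "a ^ k = 1"
    using LeastI_ex[of "\<lambda>n. n > 0 \<and> a ^ n = 1"] pow_one_exists[of a] unfolding k_def by metis+
  have least: "n = 0 \<or> k \<le> n" if "a ^ n = 1" for n
    using that Least_le[of "\<lambda>n. n > 0 \<and> a ^ n = 1" n] unfolding k_def by auto
  have mod: "a ^ n = a ^ (n mod k)" for n
  proof -
    have "a ^ n = a ^ (k * (n div k) + n mod k)" by simp
    also have "\<dots> = a ^ (n mod k)" using k by (simp only: power_add power_mult) simp
    finally show ?thesis .
  qed
  have im: "cyc a = (\<lambda>i. a ^ i) ` {..<k}"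
  proof (intro equalityI subsetI)
    fix b assume "b \<in> cyc a"
    then obtain n where "b = a ^ n" by (auto simp: cyc_def)
    then have "b = a ^ (n mod k)" using mod by simp
    then show "b \<in> (\<lambda>i. a ^ i) ` {..<k}" using k by auto
  qed (auto simp: cyc_def)
  have "inj_on (\<lambda>i. a ^ i) {..<k}"
  proof (rule linorder_inj_onI)
    fix i j assume ij: "i < j" "i \<in> {..<k}" "j \<in> {..<k}"
    show "a ^ i \<noteq> a ^ j"
    proof
      assume "a ^ i = a ^ j"
      moreover have "a ^ i * a ^ (j - i) = a ^ j" using ij(1) by (simp only: power_add [symmetric]) simp
      ultimately have "a ^ i * a ^ (j - i) = a ^ i * 1" by simp
      then have "a ^ (j - i) = 1" by (simp only: grp_cancel)
      then show False using least[of "j - i"] ij by simp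
    qed
  qed auto
  then have gk: "gord a = k" unfolding gord_def im by (simp add: card_image)
  show "gord a > 0" "a ^ gord a = 1" "cyc a = (\<lambda>i. a ^ i) ` {..<gord a}"
    using k gk im by auto
  show "a ^ n = 1 \<longleftrightarrow> gord a dvd n"
  proof
    assume "a ^ n = 1"
    then have "a ^ (n mod k) = 1" using mod[of n] by simp
    then have "n mod k = 0" using least[of "n mod k"] k(1) by (meson mod_less_divisor not_le)
    then show "gord a dvd n" using gk by auto
  next
    assume "gord a dvd n"
    then show "a ^ n = 1" using gk k(2) by (auto simp: dvd_def power_mult)
  qed
  show "sbg (cyc a)"
  proof (rule sbgI)
    show "1 \<in> cyc a" unfolding cyc_def by (metis power_0 rangeI)
    fix b assume "b \<in> cyc a"
    then obtain n where n: "b = a ^ n" by (auto simp: cyc_def)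
    { fix c assume "c \<in> cyc a"
      then obtain m where "c = a ^ m" by (auto simp: cyc_def)
      then have "b * c = a ^ (n + m)" using n by (simp add: power_add)
      then show "b * c \<in> cyc a" by (auto simp: cyc_def) }
    have "b * a ^ (n * (k - 1)) = a ^ (n + n * (k - 1))" using n by (simp add: power_add)
    also have "n + n * (k - 1) = k * n" using k(1) by (cases k) (simp_all add: algebra_simps)
    also have "a ^ (k * n) = 1" using k(2) by (simp add: power_mult)
    finally have "inverse b = a ^ (n * (k - 1))" by (simp add: mult_eq_one_inv)
    then show "inverse b \<in> cyc a" by (auto simp: cyc_def)
  qed
qed

lemma self_in_cyc: "a \<in> cyc a"
  unfolding cyc_def by (rule range_eqI[of _ _ 1]) simp

lemma cyc_subset: "sbg H \<Longrightarrow> a \<in> H \<Longrightarrow> cyc a \<subseteq> H"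
  by (auto simp: cyc_def sbg_pow)

lemma gord_dvd_card:
  fixes a :: "'a::{grp,finite}"
  shows "sbg H \<Longrightarrow> a \<in> H \<Longrightarrow> gord a dvd card H"
  unfolding gord_def by (intro lagrange_sbg sbg_cyc cyc_subset)

lemma gord_eq_1_iff: "gord (a::'a::{grp,finite}) = 1 \<longleftrightarrow> a = 1"
  using pow_eq_1_iff[of a 1] by auto

lemma gord_prime: "a \<noteq> 1 \<Longrightarrow> a ^ p = 1 \<Longrightarrow> prime p \<Longrightarrow> gord (a::'a::{grp,finite}) = p"
  by (metis gord_eq_1_iff pow_eq_1_iff prime_nat_iff)

lemma gord_pow_prime:
  fixes a :: "'a::{grp,finite}"
  assumes "prime p" "p dvd gord a"
  shows "gord (a ^ (gord a div p)) = p"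
proof (rule gord_prime)
  have "0 < gord a div p" "gord a div p < gord a"
    using assms(2) gord_pos[of a] prime_gt_1_nat[OF assms(1)] by (auto simp: dvd_def)
  then show "a ^ (gord a div p) \<noteq> 1" using pow_eq_1_iff by (metis dvd_imp_le not_le)
  show "(a ^ (gord a div p)) ^ p = 1" using assms by (simp add: power_mult [symmetric])
qed (use assms in auto)

lemma gord_conj: "gord (g * a * inverse g) = gord (a::'a::{grp,finite})"
proof -
  have "(g * a * inverse g) ^ n = g * a ^ n * inverse g" for n
    by (induction n) (simp_all add: mult.assoc)
  then have "cyc (g * a * inverse g) = cj g (cyc a)" by (auto simp: cyc_def cj_def)
  then show ?thesis by (simp add: gord_def)
qed

lemma cyc_conj: "cyc (g * a * inverse g) = cj g (cyc (a::'a::grp))"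
proof -
  have "(g * a * inverse g) ^ n = g * a ^ n * inverse g" for n
    by (induction n) (simp_all add: mult.assoc)
  then show ?thesis by (auto simp: cyc_def cj_def)
qed

lemma cyc_prime_card:
  fixes a :: "'a::{grp,finite}"
  assumes P: "sbg P" "card P = p" "prime p" and a: "a \<in> P" "a \<noteq> 1"
  shows "cyc a = P" "gord a = p"
proof -
  have "gord a dvd p" using gord_dvd_card[OF P(1) a(1)] P(2) by simp
  then show "gord a = p" using a(2) P(3) gord_eq_1_iff by (metis prime_nat_iff)
  then show "cyc a = P"
    using cyc_subset[OF P(1) a(1)] P(2) by (intro card_subset_eq) (auto simp: gord_def)
qed

lemma cauchy_sbg:
  fixes M :: "'a::{grp,finite} set"
  assumes "sbg M" "prime p" "p dvd card M"
  obtains a where "a \<in> M" "gord a = p"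
proof -
  obtain H where H: "sbg H" "H \<subseteq> M" "card H = p ^ 1"
    using sylow_exists[of M p 1] assms by auto
  then have "card H > 1" using assms(2) prime_gt_1_nat by simp
  then obtain a where "a \<in> H" "a \<noteq> 1"
    by (metis card_1_singleton_iff card_sbg_pos[OF H(1)] One_nat_def is_singletonI' is_singleton_def less_not_refl2 sbgD(1)[OF H(1)] all_not_in_conv)
  then show thesis using that[of a] cyc_prime_card(2)[OF H(1) _ assms(2)] H by auto
qed

subsection \<open>Sylow subgroups\<close>

text \<open>The parameter q is the order of the subgroups, not a prime. The members are Sylow
  subgroups when q is the exact power of a prime dividing \<open>card M\<close>.\<close>

definition Sy :: "'a::grp set \<Rightarrow> nat \<Rightarrow> 'a set set" where
  "Sy M q = {P. sbg P \<and> P \<subseteq> M \<and> card P = q}"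

lemma Sy_iff: "P \<in> Sy M q \<longleftrightarrow> sbg P \<and> P \<subseteq> M \<and> card P = q"
  by (simp add: Sy_def)

lemma finite_Sy [simp]: "finite (Sy (M::'a::{grp,finite} set) q)"
  by (rule finite_subset[of _ UNIV]) auto

lemma cj_Sy: "sbg M \<Longrightarrow> g \<in> M \<Longrightarrow> P \<in> Sy M q \<Longrightarrow> cj g P \<in> Sy M q"
  by (simp add: Sy_iff sbg_cj cj_subset_self)

text \<open>Q acts by left multiplication on the m left cosets of P in M. As p does not divide m,
  some coset of g is fixed, and this means that Q lies in the conjugate of P by g.\<close>

lemma sylow_conj:
  fixes M :: "'a::{grp,finite} set"
  assumes M: "sbg M" and P: "sbg P" "P \<subseteq> M" "card M = card P * m" and p: "prime p" "\<not> p dvd m"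
    and Q: "sbg Q" "Q \<subseteq> M" "card Q = p ^ k"
  obtains g where "g \<in> M" "Q \<subseteq> cj g P"
proof -
  let ?X = "(\<lambda>g. (*) g ` P) ` M"
  have "card ?X = m"
    using card_cosets[OF P(1) M P(2)] P(3) card_sbg_pos[OF P(1)] by (metis mult.commute mult_cancel2 neq0_conv)
  moreover have "[card ?X = card {x\<in>?X. \<forall>g\<in>Q. (*) g ` x = x}] (mod p)"
  proof (rule fixed_points_mod[OF Q(1,3) p(1) acts_coset])
    fix g x assume "g \<in> Q" "x \<in> ?X"
    then obtain h where h: "h \<in> M" "x = (*) h ` P" by auto
    have "(*) g ` x = (*) (g * h) ` P" using h by (simp add: image_image mult.assoc)
    then show "(*) g ` x \<in> ?X" using h Q(2) \<open>g \<in> Q\<close> sbgD(2)[OF M] by auto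
  qed auto
  ultimately have "{x\<in>?X. \<forall>g\<in>Q. (*) g ` x = x} \<noteq> {}"
    using p(2) by (metis card.empty cong_0_iff)
  then obtain g where g: "g \<in> M" "\<And>h. h \<in> Q \<Longrightarrow> (*) h ` (*) g ` P = (*) g ` P" by auto
  have "h \<in> cj g P" if h: "h \<in> Q" for h
  proof -
    have "(*) g ` P = (*) (h * g) ` P" using g(2)[OF h] by (simp add: image_image mult.assoc)
    then have "inverse g * (h * g) \<in> P" using coset_eq_iff[OF P(1)] by blast
    then show ?thesis by (simp add: cj_iff mult.assoc)
  qed
  then show thesis by (intro that[OF g(1)] subsetI)
qed

lemma Sy_eq_conj:
  fixes M :: "'a::{grp,finite} set"
  assumes M: "sbg M" "card M = q * m" and p: "prime p" "q = p ^ k" "\<not> p dvd m" and P: "P \<in> Sy M q"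
  shows "Sy M q = (\<lambda>g. cj g P) ` M"
proof (intro equalityI subsetI)
  fix Q assume Q: "Q \<in> Sy M q"
  obtain g where g: "g \<in> M" "Q \<subseteq> cj g P"
    using sylow_conj[OF M(1), of P m p Q k] P Q M p by (auto simp: Sy_iff)
  then have "Q = cj g P" using P Q by (intro card_subset_eq) (auto simp: Sy_iff)
  then show "Q \<in> (\<lambda>g. cj g P) ` M" using g by auto
qed (use cj_Sy[OF M(1) _ P] in auto)

lemma card_Sy:
  fixes M :: "'a::{grp,finite} set"
  assumes M: "sbg M" "card M = q * m" and p: "prime p" "q = p ^ k" "\<not> p dvd m" and P: "P \<in> Sy M q"
  shows "card (Sy M q) * card (nrm P \<inter> M) = card M"
proof -
  have "nrm P \<inter> M = {g\<in>M. cj g P = P}" by (auto simp: nrm_def)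
  then show ?thesis using orbit_stab[OF M(1) acts_cj, of P] Sy_eq_conj[OF assms] by simp
qed

text \<open>Both groups are Sylow in the normalizer of R in M, hence conjugate there, and there R
  has no other conjugate.\<close>

lemma Sy_normal_unique:
  fixes M :: "'a::{grp,finite} set"
  assumes M: "sbg M" "card M = q * m" and p: "prime p" "q = p ^ k" "\<not> p dvd m"
    and P: "P \<in> Sy M q" and R: "R \<in> Sy M q" and n: "P \<subseteq> nrm R"
  shows "P = R"
proof -
  let ?N = "nrm R \<inter> M"
  have N: "sbg ?N" by (intro sbg_Int sbg_nrm M)
  have RN: "sbg R" "R \<subseteq> ?N" using R subset_nrm by (auto simp: Sy_iff)
  obtain m' where m': "card ?N = card R * m'" using lagrange_sbg[OF RN(1) N RN(2)] by (auto simp: dvd_def)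
  have "card ?N dvd card M" by (rule lagrange_sbg[OF N M(1)]) auto
  then have "m' dvd m" using m' M(2) R card_sbg_pos[OF RN(1)] by (auto simp: Sy_iff)
  then have "\<not> p dvd m'" using p(3) dvd_trans by blast
  then obtain g where g: "g \<in> ?N" "P \<subseteq> cj g R"
    using sylow_conj[OF N RN m' p(1), of P k] P n p by (auto simp: Sy_iff)
  then have "P \<subseteq> R" by (simp add: nrm_def)
  then show ?thesis using P R by (intro card_subset_eq) (auto simp: Sy_iff)
qed

text \<open>One Sylow subgroup acts on all of them by conjugation, and by
  \<open>Sy_normal_unique\<close> it fixes only itself.\<close>

lemma Sy_mod:
  fixes M :: "'a::{grp,finite} set"
  assumes M: "sbg M" "card M = q * m" and p: "prime p" "q = p ^ k" "\<not> p dvd m"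
  shows "[card (Sy M q) = 1] (mod p)"
proof -
  obtain P where P: "P \<in> Sy M q" using sylow_exists[OF M(1) p(1), of k] M p by (auto simp: Sy_iff)
  have "[card (Sy M q) = card {R\<in>Sy M q. \<forall>g\<in>P. cj g R = R}] (mod p)"
  proof (rule fixed_points_mod[OF _ _ p(1) acts_cj])
    show "sbg P" "card P = p ^ k" using P p by (auto simp: Sy_iff)
    fix g R assume "g \<in> P" "R \<in> Sy M q"
    then show "cj g R \<in> Sy M q" using cj_Sy[OF M(1)] P by (auto simp: Sy_iff)
  qed auto
  moreover have "{R\<in>Sy M q. \<forall>g\<in>P. cj g R = R} = {P}"
  proof (intro equalityI subsetI)
    fix R assume "R \<in> {R\<in>Sy M q. \<forall>g\<in>P. cj g R = R}"
    then have "P = R" by (intro Sy_normal_unique[OF assms P]) (auto simp: nrm_def)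
    then show "R \<in> {P}" by simp
  next
    fix R assume "R \<in> {P}"
    then show "R \<in> {R\<in>Sy M q. \<forall>g\<in>P. cj g R = R}"
      using P subset_nrm[of P] by (auto simp: Sy_iff nrm_def)
  qed
  ultimately show ?thesis by simp
qed

lemma Sy_prime_Int:
  fixes P :: "'a::{grp,finite} set"
  assumes "P \<in> Sy M p" "R \<in> Sy M' p" "prime p" "a \<in> P" "a \<in> R" "a \<noteq> 1"
  shows "P = R"
  using assms cyc_prime_card(1)[of P p a] cyc_prime_card(1)[of R p a] by (auto simp: Sy_iff)

definition El :: "'a::grp set \<Rightarrow> nat \<Rightarrow> 'a set" where
  "El M n = {a\<in>M. gord a = n}"

lemma cyc_in_Sy: "sbg M \<Longrightarrow> a \<in> El M n \<Longrightarrow> cyc (a::'a::{grp,finite}) \<in> Sy M n"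
  by (simp add: El_def Sy_iff sbg_cyc cyc_subset gord_def)

text \<open>Different subgroups of order p share only 1, and each contributes p - 1
  generators.\<close>

lemma card_El:
  fixes M :: "'a::{grp,finite} set"
  assumes "sbg M" "prime p"
  shows "card (El M p) = (p - 1) * card (Sy M p)"
proof -
  have "El M p = (\<Union>P\<in>Sy M p. P - {1})"
  proof (intro equalityI subsetI)
    fix a assume a: "a \<in> El M p"
    then have "a \<noteq> 1" using assms(2) gord_eq_1_iff not_prime_1 by (metis (mono_tags, lifting) El_def mem_Collect_eq)
    then show "a \<in> (\<Union>P\<in>Sy M p. P - {1})"
      using cyc_in_Sy[OF assms(1) a] self_in_cyc[of a] by blast
  next
    fix a assume "a \<in> (\<Union>P\<in>Sy M p. P - {1})"
    then obtain P where "P \<in> Sy M p" "a \<in> P" "a \<noteq> 1" by auto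
    then show "a \<in> El M p" using cyc_prime_card(2)[of P p a] assms(2) by (auto simp: Sy_iff El_def)
  qed
  also have "card \<dots> = (\<Sum>P\<in>Sy M p. card (P - {1}))"
  proof (rule card_UN_disjoint)
    show "\<forall>P\<in>Sy M p. \<forall>R\<in>Sy M p. P \<noteq> R \<longrightarrow> (P - {1}) \<inter> (R - {1}) = {}"
      using Sy_prime_Int[OF _ _ assms(2)] by blast
  qed auto
  also have "\<dots> = (\<Sum>P\<in>Sy M p. p - 1)"
    by (rule sum.cong) (auto simp: Sy_iff sbgD card_Diff_singleton)
  finally show ?thesis by simp
qed

subsection \<open>Centralizing elements of prime order\<close>

lemma commute_cyc:
  fixes a b :: "'a::grp"
  assumes "a * b = b * a" "c \<in> cyc a" "d \<in> cyc b"
  shows "c * d = d * c"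
  using assms by (auto simp: cyc_def) (metis power_commuting_commutes)

text \<open>Q permutes the p - 1 nontrivial elements of P. If q does not divide their number, one of
  them is fixed by Q, and it generates P.\<close>

lemma norm_imp_commute:
  fixes P Q :: "'a::{grp,finite} set"
  assumes P: "sbg P" "card P = p" "prime p" and Q: "sbg Q" "card Q = q" "prime q" "Q \<subseteq> nrm P"
    and n: "\<not> q dvd p - 1" and a: "a \<in> P" and b: "b \<in> Q"
  shows "a * b = b * a"
proof -
  let ?f = "\<lambda>g x. g * x * inverse g"
  have "[card (P - {1}) = card {x\<in>P - {1}. \<forall>g\<in>Q. ?f g x = x}] (mod q)"
  proof (rule fixed_points_mod[OF Q(1) _ Q(3), of 1])
    show "acts Q ?f" by (simp add: acts_def mult.assoc)
    fix g x assume g: "g \<in> Q" and x: "x \<in> P - {1}"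
    have "?f g x \<in> cj g P" using x by (auto simp: cj_def)
    then have "?f g x \<in> P" using g Q(4) by (auto simp: nrm_def)
    moreover have "?f g x \<noteq> 1"
    proof
      assume "?f g x = 1"
      then have "g * x * inverse g * g = g" by simp
      then have "g * x = g * 1" by (simp add: mult.assoc)
      then show False using x by (simp only: grp_cancel) simp
    qed
    ultimately show "?f g x \<in> P - {1}" by simp
  qed (use Q in auto)
  moreover have "card (P - {1}) = p - 1" using P by (simp add: sbgD)
  ultimately have "{x\<in>P - {1}. \<forall>g\<in>Q. ?f g x = x} \<noteq> {}" using n by (metis card.empty cong_0_iff)
  then obtain x where x: "x \<in> P" "x \<noteq> 1" "b * x * inverse b = x" using b by auto
  have "b * x = b * x * inverse b * b" by (simp add: mult.assoc)
  then have "x * b = b * x" using x(3) by simp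
  moreover have "a \<in> cyc x" using cyc_prime_card(1)[OF P x(1,2)] a by simp
  ultimately show ?thesis by (rule commute_cyc[OF _ _ self_in_cyc])
qed

text \<open>For distinct primes this is an edge of the prime graph: there is an element of order p
  q. Being a property of the whole group, it passes freely between conjugate Sylow subgroups and, by
  symmetry, between p and q.\<close>

definition commuting_orders :: "'a::grp itself \<Rightarrow> nat \<Rightarrow> nat \<Rightarrow> bool" where
  "commuting_orders _ p q \<longleftrightarrow> (\<exists>a b::'a. gord a = p \<and> gord b = q \<and> a * b = b * a)"

lemma commuting_orders_sym: "commuting_orders T p q \<longleftrightarrow> commuting_orders T q p"
  by (auto simp: commuting_orders_def) metis+

lemma dvd_nrm_imp_commuting:
  fixes P :: "'a::{grp,finite} set"
  assumes P: "P \<in> Sy M p" "prime p" and q: "prime q" "q dvd card (nrm P)" "\<not> q dvd p - 1"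
  shows "commuting_orders TYPE('a) p q"
proof -
  obtain b where b: "b \<in> nrm P" "gord b = q" using cauchy_sbg[OF sbg_nrm q(1,2)] .
  have "card P = p" "sbg P" using P by (auto simp: Sy_iff)
  then obtain a where a: "a \<in> P" "gord a = p" using cauchy_sbg[of P p] P(2) by auto
  have "a * b = b * a"
    by (rule norm_imp_commute[of P p "cyc b" q])
      (use \<open>card P = p\<close> \<open>sbg P\<close> P q a b cyc_subset[OF sbg_nrm b(1)] sbg_cyc self_in_cyc in \<open>auto simp: gord_def\<close>)
  then show ?thesis using a b by (auto simp: commuting_orders_def)
qed

definition exact_prime :: "nat \<Rightarrow> nat \<Rightarrow> bool" where
  "exact_prime p n \<longleftrightarrow> prime p \<and> p dvd n \<and> \<not> p dvd n div p"

lemma exact_primeD: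
  assumes "exact_prime p n"
  shows "prime p" "n = p * (n div p)" "\<not> p dvd n div p"
  using assms by (auto simp: exact_prime_def)

lemma exact_prime_dvd:
  assumes "exact_prime p n" "m dvd n" "p dvd m"
  shows "exact_prime p m"
proof -
  obtain k where k: "n = m * k" using assms(2) by (auto simp: dvd_def)
  obtain l where l: "m = p * l" using assms(3) by (auto simp: dvd_def)
  have p: "prime p" "p > 0" using assms(1) by (auto simp: exact_prime_def prime_gt_0_nat)
  have "n div p = l * k" using k l p by simp
  then have "\<not> p dvd l" using assms(1) by (auto simp: exact_prime_def)
  then show ?thesis using p l by (simp add: exact_prime_def)
qed

lemma Sy_UNIV_conj:
  fixes P Q :: "'a::{grp,finite} set"
  assumes "exact_prime p CARD('a)" "P \<in> Sy UNIV p" "Q \<in> Sy UNIV p"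
  obtains g where "Q = cj g P"
proof -
  have "Q \<in> (\<lambda>g. cj g P) ` UNIV"
    using Sy_eq_conj[OF sbg_UNIV, of p "CARD('a) div p" p 1 P] exact_primeD[OF assms(1)] assms by simp
  then show thesis using that by auto
qed

text \<open>The member of order p in a commuting pair generates a conjugate of P, so the other
  member can be conjugated into the normalizer of P.\<close>

lemma commuting_imp_dvd_nrm:
  fixes P :: "'a::{grp,finite} set"
  assumes p: "exact_prime p CARD('a)" and P: "P \<in> Sy UNIV p" and c: "commuting_orders TYPE('a) p q"
  shows "q dvd card (nrm P)"
proof -
  obtain a b :: 'a where ab: "gord a = p" "gord b = q" "a * b = b * a"
    using c by (auto simp: commuting_orders_def)
  have "cyc a \<in> Sy UNIV p" using ab(1) by (intro cyc_in_Sy sbg_UNIV) (simp add: El_def)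
  then obtain g where g: "P = cj g (cyc a)" using Sy_UNIV_conj[OF p _ P] by metis
  have "b \<in> nrm (cyc a)"
  proof (rule nrmI_finite)
    show "cj b (cyc a) \<subseteq> cyc a"
    proof
      fix c assume "c \<in> cj b (cyc a)"
      then obtain d where d: "d \<in> cyc a" "c = b * d * inverse b" by (auto simp: cj_def)
      then have "b * d = d * b" using commute_cyc[OF ab(3) d(1) self_in_cyc] by simp
      then show "c \<in> cyc a" using d by (simp add: mult.assoc)
    qed
  qed simp
  then have "gord b dvd card (nrm (cyc a))" by (intro gord_dvd_card sbg_nrm)
  then show ?thesis using g ab(2) by (simp add: nrm_cj)
qed

text \<open>A single noncommuting pair decides: the subgroups of order q in the normalizer of P are
  Sylow subgroups of it, hence conjugate inside it, so if one of them centralized P, all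
  would.\<close>

lemma not_commuting_orders:
  fixes P :: "'a::{grp,finite} set"
  assumes p: "exact_prime p CARD('a)" and qN: "exact_prime q (card (nrm P))" and P: "P \<in> Sy UNIV p"
    and b: "b \<in> nrm P" "gord b = q" and a: "a \<in> P" "a * b \<noteq> b * a"
  shows "\<not> commuting_orders TYPE('a) p q"
proof
  assume "commuting_orders TYPE('a) p q"
  then obtain a' b' :: 'a where ab: "gord a' = p" "gord b' = q" "a' * b' = b' * a'"
    by (auto simp: commuting_orders_def)
  have "cyc a' \<in> Sy UNIV p" using ab(1) by (intro cyc_in_Sy sbg_UNIV) (simp add: El_def)
  then obtain g where g: "P = cj g (cyc a')" using Sy_UNIV_conj[OF p _ P] by metis
  define c where "c = g * b' * inverse g"
  have comm: "x * c = c * x" if x: "x \<in> P" for x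
  proof -
    obtain y where y: "y \<in> cyc a'" "x = g * y * inverse g" using x g by (auto simp: cj_def)
    have "y * b' = b' * y" by (rule commute_cyc[OF ab(3) y(1) self_in_cyc])
    then have "g * (y * b') * inverse g = g * (b' * y) * inverse g" by simp
    then show ?thesis using y(2) by (simp add: c_def mult.assoc)
  qed
  have cP: "c \<in> nrm P"
  proof (rule nrmI_finite)
    show "cj c P \<subseteq> P"
    proof
      fix x assume "x \<in> cj c P"
      then obtain y where y: "y \<in> P" "x = c * y * inverse c" by (auto simp: cj_def)
      then have "x = y * c * inverse c" using comm[OF y(1)] by simp
      then show "x \<in> P" using y(1) by (simp add: mult.assoc)
    qed
  qed simp
  have gc: "gord c = q" using ab(2) by (simp add: c_def gord_conj)
  have "cyc c \<in> Sy (nrm P) q" "cyc b \<in> Sy (nrm P) q"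
    using cP gc b by (auto intro!: cyc_in_Sy sbg_nrm simp: El_def)
  then have "cyc b \<in> (\<lambda>g. cj g (cyc c)) ` nrm P"
    using Sy_eq_conj[OF sbg_nrm exact_primeD(2)[OF qN] exact_primeD(1)[OF qN], of 1 "cyc c"] exact_primeD[OF qN]
    by simp
  then obtain h where h: "h \<in> nrm P" "cyc b = cj h (cyc c)" by auto
  then have "b \<in> cj h (cyc c)" using self_in_cyc[of b] by simp
  then obtain d where d: "d \<in> cyc c" "b = h * d * inverse h" by (auto simp: cj_def)
  have "inverse h \<in> nrm P" using h(1) sbgD(3)[OF sbg_nrm] by blast
  then have "cj (inverse h) P = P" by (simp add: nrm_def)
  moreover have "inverse h * a * inverse (inverse h) \<in> cj (inverse h) P" using a(1) by (auto simp: cj_def)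
  ultimately have y: "inverse h * a * h \<in> P" by simp
  define y where "y = inverse h * a * h"
  have "y * d = d * y"
    using commute_cyc[OF comm[OF y] self_in_cyc d(1)] by (simp add: y_def)
  then have "h * (y * d) * inverse h = h * (d * y) * inverse h" by simp
  then have "a * b = b * a" using d(2) by (simp add: y_def mult.assoc)
  then show False using a(2) by simp
qed

subsection \<open>Matrices over the field with 11 elements\<close>

text \<open>Opaque names for the field elements let matrix products be rewritten by finite tables,
  with no reduction of numerals modulo 11 on the way.\<close>

definition f2 :: 11 where "f2 = 2"
definition f3 :: 11 where "f3 = 3"
definition f4 :: 11 where "f4 = 4"
definition f5 :: 11 where "f5 = 5"
definition f6 :: 11 where "f6 = 6"
definition f7 :: 11 where "f7 = 7"
definition f8 :: 11 where "f8 = 8"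
definition f9 :: 11 where "f9 = 9"
definition f10 :: 11 where "f10 = 10"

lemmas f_defs = f2_def f3_def f4_def f5_def f6_def f7_def f8_def f9_def f10_def

lemma f_mult:
  shows "f2 * f2 = f4" "f2 * f3 = f6" "f2 * f4 = f8" "f2 * f5 = f10" "f2 * f6 = 1" "f2 * f7 = f3"
    "f2 * f8 = f5" "f2 * f9 = f7" "f2 * f10 = f9" "f3 * f2 = f6" "f3 * f3 = f9" "f3 * f4 = 1"
    "f3 * f5 = f4" "f3 * f6 = f7" "f3 * f7 = f10" "f3 * f8 = f2" "f3 * f9 = f5" "f3 * f10 = f8"
    "f4 * f2 = f8" "f4 * f3 = 1" "f4 * f4 = f5" "f4 * f5 = f9" "f4 * f6 = f2" "f4 * f7 = f6"
    "f4 * f8 = f10" "f4 * f9 = f3" "f4 * f10 = f7" "f5 * f2 = f10" "f5 * f3 = f4" "f5 * f4 = f9"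
    "f5 * f5 = f3" "f5 * f6 = f8" "f5 * f7 = f2" "f5 * f8 = f7" "f5 * f9 = 1" "f5 * f10 = f6"
    "f6 * f2 = 1" "f6 * f3 = f7" "f6 * f4 = f2" "f6 * f5 = f8" "f6 * f6 = f3" "f6 * f7 = f9"
    "f6 * f8 = f4" "f6 * f9 = f10" "f6 * f10 = f5" "f7 * f2 = f3" "f7 * f3 = f10" "f7 * f4 = f6"
    "f7 * f5 = f2" "f7 * f6 = f9" "f7 * f7 = f5" "f7 * f8 = 1" "f7 * f9 = f8" "f7 * f10 = f4"
    "f8 * f2 = f5" "f8 * f3 = f2" "f8 * f4 = f10" "f8 * f5 = f7" "f8 * f6 = f4" "f8 * f7 = 1"
    "f8 * f8 = f9" "f8 * f9 = f6" "f8 * f10 = f3" "f9 * f2 = f7" "f9 * f3 = f5" "f9 * f4 = f3"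
    "f9 * f5 = 1" "f9 * f6 = f10" "f9 * f7 = f8" "f9 * f8 = f6" "f9 * f9 = f4" "f9 * f10 = f2"
    "f10 * f2 = f9" "f10 * f3 = f8" "f10 * f4 = f7" "f10 * f5 = f6" "f10 * f6 = f5" "f10 * f7 = f4"
    "f10 * f8 = f3" "f10 * f9 = f2" "f10 * f10 = 1"
  by (simp_all add: f_defs)

lemma f_add:
  shows "1 + 1 = f2" "1 + f2 = f3" "1 + f3 = f4" "1 + f4 = f5" "1 + f5 = f6" "1 + f6 = f7"
    "1 + f7 = f8" "1 + f8 = f9" "1 + f9 = f10" "1 + f10 = 0" "f2 + 1 = f3" "f2 + f2 = f4"
    "f2 + f3 = f5" "f2 + f4 = f6" "f2 + f5 = f7" "f2 + f6 = f8" "f2 + f7 = f9" "f2 + f8 = f10"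
    "f2 + f9 = 0" "f2 + f10 = 1" "f3 + 1 = f4" "f3 + f2 = f5" "f3 + f3 = f6" "f3 + f4 = f7"
    "f3 + f5 = f8" "f3 + f6 = f9" "f3 + f7 = f10" "f3 + f8 = 0" "f3 + f9 = 1" "f3 + f10 = f2"
    "f4 + 1 = f5" "f4 + f2 = f6" "f4 + f3 = f7" "f4 + f4 = f8" "f4 + f5 = f9" "f4 + f6 = f10"
    "f4 + f7 = 0" "f4 + f8 = 1" "f4 + f9 = f2" "f4 + f10 = f3" "f5 + 1 = f6" "f5 + f2 = f7"
    "f5 + f3 = f8" "f5 + f4 = f9" "f5 + f5 = f10" "f5 + f6 = 0" "f5 + f7 = 1" "f5 + f8 = f2"
    "f5 + f9 = f3" "f5 + f10 = f4" "f6 + 1 = f7" "f6 + f2 = f8" "f6 + f3 = f9" "f6 + f4 = f10"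
    "f6 + f5 = 0" "f6 + f6 = 1" "f6 + f7 = f2" "f6 + f8 = f3" "f6 + f9 = f4" "f6 + f10 = f5"
    "f7 + 1 = f8" "f7 + f2 = f9" "f7 + f3 = f10" "f7 + f4 = 0" "f7 + f5 = 1" "f7 + f6 = f2"
    "f7 + f7 = f3" "f7 + f8 = f4" "f7 + f9 = f5" "f7 + f10 = f6" "f8 + 1 = f9" "f8 + f2 = f10"
    "f8 + f3 = 0" "f8 + f4 = 1" "f8 + f5 = f2" "f8 + f6 = f3" "f8 + f7 = f4" "f8 + f8 = f5"
    "f8 + f9 = f6" "f8 + f10 = f7" "f9 + 1 = f10" "f9 + f2 = 0" "f9 + f3 = 1" "f9 + f4 = f2"
    "f9 + f5 = f3" "f9 + f6 = f4" "f9 + f7 = f5" "f9 + f8 = f6" "f9 + f9 = f7" "f9 + f10 = f8"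
    "f10 + 1 = 0" "f10 + f2 = 1" "f10 + f3 = f2" "f10 + f4 = f3" "f10 + f5 = f4" "f10 + f6 = f5"
    "f10 + f7 = f6" "f10 + f8 = f7" "f10 + f9 = f8" "f10 + f10 = f9"
  by (simp_all add: f_defs)

lemma f_neq:
  shows "(0::11) \<noteq> 1" "0 \<noteq> f2" "0 \<noteq> f3" "0 \<noteq> f4" "0 \<noteq> f5" "0 \<noteq> f6"
    "0 \<noteq> f7" "0 \<noteq> f8" "0 \<noteq> f9" "0 \<noteq> f10" "(1::11) \<noteq> 0" "1 \<noteq> f2"
    "1 \<noteq> f3" "1 \<noteq> f4" "1 \<noteq> f5" "1 \<noteq> f6" "1 \<noteq> f7" "1 \<noteq> f8"
    "1 \<noteq> f9" "1 \<noteq> f10" "f2 \<noteq> 0" "f2 \<noteq> 1" "f2 \<noteq> f3" "f2 \<noteq> f4"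
    "f2 \<noteq> f5" "f2 \<noteq> f6" "f2 \<noteq> f7" "f2 \<noteq> f8" "f2 \<noteq> f9" "f2 \<noteq> f10"
    "f3 \<noteq> 0" "f3 \<noteq> 1" "f3 \<noteq> f2" "f3 \<noteq> f4" "f3 \<noteq> f5" "f3 \<noteq> f6"
    "f3 \<noteq> f7" "f3 \<noteq> f8" "f3 \<noteq> f9" "f3 \<noteq> f10" "f4 \<noteq> 0" "f4 \<noteq> 1"
    "f4 \<noteq> f2" "f4 \<noteq> f3" "f4 \<noteq> f5" "f4 \<noteq> f6" "f4 \<noteq> f7" "f4 \<noteq> f8"
    "f4 \<noteq> f9" "f4 \<noteq> f10" "f5 \<noteq> 0" "f5 \<noteq> 1" "f5 \<noteq> f2" "f5 \<noteq> f3"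
    "f5 \<noteq> f4" "f5 \<noteq> f6" "f5 \<noteq> f7" "f5 \<noteq> f8" "f5 \<noteq> f9" "f5 \<noteq> f10"
    "f6 \<noteq> 0" "f6 \<noteq> 1" "f6 \<noteq> f2" "f6 \<noteq> f3" "f6 \<noteq> f4" "f6 \<noteq> f5"
    "f6 \<noteq> f7" "f6 \<noteq> f8" "f6 \<noteq> f9" "f6 \<noteq> f10" "f7 \<noteq> 0" "f7 \<noteq> 1"
    "f7 \<noteq> f2" "f7 \<noteq> f3" "f7 \<noteq> f4" "f7 \<noteq> f5" "f7 \<noteq> f6" "f7 \<noteq> f8"
    "f7 \<noteq> f9" "f7 \<noteq> f10" "f8 \<noteq> 0" "f8 \<noteq> 1" "f8 \<noteq> f2" "f8 \<noteq> f3"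
    "f8 \<noteq> f4" "f8 \<noteq> f5" "f8 \<noteq> f6" "f8 \<noteq> f7" "f8 \<noteq> f9" "f8 \<noteq> f10"
    "f9 \<noteq> 0" "f9 \<noteq> 1" "f9 \<noteq> f2" "f9 \<noteq> f3" "f9 \<noteq> f4" "f9 \<noteq> f5"
    "f9 \<noteq> f6" "f9 \<noteq> f7" "f9 \<noteq> f8" "f9 \<noteq> f10" "f10 \<noteq> 0" "f10 \<noteq> 1"
    "f10 \<noteq> f2" "f10 \<noteq> f3" "f10 \<noteq> f4" "f10 \<noteq> f5" "f10 \<noteq> f6" "f10 \<noteq> f7"
    "f10 \<noteq> f8" "f10 \<noteq> f9"
  by (simp_all add: f_defs)

lemmas f_arith = f_mult f_add mult_zero_left mult_zero_right mult_1_left mult_1_right add_0_left add_0_right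

text \<open>Named after the vector operation a u + v. A row times a matrix is accumulated as a
  linear combination of the rows of the matrix, a form that rewriting evaluates directly.\<close>

primrec axpy :: "11 \<Rightarrow> 11 list \<Rightarrow> 11 list \<Rightarrow> 11 list" where
  "axpy a [] v = []"
| "axpy a (b # u) v = (a * b + hd v) # axpy a u (tl v)"

primrec vmul :: "11 list \<Rightarrow> 11 list list \<Rightarrow> 11 list" where
  "vmul [] B = [0, 0, 0, 0, 0, 0, 0]"
| "vmul (a # r) B = axpy a (hd B) (vmul r (tl B))"

definition mmul :: "11 list list \<Rightarrow> 11 list list \<Rightarrow> 11 list list" where
  "mmul A B = map (\<lambda>r. vmul r B) A"

text \<open>The index list ends with 7, which equals 0 in the index type, in agreement with the
  order of \<open>vector\<close>.\<close>

definition rows :: "11 ^ 7 ^ 7 \<Rightarrow> 11 list list" where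
  "rows A = map (\<lambda>i. map (\<lambda>j. A $ i $ j) [1, 2, 3, 4, 5, 6, 7]) [1, 2, 3, 4, 5, 6, 7]"

lemma UNIV_7: "(UNIV :: 7 set) = {1, 2, 3, 4, 5, 6, 7}"
proof -
  have "x \<in> {1, 2, 3, 4, 5, 6, 7}" for x :: 7
  proof (cases x)
    case (of_int z)
    have "0 \<le> z" "z < 7" using of_int by simp_all
    then have "z = 0 \<or> z = 1 \<or> z = 2 \<or> z = 3 \<or> z = 4 \<or> z = 5 \<or> z = 6" by presburger
    then show ?thesis using of_int(1) by (elim disjE) simp_all
  qed
  then show ?thesis by blast
qed

lemma all_7: "(\<forall>i::7. P i) \<longleftrightarrow> P 1 \<and> P 2 \<and> P 3 \<and> P 4 \<and> P 5 \<and> P 6 \<and> P 7"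
proof -
  have "(\<forall>i::7. P i) \<longleftrightarrow> (\<forall>i\<in>UNIV. P i)" by simp
  then show ?thesis by (simp only: UNIV_7 ball_simps simp_thms)
qed

lemma sum_7: "(\<Sum>i\<in>(UNIV::7 set). f i) = f 1 + f 2 + f 3 + f 4 + f 5 + f 6 + (f 7 :: 'a::comm_monoid_add)"
  unfolding UNIV_7 by (simp add: add.assoc)

lemma vector_7:
  fixes a b c d e f g :: "'a::zero"
  defines "v \<equiv> vector [a, b, c, d, e, f, g] :: 'a ^ 7"
  shows "v $ 1 = a" "v $ 2 = b" "v $ 3 = c" "v $ 4 = d" "v $ 5 = e" "v $ 6 = f" "v $ 7 = g"
  by (simp_all add: v_def vector_def)

lemma rows_inj: "rows A = rows B \<longleftrightarrow> A = B"
  by (simp add: rows_def vec_eq_iff all_7 conj_assoc)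

lemma rows_mult: "rows (A ** B) = mmul (rows A) (rows B)"
  by (simp add: rows_def mmul_def matrix_matrix_mult_def sum_7 add.assoc)

lemma rows_one: "rows (mat 1) = [[1,0,0,0,0,0,0],[0,1,0,0,0,0,0],[0,0,1,0,0,0,0],[0,0,0,1,0,0,0],
    [0,0,0,0,1,0,0],[0,0,0,0,0,1,0],[0,0,0,0,0,0,1]]"
  by (simp add: rows_def mat_def)

lemma rows_janko_Y: "rows janko_Y = [[0, 1, 0, 0, 0, 0, 0], [0, 0, 1, 0, 0, 0, 0], [0, 0, 0, 1, 0, 0, 0], [0, 0, 0, 0, 1, 0, 0], [0, 0, 0, 0, 0, 1, 0], [0, 0, 0, 0, 0, 0, 1], [1, 0, 0, 0, 0, 0, 0]]"
  by (simp add: rows_def janko_Y_def vector_7)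

lemma rows_janko_Z: "rows janko_Z = [[f8, f2, f10, f10, f8, f10, f8], [f9, 1, 1, f3, 1, f3, f3], [f10, f10, f8, f10, f8, f8, f2], [f10, f8, f10, f8, f8, f2, f10], [f8, f10, f8, f8, f2, f10, f10], [1, f3, f3, f9, 1, 1, f3], [f3, f3, f9, 1, 1, f3, 1]]"
  by (simp add: rows_def janko_Z_def vector_7 f_defs)


lemmas mat_eval = mmul_def list.map vmul.simps axpy.simps list.sel f_arith

subsection \<open>The group as a type\<close>

lemma group_GL: "Group.group GL_7_11"
proof (rule groupI)
  fix A assume "A \<in> carrier GL_7_11"
  then obtain B where "A ** B = mat 1" "B ** A = mat 1" by (auto simp: GL_7_11_def invertible_def)
  then show "\<exists>B\<in>carrier GL_7_11. B \<otimes>\<^bsub>GL_7_11\<^esub> A = \<one>\<^bsub>GL_7_11\<^esub>"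
    by (auto simp: GL_7_11_def invertible_def)
next
  have "invertible (mat 1 :: 11 ^ 7 ^ 7)" unfolding invertible_def by (intro exI[of _ "mat 1"]) simp
  then show "\<one>\<^bsub>GL_7_11\<^esub> \<in> carrier GL_7_11" by (simp add: GL_7_11_def)
qed (auto simp: GL_7_11_def invertible_mult matrix_mul_assoc)

lemma janko_carrier: "janko_Y \<in> carrier GL_7_11" "janko_Z \<in> carrier GL_7_11"
proof -
  have inv: "A \<in> carrier GL_7_11" if "A ** B = mat 1" "B ** A = mat 1" for A B
    using that by (auto simp: GL_7_11_def invertible_def)
  let ?Y2 = "janko_Y ** janko_Y" and ?Z2 = "janko_Z ** janko_Z"
  let ?Y6 = "?Y2 ** ?Y2 ** ?Y2" and ?Z4 = "?Z2 ** ?Z2"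
  have "janko_Y ** ?Y6 = mat 1" "?Y6 ** janko_Y = mat 1"
    by (simp_all only: rows_inj [symmetric] rows_mult rows_janko_Y rows_one mat_eval)
  then show "janko_Y \<in> carrier GL_7_11" by (rule inv)
  have "janko_Z ** ?Z4 = mat 1" "?Z4 ** janko_Z = mat 1"
    by (simp_all only: rows_inj [symmetric] rows_mult rows_janko_Z rows_one mat_eval)
  then show "janko_Z \<in> carrier GL_7_11" by (rule inv)
qed

lemma group_J1: "Group.group J1"
  unfolding J1_def by (rule group.group_subgroup_generated[OF group_GL])

lemma J1_simps: "mult J1 = (**)" "one J1 = mat 1"
  by (simp_all add: J1_def GL_7_11_def subgroup_generated_def)

lemma janko_in_J1: "janko_Y \<in> carrier J1" "janko_Z \<in> carrier J1"
  using janko_carrier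
  by (auto simp: J1_def group.carrier_subgroup_generated_subset [OF group_GL]
      intro!: set_mp[OF group.subgroup_generated_subset_carrier_subset[OF group_GL]])

text \<open>As a type the group inherits finiteness from the matrices, and its equations fall under
  the class \<open>grp\<close>.\<close>

typedef j1 = "carrier J1"
  using janko_in_J1 by blast

setup_lifting type_definition_j1

instance j1 :: finite
proof
  have "range Rep_j1 \<subseteq> UNIV" by simp
  then show "finite (UNIV :: j1 set)"
    using Rep_j1_inject by (metis finite_code finite_imageD finite_subset injI)
qed

instantiation j1 :: grp
begin

lift_definition one_j1 :: j1 is "mat 1"
  using group.is_monoid[OF group_J1] monoid.one_closed J1_simps by metis

lift_definition times_j1 :: "j1 \<Rightarrow> j1 \<Rightarrow> j1" is "(**)"
  using group.is_monoid[OF group_J1] monoid.m_closed J1_simps by metis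

lift_definition inverse_j1 :: "j1 \<Rightarrow> j1" is "\<lambda>A. inv\<^bsub>J1\<^esub> A"
  by (rule group.inv_closed[OF group_J1])

definition divide_j1 :: "j1 \<Rightarrow> j1 \<Rightarrow> j1" where
  "divide_j1 a b = a * inverse b"

instance
proof
  fix a b c :: j1
  show "a * b * c = a * (b * c)" by transfer (simp add: matrix_mul_assoc)
  show "1 * a = a" by transfer (simp add: matrix_mul_lid)
  show "a * 1 = a" by transfer (simp add: matrix_mul_rid)
  show "inverse a * a = 1" by transfer (metis J1_simps group.l_inv[OF group_J1])
  show "a div b = a * inverse b" by (rule divide_j1_def)
qed

end

lift_definition gY :: j1 is janko_Y by (rule janko_in_J1)
lift_definition gZ :: j1 is janko_Z by (rule janko_in_J1)

text \<open>Closure under right multiplication by the generators suffices by finiteness: a right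
  multiplication that maps S into S maps it onto S, so the elements with this property form a
  subgroup.\<close>

lemma generated_j1:
  assumes S: "(1::j1) \<in> S" "\<And>g. g \<in> S \<Longrightarrow> g * gY \<in> S" "\<And>g. g \<in> S \<Longrightarrow> g * gZ \<in> S"
  shows "S = UNIV"
proof -
  define T where "T = {t. \<forall>s\<in>S. s * t \<in> S}"
  have TI: "t \<in> T" if "\<And>s. s \<in> S \<Longrightarrow> s * t \<in> S" for t using that by (simp add: T_def)
  have TD: "s * t \<in> S" if "t \<in> T" "s \<in> S" for s t using that by (simp add: T_def)
  have inv: "inverse t \<in> T" if t: "t \<in> T" for t
  proof (rule TI)
    fix s assume s: "s \<in> S"
    have "(\<lambda>s. s * t) ` S = S"
      by (rule card_subset_eq) (use TD[OF t] in \<open>auto simp: card_image inj_on_def\<close>)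
    then obtain s' where "s' \<in> S" "s = s' * t" using s by (metis (no_types, lifting) imageE)
    then show "s * inverse t \<in> S" by (simp add: mult.assoc)
  qed
  have sub: "carrier J1 \<subseteq> carrier GL_7_11"
    unfolding J1_def by (rule group.carrier_subgroup_generated_subset[OF group_GL])
  have "subgroup (Rep_j1 ` T) GL_7_11"
  proof (rule group.subgroupI[OF group_GL])
    show "Rep_j1 ` T \<subseteq> carrier GL_7_11" using Rep_j1 sub by blast
    have "1 \<in> T" by (rule TI) simp
    then show "Rep_j1 ` T \<noteq> {}" by blast
    fix A assume "A \<in> Rep_j1 ` T"
    then obtain t where t: "t \<in> T" "A = Rep_j1 t" by auto
    have "Rep_j1 (inverse t) ** A = mat 1"
      using t(2) by (simp only: times_j1.rep_eq [symmetric] inv_cancel one_j1.rep_eq)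
    then have "inv\<^bsub>GL_7_11\<^esub> A = Rep_j1 (inverse t)"
      by (intro group.inv_equality[OF group_GL])
        (use t(2) Rep_j1[of t] Rep_j1[of "inverse t"] sub in \<open>auto simp: GL_7_11_def\<close>)
    then show "inv\<^bsub>GL_7_11\<^esub> A \<in> Rep_j1 ` T" using inv[OF t(1)] by simp
    fix B assume "B \<in> Rep_j1 ` T"
    then obtain u where u: "u \<in> T" "B = Rep_j1 u" by auto
    have "t * u \<in> T" by (rule TI) (simp add: mult.assoc [symmetric] TD t u)
    moreover have "A \<otimes>\<^bsub>GL_7_11\<^esub> B = Rep_j1 (t * u)" using t u by (simp add: GL_7_11_def times_j1.rep_eq)
    ultimately show "A \<otimes>\<^bsub>GL_7_11\<^esub> B \<in> Rep_j1 ` T" by simp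
  qed
  moreover have "gY \<in> T" "gZ \<in> T" using S by (auto intro!: TI)
  then have "{janko_Y, janko_Z} \<subseteq> Rep_j1 ` T"
    by (auto simp: gY.rep_eq [symmetric] gZ.rep_eq [symmetric])
  ultimately have c: "carrier J1 \<subseteq> Rep_j1 ` T"
    unfolding J1_def by (intro group.subgroup_generated_minimal[OF group_GL])
  have "t \<in> S" for t
  proof -
    have "Rep_j1 t \<in> Rep_j1 ` T" using Rep_j1[of t] c by blast
    then have "t \<in> T" by (auto simp: Rep_j1_inject)
    then show ?thesis using TD[OF _ S(1)] by simp
  qed
  then show ?thesis by blast
qed

definition mt :: "j1 \<Rightarrow> 11 list list" where
  "mt g = rows (Rep_j1 g)"

lemma mt_inj: "g = h \<longleftrightarrow> mt g = mt h"
  by (simp add: mt_def rows_inj Rep_j1_inject)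

lemma mt_mult: "mt (g * h) = mmul (mt g) (mt h)"
  by (simp add: mt_def times_j1.rep_eq rows_mult)

lemma mt_one: "mt 1 = [[1, 0, 0, 0, 0, 0, 0], [0, 1, 0, 0, 0, 0, 0], [0, 0, 1, 0, 0, 0, 0], [0, 0, 0, 1, 0, 0, 0], [0, 0, 0, 0, 1, 0, 0], [0, 0, 0, 0, 0, 1, 0], [0, 0, 0, 0, 0, 0, 1]]"
  by (simp add: mt_def one_j1.rep_eq rows_one)

lemma mt_Y: "mt gY = [[0, 1, 0, 0, 0, 0, 0], [0, 0, 1, 0, 0, 0, 0], [0, 0, 0, 1, 0, 0, 0], [0, 0, 0, 0, 1, 0, 0], [0, 0, 0, 0, 0, 1, 0], [0, 0, 0, 0, 0, 0, 1], [1, 0, 0, 0, 0, 0, 0]]"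
  by (simp add: mt_def gY.rep_eq rows_janko_Y)

lemma mt_Z: "mt gZ = [[f8, f2, f10, f10, f8, f10, f8], [f9, 1, 1, f3, 1, f3, f3], [f10, f10, f8, f10, f8, f8, f2], [f10, f8, f10, f8, f8, f2, f10], [f8, f10, f8, f8, f2, f10, f10], [1, f3, f3, f9, 1, 1, f3], [f3, f3, f9, 1, 1, f3, 1]]"
  by (simp add: mt_def gZ.rep_eq rows_janko_Z)

lemma Y_order: "gY * (gY * gY * (gY * gY) * (gY * gY)) = 1"
  by (simp only: mt_inj mt_mult mt_Y mt_one mat_eval)

lemma Z_order: "gZ * (gZ * gZ * (gZ * gZ)) = 1"
  by (simp only: mt_inj mt_mult mt_Z mt_one mat_eval)

lemma mt_inverse_Y: "mt (inverse gY) = [[0, 0, 0, 0, 0, 0, 1], [1, 0, 0, 0, 0, 0, 0], [0, 1, 0, 0, 0, 0, 0], [0, 0, 1, 0, 0, 0, 0], [0, 0, 0, 1, 0, 0, 0], [0, 0, 0, 0, 1, 0, 0], [0, 0, 0, 0, 0, 1, 0]]"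
  using Y_order by (simp only: mult_eq_one_inv [symmetric] grp.inverse_unique mt_mult mt_Y mat_eval)

lemma mt_inverse_Z: "mt (inverse gZ) = [[f8, f9, f10, f10, f8, 1, f3], [f2, 1, f10, f8, f10, f3, f3], [f10, 1, f8, f10, f8, f3, f9], [f10, f3, f10, f8, f8, f9, 1], [f8, 1, f8, f8, f2, 1, 1], [f10, f3, f8, f2, f10, 1, f3], [f8, f3, f2, f10, f10, f3, 1]]"
  using Z_order by (simp only: grp.inverse_unique mt_mult mt_Z mat_eval)

section \<open>Named elements, their matrices and the relations between them\<close>

lemmas mt_gen = mt_mult mt_Y mt_Z mt_inverse_Y mt_inverse_Z mt_one mat_eval

text \<open>\<open>gx\<close> and \<open>gZ\<close> generate a group of order 55, which
  \<open>gw\<close> extends to one of order 660; the involution \<open>gt\<close> inverts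
  \<open>gx\<close> and centralizes \<open>gZ\<close>. \<open>ge\<close> is a diagonal involution.
  \<open>gp\<close> and \<open>gr\<close> normalize the group of \<open>gY\<close>, raising it to
  the powers 2 and 3. \<open>gs\<close> normalizes the group of \<open>gu\<close>, of order 19,
  raising it to the power 8, which has order 6 modulo 19.\<close>

definition gx :: j1 where "gx = gZ * gZ * gY * gZ * gY * gY * gZ * gZ * inverse gY * gZ * inverse gY"
definition gw :: j1 where "gw = gY * inverse gZ * inverse gZ * inverse gY * inverse gZ * inverse gY * inverse gZ * inverse gY * inverse gZ * inverse gZ * gY"
definition gt :: j1 where "gt = gY * gY * gZ * gZ * inverse gY * gZ * inverse gY * gZ * gY * gY * gZ * gZ * inverse gY * inverse gY"
definition ge :: j1 where "ge = gZ * gY * inverse gZ * gY"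
definition gp :: j1 where "gp = gY * inverse gZ * inverse gY * inverse gZ * inverse gY * inverse gZ * gY * gZ * gZ * gY * gZ * gY * gZ * inverse gY * inverse gZ * inverse gZ"
definition gr :: j1 where "gr = gZ * gY * gZ * gY * gZ * gZ * gY * inverse gZ * inverse gY * inverse gZ * gY * gY * inverse gZ * gY * inverse gZ * inverse gZ"
definition gu :: j1 where "gu = gY * inverse gZ * gY"
definition gs :: j1 where "gs = gZ * gY * gY * inverse gZ * inverse gZ * inverse gY * inverse gZ * inverse gY * inverse gZ * gY * inverse gZ"

lemma mt_gx: "mt gx = [[1, f9, f3, f9, f6, f3, f9], [f6, f6, f4, f5, f10, f2, f9], [f9, f7, f5, f10, f6, f2, f5], [f8, f9, f5, f10, f9, f3, f2], [f8, f6, f9, f8, f7, f5, f10], [f9, f5, 1, f9, f9, f9, f5], [f2, 1, f8, f10, f6, f10, f2]]"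
  by (simp only: gx_def mt_gen)

lemma mt_gw: "mt gw = [[0, f9, 0, f2, f7, f4, f7], [f9, f9, f7, f4, f10, 1, f5], [0, f7, f2, 0, f7, f9, f4], [f2, f4, 0, 0, f7, f7, f9], [f7, f10, f7, f7, f4, f10, f10], [f4, 1, f9, f7, f10, f5, f9], [f7, f5, f4, f9, f10, f9, 1]]"
  by (simp only: gw_def mt_gen)

lemma mt_gt: "mt gt = [[f9, 0, f8, f8, 1, 0, 0], [0, f9, 0, 0, 0, f7, f5], [f8, 0, f8, f9, 1, 0, 0], [f8, 0, f9, f8, 1, 0, 0], [1, 0, 1, 1, f8, 0, 0], [0, f7, 0, 0, 0, f5, f9], [0, f5, 0, 0, 0, f9, f7]]"
  by (simp only: gt_def mt_gen)

lemma mt_ge: "mt ge = [[f10, 0, 0, 0, 0, 0, 0], [0, f10, 0, 0, 0, 0, 0], [0, 0, f10, 0, 0, 0, 0], [0, 0, 0, 1, 0, 0, 0], [0, 0, 0, 0, 1, 0, 0], [0, 0, 0, 0, 0, f10, 0], [0, 0, 0, 0, 0, 0, 1]]"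
  by (simp only: ge_def mt_gen)

lemma mt_gp: "mt gp = [[1, 0, 0, 0, 0, 0, 0], [0, 0, 0, 0, 1, 0, 0], [0, 1, 0, 0, 0, 0, 0], [0, 0, 0, 0, 0, 1, 0], [0, 0, 1, 0, 0, 0, 0], [0, 0, 0, 0, 0, 0, 1], [0, 0, 0, 1, 0, 0, 0]]"
  by (simp only: gp_def mt_gen)

lemma mt_gr: "mt gr = [[1, f3, f3, f9, 1, 1, f3], [f3, f9, 1, 1, f3, 1, f3], [1, 1, f3, 1, f3, f3, f9], [f3, 1, f3, f3, f9, 1, 1], [f3, f3, f9, 1, 1, f3, 1], [f9, 1, 1, f3, 1, f3, f3], [1, f3, 1, f3, f3, f9, 1]]"
  by (simp only: gr_def mt_gen)

lemma mt_gu: "mt gu = [[f3, f2, 1, f10, f8, f10, f3], [f9, f10, 1, f8, f10, f8, f3], [1, f10, f3, f10, f8, f8, f9], [1, f8, 1, f8, f8, f2, 1], [f3, f10, f3, f8, f2, f10, 1], [1, f8, f3, f2, f10, f10, f3], [f3, f8, f9, f10, f10, f8, 1]]"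
  by (simp only: gu_def mt_gen)

lemma mt_gs: "mt gs = [[f6, f4, f2, f8, 1, f6, f8], [f8, f2, f8, f10, f6, f2, f9], [0, f9, 1, f4, f8, f9, 0], [f10, f2, f10, f7, f6, f8, 0], [f2, 0, f10, f7, f4, f2, f9], [f10, f10, f8, f3, f2, f8, 1], [f7, f7, f3, 0, f8, f10, f4]]"
  by (simp only: gs_def mt_gen)

text \<open>Tabulated powers make every power in a later relation cost a single matrix
  product.\<close>

lemma mt_gx_2: "mt (gx ^ 2) = [[f5, f5, f8, f9, f10, f3, f7], [f3, 0, f9, f10, f10, f2, f2], [f10, f2, f6, f8, f4, f3, f5], [f4, f3, f4, 1, f8, f9, f10], [f2, 1, f6, 0, f3, f5, f5], [f8, f6, f7, f2, f2, 0, f8], [f5, f5, f4, f9, f7, f7, f3]]"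
  by (simp only: power2_eq_square mt_gx mt_mult mat_eval)

lemma mt_gx_3: "mt (gx ^ 3) = [[f3, f8, f5, f10, f7, f6, f2], [f2, f10, f3, f5, f9, f2, f8], [0, f7, 0, f8, f9, f2, f10], [0, f7, 1, f5, f9, f8, f10], [f9, f4, f2, f4, 0, f9, 1], [1, f8, f10, f2, f10, f3, f3], [f4, 0, f7, f8, f7, 1, f8]]"
  by (simp only: power_add[of gx 2 1, simplified] mt_gx mt_gx_2 mt_mult mat_eval)

lemma mt_gx_4: "mt (gx ^ 4) = [[f4, f10, f3, f6, f3, f9, f6], [f4, f7, f2, f10, f7, f3, f7], [f7, 1, 0, f8, f8, f3, 1], [f2, 0, f7, f9, f8, f6, f8], [1, f3, f2, f10, f9, f10, f6], [f4, f3, f3, f9, f4, f9, f3], [f3, f3, f6, 1, f2, f9, f2]]"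
  by (simp only: power_add[of gx 3 1, simplified] mt_gx mt_gx_3 mt_mult mat_eval)

lemma mt_gx_5: "mt (gx ^ 5) = [[f3, f9, f5, 0, f4, f3, f9], [f10, f4, f2, f3, f6, f5, f8], [f5, f7, f5, f7, f4, f3, f9], [f7, f3, f8, f2, f7, 1, f10], [f5, f10, f5, f3, f8, f7, f9], [f9, f8, f10, f6, f5, f6, 0], [f8, 1, 0, f9, f2, f9, 1]]"
  by (simp only: power_add[of gx 4 1, simplified] mt_gx mt_gx_4 mt_mult mat_eval)

lemma mt_gx_6: "mt (gx ^ 6) = [[f3, f10, f5, f7, f5, f9, f8], [f9, f4, f7, f3, f10, f8, 1], [f5, f2, f5, f8, f5, f10, 0], [0, f3, f7, f2, f3, f6, f9], [f4, f6, f4, f7, f8, f5, f2], [f3, f5, f3, 1, f7, f6, f9], [f9, f8, f9, f10, f9, 0, 1]]"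
  by (simp only: power_add[of gx 5 1, simplified] mt_gx mt_gx_5 mt_mult mat_eval)

lemma mt_gx_7: "mt (gx ^ 7) = [[f4, f4, f7, f2, 1, f4, f3], [f10, f7, 1, 0, f3, f3, f3], [f3, f2, 0, f7, f2, f3, f6], [f6, f10, f8, f9, f10, f9, 1], [f3, f7, f8, f8, f9, f4, f2], [f9, f3, f3, f6, f10, f9, f9], [f6, f7, 1, f8, f6, f3, f2]]"
  by (simp only: power_add[of gx 6 1, simplified] mt_gx mt_gx_6 mt_mult mat_eval)

lemma mt_gx_8: "mt (gx ^ 8) = [[f3, f2, 0, 0, f9, 1, f4], [f8, f10, f7, f7, f4, f8, 0], [f5, f3, 0, 1, f2, f10, f7], [f10, f5, f8, f5, f4, f2, f8], [f7, f9, f9, f9, 0, f10, f7], [f6, f2, f2, f8, f9, f3, 1], [f2, f8, f10, f10, 1, f3, f8]]"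
  by (simp only: power_add[of gx 7 1, simplified] mt_gx mt_gx_7 mt_mult mat_eval)

lemma mt_gx_9: "mt (gx ^ 9) = [[f5, f3, f10, f4, f2, f8, f5], [f5, 0, f2, f3, 1, f6, f5], [f8, f9, f6, f4, f6, f7, f4], [f9, f10, f8, 1, 0, f2, f9], [f10, f10, f4, f8, f3, f2, f7], [f3, f2, f3, f9, f5, 0, f7], [f7, f2, f5, f10, f5, f8, f3]]"
  by (simp only: power_add[of gx 8 1, simplified] mt_gx mt_gx_8 mt_mult mat_eval)

lemma mt_gx_10: "mt (gx ^ 10) = [[1, f6, f9, f8, f8, f9, f2], [f9, f6, f7, f9, f6, f5, 1], [f3, f4, f5, f5, f9, 1, f8], [f9, f5, f10, f10, f8, f9, f10], [f6, f10, f6, f9, f7, f9, f6], [f3, f2, f2, f3, f5, f9, f10], [f9, f9, f5, f2, f10, f5, f2]]"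
  by (simp only: power_add[of gx 9 1, simplified] mt_gx mt_gx_9 mt_mult mat_eval)

lemma mt_gZ_2: "mt (gZ ^ 2) = [[f6, f2, f10, f10, f7, f3, 0], [f9, f4, f8, 0, f3, f8, f8], [f10, f3, f6, f10, f7, 0, f2], [f10, 0, f10, f6, f7, f2, f3], [f7, f8, f7, f7, f6, f8, f8], [f8, f8, 0, f9, f3, f4, f8], [0, f8, f9, f8, f3, f8, f4]]"
  by (simp only: power2_eq_square mt_Z mt_mult mat_eval)

lemma mt_gZ_3: "mt (gZ ^ 3) = [[f6, f9, f10, f10, f7, f8, 0], [f2, f4, f3, 0, f8, f8, f8], [f10, f8, f6, f10, f7, 0, f9], [f10, 0, f10, f6, f7, f9, f8], [f7, f3, f7, f7, f6, f3, f3], [f3, f8, 0, f2, f8, f4, f8], [0, f8, f2, f3, f8, f8, f4]]"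
  by (simp only: power_add[of gZ 2 1, simplified] mt_Z mt_gZ_2 mt_mult mat_eval)

lemma mt_gZ_4: "mt (gZ ^ 4) = [[f8, f9, f10, f10, f8, 1, f3], [f2, 1, f10, f8, f10, f3, f3], [f10, 1, f8, f10, f8, f3, f9], [f10, f3, f10, f8, f8, f9, 1], [f8, 1, f8, f8, f2, 1, 1], [f10, f3, f8, f2, f10, 1, f3], [f8, f3, f2, f10, f10, f3, 1]]"
  by (simp only: power_add[of gZ 3 1, simplified] mt_Z mt_gZ_3 mt_mult mat_eval)

lemma mt_gY_2: "mt (gY ^ 2) = [[0, 0, 1, 0, 0, 0, 0], [0, 0, 0, 1, 0, 0, 0], [0, 0, 0, 0, 1, 0, 0], [0, 0, 0, 0, 0, 1, 0], [0, 0, 0, 0, 0, 0, 1], [1, 0, 0, 0, 0, 0, 0], [0, 1, 0, 0, 0, 0, 0]]"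
  by (simp only: power2_eq_square mt_Y mt_mult mat_eval)

lemma mt_gY_3: "mt (gY ^ 3) = [[0, 0, 0, 1, 0, 0, 0], [0, 0, 0, 0, 1, 0, 0], [0, 0, 0, 0, 0, 1, 0], [0, 0, 0, 0, 0, 0, 1], [1, 0, 0, 0, 0, 0, 0], [0, 1, 0, 0, 0, 0, 0], [0, 0, 1, 0, 0, 0, 0]]"
  by (simp only: power_add[of gY 2 1, simplified] mt_Y mt_gY_2 mt_mult mat_eval)

lemma mt_gY_4: "mt (gY ^ 4) = [[0, 0, 0, 0, 1, 0, 0], [0, 0, 0, 0, 0, 1, 0], [0, 0, 0, 0, 0, 0, 1], [1, 0, 0, 0, 0, 0, 0], [0, 1, 0, 0, 0, 0, 0], [0, 0, 1, 0, 0, 0, 0], [0, 0, 0, 1, 0, 0, 0]]"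
  by (simp only: power_add[of gY 3 1, simplified] mt_Y mt_gY_3 mt_mult mat_eval)

lemma mt_gY_5: "mt (gY ^ 5) = [[0, 0, 0, 0, 0, 1, 0], [0, 0, 0, 0, 0, 0, 1], [1, 0, 0, 0, 0, 0, 0], [0, 1, 0, 0, 0, 0, 0], [0, 0, 1, 0, 0, 0, 0], [0, 0, 0, 1, 0, 0, 0], [0, 0, 0, 0, 1, 0, 0]]"
  by (simp only: power_add[of gY 4 1, simplified] mt_Y mt_gY_4 mt_mult mat_eval)

lemma mt_gY_6: "mt (gY ^ 6) = [[0, 0, 0, 0, 0, 0, 1], [1, 0, 0, 0, 0, 0, 0], [0, 1, 0, 0, 0, 0, 0], [0, 0, 1, 0, 0, 0, 0], [0, 0, 0, 1, 0, 0, 0], [0, 0, 0, 0, 1, 0, 0], [0, 0, 0, 0, 0, 1, 0]]"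
  by (simp only: power_add[of gY 5 1, simplified] mt_Y mt_gY_5 mt_mult mat_eval)

lemmas mt_named = mt_gx mt_gw mt_gt mt_ge mt_gp mt_gr mt_gu mt_gs mt_gx_2 mt_gx_3 mt_gx_4 mt_gx_5 mt_gx_6 mt_gx_7 mt_gx_8 mt_gx_9 mt_gx_10 mt_gZ_2 mt_gZ_3 mt_gZ_4 mt_gY_2 mt_gY_3 mt_gY_4 mt_gY_5 mt_gY_6
lemmas rel_eval = mt_inj mt_gen mt_named

lemma rel_B:
  shows "gx ^ 10 * gx = 1"
    "gZ ^ 4 * gZ = 1"
    "gZ * gx = gx ^ 5 * gZ"
    "gw * gw = 1"
    "gt * gt = 1"
    "gw * gZ * gw = gZ ^ 4"
    "gt * gx * gt = gx ^ 10"
    "gt * gZ = gZ * gt"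
  by (simp_all only: rel_eval)

text \<open>These rules reduce two occurrences of \<open>gw\<close> to one; they are the nontrivial
  part of the Bruhat decomposition of the subgroup of order 660.\<close>

lemma rel_w:
  shows "gw * gx * gw = gx ^ 2 * gZ ^ 4 * gw * gx ^ 2"
    "gw * gx ^ 2 * gw = gx * gZ * gw * gx"
    "gw * gx ^ 3 * gw = gx ^ 8 * gw * gx ^ 8"
    "gw * gx ^ 4 * gw = gx ^ 6 * gZ ^ 3 * gw * gx ^ 6"
    "gw * gx ^ 5 * gw = gx ^ 7 * gZ ^ 2 * gw * gx ^ 7"
    "gw * gx ^ 6 * gw = gx ^ 4 * gZ ^ 2 * gw * gx ^ 4"
    "gw * gx ^ 7 * gw = gx ^ 5 * gZ ^ 3 * gw * gx ^ 5"
    "gw * gx ^ 8 * gw = gx ^ 3 * gw * gx ^ 3"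
    "gw * gx ^ 9 * gw = gx ^ 10 * gZ * gw * gx ^ 10"
    "gw * gx ^ 10 * gw = gx ^ 9 * gZ ^ 4 * gw * gx ^ 9"
  by (simp_all only: rel_eval)

text \<open>Together with 1 and \<open>gt\<close>, these represent the double cosets of the subgroup
  of order 660. The relations \<open>rel_d2\<close>, \<open>rel_d3\<close> and \<open>rel_d4\<close>
  tell in which double coset each neighbour of a representative lies.\<close>

definition d2 :: j1 where "d2 = gt * gw * gt"
definition d3 :: j1 where "d3 = gt * gw * gt * gx ^ 2 * gw * gt"
definition d4 :: j1 where "d4 = gt * gw * gt * gw * gt"

lemma mt_d2: "mt d2 = [[0, f7, f2, 0, f7, f9, f4], [f7, f5, f4, f9, f10, f9, 1], [f2, f4, 0, 0, f7, f7, f9], [0, f9, 0, f2, f7, f4, f7], [f7, f10, f7, f7, f4, f10, f10], [f9, f9, f7, f4, f10, 1, f5], [f4, 1, f9, f7, f10, f5, f9]]"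
  by (simp only: d2_def mt_gen mt_named)

lemma mt_d3: "mt d3 = [[0, f3, f3, f5, f7, f2, f9], [f3, f4, f6, f6, f8, f9, 1], [f3, f6, 1, f9, f6, f8, f7], [f5, f6, f9, f10, f6, 0, f8], [f7, f8, f6, f6, f4, f9, f4], [f2, f9, f8, 0, f9, f10, 1], [f9, 1, f7, f8, f4, 1, f3]]"
  by (simp only: d3_def mt_gen mt_named)

lemma mt_d4: "mt d4 = [[f8, 0, f8, f9, 1, 0, 0], [0, f5, 0, 0, 0, f9, f7], [f8, 0, f9, f8, 1, 0, 0], [f9, 0, f8, f8, 1, 0, 0], [1, 0, 1, 1, f8, 0, 0], [0, f9, 0, 0, 0, f7, f5], [0, f7, 0, 0, 0, f5, f9]]"
  by (simp only: d4_def mt_gen mt_named)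

lemmas rel_eval_d = rel_eval mt_d2 mt_d3 mt_d4

lemma rel_d2:
  shows "d2 * gt = gt * gw"
    "d2 * gw * gt = d4"
    "d2 * gx * gw * gt = gx ^ 3 * gZ * gw * gx ^ 6 * d2 * gx ^ 5 * gZ * gw * gx ^ 8"
    "d2 * gx ^ 2 * gw * gt = d3"
    "d2 * gx ^ 3 * gw * gt = gx * gw * gx ^ 8 * d2 * gx * gZ ^ 3 * gw * gx ^ 10"
    "d2 * gx ^ 4 * gw * gt = gx ^ 9 * gw * gx ^ 7 * d2 * gx ^ 9 * gZ * gw * gx ^ 2"
    "d2 * gx ^ 5 * gw * gt = gx ^ 5 * gw * gx ^ 6 * d2 * gx ^ 5 * gw * gx ^ 6"
    "d2 * gx ^ 6 * gw * gt = gZ ^ 3 * d3 * gZ ^ 2"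
    "d2 * gx ^ 7 * gw * gt = gZ * d3 * gZ ^ 4"
    "d2 * gx ^ 8 * gw * gt = gZ ^ 2 * d3 * gZ ^ 3"
    "d2 * gx ^ 9 * gw * gt = gx ^ 4 * gw * gx ^ 2 * d2 * gx ^ 4 * gZ ^ 4 * gw * gx ^ 7"
    "d2 * gx ^ 10 * gw * gt = gZ ^ 4 * d3 * gZ"
  by (simp_all only: rel_eval_d)

lemma rel_d3:
  shows "d3 * gt = d2 * gx ^ 2 * gw"
    "d3 * gw * gt = gx ^ 10 * gZ * gw * d2 * gx ^ 2 * gZ ^ 4 * gw * gx ^ 9"
    "d3 * gx * gw * gt = gx ^ 9 * gZ ^ 3 * d3 * gx ^ 4 * gZ ^ 3 * gw * gx ^ 8"
    "d3 * gx ^ 2 * gw * gt = gx ^ 3 * gZ ^ 2 * gw * gx ^ 7 * d3 * gx ^ 4 * gZ ^ 2 * gw * gx ^ 8"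
    "d3 * gx ^ 3 * gw * gt = gx ^ 3 * gw * gx ^ 8 * d2 * gx ^ 2 * gw * gx ^ 8"
    "d3 * gx ^ 4 * gw * gt = gx ^ 6 * gZ ^ 2 * d3 * gx * gZ ^ 2 * gw * gx ^ 2"
    "d3 * gx ^ 5 * gw * gt = gx ^ 3 * gZ ^ 2 * d3 * gx ^ 9 * gZ ^ 3 * gw * gx ^ 6"
    "d3 * gx ^ 6 * gw * gt = gx ^ 8 * gw * gx ^ 4 * d2 * gx ^ 7 * gZ ^ 3 * gw * gx"
    "d3 * gx ^ 7 * gw * gt = gZ ^ 4 * gw * gx ^ 6 * d3 * gx * gZ ^ 3 * gw * gx ^ 7"
    "d3 * gx ^ 8 * gw * gt = gx ^ 6 * gZ * gw * gx ^ 5 * d2 * gx ^ 2 * gZ * gw * gx ^ 4"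
    "d3 * gx ^ 9 * gw * gt = gx ^ 10 * gZ ^ 3 * d3 * gx ^ 5 * gZ ^ 2 * gw * gx ^ 7"
    "d3 * gx ^ 10 * gw * gt = gZ * gw * gx * d2 * gx ^ 2 * gZ ^ 4 * gw"
  by (simp_all only: rel_eval_d)

lemma rel_d4:
  shows "d4 * gt = d2 * gw"
    "d4 * gw * gt = gw * d2 * gw"
    "d4 * gx * gw * gt = gx * gw * gx ^ 7 * d2 * gw * gx ^ 7"
    "d4 * gx ^ 2 * gw * gt = gx ^ 2 * gw * gx * d2 * gw * gx"
    "d4 * gx ^ 3 * gw * gt = gx ^ 3 * gw * gx ^ 6 * d2 * gw * gx ^ 6"
    "d4 * gx ^ 4 * gw * gt = gx ^ 4 * gZ * gw * gx ^ 6 * d2 * gZ ^ 4 * gw * gx ^ 10"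
    "d4 * gx ^ 5 * gw * gt = gx ^ 5 * gw * gx ^ 8 * d2 * gw * gx ^ 8"
    "d4 * gx ^ 6 * gw * gt = gx ^ 6 * gw * gx ^ 4 * d2 * gw * gx ^ 4"
    "d4 * gx ^ 7 * gw * gt = gx ^ 7 * gw * gx ^ 5 * d2 * gw * gx ^ 5"
    "d4 * gx ^ 8 * gw * gt = gx ^ 8 * gw * gx ^ 3 * d2 * gw * gx ^ 3"
    "d4 * gx ^ 9 * gw * gt = gx ^ 9 * gw * gx ^ 2 * d2 * gw * gx ^ 2"
    "d4 * gx ^ 10 * gw * gt = gx ^ 10 * gw * gx ^ 9 * d2 * gw * gx ^ 9"
  by (simp_all only: rel_eval_d)

lemma rel_Y:
  shows "gY = gx ^ 10 * gZ ^ 2 * gw * gx ^ 5 * d2 * gx ^ 6 * gZ ^ 4 * gw * gx ^ 10"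
  by (simp_all only: rel_eval_d)

text \<open>Elements of the subgroup of order 660 that conjugation by \<open>d3\<close> or
  \<open>d4\<close> keeps inside it. They make the stabilizers large and hence the double cosets
  small.\<close>

lemma rel_stab:
  shows "gx ^ 3 * gw * gx ^ 8 * d3 = d3 * gx ^ 3 * gw * gx ^ 8"
    "gx ^ 10 * gZ * gw * d3 = d3 * gZ * gw * gx"
    "gZ * d4 = d4 * gZ"
    "gw * d4 = d4 * gw"
    "gx * gw * gx ^ 7 * d4 = d4 * gx * gw * gx ^ 7"
  by (simp_all only: rel_eval_d)

lemma rel_v:
  shows "gx ^ 10 * gZ * gw * gx * d4 = d4 * gx ^ 10 * gZ * gw * gx"
    "gx ^ 10 * gZ * gw * gx * gw = gw * gx ^ 10 * gZ * gw * gx"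
    "gx ^ 10 * gZ * gw * gx * gx ^ 10 * gZ * gw * gx = 1"
    "gx ^ 3 * gw * gx ^ 8 * gx ^ 3 * gw * gx ^ 8 = 1"
    "gx ^ 10 * gZ * gw * gx ^ 10 * gZ * gw * gx ^ 10 * gZ * gw = 1"
    "gx * gw * gx ^ 7 * gx * gw * gx ^ 7 * gx * gw * gx ^ 7 = 1"
  by (simp_all only: rel_eval_d)

lemma rel_wt:
  shows "gw * gt * gw * gt * gw * gt * gw * gt * gw * gt * gw * gt = 1"
  by (simp_all only: rel_eval)

lemma rel_Y7:
  shows "gY ^ 6 * gY = 1"
    "gr * gY = gY ^ 3 * gr"
    "gr * gr * gr * gr * gr * gr = 1"
    "gp * gY = gY ^ 2 * gp"
    "gp * gp * gp = 1"
  by (simp_all only: rel_eval)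

lemma rel_u:
  shows "gu ^ 19 = 1" "gs * gu = gu ^ 8 * gs" "gs * gs * gs * (gs * gs * gs) = 1"
proof -
  have p: "gu ^ 8 = (gu * gu * (gu * gu)) * (gu * gu * (gu * gu))" "gu ^ 19 = gu ^ 8 * gu ^ 8 * gu * gu * gu"
    by (simp_all add: numeral_eq_Suc mult.assoc)
  show "gu ^ 19 = 1" "gs * gu = gu ^ 8 * gs" "gs * gs * gs * (gs * gs * gs) = 1"
    by (simp_all only: p rel_eval)
qed

text \<open>The first three relations make the conjugates of \<open>ge\<close> under
  \<open>gY\<close> close up to a group of order 8 normalized by \<open>gp\<close>. The last one
  puts a conjugate of \<open>gY\<close> into the normalizer of that group, so that two conjugates of
  this normalizer share the group of \<open>gY\<close>.\<close>

lemma rel_E: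
  shows "ge * ge = 1"
    "ge * gY * ge * gY ^ 6 = gY ^ 3 * ge * gY ^ 4"
    "gp * ge = gY ^ 5 * ge * gY ^ 2 * gp"
    "gZ * gY * inverse gZ = ge * gY ^ 6"
  by (simp_all only: rel_eval)

text \<open>\<open>gq2\<close>, \<open>gq3\<close> and \<open>gq4\<close> multiply a power of
  \<open>gx\<close> by a power of its conjugate under the second, third and fourth power of
  \<open>gw * gt\<close>. Their order 7 later excludes three configurations of Sylow
  11-subgroups.\<close>

definition gq2 :: j1 where "gq2 = gx * (gw * gt * gw * gt * gx ^ 5 * (gt * gw * gt * gw))"
lemma mt_gq2: "mt gq2 = [[f4, f7, 0, f8, f10, f5, 0], [f4, f4, f3, 1, f4, f8, 0], [f5, f5, 1, f4, f9, f2, f5], [f2, f9, f5, f3, f9, f7, f4], [f6, f8, 0, 0, f5, f7, f5], [f3, f7, f4, f7, f6, f2, f5], [f7, f6, f7, f7, f6, f9, f3]]"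
  by (simp only: gq2_def mt_gen mt_named)

lemma rel_gq2: "gq2 * gq2 * gq2 * (gq2 * gq2 * gq2) * gq2 = 1" "gq2 \<noteq> 1"
  by (simp_all only: mt_inj mt_gen mt_gq2 list.inject f_neq simp_thms)

definition gq3 :: j1 where "gq3 = gx ^ 2 * (gw * gt * gw * gt * gw * gt * gx ^ 4 * (gt * gw * gt * gw * gt * gw))"
lemma mt_gq3: "mt gq3 = [[0, f7, f2, f7, 0, f7, f2], [f4, f4, 1, 1, f4, f10, f7], [f2, f10, f2, f10, f4, f5, f4], [f7, f10, f10, f6, f2, f9, f7], [0, f7, f4, f2, f9, f4, 0], [f4, f10, f6, f2, f7, 1, f9], [f9, f7, f7, f4, 0, f9, 0]]"
  by (simp only: gq3_def mt_gen mt_named)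

lemma rel_gq3: "gq3 * gq3 * gq3 * (gq3 * gq3 * gq3) * gq3 = 1" "gq3 \<noteq> 1"
  by (simp_all only: mt_inj mt_gen mt_gq3 list.inject f_neq simp_thms)

definition gq4 :: j1 where "gq4 = gx * (gw * gt * gw * gt * gw * gt * gw * gt * gx ^ 5 * (gt * gw * gt * gw * gt * gw * gt * gw))"
lemma mt_gq4: "mt gq4 = [[f2, f9, f10, f2, f3, f8, f5], [0, f9, f7, f8, 1, f10, f5], [f10, 1, f3, f8, 1, f8, f9], [f3, f7, f8, f6, f5, f2, f10], [0, f2, f4, f9, 0, 1, f3], [f2, 0, f7, f2, f9, f10, f7], [f7, f4, 0, f10, f4, f3, f3]]"
  by (simp only: gq4_def mt_gen mt_named)

lemma rel_gq4: "gq4 * gq4 * gq4 * (gq4 * gq4 * gq4) * gq4 = 1" "gq4 \<noteq> 1"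
  by (simp_all only: mt_inj mt_gen mt_gq4 list.inject f_neq simp_thms)

subsection \<open>The subgroup of order 660\<close>

lemma sbg_finiteI:
  fixes H :: "'a::{grp,finite} set"
  assumes "1 \<in> H" "\<And>a b. a \<in> H \<Longrightarrow> b \<in> H \<Longrightarrow> a * b \<in> H"
  shows "sbg H"
proof (rule sbgI)
  fix a assume a: "a \<in> H"
  have "a ^ n \<in> H" for n by (induction n) (use a assms in auto)
  moreover have "a * a ^ (gord a - 1) = 1"
    using gord_pos[of a] pow_gord[of a] by (cases "gord a") auto
  then have "inverse a = a ^ (gord a - 1)" by (simp add: mult_eq_one_inv)
  ultimately show "inverse a \<in> H" by simp
qed (use assms in auto)

lemma pow_mod:
  fixes a :: "'a::monoid_mult"
  assumes "a ^ k = 1"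
  shows "a ^ n = a ^ (n mod k)"
proof -
  have "a ^ n = a ^ (k * (n div k) + n mod k)" by simp
  also have "\<dots> = a ^ (n mod k)" using assms by (simp only: power_add power_mult) simp
  finally show ?thesis .
qed

lemma gx11: "gx ^ 11 = 1" and gZ5: "gZ ^ 5 = 1" and gY7: "gY ^ 7 = 1"
  using rel_B(1,2) rel_Y7(1) power_add[of gx 10 1] power_add[of gZ 4 1] power_add[of gY 6 1] by simp_all

lemma gx_not_1: "gx \<noteq> 1" and gZ_not_1: "gZ \<noteq> 1" and gY_not_1: "gY \<noteq> 1" and gw_not_1: "gw \<noteq> 1"
  and gt_not_1: "gt \<noteq> 1" and ge_not_1: "ge \<noteq> 1" and gu_not_1: "gu \<noteq> 1"
  by (simp_all only: rel_eval list.inject f_neq simp_thms)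

lemma gords: "gord gx = 11" "gord gZ = 5" "gord gY = 7" "gord gw = 2" "gord gt = 2" "gord ge = 2" "gord gu = 19"
  using gx11 gZ5 gY7 rel_B(4,5) rel_E(1) rel_u(1) gx_not_1 gZ_not_1 gY_not_1 gw_not_1 gt_not_1 ge_not_1 gu_not_1
  by (auto intro!: gord_prime simp: power2_eq_square)

lemma gZ_gx: "gZ ^ c * gx ^ a = gx ^ (5 ^ c * a) * gZ ^ c"
proof (induction c arbitrary: a)
  case (Suc c)
  have 1: "gZ * gx ^ k = gx ^ (5 * k) * gZ" for k
  proof (induction k)
    case (Suc k)
    have "gZ * gx ^ Suc k = gx ^ (5 * k) * (gZ * gx)"
      using Suc by (simp add: power_Suc2 mult.assoc [symmetric] del: power_Suc)
    also have "\<dots> = gx ^ (5 * Suc k) * gZ"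
      by (simp add: rel_B(3) mult.assoc [symmetric] power_add [symmetric] add.commute)
    finally show ?case .
  qed simp
  have "gZ ^ Suc c * gx ^ a = gZ ^ c * (gZ * gx ^ a)" by (simp add: power_Suc2 mult.assoc del: power_Suc)
  also have "\<dots> = gZ ^ c * gx ^ (5 * a) * gZ" by (simp add: 1 mult.assoc)
  also have "\<dots> = gx ^ (5 ^ c * (5 * a)) * (gZ ^ c * gZ)" by (simp add: Suc mult.assoc)
  finally show ?case by (simp add: power_Suc2 ac_simps del: power_Suc)
qed simp

lemma gx_gZ: "gx ^ d * gZ = gZ * gx ^ (9 * d)"
proof -
  have "gZ * gx ^ (9 * d) = gx ^ (45 * d) * gZ" using gZ_gx[of 1 "9 * d"] by simp
  also have "gx ^ (45 * d) = gx ^ d"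
    by (subst (1 2) pow_mod[OF gx11]) (simp add: mod_mult_left_eq [symmetric])
  finally show ?thesis by simp
qed

lemma gw_gZ: "gw * gZ = gZ ^ 4 * gw"
proof -
  have "gw * gZ = (gw * gZ * gw) * gw" using rel_B(4) by (simp add: mult.assoc)
  then show ?thesis using rel_B(6) by simp
qed

definition gB :: "j1 set" where
  "gB = (\<lambda>(a, c). gx ^ a * gZ ^ c) ` ({..<11} \<times> {..<5})"

text \<open>The Bruhat form of PSL(2,11) with Borel subgroup \<open>gB\<close>. It makes the bound
  55 + 55 * 11 on the number of elements immediate.\<close>

definition gL :: "j1 set" where
  "gL = gB \<union> (\<lambda>(b, d). b * gw * gx ^ d) ` (gB \<times> {..<11})"

lemma gB_I: "gx ^ a * gZ ^ c \<in> gB"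
proof -
  have "gx ^ a * gZ ^ c = gx ^ (a mod 11) * gZ ^ (c mod 5)"
    using pow_mod[OF gx11] pow_mod[OF gZ5] by metis
  then show ?thesis unfolding gB_def by (auto intro!: image_eqI[of _ _ "(a mod 11, c mod 5)"])
qed

lemma gB_E:
  assumes "b \<in> gB" obtains a c where "b = gx ^ a * gZ ^ c"
  using assms by (auto simp: gB_def)

lemma sbg_gB: "sbg gB"
proof (rule sbg_finiteI)
  show "1 \<in> gB" using gB_I[of 0 0] by simp
  fix g h assume "g \<in> gB" "h \<in> gB"
  then obtain a c a' c' where "g = gx ^ a * gZ ^ c" "h = gx ^ a' * gZ ^ c'" by (auto elim!: gB_E)
  then have "g * h = gx ^ a * (gZ ^ c * gx ^ a') * gZ ^ c'" by (simp add: mult.assoc)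
  also have "\<dots> = gx ^ (a + 5 ^ c * a') * gZ ^ (c + c')" by (simp add: gZ_gx power_add mult.assoc)
  finally show "g * h \<in> gB" using gB_I by simp
qed

lemma gen_in_gB: "gx \<in> gB" "gZ \<in> gB" "gx ^ n \<in> gB" "gZ ^ n \<in> gB"
  using gB_I[of 1 0] gB_I[of 0 1] gB_I[of n 0] gB_I[of 0 n] by simp_all

lemma gL_I: "b \<in> gB \<Longrightarrow> b * gw * gx ^ d \<in> gL"
proof -
  assume "b \<in> gB"
  moreover have "gx ^ d = gx ^ (d mod 11)" by (rule pow_mod[OF gx11])
  ultimately show ?thesis unfolding gL_def by (auto intro!: image_eqI[of _ _ "(b, d mod 11)"])
qed

lemma gB_gL: "gB \<subseteq> gL" by (simp add: gL_def)

lemma gL_E: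
  assumes "g \<in> gL"
  obtains "g \<in> gB" | b d where "b \<in> gB" "g = b * gw * gx ^ d"
  using assms by (auto simp: gL_def)

lemma gw_gx_gw:
  assumes "0 < d" "d < 11"
  obtains a c e where "gw * gx ^ d * gw = gx ^ a * gZ ^ c * gw * gx ^ e"
proof -
  have *: "\<exists>a c e. g = gx ^ a * gZ ^ c * gw * gx ^ e"
    if "g = gx ^ a * gZ ^ c * gw * gx ^ e" for g a c e using that by blast
  have "d = 1 \<or> d = 2 \<or> d = 3 \<or> d = 4 \<or> d = 5 \<or> d = 6 \<or> d = 7 \<or> d = 8 \<or> d = 9 \<or> d = 10"
    using assms by presburger
  then have "\<exists>a c e. gw * gx ^ d * gw = gx ^ a * gZ ^ c * gw * gx ^ e"
    using *[of _ 2 4 2] *[of _ 1 1 1] *[of _ 8 0 8] *[of _ 6 3 6] *[of _ 7 2 7] *[of _ 4 2 4] *[of _ 5 3 5]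
      *[of _ 3 0 3] *[of _ 10 1 10] *[of _ 9 4 9] rel_w
    by (elim disjE) (simp_all only: power_one_right power_0 mult_1_right)
  then show thesis using that by blast
qed

lemma gL_right:
  assumes g: "g \<in> gL"
  shows "g * gx \<in> gL" "g * gZ \<in> gL" "g * gw \<in> gL"
proof -
  have "g * gx \<in> gL \<and> g * gZ \<in> gL \<and> g * gw \<in> gL" using g
  proof (cases rule: gL_E)
    case 1
    then show ?thesis using gL_I[OF 1, of 0] sbgD(2)[OF sbg_gB 1] gen_in_gB gB_gL by auto
  next
    case (2 b d)
    have x: "g * gx \<in> gL" using gL_I[OF 2(1), of "Suc d"] 2(2) by (simp add: mult.assoc power_Suc2 del: power_Suc)
    have "g * gZ = b * gw * (gx ^ d * gZ)" using 2(2) by (simp add: mult.assoc)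
    also have "\<dots> = b * (gw * gZ) * gx ^ (9 * d)" by (simp add: gx_gZ mult.assoc)
    also have "\<dots> = b * gZ ^ 4 * gw * gx ^ (9 * d)" by (simp add: gw_gZ mult.assoc)
    finally have z: "g * gZ \<in> gL" using gL_I[of "b * gZ ^ 4"] sbgD(2)[OF sbg_gB 2(1)] gen_in_gB by simp
    have "g * gw \<in> gL"
    proof (cases "d mod 11 = 0")
      case True
      then have "gx ^ d = 1" using pow_mod[OF gx11, of d] by simp
      then have "g * gw = b" using 2(2) rel_B(4) by (simp add: mult.assoc)
      then show ?thesis using 2(1) gB_gL by auto
    next
      case False
      then obtain a c e where *: "gw * gx ^ (d mod 11) * gw = gx ^ a * gZ ^ c * gw * gx ^ e"
        using gw_gx_gw[of "d mod 11"] by auto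
      have "g * gw = b * (gw * gx ^ (d mod 11) * gw)"
        using 2(2) pow_mod[OF gx11, of d] by (simp add: mult.assoc)
      also have "\<dots> = b * (gx ^ a * gZ ^ c) * gw * gx ^ e" using * by (simp add: mult.assoc)
      finally show ?thesis using gL_I[of "b * (gx ^ a * gZ ^ c)"] sbgD(2)[OF sbg_gB 2(1) gB_I] by simp
    qed
    then show ?thesis using x z by simp
  qed
  then show "g * gx \<in> gL" "g * gZ \<in> gL" "g * gw \<in> gL" by auto
qed

lemma right_mult_pow:
  assumes "\<And>g. g \<in> S \<Longrightarrow> g * h \<in> S" "(g::'a::monoid_mult) \<in> S"
  shows "g * h ^ n \<in> S"
  by (induction n) (use assms in \<open>auto simp: power_Suc2 mult.assoc [symmetric] simp del: power_Suc\<close>)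

lemma right_mult_gL:
  assumes "\<And>g. g \<in> S \<Longrightarrow> g * gx \<in> S" "\<And>g. g \<in> S \<Longrightarrow> g * gZ \<in> S" "\<And>g. g \<in> S \<Longrightarrow> g * gw \<in> S"
    and g: "g \<in> S" and h: "h \<in> gL"
  shows "g * h \<in> S"
proof -
  have B: "g * b \<in> S" if "g \<in> S" "b \<in> gB" for g b
    using that right_mult_pow[OF assms(1)] right_mult_pow[OF assms(2)]
    by (elim gB_E) (simp add: mult.assoc [symmetric])
  show ?thesis using h
  proof (cases rule: gL_E)
    case 1
    then show ?thesis using B g by simp
  next
    case (2 b d)
    have "g * b * gw * gx ^ d \<in> S" by (intro right_mult_pow[OF assms(1)] assms(3) B g 2)
    then show ?thesis using 2 by (simp add: mult.assoc)
  qed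
qed

lemma sbg_gL: "sbg gL"
proof (rule sbg_finiteI)
  show "1 \<in> gL" using sbgD(1)[OF sbg_gB] gB_gL by auto
  fix a b assume "a \<in> gL" "b \<in> gL"
  then show "a * b \<in> gL" by (intro right_mult_gL[of gL a b] gL_right)
qed

lemma gen_in_gL: "gx \<in> gL" "gZ \<in> gL" "gw \<in> gL" "gx ^ n \<in> gL" "gZ ^ n \<in> gL"
  using gen_in_gB gB_gL gL_I[OF sbgD(1)[OF sbg_gB], of 0] by auto

lemma dvd_55: "55 dvd (n::nat)" if "11 dvd n" "5 dvd n"
  using divides_mult[of 11 n 5] that by (simp add: coprime_iff_gcd_eq_1 gcd_non_0_nat)

lemma dvd_60: "60 dvd (n::nat)" if "3 dvd n" "4 dvd n" "5 dvd n"
  using divides_mult[of 12 n 5] divides_mult[of 3 n 4] that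
  by (simp add: coprime_iff_gcd_eq_1 gcd_non_0_nat)

lemma dvd_660: "660 dvd (n::nat)" if "60 dvd n" "11 dvd n"
  using divides_mult[of 60 n 11] that by (simp add: coprime_iff_gcd_eq_1 gcd_non_0_nat)

lemma four_group:
  fixes a b :: "'a::{grp,finite}"
  assumes H: "sbg H" "a \<in> H" "b \<in> H" and ab: "a * a = 1" "b * b = 1" "a * b = b * a" "a \<noteq> 1" "b \<noteq> 1" "a \<noteq> b"
  shows "4 dvd card H"
proof -
  have "a * b \<noteq> 1" "a * b \<noteq> a" "a * b \<noteq> b"
  proof -
    show "a * b \<noteq> 1" using ab by (metis grp_cancel(1))
    show "a * b \<noteq> a" using ab grp_cancel(1)[of a b 1] by simp
    show "a * b \<noteq> b" using ab grp_cancel(2)[of a b 1] by simp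
  qed
  then have "distinct [1, a, b, a * b]" using ab(4,5,6) by auto
  then have "card {1, a, b, a * b} = 4" using distinct_card[of "[1, a, b, a * b]"] by simp
  moreover have 1: "a * (a * x) = x" "b * (b * x) = x" for x
    by (simp_all add: mult.assoc [symmetric] ab(1,2))
  have 2: "b * (a * x) = a * (b * x)" for x
    by (simp only: mult.assoc [symmetric] ab(3))
  have "sbg {1, a, b, a * b}"
    by (rule sbg_finiteI) (auto simp: mult.assoc 1 2 ab(1,2) ab(3) [symmetric])
  ultimately show ?thesis using lagrange_sbg[of "{1, a, b, a * b}" H] H sbgD[OF H(1)] by auto
qed

definition gv :: j1 where "gv = gx ^ 10 * gZ * gw * gx"
definition ga :: j1 where "ga = gx * gw * gx ^ 7"

lemma gv_ga_in_gL: "gv \<in> gL" "ga \<in> gL"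
  using gL_I[OF gB_I, of 10 1 1] gL_I[OF gB_I, of 1 0 7] by (simp_all add: gv_def ga_def)

lemma gv_facts: "gv * d4 = d4 * gv" "gv * gw = gw * gv" "gv * gv = 1" "gv \<noteq> 1" "gv \<noteq> gw"
proof -
  show "gv * d4 = d4 * gv" "gv * gw = gw * gv" "gv * gv = 1"
    using rel_v(1,2,3) by (simp_all add: gv_def mult.assoc)
  show "gv \<noteq> 1" "gv \<noteq> gw" by (simp_all only: gv_def rel_eval list.inject f_neq simp_thms)
qed

lemma ga_facts: "ga * d4 = d4 * ga" "gord ga = 3"
proof -
  show "ga * d4 = d4 * ga" using rel_stab(5) by (simp add: ga_def mult.assoc)
  have "ga ^ 3 = 1" using rel_v(6) by (simp add: ga_def mult.assoc power3_eq_cube)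
  moreover have "ga \<noteq> 1" by (simp only: ga_def rel_eval list.inject f_neq simp_thms)
  ultimately show "gord ga = 3" by (intro gord_prime) auto
qed

lemma card_gB: "card gB = 55"
proof -
  have "card gB \<le> card ({..<11::nat} \<times> {..<5::nat})" unfolding gB_def by (rule card_image_le) simp
  moreover have "55 dvd card gB"
    using gord_dvd_card[OF sbg_gB gen_in_gB(1)] gord_dvd_card[OF sbg_gB gen_in_gB(2)]
    by (intro dvd_55) (simp_all add: gords)
  ultimately show ?thesis using card_sbg_pos[OF sbg_gB] by (auto dest!: dvd_imp_le)
qed

text \<open>The Bruhat form gives at most 660 elements; elements of orders 11, 5 and 3 and a
  four-group make 660 a divisor.\<close>

lemma card_gL: "card gL = 660"
proof -
  have "card gL \<le> card gB + card (gB \<times> {..<11::nat})"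
    unfolding gL_def by (rule order.trans[OF card_Un_le]) (intro add_left_mono card_image_le, simp)
  moreover have "660 dvd card gL"
    using gord_dvd_card[OF sbg_gL gen_in_gL(1)] gord_dvd_card[OF sbg_gL gen_in_gL(2)]
      gord_dvd_card[OF sbg_gL gv_ga_in_gL(2)]
      four_group[OF sbg_gL gv_ga_in_gL(1) gen_in_gL(3)] gv_facts rel_B(4) gw_not_1
    by (intro dvd_660 dvd_60) (simp_all add: gords ga_facts)
  ultimately show ?thesis using card_sbg_pos[OF sbg_gL] card_gB by (auto dest!: dvd_imp_le)
qed

subsection \<open>Double cosets and the group order\<close>

definition dcr :: "nat \<Rightarrow> j1" where
  "dcr k = [1, gt, d2, d3, d4] ! k"

text \<open>Representatives of the 12 left cosets of \<open>gB\<close> in \<open>gL\<close>. Index 0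
  is the trivial coset, so the exponents of \<open>gx\<close> are shifted by one. Multiplied by
  \<open>gt\<close>, they represent the 12 neighbours of the base coset.\<close>

definition nbr :: "nat \<Rightarrow> j1" where
  "nbr i = (if i = 0 then 1 else gx ^ (i - 1) * gw)"

definition dcos :: "nat \<Rightarrow> j1 set" where
  "dcos k = {l * dcr k * l' |l l'. l \<in> gL \<and> l' \<in> gL}"

text \<open>The entry \<open>nbr_type ! k ! i\<close> is the double coset of \<open>dcr k * nbr i * gt\<close>.\<close>

definition nbr_type :: "nat list list" where
  "nbr_type = [[1,1,1,1,1,1,1,1,1,1,1,1], [0,2,2,2,2,2,2,2,2,2,2,2], [1,4,2,3,2,2,2,3,3,3,2,3],
    [2,2,3,3,2,3,3,2,3,2,3,2], [2,2,2,2,2,2,2,2,2,2,2,2]]"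

lemma dcosI: "l \<in> gL \<Longrightarrow> l' \<in> gL \<Longrightarrow> l * dcr k * l' \<in> dcos k"
  by (auto simp: dcos_def)

lemma gL_mult: "a \<in> gL \<Longrightarrow> b \<in> gL \<Longrightarrow> a * b \<in> gL"
  by (rule sbgD(2)[OF sbg_gL])

lemma all_less_12: "(\<forall>i<12. P i) \<longleftrightarrow> P 0 \<and> P 1 \<and> P 2 \<and> P 3 \<and> P 4 \<and> P 5 \<and> P 6 \<and> P 7 \<and> P 8 \<and> P 9 \<and> P 10 \<and> P (11::nat)"
proof -
  have "(\<forall>i<12. P i) \<longleftrightarrow> (\<forall>i\<in>set [0..<12]. P i)" by (simp add: Ball_def)
  also have "[0..<12] = [0, 1, 2, 3, 4, 5, 6, 7, 8, 9, 10, 11]" by (simp add: upt_rec)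
  finally show ?thesis by simp
qed

lemma dcos_witness: "g = l * dcr k * l' \<Longrightarrow> l \<in> gL \<Longrightarrow> l' \<in> gL \<Longrightarrow> g \<in> dcos k"
  using dcosI by simp

lemma gL_word: "gx ^ a * gZ ^ c * gw * gx ^ d \<in> gL" "gx ^ a * gZ ^ c \<in> gL"
  using gL_I[OF gB_I] gB_I gB_gL by auto

lemmas nbr_simps = nbr_def nbr_type_def dcr_def mult.assoc

text \<open>The numbers given to \<open>gL_word\<close> are the exponents in the outer factors of
  the relations \<open>rel_d2\<close>; the next two lemmas use the other two families in the same
  way.\<close>

lemma nbr_types_2: "\<forall>i<12. d2 * nbr i * gt \<in> dcos (nbr_type ! 2 ! i)"
  unfolding all_less_12
proof (intro conjI)
  show "d2 * nbr 0 * gt \<in> dcos (nbr_type ! 2 ! 0)"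
    by (rule dcos_witness[OF _ gL_word(2)[of 0 0] gL_word(1)[of 0 0 0]]) (use rel_d2(1) in \<open>simp add: nbr_simps\<close>)
  show "d2 * nbr 1 * gt \<in> dcos (nbr_type ! 2 ! 1)"
    by (rule dcos_witness[OF _ gL_word(2)[of 0 0] gL_word(2)[of 0 0]]) (use rel_d2(2) in \<open>simp add: nbr_simps\<close>)
  show "d2 * nbr 2 * gt \<in> dcos (nbr_type ! 2 ! 2)"
    by (rule dcos_witness[OF _ gL_word(1)[of 3 1 6] gL_word(1)[of 5 1 8]]) (use rel_d2(3) in \<open>simp add: nbr_simps\<close>)
  show "d2 * nbr 3 * gt \<in> dcos (nbr_type ! 2 ! 3)"
    by (rule dcos_witness[OF _ gL_word(2)[of 0 0] gL_word(2)[of 0 0]]) (use rel_d2(4) in \<open>simp add: nbr_simps\<close>)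
  show "d2 * nbr 4 * gt \<in> dcos (nbr_type ! 2 ! 4)"
    by (rule dcos_witness[OF _ gL_word(1)[of 1 0 8] gL_word(1)[of 1 3 10]]) (use rel_d2(5) in \<open>simp add: nbr_simps\<close>)
  show "d2 * nbr 5 * gt \<in> dcos (nbr_type ! 2 ! 5)"
    by (rule dcos_witness[OF _ gL_word(1)[of 9 0 7] gL_word(1)[of 9 1 2]]) (use rel_d2(6) in \<open>simp add: nbr_simps\<close>)
  show "d2 * nbr 6 * gt \<in> dcos (nbr_type ! 2 ! 6)"
    by (rule dcos_witness[OF _ gL_word(1)[of 5 0 6] gL_word(1)[of 5 0 6]]) (use rel_d2(7) in \<open>simp add: nbr_simps\<close>)
  show "d2 * nbr 7 * gt \<in> dcos (nbr_type ! 2 ! 7)"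
    by (rule dcos_witness[OF _ gL_word(2)[of 0 3] gL_word(2)[of 0 2]]) (use rel_d2(8) in \<open>simp add: nbr_simps\<close>)
  show "d2 * nbr 8 * gt \<in> dcos (nbr_type ! 2 ! 8)"
    by (rule dcos_witness[OF _ gL_word(2)[of 0 1] gL_word(2)[of 0 4]]) (use rel_d2(9) in \<open>simp add: nbr_simps\<close>)
  show "d2 * nbr 9 * gt \<in> dcos (nbr_type ! 2 ! 9)"
    by (rule dcos_witness[OF _ gL_word(2)[of 0 2] gL_word(2)[of 0 3]]) (use rel_d2(10) in \<open>simp add: nbr_simps\<close>)
  show "d2 * nbr 10 * gt \<in> dcos (nbr_type ! 2 ! 10)"
    by (rule dcos_witness[OF _ gL_word(1)[of 4 0 2] gL_word(1)[of 4 4 7]]) (use rel_d2(11) in \<open>simp add: nbr_simps\<close>)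
  show "d2 * nbr 11 * gt \<in> dcos (nbr_type ! 2 ! 11)"
    by (rule dcos_witness[OF _ gL_word(2)[of 0 4] gL_word(2)[of 0 1]]) (use rel_d2(12) in \<open>simp add: nbr_simps\<close>)
qed

lemma nbr_types_3: "\<forall>i<12. d3 * nbr i * gt \<in> dcos (nbr_type ! 3 ! i)"
  unfolding all_less_12
proof (intro conjI)
  show "d3 * nbr 0 * gt \<in> dcos (nbr_type ! 3 ! 0)"
    by (rule dcos_witness[OF _ gL_word(2)[of 0 0] gL_word(1)[of 2 0 0]]) (use rel_d3(1) in \<open>simp add: nbr_simps\<close>)
  show "d3 * nbr 1 * gt \<in> dcos (nbr_type ! 3 ! 1)"
    by (rule dcos_witness[OF _ gL_word(1)[of 10 1 0] gL_word(1)[of 2 4 9]]) (use rel_d3(2) in \<open>simp add: nbr_simps\<close>)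
  show "d3 * nbr 2 * gt \<in> dcos (nbr_type ! 3 ! 2)"
    by (rule dcos_witness[OF _ gL_word(2)[of 9 3] gL_word(1)[of 4 3 8]]) (use rel_d3(3) in \<open>simp add: nbr_simps\<close>)
  show "d3 * nbr 3 * gt \<in> dcos (nbr_type ! 3 ! 3)"
    by (rule dcos_witness[OF _ gL_word(1)[of 3 2 7] gL_word(1)[of 4 2 8]]) (use rel_d3(4) in \<open>simp add: nbr_simps\<close>)
  show "d3 * nbr 4 * gt \<in> dcos (nbr_type ! 3 ! 4)"
    by (rule dcos_witness[OF _ gL_word(1)[of 3 0 8] gL_word(1)[of 2 0 8]]) (use rel_d3(5) in \<open>simp add: nbr_simps\<close>)
  show "d3 * nbr 5 * gt \<in> dcos (nbr_type ! 3 ! 5)"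
    by (rule dcos_witness[OF _ gL_word(2)[of 6 2] gL_word(1)[of 1 2 2]]) (use rel_d3(6) in \<open>simp add: nbr_simps\<close>)
  show "d3 * nbr 6 * gt \<in> dcos (nbr_type ! 3 ! 6)"
    by (rule dcos_witness[OF _ gL_word(2)[of 3 2] gL_word(1)[of 9 3 6]]) (use rel_d3(7) in \<open>simp add: nbr_simps\<close>)
  show "d3 * nbr 7 * gt \<in> dcos (nbr_type ! 3 ! 7)"
    by (rule dcos_witness[OF _ gL_word(1)[of 8 0 4] gL_word(1)[of 7 3 1]]) (use rel_d3(8) in \<open>simp add: nbr_simps\<close>)
  show "d3 * nbr 8 * gt \<in> dcos (nbr_type ! 3 ! 8)"
    by (rule dcos_witness[OF _ gL_word(1)[of 0 4 6] gL_word(1)[of 1 3 7]]) (use rel_d3(9) in \<open>simp add: nbr_simps\<close>)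
  show "d3 * nbr 9 * gt \<in> dcos (nbr_type ! 3 ! 9)"
    by (rule dcos_witness[OF _ gL_word(1)[of 6 1 5] gL_word(1)[of 2 1 4]]) (use rel_d3(10) in \<open>simp add: nbr_simps\<close>)
  show "d3 * nbr 10 * gt \<in> dcos (nbr_type ! 3 ! 10)"
    by (rule dcos_witness[OF _ gL_word(2)[of 10 3] gL_word(1)[of 5 2 7]]) (use rel_d3(11) in \<open>simp add: nbr_simps\<close>)
  show "d3 * nbr 11 * gt \<in> dcos (nbr_type ! 3 ! 11)"
    by (rule dcos_witness[OF _ gL_word(1)[of 0 1 1] gL_word(1)[of 2 4 0]]) (use rel_d3(12) in \<open>simp add: nbr_simps\<close>)
qed

lemma nbr_types_4: "\<forall>i<12. d4 * nbr i * gt \<in> dcos (nbr_type ! 4 ! i)"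
  unfolding all_less_12
proof (intro conjI)
  show "d4 * nbr 0 * gt \<in> dcos (nbr_type ! 4 ! 0)"
    by (rule dcos_witness[OF _ gL_word(2)[of 0 0] gL_word(1)[of 0 0 0]]) (use rel_d4(1) in \<open>simp add: nbr_simps\<close>)
  show "d4 * nbr 1 * gt \<in> dcos (nbr_type ! 4 ! 1)"
    by (rule dcos_witness[OF _ gL_word(1)[of 0 0 0] gL_word(1)[of 0 0 0]]) (use rel_d4(2) in \<open>simp add: nbr_simps\<close>)
  show "d4 * nbr 2 * gt \<in> dcos (nbr_type ! 4 ! 2)"
    by (rule dcos_witness[OF _ gL_word(1)[of 1 0 7] gL_word(1)[of 0 0 7]]) (use rel_d4(3) in \<open>simp add: nbr_simps\<close>)
  show "d4 * nbr 3 * gt \<in> dcos (nbr_type ! 4 ! 3)"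
    by (rule dcos_witness[OF _ gL_word(1)[of 2 0 1] gL_word(1)[of 0 0 1]]) (use rel_d4(4) in \<open>simp add: nbr_simps\<close>)
  show "d4 * nbr 4 * gt \<in> dcos (nbr_type ! 4 ! 4)"
    by (rule dcos_witness[OF _ gL_word(1)[of 3 0 6] gL_word(1)[of 0 0 6]]) (use rel_d4(5) in \<open>simp add: nbr_simps\<close>)
  show "d4 * nbr 5 * gt \<in> dcos (nbr_type ! 4 ! 5)"
    by (rule dcos_witness[OF _ gL_word(1)[of 4 1 6] gL_word(1)[of 0 4 10]]) (use rel_d4(6) in \<open>simp add: nbr_simps\<close>)
  show "d4 * nbr 6 * gt \<in> dcos (nbr_type ! 4 ! 6)"
    by (rule dcos_witness[OF _ gL_word(1)[of 5 0 8] gL_word(1)[of 0 0 8]]) (use rel_d4(7) in \<open>simp add: nbr_simps\<close>)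
  show "d4 * nbr 7 * gt \<in> dcos (nbr_type ! 4 ! 7)"
    by (rule dcos_witness[OF _ gL_word(1)[of 6 0 4] gL_word(1)[of 0 0 4]]) (use rel_d4(8) in \<open>simp add: nbr_simps\<close>)
  show "d4 * nbr 8 * gt \<in> dcos (nbr_type ! 4 ! 8)"
    by (rule dcos_witness[OF _ gL_word(1)[of 7 0 5] gL_word(1)[of 0 0 5]]) (use rel_d4(9) in \<open>simp add: nbr_simps\<close>)
  show "d4 * nbr 9 * gt \<in> dcos (nbr_type ! 4 ! 9)"
    by (rule dcos_witness[OF _ gL_word(1)[of 8 0 3] gL_word(1)[of 0 0 3]]) (use rel_d4(10) in \<open>simp add: nbr_simps\<close>)
  show "d4 * nbr 10 * gt \<in> dcos (nbr_type ! 4 ! 10)"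
    by (rule dcos_witness[OF _ gL_word(1)[of 9 0 2] gL_word(1)[of 0 0 2]]) (use rel_d4(11) in \<open>simp add: nbr_simps\<close>)
  show "d4 * nbr 11 * gt \<in> dcos (nbr_type ! 4 ! 11)"
    by (rule dcos_witness[OF _ gL_word(1)[of 10 0 9] gL_word(1)[of 0 0 9]]) (use rel_d4(12) in \<open>simp add: nbr_simps\<close>)
qed

lemma gt_gx: "gt * gx ^ a = gx ^ (10 * a) * gt"
proof (induction a)
  case (Suc a)
  have "gt * gx = gt * gx * gt * gt" using rel_B(5) by (simp add: mult.assoc)
  then have 1: "gt * gx = gx ^ 10 * gt" using rel_B(7) by simp
  have "gt * gx ^ Suc a = gx ^ (10 * a) * (gt * gx)"
    using Suc by (simp add: power_Suc2 mult.assoc [symmetric] del: power_Suc)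
  then show ?case using 1 by (simp add: mult.assoc [symmetric] power_add [symmetric] add.commute)
qed simp

lemma gt_gZ: "gt * gZ ^ c = gZ ^ c * gt"
  using power_commuting_commutes[OF rel_B(8)[symmetric]] by simp

lemma gB_gt:
  assumes "b \<in> gB" obtains b' where "b' \<in> gB" "gt * b = b' * gt"
proof -
  obtain a c where "b = gx ^ a * gZ ^ c" using assms by (rule gB_E)
  then have "gt * b = gx ^ (10 * a) * (gt * gZ ^ c)" by (simp add: gt_gx mult.assoc [symmetric])
  then have "gt * b = gx ^ (10 * a) * gZ ^ c * gt" by (simp add: gt_gZ mult.assoc)
  then show thesis using that[OF gB_I] by simp
qed

lemma gB_gt':
  assumes "b \<in> gB" obtains b' where "b' \<in> gB" "b * gt = gt * b'"
proof -
  obtain b' where b': "b' \<in> gB" "gt * b = b' * gt" by (rule gB_gt[OF assms])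
  have "gt * (gt * b) * gt = gt * (b' * gt) * gt" using b' by simp
  then have "b * gt = gt * b'" using rel_B(5) by (metis mult.assoc mult.left_neutral mult.right_neutral)
  then show thesis using that b' by blast
qed

lemma nbr_in_gL: "nbr i \<in> gL"
  using gL_word(1)[of "i - 1" 0 0] sbgD(1)[OF sbg_gL] by (simp add: nbr_def)

text \<open>The Bruhat form has its factor from \<open>gB\<close> on the left. Applying it to the
  inverse moves this factor to the right, as left cosets require.\<close>

lemma nbr_decomp:
  assumes "l \<in> gL"
  obtains i b where "i < 12" "b \<in> gB" "l = nbr i * b"
proof -
  have "inverse l \<in> gL" using sbgD(3)[OF sbg_gL assms] .
  then show thesis
  proof (cases rule: gL_E)
    case 1
    then have "l \<in> gB" using sbg_inverse_iff[OF sbg_gB] by blast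
    then show thesis using that[of 0 l] by (simp add: nbr_def)
  next
    case (2 b d)
    have "inverse gw = gw" using rel_B(4) by (simp add: mult_eq_one_inv)
    then have "inverse (b * gw * gx ^ d) = inverse (gx ^ d) * gw * inverse b" by (simp add: mult.assoc)
    then have l: "l = inverse (gx ^ d) * gw * inverse b" using 2(2) by (metis inv_cancel(5))
    have "gx ^ d * gx ^ (10 * d) = 1"
      by (simp add: power_add [symmetric] pow_mod[OF gx11, of "11 * d"])
    then have "inverse (gx ^ d) = gx ^ (10 * d)" by (simp add: mult_eq_one_inv)
    also have "\<dots> = gx ^ (10 * d mod 11)" by (rule pow_mod[OF gx11])
    finally have "l = nbr (Suc (10 * d mod 11)) * inverse b" using l by (simp add: nbr_def)
    then show thesis using that[of "Suc (10 * d mod 11)" "inverse b"] sbgD(3)[OF sbg_gB 2(1)] by simp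
  qed
qed

lemma nbr_types:
  assumes "k < 5" "i < 12"
  shows "dcr k * nbr i * gt \<in> dcos (nbr_type ! k ! i)"
proof -
  have t0: "\<forall>i<12. nbr_type ! 0 ! i = 1" and t1: "\<forall>i<12. i \<noteq> 0 \<longrightarrow> nbr_type ! 1 ! i = 2"
    unfolding all_less_12 by (simp_all add: nbr_type_def)
  have "k = 0 \<or> k = 1 \<or> k = 2 \<or> k = 3 \<or> k = 4" using assms(1) by presburger
  then show ?thesis
  proof (elim disjE)
    assume k: "k = 0"
    have "dcr 0 * nbr i * gt \<in> dcos 1"
      by (rule dcos_witness[OF _ nbr_in_gL[of i] sbgD(1)[OF sbg_gL]]) (simp add: dcr_def)
    moreover have "nbr_type ! 0 ! i = 1" using t0 assms(2) by simp
    ultimately show ?thesis using k by simp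
  next
    assume k: "k = 1"
    show ?thesis
    proof (cases "i = 0")
      case True
      have "dcr 1 * nbr 0 * gt \<in> dcos 0"
        by (rule dcos_witness[OF _ sbgD(1)[OF sbg_gL] sbgD(1)[OF sbg_gL]]) (simp add: dcr_def nbr_def rel_B(5))
      then show ?thesis using k True by (simp add: nbr_type_def)
    next
      case False
      have "dcr 1 * nbr i * gt \<in> dcos 2"
        by (rule dcos_witness[OF _ gen_in_gL(4)[of "10 * (i - 1)"] sbgD(1)[OF sbg_gL]])
          (use False in \<open>simp add: dcr_def nbr_def d2_def mult.assoc [symmetric] gt_gx\<close>)
      moreover have "nbr_type ! 1 ! i = 2" using t1 assms(2) False by simp
      ultimately show ?thesis using k by simp
    qed
  qed (use nbr_types_2 nbr_types_3 nbr_types_4 assms(2) in \<open>simp_all add: dcr_def\<close>)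
qed

lemma nbr_type_less: "k < 5 \<Longrightarrow> i < 12 \<Longrightarrow> nbr_type ! k ! i < 5"
proof -
  have "\<forall>r\<in>set nbr_type. length r = 12 \<and> (\<forall>v\<in>set r. v < 5)" "length nbr_type = 5" by (simp_all add: nbr_type_def)
  then show "k < 5 \<Longrightarrow> i < 12 \<Longrightarrow> nbr_type ! k ! i < 5" by (metis nth_mem)
qed

lemma dcos_right: "u \<in> dcos k \<Longrightarrow> l \<in> gL \<Longrightarrow> u * l \<in> dcos k"
  unfolding dcos_def using gL_mult by (auto simp: mult.assoc) (metis mult.assoc)

lemma dcos_left: "u \<in> dcos k \<Longrightarrow> l \<in> gL \<Longrightarrow> l * u \<in> dcos k"
  unfolding dcos_def using gL_mult by (auto simp: mult.assoc [symmetric]) metis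

lemma dcos_gt:
  assumes "u \<in> dcos k" "k < 5"
  obtains j where "j < 5" "u * gt \<in> dcos j"
proof -
  obtain l l' where l: "l \<in> gL" "l' \<in> gL" "u = l * dcr k * l'" using assms(1) by (auto simp: dcos_def)
  obtain i b where i: "i < 12" "b \<in> gB" "l' = nbr i * b" using nbr_decomp[OF l(2)] .
  obtain b' where b': "b' \<in> gB" "b * gt = gt * b'" by (rule gB_gt'[OF i(2)])
  have "u * gt = l * dcr k * nbr i * (b * gt)" using l(3) i(3) by (simp add: mult.assoc)
  also have "\<dots> = l * (dcr k * nbr i * gt) * b'" using b'(2) by (simp add: mult.assoc)
  also have "\<dots> \<in> dcos (nbr_type ! k ! i)"
    using b'(1) gB_gL by (intro dcos_right dcos_left nbr_types assms(2) i(1) l(1)) auto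
  finally show thesis using that nbr_type_less[OF assms(2) i(1)] by blast
qed

text \<open>By \<open>rel_Y\<close> the generator \<open>gY\<close> is a word in elements of
  \<open>gL\<close> and \<open>gt\<close>; the other generator lies in \<open>gL\<close>.\<close>

lemma generated_gL_gt:
  assumes S: "1 \<in> S" "\<And>g l. g \<in> S \<Longrightarrow> l \<in> gL \<Longrightarrow> g * l \<in> S" "\<And>g. g \<in> S \<Longrightarrow> g * gt \<in> S"
  shows "S = UNIV"
proof (rule generated_j1[OF S(1)])
  fix g assume g: "g \<in> S"
  have "g * (gx ^ 10 * gZ ^ 2 * gw * gx ^ 5) * gt * gw * gt * (gx ^ 6 * gZ ^ 4 * gw * gx ^ 10) \<in> S"
    by (intro S(2,3) g gL_word gen_in_gL)
  then show "g * gY \<in> S" using rel_Y by (simp add: d2_def mult.assoc)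
  show "g * gZ \<in> S" by (intro S(2) g gen_in_gL)
qed

text \<open>The table \<open>nbr_type\<close> certifies that multiplication by \<open>gt\<close>
  leads to no new double coset.\<close>

lemma Un_dcos: "(\<Union>k<5. dcos k) = UNIV"
proof (rule generated_gL_gt)
  have "1 \<in> dcos 0"
    by (rule dcos_witness[OF _ sbgD(1)[OF sbg_gL] sbgD(1)[OF sbg_gL]]) (simp add: dcr_def)
  then show "1 \<in> (\<Union>k<5. dcos k)" by auto
next
  fix g l assume "g \<in> (\<Union>k<5. dcos k)" "l \<in> gL"
  then show "g * l \<in> (\<Union>k<5. dcos k)" using dcos_right by auto
next
  fix g assume "g \<in> (\<Union>k<5. dcos k)"
  then obtain k where "k < 5" "g \<in> dcos k" by auto
  then obtain j where "j < 5" "g * gt \<in> dcos j" using dcos_gt by metis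
  then show "g * gt \<in> (\<Union>k<5. dcos k)" by auto
qed

text \<open>The stabilizer in \<open>gL\<close> of the coset of \<open>dcr k\<close>; its index in
  \<open>gL\<close> is the number of cosets in the double coset.\<close>

definition dstab :: "nat \<Rightarrow> j1 set" where
  "dstab k = {l\<in>gL. inverse (dcr k) * l * dcr k \<in> gL}"

text \<open>The lengths of the orbits of \<open>gL\<close> on the 266 cosets. Until the order of the
  group is known they are only upper bounds.\<close>

definition subdeg :: "nat \<Rightarrow> nat" where
  "subdeg k = [1, 12, 132, 110, 11] ! k"

lemma sbg_dstab: "sbg (dstab k)"
proof -
  have "dstab k = gL \<inter> cj (dcr k) gL" by (auto simp: dstab_def cj_iff)
  then show ?thesis by (simp add: sbg_Int sbg_cj sbg_gL)
qed

lemma card_dcosets: "card ((\<lambda>l. (*) l ` (*) (dcr k) ` gL) ` gL) * card (dstab k) = 660"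
proof -
  have "(*) l ` (*) (dcr k) ` gL = (*) (dcr k) ` gL \<longleftrightarrow> inverse (dcr k) * l * dcr k \<in> gL" for l
    using coset_eq_iff[OF sbg_gL, of "dcr k" "l * dcr k"] by (auto simp: image_image mult.assoc)
  then have "{l\<in>gL. (*) l ` (*) (dcr k) ` gL = (*) (dcr k) ` gL} = dstab k" by (simp add: dstab_def)
  then show ?thesis using orbit_stab[OF sbg_gL acts_coset, of "(*) (dcr k) ` gL"] card_gL by simp
qed

lemma dstabI: "l \<in> gL \<Longrightarrow> l' \<in> gL \<Longrightarrow> l * dcr k = dcr k * l' \<Longrightarrow> l \<in> dstab k"
  by (simp add: dstab_def mult.assoc)

lemma dvd_6: "6 dvd (n::nat)" if "2 dvd n" "3 dvd n"
  using divides_mult[of 2 n 3] that by (simp add: coprime_iff_gcd_eq_1 gcd_non_0_nat)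

text \<open>Exhibited elements and subgroups make the stabilizer orders divisible by 660, 55, 5, 6
  and 60.\<close>

lemma dstab_dvd:
  assumes "k < 5" shows "660 dvd subdeg k * card (dstab k)"
proof -
  have "k = 0 \<or> k = 1 \<or> k = 2 \<or> k = 3 \<or> k = 4" using assms by presburger
  then show ?thesis
  proof (elim disjE)
    assume k: "k = 0"
    have "dstab 0 = gL" by (auto simp: dstab_def dcr_def)
    then show ?thesis using k card_gL by (simp add: subdeg_def)
  next
    assume k: "k = 1"
    have "gB \<subseteq> dstab 1"
    proof
      fix b assume b: "b \<in> gB"
      obtain b' where "b' \<in> gB" "b * gt = gt * b'" by (rule gB_gt'[OF b])
      then show "b \<in> dstab 1" using b gB_gL by (intro dstabI[of b b']) (auto simp: dcr_def)
    qed
    then have "55 dvd card (dstab 1)" using lagrange_sbg[OF sbg_gB sbg_dstab] card_gB by auto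
    then show ?thesis using k by (auto simp: subdeg_def dvd_def)
  next
    assume k: "k = 2"
    have "gZ * d2 = gt * (gZ * gw) * gt" by (simp add: d2_def mult.assoc [symmetric] rel_B(8))
    moreover have "gZ * gw = gw * gZ ^ 4"
      using rel_B(4,6) by (metis mult.assoc mult.left_neutral mult.right_neutral)
    ultimately have "gZ * d2 = d2 * gZ ^ 4" by (simp add: d2_def mult.assoc gt_gZ)
    then have "gZ \<in> dstab 2" by (intro dstabI[of _ "gZ ^ 4"] gen_in_gL) (simp add: dcr_def)
    then have "5 dvd card (dstab 2)" using gord_dvd_card[OF sbg_dstab] gords by metis
    then show ?thesis using k by (auto simp: subdeg_def dvd_def)
  next
    assume k: "k = 3"
    define a b where "a = gx ^ 3 * gw * gx ^ 8" and "b = gx ^ 10 * gZ * gw"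
    have ab: "a \<in> dstab 3" "b \<in> dstab 3"
      using rel_stab(1,2) gL_word(1)[of 3 0 8] gL_word(1)[of 10 1 0] gL_word(1)[of 0 1 1]
      by (auto simp: a_def b_def dcr_def mult.assoc intro: dstabI)
    have "a \<noteq> 1" "b \<noteq> 1" by (simp_all only: a_def b_def rel_eval list.inject f_neq simp_thms)
    moreover have "a ^ 2 = 1" "b ^ 3 = 1" using rel_v(4,5) by (simp_all add: a_def b_def power2_eq_square power3_eq_cube mult.assoc)
    ultimately have "gord a = 2" "gord b = 3" by (auto intro!: gord_prime)
    then have "6 dvd card (dstab 3)" using gord_dvd_card[OF sbg_dstab ab(1)] gord_dvd_card[OF sbg_dstab ab(2)]
      by (intro dvd_6) simp_all
    then show ?thesis using k by (auto simp: subdeg_def dvd_def)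
  next
    assume k: "k = 4"
    have "gZ \<in> dstab 4" "ga \<in> dstab 4" "gw \<in> dstab 4" "gv \<in> dstab 4"
      using rel_stab(3,4) ga_facts gv_facts gv_ga_in_gL gen_in_gL by (auto simp: dcr_def intro: dstabI)
    then have "60 dvd card (dstab 4)"
      using gord_dvd_card[OF sbg_dstab, of gZ] gord_dvd_card[OF sbg_dstab, of ga]
        four_group[OF sbg_dstab, of gv 4 gw] gv_facts rel_B(4) gw_not_1
      by (intro dvd_60) (auto simp: gords ga_facts)
    then show ?thesis using k by (auto simp: subdeg_def dvd_def)
  qed
qed

lemma card_dcos_le:
  assumes "k < 5"
  shows "card (dcos k) \<le> card ((\<lambda>l. (*) l ` (*) (dcr k) ` gL) ` gL) * 660"
    and "card ((\<lambda>l. (*) l ` (*) (dcr k) ` gL) ` gL) \<le> subdeg k"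
proof -
  let ?C = "(\<lambda>l. (*) l ` (*) (dcr k) ` gL) ` gL"
  have "dcos k = \<Union>?C" by (auto simp: dcos_def image_image mult.assoc)
  then have "card (dcos k) \<le> (\<Sum>c\<in>?C. card c)" by (simp add: card_Union_le_sum_card)
  also have "\<dots> = (\<Sum>c\<in>?C. 660)"
    by (rule sum.cong) (auto simp: card_image inj_on_def image_image mult.assoc card_gL)
  finally show "card (dcos k) \<le> card ?C * 660" by simp
  obtain m where m: "subdeg k * card (dstab k) = 660 * m" using dstab_dvd[OF assms] by (auto simp: dvd_def)
  have "subdeg k > 0" using assms by (auto simp: subdeg_def less_Suc_eq numeral_eq_Suc)
  then have "m > 0" using m card_sbg_pos[OF sbg_dstab, of k] by (metis mult_is_0 neq0_conv)
  have "subdeg k * card (dstab k) = card ?C * m * card (dstab k)"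
    using m card_dcosets[of k] by (simp add: ac_simps)
  then have "subdeg k = card ?C * m" using card_sbg_pos[OF sbg_dstab, of k] by (metis mult_right_cancel neq0_conv)
  then show "card ?C \<le> subdeg k" using \<open>m > 0\<close> by simp
qed

lemma sum_5: "(\<Sum>k<5. f k) = f 0 + f 1 + f 2 + f 3 + (f (4::nat) :: 'a::comm_monoid_add)"
  by (simp add: eval_nat_numeral add.assoc)

lemma CARD_le: "CARD(j1) \<le> 175560"
proof -
  have "CARD(j1) = card (\<Union>k<5. dcos k)" by (simp add: Un_dcos)
  also have "\<dots> \<le> (\<Sum>k<5. card (dcos k))" by (rule card_UN_le) simp
  also have "\<dots> \<le> (\<Sum>k<5. subdeg k * 660)"
  proof (rule sum_mono)
    fix k :: nat assume "k \<in> {..<5}"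
    then show "card (dcos k) \<le> subdeg k * 660"
      using card_dcos_le[of k] by (meson lessThan_iff mult_le_mono1 order.trans)
  qed
  also have "\<dots> = 175560" by (simp add: sum_5 subdeg_def)
  finally show ?thesis .
qed

subsection \<open>The order of the group\<close>

lemma elementary_8:
  fixes a b c :: "'a::{grp,finite}"
  assumes sq: "a * a = 1" "b * b = 1" "c * c = 1" and cm: "b * a = a * b" "c * a = a * c" "c * b = b * c"
  shows "sbg {1, a, b, c, a * b, a * c, b * c, a * (b * c)}"
proof -
  have 1: "a * (a * x) = x" "b * (b * x) = x" "c * (c * x) = x" for x
    by (simp_all add: mult.assoc [symmetric] sq)
  have 2: "b * (a * x) = a * (b * x)" "c * (a * x) = a * (c * x)" "c * (b * x) = b * (c * x)" for x
    by (simp_all only: mult.assoc [symmetric] cm)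
  show ?thesis by (rule sbg_finiteI) (auto simp: mult.assoc sq cm 1 2)
qed

section \<open>An elementary abelian subgroup of order 8\<close>

definition e1 :: j1 where "e1 = gY * ge * inverse gY"
definition e2 :: j1 where "e2 = gY ^ 2 * ge * inverse (gY ^ 2)"

definition gE :: "j1 set" where
  "gE = {1, ge, e1, e2, ge * e1, ge * e2, e1 * e2, ge * (e1 * e2)}"

lemma gY_inv_pow: "inverse (gY ^ k) = gY ^ (7 - k)" if "k \<le> 7"
proof -
  have "gY ^ k * gY ^ (7 - k) = 1" using that gY7 by (simp add: power_add [symmetric])
  then show ?thesis by (simp add: mult_eq_one_inv)
qed

text \<open>The first relation is x^3 = 1 + x in additive form: conjugation by \<open>gY\<close>
  acts on the group of order 8 like multiplication by a primitive element of the field with 8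
  elements.\<close>

lemma e_rel:
  "ge * e1 = gY ^ 3 * ge * inverse (gY ^ 3)" "ge * ge = 1" "e1 * e1 = 1" "e2 * e2 = 1"
  "e1 * ge = ge * e1" "e2 * ge = ge * e2" "e2 * e1 = e1 * e2"
proof -
  have i: "inverse gY = gY ^ 6" "inverse (gY ^ 2) = gY ^ 5" "inverse (gY ^ 3) = gY ^ 4"
    using gY_inv_pow[of 1] gY_inv_pow[of 2] gY_inv_pow[of 3] by simp_all
  show "ge * e1 = gY ^ 3 * ge * inverse (gY ^ 3)" using rel_E(2) i by (simp add: e1_def mult.assoc)
  show "ge * ge = 1" "e1 * e1 = 1" "e2 * e2 = 1"
  "e1 * ge = ge * e1" "e2 * ge = ge * e2" "e2 * e1 = e1 * e2"
    by (simp_all only: e1_def e2_def i rel_eval)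
qed

lemma sbg_gE: "sbg gE"
  unfolding gE_def by (rule elementary_8) (simp_all add: e_rel)

lemma gE_commute: "a \<in> gE \<Longrightarrow> b \<in> gE \<Longrightarrow> a * b = b * a"
proof -
  have 2: "e1 * (ge * x) = ge * (e1 * x)" "e2 * (ge * x) = ge * (e2 * x)" "e2 * (e1 * x) = e1 * (e2 * x)" for x
    by (simp_all only: mult.assoc [symmetric] e_rel(5-7))
  show "a \<in> gE \<Longrightarrow> b \<in> gE \<Longrightarrow> a * b = b * a"
    unfolding gE_def by (auto simp: mult.assoc 2 e_rel(5-7))
qed

lemma gE_square: "a \<in> gE \<Longrightarrow> a * a = 1"
proof -
  have 1: "ge * (ge * x) = x" "e1 * (e1 * x) = x" "e2 * (e2 * x) = x" for x
    by (simp_all add: mult.assoc [symmetric] e_rel(2-4))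
  have 2: "e1 * (ge * x) = ge * (e1 * x)" "e2 * (ge * x) = ge * (e2 * x)" "e2 * (e1 * x) = e1 * (e2 * x)" for x
    by (simp_all only: mult.assoc [symmetric] e_rel(5-7))
  show "a \<in> gE \<Longrightarrow> a * a = 1"
    unfolding gE_def by (auto simp: mult.assoc 1 2 e_rel(2-7))
qed

lemma gE_distinct: "distinct [1, ge, e1, e2, ge * e1, ge * e2, e1 * e2, ge * (e1 * e2)]"
proof -
  have i: "inverse gY = gY ^ 6" "inverse (gY ^ 2) = gY ^ 5"
    using gY_inv_pow[of 1] gY_inv_pow[of 2] by simp_all
  have "distinct (map mt [1, ge, e1, e2, ge * e1, ge * e2, e1 * e2, ge * (e1 * e2)])"
    by (simp only: e1_def e2_def i mt_gen mt_named list.map distinct.simps list.set insert_iff empty_iff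
        list.inject f_neq simp_thms)
  then show ?thesis by (simp only: distinct_map)
qed

lemma card_gE: "card gE = 8"
  using distinct_card[OF gE_distinct] by (simp add: gE_def)

lemma cj_gE_I:
  assumes "g * ge * inverse g \<in> gE" "g * e1 * inverse g \<in> gE" "g * e2 * inverse g \<in> gE"
  shows "g \<in> nrm gE"
proof (rule nrmI_finite)
  have m: "g * (x * y) * inverse g = (g * x * inverse g) * (g * y * inverse g)" for x y
    by (simp add: mult.assoc)
  have M: "g * (x * y) * inverse g \<in> gE" if "g * x * inverse g \<in> gE" "g * y * inverse g \<in> gE" for x y
    unfolding m by (intro sbgD(2)[OF sbg_gE] that)
  show "cj g gE \<subseteq> gE"
    using assms M sbgD(1)[OF sbg_gE] unfolding cj_def by (subst (1) gE_def) (auto simp del: mult.assoc)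
qed simp

lemma gY_nrm_gE: "gY \<in> nrm gE"
proof (rule cj_gE_I)
  have "gY * ge * inverse gY = e1" "gY * e1 * inverse gY = e2"
    by (simp_all add: e1_def e2_def mult.assoc power2_eq_square)
  moreover have "gY * e2 * inverse gY = ge * e1"
    by (simp add: e_rel(1)) (simp add: e2_def mult.assoc numeral_eq_Suc)
  ultimately show "gY * ge * inverse gY \<in> gE" "gY * e1 * inverse gY \<in> gE" "gY * e2 * inverse gY \<in> gE"
    by (simp_all add: gE_def)
qed

text \<open>Conjugation by \<open>gp\<close> squares \<open>gY\<close> and takes \<open>ge\<close>
  to one of its conjugates under powers of \<open>gY\<close>, so it permutes these conjugates, which
  lie in \<open>gE\<close>.\<close>

lemma gp_nrm_gE: "gp \<in> nrm gE"
proof (rule cj_gE_I)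
  have Yn: "gY ^ n * x * inverse (gY ^ n) \<in> gE" if "x \<in> gE" for n x
  proof -
    have "gY ^ n \<in> nrm gE" by (rule sbg_pow[OF sbg_nrm gY_nrm_gE])
    then have "cj (gY ^ n) gE = gE" by (simp add: nrm_def)
    then show ?thesis using that by (auto simp: cj_def)
  qed
  have p0: "gp * ge * inverse gp = gY ^ 5 * ge * inverse (gY ^ 5)"
    using rel_E(3) gY_inv_pow[of 5] by (simp add: mult.assoc)
  then have P: "gp * ge * inverse gp \<in> gE" using Yn by (simp add: gE_def)
  have c: "gp * gY * inverse gp = gY ^ 2" using rel_Y7(4) by (simp add: mult.assoc)
  have pw: "gp * gY ^ n * inverse gp = gY ^ (2 * n)" for n
  proof (induction n)
    case (Suc n)
    have "gp * gY ^ Suc n * inverse gp = (gp * gY ^ n * inverse gp) * (gp * gY * inverse gp)"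
      by (simp add: mult.assoc power_Suc2 del: power_Suc)
    then show ?case using Suc c by (simp add: power_add [symmetric] power_Suc2 del: power_Suc)
  qed simp
  have "gp * (gY ^ n * ge * inverse (gY ^ n)) * inverse gp \<in> gE" for n
  proof -
    have "gp * (gY ^ n * ge * inverse (gY ^ n)) * inverse gp =
      (gp * gY ^ n * inverse gp) * (gp * ge * inverse gp) * inverse (gp * gY ^ n * inverse gp)"
      by (simp add: mult.assoc)
    then show ?thesis using Yn[OF P] pw by simp
  qed
  from this[of 1] this[of 2] P
  show "gp * ge * inverse gp \<in> gE" "gp * e1 * inverse gp \<in> gE" "gp * e2 * inverse gp \<in> gE"
    by (simp_all add: e1_def e2_def)
qed

lemma gord_gp: "gord gp = 3"
proof (rule gord_prime)
  show "gp ^ 3 = 1" using rel_Y7(5) by (simp add: power3_eq_cube mult.assoc)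
  show "gp \<noteq> 1" by (simp_all only: rel_eval list.inject f_neq simp_thms)
qed simp

text \<open>The bound from the double cosets meets the divisor 8 * 7 * 11 * 19 * 5 * 3
  exactly.\<close>

lemma CARD_j1: "CARD(j1) = 175560"
proof -
  have "8 dvd CARD(j1)" using lagrange_sbg[OF sbg_gE sbg_UNIV] card_gE by simp
  moreover have "n dvd CARD(j1)" if "gord (g::j1) = n" for g n
    using gord_dvd_card[OF sbg_UNIV, of g] that by simp
  then have "7 dvd CARD(j1)" "11 dvd CARD(j1)" "19 dvd CARD(j1)" "5 dvd CARD(j1)" "3 dvd CARD(j1)"
    using gords gord_gp by blast+
  ultimately have "8 * 7 * 11 * 19 * 5 * 3 dvd CARD(j1)"
    by (intro divides_mult) (simp_all add: coprime_iff_gcd_eq_1 gcd_non_0_nat)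
  then have "175560 \<le> CARD(j1)" by (intro dvd_imp_le) auto
  then show ?thesis using CARD_le by simp
qed

lemma exact_primes: "exact_prime 3 CARD(j1)" "exact_prime 5 CARD(j1)" "exact_prime 7 CARD(j1)"
  "exact_prime 11 CARD(j1)" "exact_prime 19 CARD(j1)"
  by (simp_all add: exact_prime_def CARD_j1)

subsection \<open>Normalizers of the Sylow subgroups\<close>

lemma cyc_nrmI:
  fixes a :: "'a::{grp,finite}"
  shows "g * a = a ^ r * g \<Longrightarrow> g \<in> nrm (cyc a)"
proof (rule nrmI_finite)
  assume "g * a = a ^ r * g"
  then have "g * a * inverse g = a ^ r" by (simp add: mult.assoc)
  then have "cj g (cyc a) = cyc (a ^ r)" using cyc_conj[of g a] by simp
  then show "cj g (cyc a) \<subseteq> cyc a" using cyc_subset[OF sbg_cyc sbg_pow[OF sbg_cyc self_in_cyc]] by simp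
qed simp

lemma pow_conj:
  assumes "g * a = a ^ r * (g::'a::grp)"
  shows "g ^ n * a = a ^ (r ^ n) * g ^ n"
proof (induction n)
  case (Suc n)
  have 1: "g * a ^ m = a ^ (r * m) * g" for m
  proof (induction m)
    case (Suc m)
    have "g * a ^ Suc m = a ^ (r * m) * (g * a)" using Suc by (simp add: power_Suc2 mult.assoc [symmetric] del: power_Suc)
    then show ?case using assms by (simp add: mult.assoc [symmetric] power_add [symmetric] add.commute)
  qed simp
  have "g ^ Suc n * a = g * (a ^ (r ^ n) * g ^ n)" using Suc by (simp add: mult.assoc)
  also have "\<dots> = (g * a ^ (r ^ n)) * g ^ n" by (simp add: mult.assoc)
  finally show ?case using 1 by (simp add: mult.assoc)
qed simp

lemma pow_conj_not_commute:
  fixes g a :: "'a::{grp,finite}"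
  assumes "g * a = a ^ r * g" "\<not> gord a dvd r ^ n - 1" "r > 0"
  shows "a * g ^ n \<noteq> g ^ n * a" "g ^ n \<noteq> 1"
proof -
  show "a * g ^ n \<noteq> g ^ n * a"
  proof
    assume "a * g ^ n = g ^ n * a"
    then have "a ^ (r ^ n) = a" using pow_conj[OF assms(1), of n] by simp
    moreover have "a ^ (r ^ n) = a * a ^ (r ^ n - 1)" using assms(3) by (cases "r ^ n") auto
    ultimately have "a * a ^ (r ^ n - 1) = a * 1" by simp
    then have "a ^ (r ^ n - 1) = 1" by (simp only: grp_cancel)
    then show False using assms(2) by (simp add: pow_eq_1_iff)
  qed
  then show "g ^ n \<noteq> 1" by auto
qed

abbreviation commuting :: "nat \<Rightarrow> nat \<Rightarrow> bool" where
  "commuting \<equiv> commuting_orders TYPE(j1)"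

text \<open>The last alternative serves p = 19. For 3 the square of \<open>gw * gt\<close> is chosen
  so that \<open>gw\<close>, \<open>gt\<close> and \<open>gZ\<close> normalize \<open>sy 3\<close>
  as well as \<open>sy 5\<close>.\<close>

definition sy :: "nat \<Rightarrow> j1 set" where
  "sy p = cyc (if p = 3 then (gw * gt) ^ 2 else if p = 5 then gZ else if p = 7 then gY else if p = 11 then gx else gu)"

lemma sy_simps: "sy 3 = cyc ((gw * gt) ^ 2)" "sy 5 = cyc gZ" "sy 7 = cyc gY" "sy 11 = cyc gx" "sy 19 = cyc gu"
  by (simp_all add: sy_def)

lemma gwgt_order: "gord (gw * gt) = 6"
proof -
  have 6: "(gw * gt) ^ 6 = 1" using rel_wt by (simp add: numeral_eq_Suc mult.assoc)
  have "(gw * gt) ^ 2 \<noteq> 1" "(gw * gt) ^ 3 \<noteq> 1"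
    by (simp_all only: power2_eq_square power3_eq_cube rel_eval list.inject f_neq simp_thms)
  then have "\<not> gord (gw * gt) dvd 2" "\<not> gord (gw * gt) dvd 3" "gord (gw * gt) dvd 6"
    using 6 by (simp_all add: pow_eq_1_iff)
  moreover have "n = 6" if "\<not> n dvd 2" "\<not> n dvd 3" "n dvd 6" for n :: nat
  proof -
    have "n \<le> 6" using that(3) by (intro dvd_imp_le) auto
    then have "n \<in> {0, 1, 2, 3, 4, 5, 6}" by auto
    then show ?thesis using that by auto
  qed
  ultimately show ?thesis by blast
qed

lemma gw_gt_inv: "inverse gw = gw" "inverse gt = gt" "gw * (gw * x) = x" "gt * (gt * x) = x"
proof -
  show "inverse gw = gw" "inverse gt = gt" using rel_B(4,5) by (simp_all add: mult_eq_one_inv)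
  show "gw * (gw * x) = x" "gt * (gt * x) = x" by (simp_all only: mult.assoc [symmetric] rel_B(4,5) mult_1_left)
qed

lemma gwgt_inverse: "inverse ((gw * gt) ^ n) = (gt * gw) ^ n"
  by (induction n) (simp_all add: gw_gt_inv power_commutes mult.assoc)

text \<open>The involutions \<open>gw\<close> and \<open>gt\<close> generate a dihedral group of
  order 12 and invert its rotations. As \<open>gw\<close> inverts \<open>gZ\<close> and
  \<open>gt\<close> centralizes it, \<open>gw * gt\<close> inverts it and the square centralizes
  it.\<close>

lemma sy3_facts: "gord ((gw * gt) ^ 2) = 3" "gt * (gw * gt) ^ n = inverse ((gw * gt) ^ n) * gt"
  "gw * (gw * gt) ^ n = inverse ((gw * gt) ^ n) * gw" "gZ * (gw * gt) ^ 2 = (gw * gt) ^ 2 * gZ"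
proof -
  show "gord ((gw * gt) ^ 2) = 3"
    using gord_pow_prime[of 3 "gw * gt"] by (simp add: gwgt_order)
  show "gt * (gw * gt) ^ n = inverse ((gw * gt) ^ n) * gt"
    by (simp only: gwgt_inverse) (induction n, simp_all add: mult.assoc)
  have "(gw * gt) ^ n * gw = gw * (gt * gw) ^ n" by (induction n) (simp_all add: mult.assoc)
  then have "gw * ((gw * gt) ^ n * gw) * gw = (gt * gw) ^ n * gw" by (simp add: gw_gt_inv mult.assoc)
  then show "gw * (gw * gt) ^ n = inverse ((gw * gt) ^ n) * gw"
    using rel_B(4) by (simp add: gwgt_inverse mult.assoc)
  have "gw * gt * gZ = inverse gZ * (gw * gt)"
  proof -
    have "gw * gZ = inverse gZ * gw"
      using gw_gZ rel_B(2) by (metis inv_cancel(5) mult_eq_one_inv)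
    then show ?thesis using rel_B(8) by (metis mult.assoc)
  qed
  then have "gw * gt * (gw * gt * gZ) = gZ * (gw * gt) * (gw * gt)"
    by (metis inv_cancel(2,3) inv_cancel(4) mult.assoc)
  then show "gZ * (gw * gt) ^ 2 = (gw * gt) ^ 2 * gZ" by (simp add: power2_eq_square mult.assoc)
qed

lemma sy_in_Sy: "p \<in> {3, 5, 7, 11, 19} \<Longrightarrow> sy p \<in> Sy UNIV p"
  by (auto simp: sy_simps El_def gords sy3_facts intro!: cyc_in_Sy sbg_UNIV)

definition NN :: "nat \<Rightarrow> nat" where
  "NN p = card (nrm (sy p))"

lemma NN_eq: "(P::j1 set) \<in> Sy UNIV p \<Longrightarrow> p \<in> {3, 5, 7, 11, 19} \<Longrightarrow> card (nrm P) = NN p"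
proof -
  assume P: "(P::j1 set) \<in> Sy UNIV p" and p: "p \<in> {3, 5, 7, 11, 19}"
  then have "exact_prime p CARD(j1)" using exact_primes by auto
  then obtain g where "P = cj g (sy p)" using Sy_UNIV_conj[OF _ sy_in_Sy[OF p] P] by metis
  then show "card (nrm P) = NN p" by (simp add: NN_def nrm_cj)
qed

lemma Sy_NN: "p \<in> {3, 5, 7, 11, 19} \<Longrightarrow> card (Sy (UNIV::j1 set) p) * NN p = 175560 \<and> [card (Sy (UNIV::j1 set) p) = 1] (mod p)"
proof -
  assume p: "p \<in> {3, 5, 7, 11, 19}"
  then have e: "exact_prime p CARD(j1)" using exact_primes by auto
  show ?thesis
    using card_Sy[OF sbg_UNIV exact_primeD(2)[OF e] exact_primeD(1)[OF e], of 1, OF _ exact_primeD(3)[OF e] sy_in_Sy[OF p]]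
      Sy_mod[OF sbg_UNIV exact_primeD(2)[OF e] exact_primeD(1)[OF e], of 1, OF _ exact_primeD(3)[OF e]]
    by (simp add: NN_def CARD_j1)
qed

lemma dvd_NN_commuting: "p \<in> {3, 5, 7, 11, 19} \<Longrightarrow> prime q \<Longrightarrow> q dvd NN p \<Longrightarrow> \<not> q dvd p - 1 \<Longrightarrow> commuting p q"
  using dvd_nrm_imp_commuting[OF sy_in_Sy, of p q] by (auto simp: NN_def)

lemma commuting_dvd_NN: "p \<in> {3, 5, 7, 11, 19} \<Longrightarrow> commuting p q \<Longrightarrow> q dvd NN p"
  using commuting_imp_dvd_nrm[OF _ sy_in_Sy, of p q] exact_primes by (auto simp: NN_def)

lemma not_commuting:
  assumes "p \<in> {3, 5, 7, 11, 19}" "exact_prime q (NN p)" "b \<in> nrm (sy p)" "gord b = q" "a \<in> sy p" "a * b \<noteq> b * a"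
  shows "\<not> commuting p q"
proof -
  have "exact_prime p CARD(j1)" using assms(1) exact_primes by auto
  then show ?thesis using not_commuting_orders[OF _ _ sy_in_Sy[OF assms(1)], of q b a] assms by (auto simp: NN_def)
qed

lemma gord_dvd_NN: "b \<in> nrm (sy p) \<Longrightarrow> gord b dvd NN p"
  unfolding NN_def by (rule gord_dvd_card[OF sbg_nrm])

lemma exact_prime_NN: "q \<in> {3, 5, 7, 11, 19} \<Longrightarrow> q dvd NN p \<Longrightarrow> exact_prime q (NN p)"
  using exact_prime_dvd[of q "CARD(j1)" "NN p"] exact_primes lagrange_sbg[OF sbg_nrm sbg_UNIV] by (auto simp: NN_def)

lemma nrm_sy_elements:
  "gZ \<in> nrm (sy 11)" "gt \<in> nrm (sy 11)" "gp \<in> nrm (sy 7)" "gr \<in> nrm (sy 7)" "gs \<in> nrm (sy 19)"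
  "gw \<in> nrm (sy 5)" "gt \<in> nrm (sy 5)" "gw \<in> nrm (sy 3)" "gt \<in> nrm (sy 3)" "gZ \<in> nrm (sy 3)"
proof -
  have ginv: "inverse a = a ^ (n - 1)" if "a ^ n = 1" "n > 0" for a :: j1 and n
  proof -
    have "a * a ^ (n - 1) = 1" using that by (cases n) auto
    then show ?thesis by (simp add: mult_eq_one_inv)
  qed
  have t: "gt * gx = gx ^ 10 * gt" using gt_gx[of 1] by simp
  show "gZ \<in> nrm (sy 11)" "gt \<in> nrm (sy 11)" "gp \<in> nrm (sy 7)" "gr \<in> nrm (sy 7)" "gs \<in> nrm (sy 19)"
    unfolding sy_simps using rel_B(3) t rel_Y7(2,4) rel_u(2) by (blast intro: cyc_nrmI)+
  show "gw \<in> nrm (sy 5)" unfolding sy_simps using gw_gZ by (blast intro: cyc_nrmI)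
  show "gt \<in> nrm (sy 5)" unfolding sy_simps using rel_B(8) by (intro cyc_nrmI[of _ _ 1]) simp
  have i: "inverse ((gw * gt) ^ 2) = ((gw * gt) ^ 2) ^ 2"
    using ginv[of "(gw * gt) ^ 2" 3] pow_gord[of "(gw * gt) ^ 2"] by (simp add: sy3_facts)
  show "gw \<in> nrm (sy 3)" "gt \<in> nrm (sy 3)" unfolding sy_simps
    using sy3_facts(2,3)[of 2] unfolding i by (blast intro: cyc_nrmI)+
  show "gZ \<in> nrm (sy 3)" unfolding sy_simps using sy3_facts(4) by (intro cyc_nrmI[of _ _ 1]) simp
qed

lemma self_nrm_sy: "sy p \<subseteq> nrm (sy p)"
  by (rule subset_nrm) (simp add: sy_def sbg_cyc)

lemma dvd_114: "114 dvd (n::nat)" if "19 dvd n" "2 dvd n" "3 dvd n"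
  using divides_mult[of 19 n 6] dvd_6[of n] that by (simp add: coprime_iff_gcd_eq_1 gcd_non_0_nat)

lemma dvd_42: "42 dvd (n::nat)" if "7 dvd n" "2 dvd n" "3 dvd n"
  using divides_mult[of 7 n 6] dvd_6[of n] that by (simp add: coprime_iff_gcd_eq_1 gcd_non_0_nat)

lemma dvd_110: "110 dvd (n::nat)" if "11 dvd n" "2 dvd n" "5 dvd n"
  using divides_mult[of 55 n 2] dvd_55[of n] that by (simp add: coprime_iff_gcd_eq_1 gcd_non_0_nat)

lemma gr_gs_orders: "gord (gr ^ 3) = 2" "gord (gs ^ 3) = 2" "gord (gs ^ 2) = 3"
  "gY * gr ^ 3 \<noteq> gr ^ 3 * gY" "gu * gs ^ 3 \<noteq> gs ^ 3 * gu" "gu * gs ^ 2 \<noteq> gs ^ 2 * gu"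
proof -
  have r: "(gr ^ 3) ^ 2 = 1" using rel_Y7(3) by (simp add: numeral_eq_Suc mult.assoc)
  have s: "(gs ^ 3) ^ 2 = 1" "(gs ^ 2) ^ 3 = 1" using rel_u(3) by (simp_all add: numeral_eq_Suc mult.assoc)
  note n = pow_conj_not_commute[OF rel_Y7(2), of 3] pow_conj_not_commute[OF rel_u(2), of 3] pow_conj_not_commute[OF rel_u(2), of 2]
  show "gY * gr ^ 3 \<noteq> gr ^ 3 * gY" "gu * gs ^ 3 \<noteq> gs ^ 3 * gu" "gu * gs ^ 2 \<noteq> gs ^ 2 * gu"
    using n by (simp_all add: gords)
  show "gord (gr ^ 3) = 2" "gord (gs ^ 3) = 2" "gord (gs ^ 2) = 3"
    using n r s by (auto intro!: gord_prime simp: gords)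
qed

text \<open>Lower estimates from exhibited elements; they turn out to be the exact orders. For 5 and
  3 the factor 4 comes from the four-group generated by \<open>gt\<close> and the central rotation
  of the dihedral group of order 12.\<close>

lemma NN_dvd: "110 dvd NN 11" "42 dvd NN 7" "114 dvd NN 19" "60 dvd NN 5" "60 dvd NN 3"
proof -
  have self: "n dvd NN p" if "gord a = n" "sy p = cyc a" for a n p
    using gord_dvd_NN[of a p] self_nrm_sy[of p] self_in_cyc[of a] that by auto
  show "110 dvd NN 11"
    using self[of gx 11 11] gord_dvd_NN[OF nrm_sy_elements(1)] gord_dvd_NN[OF nrm_sy_elements(2)]
    by (intro dvd_110) (simp_all add: gords sy_simps)
  show "42 dvd NN 7"
    using self[of gY 7 7] gord_dvd_NN[OF nrm_sy_elements(3)] gord_dvd_NN[OF sbg_pow[OF sbg_nrm nrm_sy_elements(4)], of 3]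
    by (intro dvd_42) (simp_all add: gords sy_simps gord_gp gr_gs_orders)
  show "114 dvd NN 19"
    using self[of gu 19 19] gord_dvd_NN[OF sbg_pow[OF sbg_nrm nrm_sy_elements(5)], of 3]
      gord_dvd_NN[OF sbg_pow[OF sbg_nrm nrm_sy_elements(5)], of 2]
    by (intro dvd_114) (simp_all add: gords sy_simps gr_gs_orders)
  have 60: "60 dvd card H" if H: "sbg H" "gw \<in> H" "gt \<in> H" "gZ \<in> H" for H
  proof -
    define s where "s = (gw * gt) ^ 3"
    have sH: "s \<in> H" "(gw * gt) ^ 2 \<in> H" using H sbgD(2)[OF H(1)] sbg_pow[OF H(1)] by (auto simp: s_def)
    have "s * s = 1" using pow_gord[of "gw * gt"] by (simp add: s_def gwgt_order power_add [symmetric])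
    then have "inverse s = s" by (simp add: mult_eq_one_inv)
    then have "gt * s = s * gt" using sy3_facts(2)[of 3] by (simp add: s_def)
    moreover have "s \<noteq> 1" using pow_eq_1_iff[of "gw * gt" 3] by (simp add: s_def gwgt_order)
    \<comment> \<open>\<open>gt\<close> centralizes \<open>gZ\<close> while s inverts it, and the
      order of \<open>gZ\<close> is odd.\<close>
    moreover have "s \<noteq> gt"
    proof
      assume "s = gt"
      then have "gt * gZ = s * gZ" by simp
      moreover have "s * gZ = inverse gZ * s"
      proof -
        have "gw * gt * gZ = inverse gZ * (gw * gt)"
          using gw_gZ rel_B(2,8) by (metis inv_cancel(5) mult.assoc mult_eq_one_inv)
        moreover have "s = (gw * gt) ^ 2 * (gw * gt)" by (simp add: s_def numeral_eq_Suc mult.assoc)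
        moreover have "(gw * gt) ^ 2 * inverse gZ = inverse gZ * (gw * gt) ^ 2"
          using sy3_facts(4) by (metis inv_cancel(1,4) mult.assoc mult.right_neutral mult.left_neutral inv_cancel(3))
        ultimately show ?thesis by (metis mult.assoc)
      qed
      ultimately have "gZ * gt = inverse gZ * gt" using \<open>s = gt\<close> rel_B(8) by simp
      then have "gZ = inverse gZ" by simp
      then have "gZ ^ 2 = 1" by (metis inv_cancel(2) power2_eq_square)
      then show False using pow_eq_1_iff[of gZ 2] by (simp add: gords)
    qed
    ultimately have "4 dvd card H"
      using four_group[OF H(1), of gt s] H sH rel_B(5) \<open>s * s = 1\<close> gt_not_1 by auto
    then show ?thesis
      using gord_dvd_card[OF H(1) sH(2)] gord_dvd_card[OF H(1,4)] by (intro dvd_60) (simp_all add: gords sy3_facts)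
  qed
  have "gZ \<in> nrm (sy 5)" using self_nrm_sy[of 5] self_in_cyc[of gZ] by (auto simp: sy_simps)
  then show "60 dvd NN 5" "60 dvd NN 3" unfolding NN_def using 60[OF sbg_nrm] nrm_sy_elements by auto
qed

subsection \<open>Elements commuting with an element of order 11\<close>

text \<open>The matrix of \<open>gx\<close> is a single unipotent Jordan block; \<open>jordan_basis\<close> has a Jordan chain as
  its columns, starting with \<open>fix_vec\<close>, and \<open>kernel_left\<close> is a left inverse of \<open>gx - 1\<close> modulo \<open>fix_vec\<close>.\<close>

definition mat_of :: "11 list list \<Rightarrow> 11 ^ 7 ^ 7" where
  "mat_of A = vector (map vector A)"

lemma length_7E:
  assumes "length xs = 7"
  obtains a b c d e f g where "xs = [a, b, c, d, e, f, g]"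
  using assms by (auto simp: numeral_eq_Suc length_Suc_conv)

lemma rows_mat_of:
  assumes "length A = 7" "\<forall>r\<in>set A. length r = 7"
  shows "rows (mat_of A) = A"
proof -
  have r: "map (\<lambda>j. vector r $ j) [1, 2, 3, 4, 5, 6, 7::7] = r" if "length r = 7" for r :: "11 list"
    using that by (rule length_7E) (simp add: vector_7)
  obtain a b c d e f g where A: "A = [a, b, c, d, e, f, g]" using assms(1) by (rule length_7E)
  show ?thesis
    unfolding rows_def mat_of_def A list.map vector_7
    using r assms(2) unfolding A by simp
qed

definition fix_vec :: "11 ^ 7" where
  "fix_vec = vector [0, 1, f8, f3, 0, f3, f7]"

definition jordan_basis :: "11 list list" where
  "jordan_basis = [[0, f3, f4, f5, f5, f5, 0], [1, f8, f8, f4, 0, f4, f3], [f8, f8, f3, 0, f8, f10, 0], [f3, 0, f5, f9, f10, f5, 0], [0, 0, f6, f2, 0, f7, 0], [f3, f4, f5, f4, f10, f4, 0], [f7, f10, f10, f8, f9, f3, 0]]"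

definition kernel_left :: "11 list list" where
  "kernel_left = [[f5, 0, f2, f7, f5, f7, 0], [0, 0, 0, 0, 0, 0, 0], [f9, 0, f6, f7, f9, f5, f2], [f4, 0, f2, f6, f4, 1, f7], [f6, 0, f2, f7, f5, 1, f10], [f4, 0, f4, 1, f10, f6, f10], [0, 0, f8, f5, 1, f2, f8]]"

lemma rows_jordan: "rows (mat_of kernel_left) = [[f5, 0, f2, f7, f5, f7, 0], [0, 0, 0, 0, 0, 0, 0], [f9, 0, f6, f7, f9, f5, f2], [f4, 0, f2, f6, f4, 1, f7], [f6, 0, f2, f7, f5, 1, f10], [f4, 0, f4, 1, f10, f6, f10], [0, 0, f8, f5, 1, f2, f8]]"
  "rows (mat_of jordan_basis) = [[0, f3, f4, f5, f5, f5, 0], [1, f8, f8, f4, 0, f4, f3], [f8, f8, f3, 0, f8, f10, 0], [f3, 0, f5, f9, f10, f5, 0], [0, 0, f6, f2, 0, f7, 0], [f3, f4, f5, f4, f10, f4, 0], [f7, f10, f10, f8, f9, f3, 0]]"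
  by (simp_all add: rows_mat_of kernel_left_def jordan_basis_def)

lemma solve_linear_11: "(a::11) + c * x = 0 \<Longrightarrow> c + d = 0 \<Longrightarrow> a = d * x"
proof -
  assume a: "a + c * x = 0" and cd: "c + d = 0"
  have "(c + d) * x = 0" using cd by simp
  then have "a + c * x = d * x + c * x" using a by (simp add: distrib_right add.commute)
  then show "a = d * x" by simp
qed

lemma kernel_left: "mat_of kernel_left ** Rep_j1 gx = mat_of kernel_left + mat_of [[1, 0, 0, 0, 0, 0, 0], [0, 0, 0, 0, 0, 0, 0], [0, f3, 1, 0, 0, 0, 0], [0, f8, 0, 1, 0, 0, 0], [0, 0, 0, 0, 1, 0, 0], [0, f8, 0, 0, 0, 1, 0], [0, f4, 0, 0, 0, 0, 1]]"
proof -
  have "rows (mat_of kernel_left ** Rep_j1 gx) = [[f6, 0, f2, f7, f5, f7, 0], [0, 0, 0, 0, 0, 0, 0], [f9, f3, f7, f7, f9, f5, f2], [f4, f8, f2, f7, f4, 1, f7], [f6, 0, f2, f7, f6, 1, f10], [f4, f8, f4, 1, f10, f7, f10], [0, f4, f8, f5, 1, f2, f9]]"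
    by (simp only: rows_mult rows_jordan mt_gx [unfolded mt_def] mat_eval)
  then show ?thesis
    by (simp add: rows_def mat_of_def kernel_left_def vector_7 vec_eq_iff all_7 f_arith)
qed

text \<open>Multiplying the equation by \<open>kernel_left\<close> leaves a reduced linear system
  whose free variable is the second coordinate.\<close>

lemma fixed_by_gx:
  assumes "Rep_j1 gx *v u = u"
  shows "u = (u $ 2) *s fix_vec"
proof -
  let ?R = "mat_of kernel_left" and ?D = "mat_of [[1, 0, 0, 0, 0, 0, 0], [0, 0, 0, 0, 0, 0, 0], [0, f3, 1, 0, 0, 0, 0], [0, f8, 0, 1, 0, 0, 0], [0, 0, 0, 0, 1, 0, 0], [0, f8, 0, 0, 0, 1, 0], [0, f4, 0, 0, 0, 0, 1]]"
  have "?R *v u = (?R ** Rep_j1 gx) *v u" using assms by (simp add: matrix_vector_mul_assoc [symmetric])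
  also have "\<dots> = ?R *v u + ?D *v u" by (simp add: kernel_left matrix_vector_mult_add_rdistrib)
  finally have "?D *v u = 0" by simp
  then have e: "u $ 1 = 0" "u $ 3 + f3 * u $ 2 = 0" "u $ 4 + f8 * u $ 2 = 0" "u $ 5 = 0" "u $ 6 + f8 * u $ 2 = 0" "u $ 7 + f4 * u $ 2 = 0"
    by (simp_all add: mat_of_def vec_eq_iff all_7 matrix_vector_mult_def sum_7 vector_7 f_arith ac_simps)
  have u1: "u $ 1 = 0 * u $ 2" using e(1) by simp
  have u3: "u $ 3 = f8 * u $ 2" by (rule solve_linear_11[OF e(2)]) (simp add: f_defs)
  have u4: "u $ 4 = f3 * u $ 2" by (rule solve_linear_11[OF e(3)]) (simp add: f_defs)
  have u5: "u $ 5 = 0 * u $ 2" using e(4) by simp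
  have u6: "u $ 6 = f3 * u $ 2" by (rule solve_linear_11[OF e(5)]) (simp add: f_defs)
  have u7: "u $ 7 = f7 * u $ 2" by (rule solve_linear_11[OF e(6)]) (simp add: f_defs)
  show ?thesis
    using u1 u3 u4 u5 u6 u7 by (simp add: fix_vec_def vec_eq_iff all_7 vector_7 ac_simps)
qed

lemma jordan_chain:
  fixes j :: 7
  shows "Rep_j1 gx *v column 1 (mat_of jordan_basis) = column 1 (mat_of jordan_basis)"
    "Rep_j1 gx *v column 2 (mat_of jordan_basis) = column 2 (mat_of jordan_basis) + column 1 (mat_of jordan_basis)"
    "Rep_j1 gx *v column 3 (mat_of jordan_basis) = column 3 (mat_of jordan_basis) + column 2 (mat_of jordan_basis)"
    "Rep_j1 gx *v column 4 (mat_of jordan_basis) = column 4 (mat_of jordan_basis) + column 3 (mat_of jordan_basis)"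
    "Rep_j1 gx *v column 5 (mat_of jordan_basis) = column 5 (mat_of jordan_basis) + column 4 (mat_of jordan_basis)"
    "Rep_j1 gx *v column 6 (mat_of jordan_basis) = column 6 (mat_of jordan_basis) + column 5 (mat_of jordan_basis)"
    "Rep_j1 gx *v column 7 (mat_of jordan_basis) = column 7 (mat_of jordan_basis) + column 6 (mat_of jordan_basis)"
proof -
  have e: "rows (Rep_j1 gx) = mt gx" by (simp add: mt_def)
  show "Rep_j1 gx *v column 1 (mat_of jordan_basis) = column 1 (mat_of jordan_basis)"
    "Rep_j1 gx *v column 2 (mat_of jordan_basis) = column 2 (mat_of jordan_basis) + column 1 (mat_of jordan_basis)"
    "Rep_j1 gx *v column 3 (mat_of jordan_basis) = column 3 (mat_of jordan_basis) + column 2 (mat_of jordan_basis)"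
    "Rep_j1 gx *v column 4 (mat_of jordan_basis) = column 4 (mat_of jordan_basis) + column 3 (mat_of jordan_basis)"
    "Rep_j1 gx *v column 5 (mat_of jordan_basis) = column 5 (mat_of jordan_basis) + column 4 (mat_of jordan_basis)"
    "Rep_j1 gx *v column 6 (mat_of jordan_basis) = column 6 (mat_of jordan_basis) + column 5 (mat_of jordan_basis)"
    "Rep_j1 gx *v column 7 (mat_of jordan_basis) = column 7 (mat_of jordan_basis) + column 6 (mat_of jordan_basis)"
    using e unfolding mt_gx rows_def list.map list.inject
    by (simp_all add: vec_eq_iff all_7 column_def matrix_vector_mult_def sum_7 mat_of_def jordan_basis_def vector_7 f_arith)
      (simp_all add: f_defs)?
qed

lemma UNIV_11: "(UNIV :: 11 set) = {0, 1, f2, f3, f4, f5, f6, f7, f8, f9, f10}"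
proof -
  have "x \<in> {0, 1, 2, 3, 4, 5, 6, 7, 8, 9, 10}" for x :: 11
  proof (cases x)
    case (of_int z)
    have "0 \<le> z" "z < 11" using of_int by simp_all
    then have "z = 0 \<or> z = 1 \<or> z = 2 \<or> z = 3 \<or> z = 4 \<or> z = 5 \<or> z = 6 \<or> z = 7 \<or> z = 8 \<or> z = 9 \<or> z = 10"
      by presburger
    then show ?thesis using of_int(1) by (elim disjE) simp_all
  qed
  then show ?thesis unfolding f_defs by blast
qed

lemma all_11: "(\<forall>x::11. P x) \<longleftrightarrow> P 0 \<and> P 1 \<and> P f2 \<and> P f3 \<and> P f4 \<and> P f5 \<and> P f6 \<and> P f7 \<and> P f8 \<and> P f9 \<and> P f10"
proof -
  have "(\<forall>x::11. P x) \<longleftrightarrow> (\<forall>x\<in>UNIV. P x)" by simp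
  then show ?thesis by (simp only: UNIV_11 ball_simps simp_thms)
qed

text \<open>3 and 7 are prime to 10, the order of the multiplicative group of the field.\<close>

lemma cube_or_seventh_root_11: "(x::11) ^ 3 = 1 \<Longrightarrow> x = 1" "(x::11) ^ 7 = 1 \<Longrightarrow> x = 1"
proof -
  have "\<forall>x::11. x * x * x = 1 \<longrightarrow> x = 1" "\<forall>x::11. x * x * x * (x * x * x) * x = 1 \<longrightarrow> x = 1"
    by (simp_all only: all_11 f_arith f_neq simp_thms)
  moreover have "x ^ 3 = x * x * x" "x ^ 7 = x * x * x * (x * x * x) * x" for x :: 11
    by (simp_all add: numeral_eq_Suc mult.assoc)
  ultimately show "(x::11) ^ 3 = 1 \<Longrightarrow> x = 1" "(x::11) ^ 7 = 1 \<Longrightarrow> x = 1"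
    by metis+
qed

lemma column_1_jordan: "column 1 (mat_of jordan_basis) = fix_vec"
  by (simp add: column_def vec_eq_iff all_7 mat_of_def jordan_basis_def fix_vec_def vector_7)

lemma fix_vec_2: "fix_vec $ 2 = 1"
  by (simp add: fix_vec_def vector_7)

lemma mv_linear:
  fixes A :: "'a::comm_ring_1 ^ 'n ^ 'm"
  shows "A *v (u + w) = A *v u + A *v w" "A *v (u - w) = A *v u - A *v w" "A *v (c *s u) = c *s (A *v u)"
  by (simp_all add: vec_eq_iff matrix_vector_mult_def sum_distrib_left algebra_simps sum.distrib sum_subtractf)

text \<open>g preserves the fixed line of \<open>gx\<close> and acts on it by a k-th root of unity,
  which is 1. Going up the Jordan chain, g can only add a multiple c of \<open>fix_vec\<close> to
  the next vector; its k-th power adds k c, and k is invertible modulo 11, so c = 0.\<close>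

lemma commute_gx_trivial:
  assumes c: "g * gx = gx * g" and k: "g ^ k = 1" "k = 3 \<or> k = 7"
  shows "g = 1"
proof -
  let ?G = "Rep_j1 g" and ?X = "Rep_j1 gx" and ?f = "\<lambda>i. column i (mat_of jordan_basis)"
  have GX: "?G *v (?X *v u) = ?X *v (?G *v u)" for u
    using c by (metis matrix_vector_mul_assoc times_j1.rep_eq)
  have Gn: "Rep_j1 (h ^ n) *v u = ((\<lambda>u. Rep_j1 h *v u) ^^ n) u" for h n u
    by (induction n) (simp_all add: one_j1.rep_eq times_j1.rep_eq matrix_vector_mul_assoc [symmetric])
  have Gk: "((\<lambda>u. ?G *v u) ^^ k) u = u" for u
    using Gn[of g k u] k(1) by (simp add: one_j1.rep_eq)
  have "?X *v (?G *v fix_vec) = ?G *v fix_vec"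
    using GX[of fix_vec] jordan_chain(1) by (simp add: column_1_jordan)
  then obtain l where l: "?G *v fix_vec = l *s fix_vec" using fixed_by_gx by blast
  have "((\<lambda>u. ?G *v u) ^^ n) fix_vec = l ^ n *s fix_vec" for n
    by (induction n) (simp_all add: l mv_linear vector_smult_assoc mult.commute)
  then have "l ^ k *s fix_vec = fix_vec" using Gk by metis
  then have "(l ^ k *s fix_vec) $ 2 = 1" by (simp add: fix_vec_2)
  then have "l ^ k = 1" by (simp add: fix_vec_2)
  then have "l = 1" using k(2) cube_or_seventh_root_11 by blast
  then have G1: "?G *v fix_vec = fix_vec" using l by simp
  have step: "?G *v u = u" if w: "?G *v w = w" and u: "?X *v u = u + w" for u w
  proof -
    have "?X *v (?G *v u) = ?G *v u + w" using GX[of u] u w by (simp add: mv_linear)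
    then have "?X *v (?G *v u - u) = ?G *v u - u" by (simp add: mv_linear u)
    then obtain c where "?G *v u - u = c *s fix_vec" using fixed_by_gx by blast
    then have c: "?G *v u = u + c *s fix_vec" by (simp add: algebra_simps)
    have "((\<lambda>u. ?G *v u) ^^ n) u = u + (of_nat n * c) *s fix_vec" for n
      by (induction n) (simp_all add: c mv_linear G1 vector_sadd_rdistrib algebra_simps)
    then have "u + (of_nat k * c) *s fix_vec = u" using Gk by metis
    then have "((of_nat k * c) *s fix_vec) $ 2 = 0" by simp
    then have "of_nat k * c = 0" by (simp add: fix_vec_2)
    then have "3 * c = 0 \<or> 7 * c = 0" using k(2) by auto
    moreover have "\<forall>c::11. 3 * c = 0 \<longrightarrow> c = 0" "\<forall>c::11. 7 * c = 0 \<longrightarrow> c = 0"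
      by (simp_all only: f3_def [symmetric] f7_def [symmetric] all_11 f_arith f_neq simp_thms)
    ultimately have "c = 0" by blast
    then show ?thesis using c by simp
  qed
  have f1: "?G *v ?f 1 = ?f 1" using G1 by (simp add: column_1_jordan)
  have f2: "?G *v ?f 2 = ?f 2" by (rule step[OF f1 jordan_chain(2)])
  have f3: "?G *v ?f 3 = ?f 3" by (rule step[OF f2 jordan_chain(3)])
  have f4: "?G *v ?f 4 = ?f 4" by (rule step[OF f3 jordan_chain(4)])
  have f5: "?G *v ?f 5 = ?f 5" by (rule step[OF f4 jordan_chain(5)])
  have f6: "?G *v ?f 6 = ?f 6" by (rule step[OF f5 jordan_chain(6)])
  have f7: "?G *v ?f 7 = ?f 7" by (rule step[OF f6 jordan_chain(7)])
  have "\<forall>j. ?G *v ?f j = ?f j" unfolding all_7 using f1 f2 f3 f4 f5 f6 f7 by blast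
  then have GF: "?G ** mat_of jordan_basis = mat_of jordan_basis"
    by (simp add: vec_eq_iff matrix_matrix_mult_def matrix_vector_mult_def column_def)
  \<comment> \<open>The literal matrix is the inverse of \<open>jordan_basis\<close>; it shows that
    the Jordan chain is a basis.\<close>
  have "rows (mat_of jordan_basis ** mat_of [[f7, 0, 0, f2, 1, f10, f6], [f5, 0, f10, f8, f5, f7, 1], [f6, 0, 1, 0, f8, f7, f10], [f2, 0, f5, f5, f4, f7, f8], [f9, 0, f4, f2, f2, 0, f4], [f10, 0, f4, f8, 0, f3, f8], [0, f4, f10, 1, 0, 1, f6]]) = rows (mat 1)"
  proof -
    have r: "rows (mat_of [[f7, 0, 0, f2, 1, f10, f6], [f5, 0, f10, f8, f5, f7, 1], [f6, 0, 1, 0, f8, f7, f10], [f2, 0, f5, f5, f4, f7, f8], [f9, 0, f4, f2, f2, 0, f4], [f10, 0, f4, f8, 0, f3, f8], [0, f4, f10, 1, 0, 1, f6]]) = [[f7, 0, 0, f2, 1, f10, f6], [f5, 0, f10, f8, f5, f7, 1], [f6, 0, 1, 0, f8, f7, f10], [f2, 0, f5, f5, f4, f7, f8], [f9, 0, f4, f2, f2, 0, f4], [f10, 0, f4, f8, 0, f3, f8], [0, f4, f10, 1, 0, 1, f6]]" by (rule rows_mat_of) simp_all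
    show ?thesis by (simp only: rows_mult rows_jordan r rows_one mat_eval)
  qed
  then have FF: "mat_of jordan_basis ** mat_of [[f7, 0, 0, f2, 1, f10, f6], [f5, 0, f10, f8, f5, f7, 1], [f6, 0, 1, 0, f8, f7, f10], [f2, 0, f5, f5, f4, f7, f8], [f9, 0, f4, f2, f2, 0, f4], [f10, 0, f4, f8, 0, f3, f8], [0, f4, f10, 1, 0, 1, f6]] = mat 1" by (simp add: rows_inj)
  have "?G = ?G ** (mat_of jordan_basis ** mat_of [[f7, 0, 0, f2, 1, f10, f6], [f5, 0, f10, f8, f5, f7, 1], [f6, 0, 1, 0, f8, f7, f10], [f2, 0, f5, f5, f4, f7, f8], [f9, 0, f4, f2, f2, 0, f4], [f10, 0, f4, f8, 0, f3, f8], [0, f4, f10, 1, 0, 1, f6]])" by (simp add: FF)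
  also have "\<dots> = (?G ** mat_of jordan_basis) ** mat_of [[f7, 0, 0, f2, 1, f10, f6], [f5, 0, f10, f8, f5, f7, 1], [f6, 0, 1, 0, f8, f7, f10], [f2, 0, f5, f5, f4, f7, f8], [f9, 0, f4, f2, f2, 0, f4], [f10, 0, f4, f8, 0, f3, f8], [0, f4, f10, 1, 0, 1, f6]]" by (rule matrix_mul_assoc)
  also have "\<dots> = mat 1" by (simp only: GF FF)
  finally show "g = 1" by (simp add: Rep_j1_inject [symmetric] one_j1.rep_eq)
qed

text \<open>All subgroups of order 11 are conjugate, so a commuting pair can be moved to one that
  contains \<open>gx\<close>.\<close>

lemma not_commuting_11: "\<not> commuting 11 3" "\<not> commuting 11 7"
proof -
  have *: False if h: "commuting 11 k" "k = 3 \<or> k = 7" for k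
  proof -
    obtain a b :: j1 where ab: "gord a = 11" "gord b = k" "a * b = b * a"
      using h(1) by (auto simp: commuting_orders_def)
    have "cyc a \<in> Sy UNIV 11" using ab(1) by (intro cyc_in_Sy sbg_UNIV) (simp add: El_def)
    then obtain g where g: "sy 11 = cj g (cyc a)" using Sy_UNIV_conj[OF exact_primes(4) _ sy_in_Sy[of 11]] by auto
    have "gx \<in> cj g (cyc a)" using g self_in_cyc[of gx] by (simp add: sy_simps)
    then obtain y where y: "y \<in> cyc a" "gx = g * y * inverse g" by (auto simp: cj_def)
    have "y * b = b * y" by (rule commute_cyc[OF ab(3) y(1) self_in_cyc])
    then have "g * (y * b) * inverse g = g * (b * y) * inverse g" by simp
    moreover have "(g * b * inverse g) * gx = g * (b * y) * inverse g"
      "gx * (g * b * inverse g) = g * (y * b) * inverse g" by (simp_all add: y(2) mult.assoc)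
    ultimately have "(g * b * inverse g) * gx = gx * (g * b * inverse g)" by simp
    moreover have gb: "gord (g * b * inverse g) = k" using ab(2) by (simp add: gord_conj)
    then have "(g * b * inverse g) ^ k = 1" using pow_gord by metis
    ultimately have "g * b * inverse g = 1" using commute_gx_trivial h(2) by blast
    then show False using gb gord_eq_1_iff[of "g * b * inverse g"] h(2) by auto
  qed
  show "\<not> commuting 11 3" "\<not> commuting 11 7" using * by blast+
qed


lemmas nrm_cyc_elements = nrm_sy_elements [unfolded sy_simps]

section \<open>Exact orders of the Sylow normalizers\<close>

lemma dvd_split:
  fixes k m q :: nat
  assumes "k dvd q * m" "prime q" "\<not> q dvd k"
  shows "k dvd m"
  using assms by (metis coprime_commute coprime_dvd_mult_right_iff prime_imp_coprime)

lemma index_mod: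
  fixes n k m p :: nat
  assumes "n * k = m" "[n = 1] (mod p)" "[m = 1] (mod p)"
  shows "[k = 1] (mod p)"
  using assms by (metis cong_scalar_right cong_sym cong_trans mult_1)

text \<open>b is the known part of the normalizer order. The number of Sylow subgroups times the
  unknown cofactor k equals m, and since both this number and m are 1 modulo p, so is k.\<close>

lemma NN_index:
  assumes p: "p \<in> {3, 5, 7, 11, 19}" and d: "b dvd NN p" "b * m = 175560" and m: "[m = 1] (mod p)"
  obtains k where "NN p = b * k" "k dvd m" "[k = 1] (mod p)" "b > 0" "k > 0"
proof -
  obtain k where k: "NN p = b * k" using d(1) by (auto simp: dvd_def)
  have "card (Sy (UNIV::j1 set) p) * (b * k) = b * m" using Sy_NN[OF p] k d(2) by simp
  moreover have b0: "b > 0" using d(2) by (metis mult_is_0 neq0_conv zero_neq_numeral)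
  ultimately have e: "card (Sy (UNIV::j1 set) p) * k = m" by (simp add: ac_simps)
  have "k > 0" using e d(2) by (metis mult_is_0 neq0_conv zero_neq_numeral)
  then show thesis using that[OF k _ _ b0] e index_mod[OF e _ m] Sy_NN[OF p] by (metis dvd_triv_right)
qed

lemma dvd_mod_one:
  fixes k m p :: nat
  assumes "k dvd m" "m > 0" "[k = 1] (mod p)" "p > 1"
    and "\<forall>q\<in>set [0..<m div p + 1]. (p * q + 1) dvd m \<longrightarrow> P (p * q + 1)"
  shows "P k"
proof -
  have "k mod p = 1" using assms(3,4) by (simp add: cong_def)
  then have k: "k = p * (k div p) + 1" by (metis div_mult_mod_eq mult.commute)
  have "k div p \<le> m div p" using assms(1,2) by (intro div_le_mono dvd_imp_le)
  then show ?thesis using assms(1,5) k by (metis (no_types, lifting) atLeastLessThan_iff le_imp_less_Suc plus_1_eq_Suc add.commute set_upt zero_le)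
qed

lemma prime_numerals: "prime (2::nat)" "prime (3::nat)" "prime (5::nat)" "prime (7::nat)" "prime (11::nat)" "prime (19::nat)"
  by simp_all

text \<open>The cofactor divides 1596 = 4 * 3 * 7 * 19. The Jordan block excludes 3 and 7, and 1 is
  the only divisor of 76 congruent to 1 modulo 11. The other primes are then treated in an order in
  which every exclusion rests on a normalizer already known.\<close>

lemma NN_11: "NN 11 = 110"
proof -
  obtain k where k: "NN 11 = 110 * k" "k dvd 1596" "[k = 1] (mod 11)"
    using NN_index[OF _ NN_dvd(1), of 1596] by (auto simp: cong_def)
  have "\<not> 3 dvd k" using dvd_NN_commuting[of 11 3] not_commuting_11 k(1) by (auto intro: dvd_mult)
  moreover have "\<not> 7 dvd k" using dvd_NN_commuting[of 11 7] not_commuting_11 k(1) by (auto intro: dvd_mult)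
  ultimately have "k dvd 76" using dvd_split[of k 3 532] dvd_split[of k 7 76] k(2) by simp
  then have "k = 1" by (rule dvd_mod_one[OF _ _ k(3)]) (simp_all add: upt_rec)
  then show ?thesis using k(1) by simp
qed

lemma not_commuting_11_5: "\<not> commuting 11 5"
proof (rule not_commuting)
  show "exact_prime 5 (NN 11)" by (simp add: NN_11 exact_prime_def)
  show "gx \<in> sy 11" by (simp add: sy_simps self_in_cyc)
  show "gx * gZ \<noteq> gZ * gx" using pow_conj_not_commute(1)[OF rel_B(3), of 1] by (simp add: gords)
qed (simp_all add: nrm_sy_elements gords)

lemma not_commuting_11_2: "\<not> commuting 11 2"
proof (rule not_commuting)
  have t: "gt * gx = gx ^ 10 * gt" using gt_gx[of 1] by simp
  show "exact_prime 2 (NN 11)" by (simp add: NN_11 exact_prime_def)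
  show "gx \<in> sy 11" by (simp add: sy_simps self_in_cyc)
  show "gx * gt \<noteq> gt * gx" using pow_conj_not_commute(1)[OF t, of 1] by (simp add: gords)
qed (simp_all add: nrm_sy_elements gords)

lemma comm_sym: "commuting p q \<longleftrightarrow> commuting q p"
  by (rule commuting_orders_sym)

text \<open>The exclusion of 19 from the normalizer for 7 and of 7 from the normalizer for 19 depend
  on each other. This partial result breaks the circle: once 11 is excluded, the cofactor for 19 can
  only be 1 or 20.\<close>

lemma not_7_dvd_NN_19: "\<not> 7 dvd NN 19"
proof
  assume 7: "7 dvd NN 19"
  obtain k where k: "NN 19 = 114 * k" "k dvd 1540" "[k = 1] (mod 19)"
    using NN_index[OF _ NN_dvd(3), of 1540] by (auto simp: cong_def)
  have "\<not> 11 dvd k"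
  proof
    assume "11 dvd k"
    then have "commuting 19 11" using dvd_NN_commuting[of 19 11] k(1) by auto
    then have "19 dvd NN 11" using commuting_dvd_NN[of 11 19] comm_sym by auto
    then show False by (simp add: NN_11)
  qed
  then have "k dvd 140" using dvd_split[of k 11 140] k(2) by simp
  have "7 dvd k" using 7 k(1) prime_dvd_mult_iff[OF prime_numerals(4), of 114 k]
    by (simp add: prime_dvd_mult_iff)
  moreover have "\<not> 7 dvd k"
    by (rule dvd_mod_one[OF \<open>k dvd 140\<close> _ k(3)]) (simp_all add: upt_rec)
  ultimately show False by simp
qed

lemma NN_7: "NN 7 = 42"
proof -
  obtain k where k: "NN 7 = 42 * k" "k dvd 4180" "[k = 1] (mod 7)"
    using NN_index[OF _ NN_dvd(2), of 4180] by (auto simp: cong_def)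
  have "\<not> 11 dvd k" using dvd_NN_commuting[of 7 11] not_commuting_11(2) comm_sym k(1) by auto
  moreover have "\<not> 19 dvd k"
  proof
    assume "19 dvd k"
    then have "commuting 7 19" using dvd_NN_commuting[of 7 19] k(1) by auto
    then show False using commuting_dvd_NN[of 19 7] comm_sym not_7_dvd_NN_19 by auto
  qed
  ultimately have "k dvd 20" using dvd_split[of k 11 380] dvd_split[of k 19 20] k(2) by simp
  then have "k = 1" by (rule dvd_mod_one[OF _ _ k(3)]) (simp_all add: upt_rec)
  then show ?thesis using k(1) by simp
qed

lemma not_commuting_7: "\<not> commuting 7 3" "\<not> commuting 7 2"
proof -
  have "gY * gp \<noteq> gp * gY" using pow_conj_not_commute(1)[OF rel_Y7(4), of 1] by (simp add: gords)
  then show "\<not> commuting 7 3"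
    by (intro not_commuting[of 7 3 gp gY]) (simp_all add: NN_7 exact_prime_def nrm_cyc_elements gord_gp sy_simps self_in_cyc)
  show "\<not> commuting 7 2"
    by (rule not_commuting[of 7 2 "gr ^ 3" gY])
      (simp_all add: NN_7 exact_prime_def sbg_pow[OF sbg_nrm] nrm_cyc_elements gr_gs_orders sy_simps self_in_cyc)
qed

lemma NN_5: "NN 5 = 60"
proof -
  obtain k where k: "NN 5 = 60 * k" "k dvd 2926" "[k = 1] (mod 5)"
    using NN_index[OF _ NN_dvd(4), of 2926] by (auto simp: cong_def)
  have "\<not> 11 dvd k" using dvd_NN_commuting[of 5 11] not_commuting_11_5 comm_sym k(1) by auto
  moreover have "\<not> 7 dvd k"
  proof
    assume "7 dvd k"
    then have "commuting 5 7" using dvd_NN_commuting[of 5 7] k(1) by auto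
    then show False using commuting_dvd_NN[of 7 5] comm_sym NN_7 by auto
  qed
  ultimately have "k dvd 38" using dvd_split[of k 11 266] dvd_split[of k 7 38] k(2) by simp
  then have "k = 1" by (rule dvd_mod_one[OF _ _ k(3)]) (simp_all add: upt_rec)
  then show ?thesis using k(1) by simp
qed

lemma NN_19: "NN 19 = 114"
proof -
  obtain k where k: "NN 19 = 114 * k" "k dvd 1540" "[k = 1] (mod 19)"
    using NN_index[OF _ NN_dvd(3), of 1540] by (auto simp: cong_def)
  have "\<not> 11 dvd k"
  proof
    assume "11 dvd k"
    then have "commuting 19 11" using dvd_NN_commuting[of 19 11] k(1) by auto
    then show False using commuting_dvd_NN[of 11 19] comm_sym NN_11 by auto
  qed
  moreover have "\<not> 5 dvd k"
  proof
    assume "5 dvd k"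
    then have "commuting 19 5" using dvd_NN_commuting[of 19 5] k(1) by auto
    then show False using commuting_dvd_NN[of 5 19] comm_sym NN_5 by auto
  qed
  moreover have "\<not> 7 dvd k" using not_7_dvd_NN_19 k(1) by auto
  ultimately have "k dvd 4" using dvd_split[of k 11 140] dvd_split[of k 7 20] dvd_split[of k 5 4] k(2) by simp
  then have "k = 1" by (rule dvd_mod_one[OF _ _ k(3)]) (simp_all add: upt_rec)
  then show ?thesis using k(1) by simp
qed

lemma not_commuting_19: "\<not> commuting 19 3" "\<not> commuting 19 2"
proof -
  show "\<not> commuting 19 3"
    by (rule not_commuting[of 19 3 "gs ^ 2" gu])
      (simp_all add: NN_19 exact_prime_def sbg_pow[OF sbg_nrm] nrm_cyc_elements gr_gs_orders sy_simps self_in_cyc)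
  show "\<not> commuting 19 2"
    by (rule not_commuting[of 19 2 "gs ^ 3" gu])
      (simp_all add: NN_19 exact_prime_def sbg_pow[OF sbg_nrm] nrm_cyc_elements gr_gs_orders sy_simps self_in_cyc)
qed

lemma NN_3: "NN 3 = 60"
proof -
  obtain k where k: "NN 3 = 60 * k" "k dvd 2926" "[k = 1] (mod 3)"
    using NN_index[OF _ NN_dvd(5), of 2926] by (auto simp: cong_def)
  have "\<not> 11 dvd k" using dvd_NN_commuting[of 3 11] not_commuting_11 comm_sym k(1) by auto
  moreover have "\<not> 7 dvd k" using dvd_NN_commuting[of 3 7] not_commuting_7 comm_sym k(1) by auto
  moreover have "\<not> 19 dvd k" using dvd_NN_commuting[of 3 19] not_commuting_19 comm_sym k(1) by auto
  ultimately have "k dvd 2" using dvd_split[of k 11 266] dvd_split[of k 7 38] dvd_split[of k 19 2] k(2) by simp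
  then have "k \<noteq> 0" "k \<le> 2" using dvd_imp_le[of k 2] by (metis dvd_0_left_iff zero_neq_numeral, simp)
  then have "k = 1 \<or> k = 2" by linarith
  then have "k = 1" using k(3) by (auto simp: cong_def)
  then show ?thesis using k(1) by simp
qed

subsection \<open>Arithmetic of subgroups\<close>

abbreviation primes5 :: "nat set" where
  "primes5 \<equiv> {3, 5, 7, 11, 19}"

definition nS :: "j1 set \<Rightarrow> nat \<Rightarrow> nat" where
  "nS M p = card (Sy M p)"

text \<open>The index of a Sylow p-subgroup in its normalizer in M. When p does not divide
  \<open>card M\<close>, division by zero makes it 0.\<close>

definition dS :: "j1 set \<Rightarrow> nat \<Rightarrow> nat" where
  "dS M p = card M div (nS M p * p)"

lemma CARD_dvd: "sbg M \<Longrightarrow> card M dvd 175560" for M :: "j1 set"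
  using lagrange_sbg[OF _ sbg_UNIV, of M] by (simp add: CARD_j1)

lemma exact_prime_card:
  assumes "sbg (M::j1 set)" "p \<in> primes5" "p dvd card M"
  shows "exact_prime p (card M)"
  using exact_prime_dvd[of p "CARD(j1)" "card M"] exact_primes assms CARD_dvd[OF assms(1)] by (auto simp: CARD_j1)

lemma Sy_facts:
  assumes M: "sbg (M::j1 set)" and p: "p \<in> primes5" and P: "P \<in> Sy M p"
  shows "card (nrm P \<inter> M) = p * dS M p" "nS M p * (p * dS M p) = card M" "p * dS M p dvd NN p"
    "nS M p mod p = 1" "nS M p > 0" "dS M p > 0" "Sy M p = (\<lambda>g. cj g P) ` M"
proof -
  have P': "sbg P" "P \<subseteq> M" "card P = p" using P by (auto simp: Sy_iff)
  have e: "exact_prime p (card M)"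
    using lagrange_sbg[OF P'(1) M P'(2)] P'(3) exact_prime_card[OF M p] by simp
  have c: "nS M p * card (nrm P \<inter> M) = card M"
    using card_Sy[OF M exact_primeD(2)[OF e] exact_primeD(1)[OF e], of 1, OF _ exact_primeD(3)[OF e] P]
    by (simp add: nS_def)
  have pd: "p dvd card (nrm P \<inter> M)"
    using lagrange_sbg[OF P'(1) sbg_Int[OF sbg_nrm M]] subset_nrm[OF P'(1)] P' by auto
  have pos: "card M > 0" by (rule card_sbg_pos[OF M])
  have p0: "p > 0" using p by auto
  obtain d where d: "card (nrm P \<inter> M) = p * d" using pd by (auto simp: dvd_def)
  have n0: "nS M p > 0" using c pos by (metis mult_is_0 neq0_conv)
  have "dS M p = d" using c d n0 p0 by (simp add: dS_def c [symmetric] ac_simps)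
  then show 1: "card (nrm P \<inter> M) = p * dS M p" using d by simp
  then show 2: "nS M p * (p * dS M p) = card M" using c by simp
  show "nS M p > 0" by (rule n0)
  show "dS M p > 0" using 2 pos by (metis mult_is_0 neq0_conv)
  have "card (nrm P \<inter> M) dvd card (nrm P)" by (intro lagrange_sbg sbg_Int sbg_nrm M) auto
  then show "p * dS M p dvd NN p" using NN_eq[of P p] P' p 1 by (simp add: Sy_iff)
  have "p > 1" using p by auto
  then show "nS M p mod p = 1"
    using Sy_mod[OF M exact_primeD(2)[OF e] exact_primeD(1)[OF e], of 1, OF _ exact_primeD(3)[OF e]]
    by (simp add: nS_def cong_def)
  show "Sy M p = (\<lambda>g. cj g P) ` M"
    using Sy_eq_conj[OF M exact_primeD(2)[OF e] exact_primeD(1)[OF e], of 1, OF _ exact_primeD(3)[OF e] P] by simp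
qed

lemma Sy_exists:
  assumes "sbg (M::j1 set)" "p \<in> primes5" "p dvd card M"
  obtains P where "P \<in> Sy M p"
proof -
  have "prime p" using assms(2) by auto
  then obtain P where "sbg P" "P \<subseteq> M" "card P = p ^ 1" using sylow_exists[OF assms(1), of p 1] assms(3) by auto
  then show thesis using that[of P] by (simp add: Sy_iff)
qed

lemma Sy_empty: "sbg (M::j1 set) \<Longrightarrow> \<not> p dvd card M \<Longrightarrow> nS M p = 0 \<and> dS M p = 0"
proof -
  assume "sbg M" "\<not> p dvd card M"
  then have "Sy M p = {}" using lagrange_sbg[of _ M] by (auto simp: Sy_iff)
  then show ?thesis by (simp add: nS_def dS_def)
qed

lemma card_El_nS: "sbg M \<Longrightarrow> prime p \<Longrightarrow> card (El M p) = (p - 1) * nS M p"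
  using card_El by (simp add: nS_def)

text \<open>The divisors of \<open>NN p\<close> divided by p; the last alternative serves 7 and 19,
  where this quotient is 6.\<close>

definition dl :: "nat \<Rightarrow> nat list" where
  "dl p = (if p = 3 then [1, 2, 4, 5, 10, 20] else if p = 5 then [1, 2, 3, 4, 6, 12]
    else if p = 11 then [1, 2, 5, 10] else [1, 2, 3, 6])"

text \<open>All values that Sylow's theorem and the normalizer orders allow for the pair of
  \<open>nS\<close> and \<open>dS\<close> in a subgroup of order m. The pair (0, 0) encodes that p
  does not divide m.\<close>

definition opt :: "nat \<Rightarrow> nat \<Rightarrow> (nat \<times> nat) list" where
  "opt m p = (if p dvd m then filter (\<lambda>x. fst x mod p = 1) (map (\<lambda>d. (m div (p * d), d)) (filter (\<lambda>d. p * d dvd m) (dl p)))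
    else [(0, 0)])"

lemma dvd_list:
  fixes k m :: nat
  assumes "k dvd m" "m > 0" "\<forall>d\<in>set [0..<m + 1]. d dvd m \<longrightarrow> P d"
  shows "P k"
  using assms dvd_imp_le[OF assms(1,2)] by auto

lemmas upt_simps = upt_rec One_nat_def [symmetric]

lemma dl_complete:
  assumes p: "p \<in> primes5" and d: "p * d dvd NN p"
  shows "d \<in> set (dl p)"
proof -
  have l: "d dvd 20 \<Longrightarrow> d \<in> {1, 2, 4, 5, 10, 20}" "d dvd 12 \<Longrightarrow> d \<in> {1, 2, 3, 4, 6, 12}"
    "d dvd 6 \<Longrightarrow> d \<in> {1, 2, 3, 6}" "d dvd 10 \<Longrightarrow> d \<in> {1, 2, 5, 10}"
    by (erule dvd_list; simp add: upt_simps del: One_nat_def)+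
  have c: "d dvd b" if "a * d dvd a * b" "a > 0" for a b :: nat using that by simp
  consider "p = 3" | "p = 5" | "p = 7" | "p = 11" | "p = 19" using p by blast
  then show ?thesis
  proof cases
    case 1
    then have "d dvd 20" using d by (intro c[of 3]) (simp_all add: NN_3)
    from l(1)[OF this] show ?thesis by (simp add: dl_def 1)
  next
    case 2
    then have "d dvd 12" using d by (intro c[of 5]) (simp_all add: NN_5)
    from l(2)[OF this] show ?thesis by (simp add: dl_def 2)
  next
    case 3
    then have "d dvd 6" using d by (intro c[of 7]) (simp_all add: NN_7)
    from l(3)[OF this] show ?thesis by (simp add: dl_def 3)
  next
    case 4
    then have "d dvd 10" using d by (intro c[of 11]) (simp_all add: NN_11)
    from l(4)[OF this] show ?thesis by (simp add: dl_def 4)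
  next
    case 5
    then have "d dvd 6" using d by (intro c[of 19]) (simp_all add: NN_19)
    from l(3)[OF this] show ?thesis by (simp add: dl_def 5)
  qed
qed

lemma opt_complete:
  assumes M: "sbg (M::j1 set)" and p: "p \<in> primes5"
  shows "(nS M p, dS M p) \<in> set (opt (card M) p)"
proof (cases "p dvd card M")
  case True
  then obtain P where P: "P \<in> Sy M p" using Sy_exists[OF M p] by blast
  note f = Sy_facts[OF M p P]
  have "card M div (p * dS M p) = nS M p" using f(2,6) p by (metis div_mult_self_is_m mult_is_0 neq0_conv insertE empty_iff zero_neq_numeral)
  moreover have "p * dS M p dvd card M" using f(2) by (metis dvd_triv_right)
  ultimately show ?thesis using True f(4) dl_complete[OF p f(3)] by (auto simp: opt_def image_iff)
next
  case False
  then show ?thesis using Sy_empty[OF M False] by (simp add: opt_def)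
qed

subsection \<open>Elements of composite order\<close>

lemma four_dvd:
  assumes H: "sbg H" "gt \<in> H" "(gw * gt) ^ 3 \<in> H"
  shows "4 dvd card H"
proof -
  define s where "s = (gw * gt) ^ 3"
  have "s * s = 1" using pow_gord[of "gw * gt"] by (simp add: s_def gwgt_order power_add [symmetric])
  then have "inverse s = s" by (simp add: mult_eq_one_inv)
  then have "gt * s = s * gt" using sy3_facts(2)[of 3] by (simp add: s_def)
  moreover have "s \<noteq> 1" using pow_eq_1_iff[of "gw * gt" 3] by (simp add: s_def gwgt_order)
  moreover have "s \<noteq> gt" by (simp only: s_def power3_eq_cube rel_eval list.inject f_neq simp_thms)
  ultimately show ?thesis
    using four_group[OF H(1), of gt s] H rel_B(5) \<open>s * s = 1\<close> gt_not_1 by (auto simp: s_def)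
qed

lemma sixty_dvd:
  assumes H: "sbg H" "gw \<in> H" "gt \<in> H" "gZ \<in> H"
  shows "60 dvd card H"
proof -
  have m: "(gw * gt) ^ k \<in> H" for k using H sbgD(2)[OF H(1)] sbg_pow[OF H(1)] by simp
  show ?thesis
    using four_dvd[OF H(1,3) m] gord_dvd_card[OF H(1) m[of 2]] gord_dvd_card[OF H(1,4)]
    by (intro dvd_60) (simp_all add: gords sy3_facts)
qed

text \<open>Both normalizers have order 60, and \<open>gw\<close>, \<open>gt\<close> and
  \<open>gZ\<close>, which lie in both, already force an intersection of order 60.\<close>

lemma nrm_5_eq_nrm_3: "nrm (sy 5) = nrm (sy 3)"
proof -
  let ?H = "nrm (sy 5) \<inter> nrm (sy 3)"
  have "gZ \<in> nrm (sy 5)" using self_nrm_sy[of 5] self_in_cyc[of gZ] by (auto simp: sy_simps)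
  then have "60 dvd card ?H" using nrm_sy_elements by (intro sixty_dvd sbg_Int sbg_nrm) auto
  then have ge: "60 \<le> card ?H" using card_sbg_pos[OF sbg_Int[OF sbg_nrm sbg_nrm]] by (intro dvd_imp_le) auto
  have "card (nrm (sy 5)) = 60" "card (nrm (sy 3)) = 60" using NN_5 NN_3 by (simp_all add: NN_def)
  then have "?H = nrm (sy 5)" "?H = nrm (sy 3)"
    using ge by (intro card_seteq; simp)+
  then show ?thesis by simp
qed

text \<open>The common normalizer of \<open>sy 3\<close> and \<open>sy 5\<close> has only one
  subgroup of order 3 and one of order 5. Hence a subgroup of order 3 that normalizes one of order
  5, or the reverse, is its unique partner.\<close>

lemma partner:
  assumes P: "(P::j1 set) \<in> Sy UNIV 5" and Q: "(Q::j1 set) \<in> Sy UNIV 3" and n: "Q \<subseteq> nrm P \<or> P \<subseteq> nrm Q"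
  shows "nrm P = nrm Q"
proof -
  have ex: "exact_prime 3 (card (nrm (sy 3)))" "exact_prime 5 (card (nrm (sy 3)))"
    using NN_3 by (simp_all add: NN_def exact_prime_def)
  have sub: "sy 3 \<in> Sy (nrm (sy 3)) 3" "sy 5 \<in> Sy (nrm (sy 3)) 5"
    using sy_in_Sy[of 3] sy_in_Sy[of 5] self_nrm_sy[of 3] self_nrm_sy[of 5] nrm_5_eq_nrm_3 by (auto simp: Sy_iff)
  have uniq3: "R = sy 3" if "R \<in> Sy (nrm (sy 3)) 3" for R
    using Sy_normal_unique[OF sbg_nrm exact_primeD(2)[OF ex(1)] exact_primeD(1)[OF ex(1)], of 1 R "sy 3"] exact_primeD(3)[OF ex(1)] that sub
    by (simp add: Sy_iff)
  have uniq5: "R = sy 5" if "R \<in> Sy (nrm (sy 3)) 5" for R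
    using Sy_normal_unique[OF sbg_nrm exact_primeD(2)[OF ex(2)] exact_primeD(1)[OF ex(2)], of 1 R "sy 5"] exact_primeD(3)[OF ex(2)] that sub nrm_5_eq_nrm_3
    by (simp add: Sy_iff)
  from n show ?thesis
  proof
    assume n: "Q \<subseteq> nrm P"
    obtain g where g: "P = cj g (sy 5)" using Sy_UNIV_conj[OF exact_primes(2) sy_in_Sy[of 5] P] by auto
    have "cj (inverse g) Q \<in> Sy (nrm (sy 3)) 3"
    proof -
      have "Q \<subseteq> cj g (nrm (sy 3))" using n g by (simp add: nrm_cj nrm_5_eq_nrm_3)
      then have "cj (inverse g) Q \<subseteq> nrm (sy 3)" using cj_mono_iff[of "inverse g" Q "cj g (nrm (sy 3))"] by simp
      then show ?thesis using Q by (simp add: Sy_iff sbg_cj)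
    qed
    then have "cj (inverse g) Q = sy 3" by (rule uniq3)
    then have "Q = cj g (sy 3)" by (metis cj_inverse(2))
    then show ?thesis using g by (simp add: nrm_cj nrm_5_eq_nrm_3)
  next
    assume n: "P \<subseteq> nrm Q"
    obtain g where g: "Q = cj g (sy 3)" using Sy_UNIV_conj[OF exact_primes(1) sy_in_Sy[of 3] Q] by auto
    have "cj (inverse g) P \<in> Sy (nrm (sy 3)) 5"
    proof -
      have "P \<subseteq> cj g (nrm (sy 3))" using n g by (simp add: nrm_cj)
      then have "cj (inverse g) P \<subseteq> nrm (sy 3)" using cj_mono_iff[of "inverse g" P "cj g (nrm (sy 3))"] by simp
      then show ?thesis using P by (simp add: Sy_iff sbg_cj)
    qed
    then have "cj (inverse g) P = sy 5" by (rule uniq5)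
    then have "P = cj g (sy 5)" by (metis cj_inverse(2))
    then show ?thesis using g by (simp add: nrm_cj nrm_5_eq_nrm_3)
  qed
qed

lemma Sy_UNIV_I: "P \<in> Sy M p \<Longrightarrow> P \<in> Sy UNIV p"
  by (simp add: Sy_iff)

lemma Sy_dS_exists:
  assumes M: "sbg (M::j1 set)" and p: "p \<in> primes5" and d: "dS M p > 0"
  obtains P where "P \<in> Sy M p"
  using Sy_empty[OF M, of p] Sy_exists[OF M p] d by (metis less_irrefl)

lemma normalizing_pair:
  assumes M: "sbg (M::j1 set)" and d: "3 dvd dS M 5 \<and> dS M 5 > 0 \<or> 5 dvd dS M 3 \<and> dS M 3 > 0"
  obtains P Q where "P \<in> Sy M 5" "Q \<in> Sy M 3" "nrm P = nrm Q"
  using d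
proof
  assume 3: "3 dvd dS M 5 \<and> dS M 5 > 0"
  then obtain P where P: "P \<in> Sy M 5" using Sy_dS_exists[OF M, of 5] by auto
  have "3 dvd card (nrm P \<inter> M)" using Sy_facts(1)[OF M _ P] 3 by simp
  then obtain Q where Q: "Q \<in> Sy (nrm P \<inter> M) 3" using Sy_exists[OF sbg_Int[OF sbg_nrm M], of 3] by auto
  then show thesis using that[OF P, of Q] partner[of P Q] P by (auto simp: Sy_iff)
next
  assume 5: "5 dvd dS M 3 \<and> dS M 3 > 0"
  then obtain Q where Q: "Q \<in> Sy M 3" using Sy_dS_exists[OF M, of 3] by auto
  have "5 dvd card (nrm Q \<inter> M)" using Sy_facts(1)[OF M _ Q] 5 by simp
  then obtain P where P: "P \<in> Sy (nrm Q \<inter> M) 5" using Sy_exists[OF sbg_Int[OF sbg_nrm M], of 5] by auto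
  then show thesis using that[of P Q] partner[of P Q] Q by (auto simp: Sy_iff)
qed

lemma count_pairs:
  fixes A :: "'a set" and R :: "'a \<Rightarrow> 'b set"
  assumes "finite A" "\<And>a. a \<in> A \<Longrightarrow> finite (R a) \<and> k \<le> card (R a)"
  shows "k * card A \<le> card (Sigma A R)"
proof -
  have "k * card A = (\<Sum>a\<in>A. k)" by simp
  also have "\<dots> \<le> (\<Sum>a\<in>A. card (R a))" by (rule sum_mono) (use assms in auto)
  also have "\<dots> = card (Sigma A R)" using assms by (simp add: card_SigmaI)
  finally show ?thesis .
qed

text \<open>Partners have the same normalizer in M, hence the same number of conjugates. Each of the
  4 \<open>nS M 5\<close> elements of order 5 commutes with at least two elements of order 3, and
  the products have order 15.\<close>

lemma elements_of_order_15:
  assumes M: "sbg (M::j1 set)" and d: "3 dvd dS M 5 \<and> dS M 5 > 0 \<or> 5 dvd dS M 3 \<and> dS M 3 > 0"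
  shows "nS M 3 = nS M 5" "8 * nS M 5 \<le> card (El M 15)"
proof -
  obtain P Q where PQ: "P \<in> Sy M 5" "Q \<in> Sy M 3" "nrm P = nrm Q" using normalizing_pair[OF assms] .
  have e: "3 * dS M 3 = 5 * dS M 5"
    using Sy_facts(1)[OF M _ PQ(1)] Sy_facts(1)[OF M _ PQ(2)] PQ(3) by simp
  then have "nS M 3 * (5 * dS M 5) = nS M 5 * (5 * dS M 5)"
    using Sy_facts(2)[OF M _ PQ(1)] Sy_facts(2)[OF M _ PQ(2)] by simp
  then show "nS M 3 = nS M 5" using Sy_facts(6)[OF M _ PQ(1)] by simp
  have 3: "3 dvd dS M 5" using e by presburger
  define R where "R a = {b\<in>El M 3. a * b = b * a}" for a
  have R: "2 \<le> card (R a)" if a: "a \<in> El M 5" for a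
  proof -
    have A: "cyc a \<in> Sy M 5" by (rule cyc_in_Sy[OF M a])
    have "3 dvd card (nrm (cyc a) \<inter> M)" using Sy_facts(1)[OF M _ A] 3 by simp
    then obtain b where b: "b \<in> nrm (cyc a) \<inter> M" "gord b = 3"
      using cauchy_sbg[OF sbg_Int[OF sbg_nrm M], of 3] prime_numerals by blast
    have ab: "a * b = b * a"
      by (rule norm_imp_commute[of "cyc a" 5 "cyc b" 3])
        (use a b A cyc_subset[OF sbg_nrm] in \<open>auto simp: El_def gord_def sbg_cyc self_in_cyc\<close>)
    have "a * b ^ 2 = b ^ 2 * a" using power_commuting_commutes[of b a 2] ab by simp
    moreover have "gord (b ^ 2) = 3"
    proof (rule gord_prime)
      show "b ^ 2 \<noteq> 1" using b(2) pow_eq_1_iff[of b 2] by simp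
      show "(b ^ 2) ^ 3 = 1" using b(2) pow_eq_1_iff[of b 6] by (simp add: power_mult [symmetric])
    qed simp
    moreover have "b ^ 2 \<in> M" using b(1) sbg_pow[OF M] by simp
    ultimately have "{b, b ^ 2} \<subseteq> R a" using ab b by (auto simp: R_def El_def)
    moreover have "b \<noteq> b ^ 2"
    proof
      assume "b = b ^ 2"
      then have "b * 1 = b * b" by (simp add: power2_eq_square)
      then have "b = 1" by (simp only: grp_cancel)
      then show False using b(2) gord_eq_1_iff[of b] by simp
    qed
    then have "card {b, b ^ 2} = 2" by simp
    ultimately show ?thesis using card_mono[of "R a" "{b, b ^ 2}"] by simp
  qed
  \<comment> \<open>6 is 1 modulo 5 and 0 modulo 3, and 10 is 0 modulo 5 and 1 modulo 3; so both
    factors are powers of the product.\<close>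
  have p: "(a * b) ^ 6 = a" "(a * b) ^ 10 = b" "gord (a * b) = 15" if "a \<in> El M 5" "b \<in> R a" for a b
  proof -
    have ab: "gord a = 5" "gord b = 3" "a * b = b * a" using that by (auto simp: El_def R_def)
    have pw: "(a * b) ^ n = a ^ n * b ^ n" for n
    proof (induction n)
      case (Suc n)
      have "(a * b) ^ Suc n = a * (b * a ^ n) * b ^ n" using Suc by (simp add: mult.assoc)
      also have "b * a ^ n = a ^ n * b" using power_commuting_commutes[OF ab(3), of n] by simp
      finally show ?case by (simp add: mult.assoc)
    qed simp
    have a5: "a ^ 5 = 1" and b3: "b ^ 3 = 1" using pow_gord[of a] pow_gord[of b] ab by simp_all
    show 6: "(a * b) ^ 6 = a" unfolding pw using pow_mod[OF a5, of 6] pow_mod[OF b3, of 6] by simp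
    show 10: "(a * b) ^ 10 = b" unfolding pw using pow_mod[OF a5, of 10] pow_mod[OF b3, of 10] by simp
    have "(a * b) ^ 15 = 1" unfolding pw using pow_mod[OF a5, of 15] pow_mod[OF b3, of 15] by simp
    then have "gord (a * b) dvd 15" by (simp add: pow_eq_1_iff)
    moreover have "\<not> gord (a * b) dvd 6" "\<not> gord (a * b) dvd 10"
      using 6 10 ab gord_eq_1_iff[of a] gord_eq_1_iff[of b] by (auto simp flip: pow_eq_1_iff)
    moreover have "n dvd 15 \<Longrightarrow> \<not> n dvd 6 \<longrightarrow> \<not> n dvd 10 \<longrightarrow> n = 15" for n :: nat
      by (erule dvd_list) (simp_all add: upt_simps del: One_nat_def)
    ultimately show "gord (a * b) = 15" by blast
  qed
  have "2 * card (El M 5) \<le> card (Sigma (El M 5) R)"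
    by (rule count_pairs) (use R in auto)
  also have "\<dots> = card ((\<lambda>(a, b). a * b) ` Sigma (El M 5) R)"
  proof (rule card_image [symmetric], rule inj_onI)
    fix x y assume xy: "x \<in> Sigma (El M 5) R" "y \<in> Sigma (El M 5) R" "(case x of (a, b) \<Rightarrow> a * b) = (case y of (a, b) \<Rightarrow> a * b)"
    obtain a b a' b' where ab: "x = (a, b)" "y = (a', b')" by (metis surj_pair)
    have "a * b = a' * b'" using xy ab by simp
    moreover have "a \<in> El M 5" "b \<in> R a" "a' \<in> El M 5" "b' \<in> R a'" using xy ab by auto
    ultimately have "a = a'" "b = b'" using p(1,2) by metis+
    then show "x = y" using ab by simp
  qed
  also have "\<dots> \<le> card (El M 15)"
  proof (rule card_mono)
    show "(\<lambda>(a, b). a * b) ` Sigma (El M 5) R \<subseteq> El M 15"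
    proof
      fix c assume "c \<in> (\<lambda>(a, b). a * b) ` Sigma (El M 5) R"
      then obtain a b where ab: "a \<in> El M 5" "b \<in> R a" "c = a * b" by auto
      then have "a \<in> M" "b \<in> M" by (auto simp: El_def R_def)
      then show "c \<in> El M 15" using p(3)[OF ab(1,2)] ab(3) sbgD(2)[OF M] by (simp add: El_def)
    qed
  qed simp
  finally show "8 * nS M 5 \<le> card (El M 15)" using card_El_nS[OF M prime_numerals(3)] by simp
qed

text \<open>Every 2-subgroup is conjugate to a subgroup of the elementary abelian group
  \<open>gE\<close>.\<close>

lemma El_2_square:
  assumes "(a::j1) ^ 2 ^ k = 1" shows "a * a = 1"
proof -
  obtain j where j: "card (cyc a) = 2 ^ j"
    using assms pow_eq_1_iff[of a "2 ^ k"] divides_primepow_nat[of 2 "gord a" k] by (auto simp: gord_def)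
  have "\<not> 2 dvd (21945::nat)" by simp
  then obtain g where "cyc a \<subseteq> cj g gE"
    using sylow_conj[OF sbg_UNIV sbg_gE, of 21945 2 "cyc a" j] j sbg_cyc by (auto simp: CARD_j1 card_gE)
  then have "a \<in> cj g gE" using self_in_cyc[of a] by blast
  then obtain b where b: "b \<in> gE" "a = g * b * inverse g" by (auto simp: cj_def)
  have "a * a = g * (b * b) * inverse g" using b(2) by (simp add: mult.assoc)
  then show ?thesis using gE_square[OF b(1)] by simp
qed

text \<open>b is the fourth power of its product with a commuting involution, so different b give
  different products.\<close>

lemma elements_of_order_6:
  assumes M: "sbg (M::j1 set)" and ex: "\<And>b. b \<in> El M 3 \<Longrightarrow> \<exists>t. t \<in> M \<and> gord t = 2 \<and> t * b = b * t"
  shows "2 * nS M 3 \<le> card (El M 6)"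
proof -
  from ex obtain f where f: "\<And>b. b \<in> El M 3 \<Longrightarrow> f b \<in> M \<and> gord (f b) = 2 \<and> f b * b = b * f b" by metis
  have p: "(b * f b) ^ 4 = b" "gord (b * f b) = 6" if b: "b \<in> El M 3" for b
  proof -
    let ?t = "f b"
    have ab: "gord b = 3" "gord ?t = 2" "?t * b = b * ?t" using f[OF b] b by (auto simp: El_def)
    have pw: "(b * ?t) ^ n = b ^ n * ?t ^ n" for n
    proof (induction n)
      case (Suc n)
      have "(b * ?t) ^ Suc n = b * (?t * b ^ n) * ?t ^ n" using Suc by (simp add: mult.assoc)
      also have "?t * b ^ n = b ^ n * ?t" using power_commuting_commutes[OF ab(3) [symmetric], of n] by simp
      finally show ?case by (simp add: mult.assoc)
    qed simp
    have b3: "b ^ 3 = 1" and t2: "?t ^ 2 = 1" using pow_gord[of b] pow_gord[of ?t] ab by simp_all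
    show 4: "(b * ?t) ^ 4 = b" unfolding pw using pow_mod[OF b3, of 4] pow_mod[OF t2, of 4] by simp
    have 3: "(b * ?t) ^ 3 = ?t" unfolding pw using pow_mod[OF b3, of 3] pow_mod[OF t2, of 3] by simp
    have "(b * ?t) ^ 6 = 1" unfolding pw using pow_mod[OF b3, of 6] pow_mod[OF t2, of 6] by simp
    then have "gord (b * ?t) dvd 6" by (simp add: pow_eq_1_iff)
    moreover have "\<not> gord (b * ?t) dvd 4" "\<not> gord (b * ?t) dvd 3"
      using 4 3 ab gord_eq_1_iff[of b] gord_eq_1_iff[of ?t] by (auto simp flip: pow_eq_1_iff)
    moreover have "n dvd 6 \<Longrightarrow> \<not> n dvd 4 \<longrightarrow> \<not> n dvd 3 \<longrightarrow> n = 6" for n :: nat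
      by (erule dvd_list) (simp_all add: upt_simps del: One_nat_def)
    ultimately show "gord (b * ?t) = 6" by blast
  qed
  have "card (El M 3) = card ((\<lambda>b. b * f b) ` El M 3)"
    by (rule card_image [symmetric], rule inj_onI) (metis p(1))
  also have "\<dots> \<le> card (El M 6)"
    by (rule card_mono) (use p(2) f sbgD(2)[OF M] in \<open>auto simp: El_def\<close>)
  finally show ?thesis using card_El_nS[OF M prime_numerals(2)] by simp
qed

text \<open>A subgroup T of order 4 in the normalizer moves b only among the two nontrivial elements
  of \<open>cyc b\<close>. So two members of T move b alike, and their quotient centralizes
  it.\<close>

lemma centralizing_involution:
  assumes M: "sbg (M::j1 set)" and d: "4 dvd dS M 3" "dS M 3 > 0" and b: "b \<in> El M 3"
  shows "\<exists>t. t \<in> M \<and> gord t = 2 \<and> t * b = b * t"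
proof -
  have B: "cyc b \<in> Sy M 3" by (rule cyc_in_Sy[OF M b])
  have "2 ^ 2 dvd card (nrm (cyc b) \<inter> M)" using Sy_facts(1)[OF M _ B] d by simp
  then obtain T where T: "sbg T" "T \<subseteq> nrm (cyc b) \<inter> M" "card T = 2 ^ 2"
    using sylow_exists[OF sbg_Int[OF sbg_nrm M] prime_numerals(1)] by blast
  let ?f = "\<lambda>t. t * b * inverse t"
  have "?f ` T \<subseteq> cyc b - {1}"
  proof
    fix c assume "c \<in> ?f ` T"
    then obtain t where t: "t \<in> T" "c = t * b * inverse t" by auto
    have "c \<in> cj t (cyc b)" using t self_in_cyc[of b] by (auto simp: cj_def)
    then have "c \<in> cyc b" using t T by (auto simp: nrm_def)
    moreover have "gord c = 3" using t b by (simp add: gord_conj El_def)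
    then have "c \<noteq> 1" using gord_eq_1_iff[of c] by auto
    ultimately show "c \<in> cyc b - {1}" by simp
  qed
  then have "card (?f ` T) \<le> card (cyc b - {1})" by (rule card_mono[rotated]) simp
  also have "\<dots> = 2" using B sbgD(1)[OF sbg_cyc, of b] by (simp add: Sy_iff card_Diff_singleton)
  finally have "\<not> inj_on ?f T" using T(3) card_image[of ?f T] by auto
  then obtain s t where st: "s \<in> T" "t \<in> T" "s \<noteq> t" "?f s = ?f t" by (auto simp: inj_on_def)
  define u where "u = inverse t * s"
  have "u \<in> T" using st sbgD[OF T(1)] by (simp add: u_def)
  have "inverse t * (s * b * inverse s) * s = inverse t * (t * b * inverse t) * s" using st(4) by simp
  then have "u * b = b * u" by (simp add: u_def mult.assoc)
  moreover have "u \<noteq> 1" using st(3) by (auto simp: u_def mult_eq_one_inv inv_eq_iff)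
  moreover have "u ^ 2 = 1"
    using El_2_square[of u 2] gord_dvd_card[OF T(1) \<open>u \<in> T\<close>] T(3) by (simp add: pow_eq_1_iff power2_eq_square)
  ultimately have "gord u = 2" by (intro gord_prime) auto
  then show ?thesis using \<open>u * b = b * u\<close> \<open>u \<in> T\<close> T(2) by auto
qed

text \<open>P normalizes no other Sylow subgroup, so its p elements move Q to p different ones, and
  these are all that are left.\<close>

lemma Sy_orbit:
  assumes M: "sbg (M::j1 set)" and p: "p \<in> primes5" and n: "nS M p = p + 1"
    and PQ: "P \<in> Sy M p" "Q \<in> Sy M p" "P \<noteq> Q"
  shows "\<And>y. y \<in> P \<Longrightarrow> y \<in> nrm Q \<Longrightarrow> y = 1" "Sy M p = insert P ((\<lambda>y. cj y Q) ` P)"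
proof -
  have pp: "prime p" "p > 1" using p by auto
  have P': "sbg P" "P \<subseteq> M" "card P = p" using PQ by (auto simp: Sy_iff)
  have ex: "exact_prime p (card M)"
    using lagrange_sbg[OF P'(1) M P'(2)] P'(3) exact_prime_card[OF M p] by simp
  show free: "y = 1" if y: "y \<in> P" "y \<in> nrm Q" for y
  proof (rule ccontr)
    assume "y \<noteq> 1"
    then have "cyc y = P" using cyc_prime_card(1)[OF P'(1,3) pp(1) y(1)] by simp
    then have "P \<subseteq> nrm Q" using cyc_subset[OF sbg_nrm y(2)] by simp
    then have "P = Q"
      using Sy_normal_unique[OF M exact_primeD(2)[OF ex] pp(1), of 1 P Q] exact_primeD(3)[OF ex] PQ by simp
    then show False using PQ by simp
  qed
  let ?O = "(\<lambda>y. cj y Q) ` P"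
  have "{y\<in>P. cj y Q = Q} = {1}" using free sbgD(1)[OF P'(1)] by (auto simp: nrm_def)
  then have "card ?O = p" using orbit_stab[OF P'(1) acts_cj, of Q] P'(3) by simp
  moreover have "?O \<subseteq> Sy M p - {P}"
  proof
    fix R assume "R \<in> ?O"
    then obtain y where y: "y \<in> P" "R = cj y Q" by auto
    have "R \<noteq> P"
    proof
      assume "R = P"
      then have "Q = cj (inverse y) P" using y(2) by (metis cj_inverse(1))
      moreover have "inverse y \<in> nrm P" using y(1) subset_nrm[OF P'(1)] sbgD(3)[OF P'(1)] by auto
      ultimately show False using PQ by (simp add: nrm_def)
    qed
    then show "R \<in> Sy M p - {P}" using y PQ cj_Sy[OF M _ PQ(2)] P'(2) by auto
  qed
  moreover have "card (Sy M p - {P}) = p" using n PQ by (simp add: nS_def)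
  ultimately have "?O = Sy M p - {P}" by (intro card_subset_eq) auto
  then show "Sy M p = insert P ?O" using PQ by auto
qed

text \<open>The pairs of an element s of order q and a Sylow p-subgroup normalized by s are counted
  twice. Each subgroup P has at least p (q - 1) such s, the conjugates under P of the nontrivial
  powers of one. Each s normalizes at most two of the p + 1 subgroups, since a third one would give
  a nontrivial element of P commuting with s.\<close>

lemma normalizing_elements:
  assumes M: "sbg (M::j1 set)" and p: "p \<in> primes5" and q: "prime q" and n: "nS M p = p + 1"
    and d: "q dvd dS M p" and c: "\<not> commuting p q"
  shows "(p + 1) * (p * (q - 1)) \<le> 2 * card (El M q)"
proof -
  have pp: "prime p" "p > 1" using p by auto
  obtain P0 where P0: "P0 \<in> Sy M p" using n by (auto simp: nS_def) (metis card.empty nat.distinct(1) ex_in_conv)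
  have nc: "s = 1 \<or> y = 1" if "P \<in> Sy M p" "y \<in> P" "gord s = q" "s * y = y * s" for P y s
  proof (rule disjCI)
    assume "y \<noteq> 1"
    then have "gord y = p" using that cyc_prime_card(2)[of P p y] pp by (auto simp: Sy_iff)
    then have "commuting p q" unfolding commuting_orders_def using that(3,4) by metis
    then show "s = 1" using c by simp
  qed
  define N where "N P = {s\<in>El M q. s \<in> nrm P}" for P
  have N1: "p * (q - 1) \<le> card (N P)" if P: "P \<in> Sy M p" for P
  proof -
    have P': "sbg P" "P \<subseteq> M" "card P = p" using P by (auto simp: Sy_iff)
    have "q dvd card (nrm P \<inter> M)" using Sy_facts(1)[OF M p P] d by simp
    then obtain s where s: "s \<in> nrm P" "s \<in> M" "gord s = q"
      using cauchy_sbg[OF sbg_Int[OF sbg_nrm M] q] by (metis IntE)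
    let ?f = "\<lambda>(y, t). y * t * inverse y"
    have g: "gord t = q" if "t \<in> cyc s - {1}" for t
      using that cyc_prime_card(2)[OF sbg_cyc _ q, of s t] s(3) by (auto simp: gord_def)
    \<comment> \<open>If two values agree, the quotient of t and t' lies both in P and in
      \<open>cyc s\<close>, hence is trivial; then the quotient of y and y' commutes with t and is
      trivial as well.\<close>
    have "inj_on ?f (P \<times> (cyc s - {1}))"
    proof (rule inj_onI)
      fix u v assume uv: "u \<in> P \<times> (cyc s - {1})" "v \<in> P \<times> (cyc s - {1})" "?f u = ?f v"
      obtain y t y' t' where u: "u = (y, t)" "v = (y', t')" by (metis surj_pair)
      have m: "y \<in> P" "y' \<in> P" "t \<in> cyc s" "t' \<in> cyc s" "t \<noteq> 1" "t' \<noteq> 1" using uv u by auto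
      define z where "z = inverse y' * y"
      have z: "z \<in> P" using m sbgD[OF P'(1)] by (simp add: z_def)
      have "inverse y' * (y * t * inverse y) * y = inverse y' * (y' * t' * inverse y') * y" using uv(3) u by simp
      then have zt: "z * t = t' * z" by (simp add: z_def mult.assoc)
      have "t' * z * inverse t' \<in> cj t' P" using z by (auto simp: cj_def)
      moreover have "t' \<in> nrm P" using cyc_subset[OF sbg_nrm s(1)] m by auto
      ultimately have "t' * z * inverse t' \<in> P" by (simp add: nrm_def)
      then have "inverse z * (t' * z * inverse t') \<in> P" using z sbgD[OF P'(1)] by simp
      moreover have "inverse z * (t' * z * inverse t') = t * inverse t'"
        using zt [symmetric] by (simp add: mult.assoc [symmetric]) 
      ultimately have w: "t * inverse t' \<in> P" by simp
      have ws: "t * inverse t' \<in> cyc s" by (intro sbgD(2)[OF sbg_cyc] sbgD(3)[OF sbg_cyc] m)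
      have "t * inverse t' = 1"
      proof (rule ccontr)
        assume w1: "t * inverse t' \<noteq> 1"
        then have "gord (t * inverse t') = q" using g ws by simp
        moreover have "gord (t * inverse t') = p" using cyc_prime_card(2)[OF P'(1,3) pp(1) w w1] .
        ultimately have "p = q" by simp
        then show False using c by (auto simp: commuting_orders_def) (metis cyc_in_Sy \<open>gord s = q\<close>)
      qed
      then have "t = t'" by (metis inv_cancel(5) mult_eq_one_inv inv_eq_iff)
      then have "t * z = z * t" using zt by simp
      then have "z = 1" using nc[OF P z g] m by auto
      then have "y = y'" by (auto simp: z_def mult_eq_one_inv inv_eq_iff)
      then show "u = v" using u \<open>t = t'\<close> by simp
    qed
    moreover have "card (cyc s - {1}) = q - 1"
      using s(3) sbgD(1)[OF sbg_cyc, of s] by (simp add: gord_def card_Diff_singleton)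
    ultimately have c: "card (?f ` (P \<times> (cyc s - {1}))) = p * (q - 1)"
      using P'(3) by (simp add: card_image card_cartesian_product)
    have sub: "?f ` (P \<times> (cyc s - {1})) \<subseteq> N P"
    proof
      fix r assume "r \<in> ?f ` (P \<times> (cyc s - {1}))"
      then obtain y t where r: "y \<in> P" "t \<in> cyc s - {1}" "r = y * t * inverse y" by auto
      have "y \<in> nrm P \<inter> M" using r(1) subset_nrm[OF P'(1)] P'(2) by auto
      moreover have "t \<in> nrm P \<inter> M" using r(2) cyc_subset[OF sbg_Int[OF sbg_nrm M], of s P] s by auto
      ultimately have "r \<in> nrm P \<inter> M"
        unfolding r(3) by (intro sbgD(2,3)[OF sbg_Int[OF sbg_nrm M]])
      then show "r \<in> N P" using g[OF r(2)] r(3) by (simp add: N_def El_def gord_conj)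
    qed
    show ?thesis unfolding c [symmetric] by (rule card_mono[OF finite sub])
  qed
  have N2: "card {P\<in>Sy M p. s \<in> nrm P} \<le> 2" if s: "s \<in> El M q" for s
  proof (rule ccontr)
    assume "\<not> ?thesis"
    then have "3 \<le> card {P\<in>Sy M p. s \<in> nrm P}" by simp
    then obtain S where S: "S \<subseteq> {P\<in>Sy M p. s \<in> nrm P}" "card S = 3"
      by (rule obtain_subset_with_card_n) blast
    then obtain P Q R where SPQR: "S = {P, Q, R}" and ne: "P \<noteq> Q" "P \<noteq> R" "Q \<noteq> R"
      unfolding card_3_iff by blast
    have PQR: "P \<in> Sy M p" "s \<in> nrm P" "Q \<in> Sy M p" "s \<in> nrm Q" "R \<in> Sy M p" "s \<in> nrm R"
      "P \<noteq> Q" "P \<noteq> R" "Q \<noteq> R" using S(1) ne unfolding SPQR by blast+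
    have P': "sbg P" "P \<subseteq> M" "card P = p" using PQR by (auto simp: Sy_iff)
    note orb = Sy_orbit[OF M p n PQR(1,3,7)]
    have "R \<in> (\<lambda>y. cj y Q) ` P" using orb(2) PQR(5,8) by blast
    then obtain y where y: "y \<in> P" "R = cj y Q" by auto
    \<comment> \<open>As s normalizes P, Q and R, the elements y and v of P move Q to the same
      subgroup R. The regular action of P makes them equal, so s commutes with y.\<close>
    define v where "v = s * y * inverse s"
    have "v \<in> cj s P" using y by (auto simp: v_def cj_def)
    then have v: "v \<in> P" using PQR(2) by (simp add: nrm_def)
    have "cj v Q = cj (s * y) (cj (inverse s) Q)" by (simp add: v_def cj_mult)
    also have "cj (inverse s) Q = Q" using sbgD(3)[OF sbg_nrm PQR(4)] by (simp add: nrm_def)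
    also have "cj (s * y) Q = cj s R" using y(2) by (simp add: cj_mult)
    also have "\<dots> = cj y Q" using PQR(6) y(2) by (simp add: nrm_def)
    finally have "cj (inverse y * v) Q = Q" by (simp add: cj_mult)
    then have "inverse y * v = 1" using orb(1) sbgD[OF P'(1)] v y(1) by (simp add: nrm_def)
    then have "v = y" by (simp add: mult_eq_one_inv)
    then have "s * y * inverse s * s = y * s" by (simp add: v_def)
    then have "s * y = y * s" by (simp add: mult.assoc)
    moreover have "s \<noteq> 1" using s q gord_eq_1_iff[of s] by (auto simp: El_def)
    ultimately have "y = 1" using nc[OF PQR(1) y(1)] s by (auto simp: El_def)
    then show False using y(2) PQR by simp
  qed
  have "(p * (q - 1)) * card (Sy M p) \<le> card (Sigma (Sy M p) N)"
    by (rule count_pairs) (use N1 in auto)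
  also have "\<dots> = card ((\<lambda>(a, b). (b, a)) ` Sigma (Sy M p) N)"
    by (rule card_image [symmetric]) (auto simp: inj_on_def)
  also have "\<dots> \<le> card (Sigma (El M q) (\<lambda>s. {P\<in>Sy M p. s \<in> nrm P}))"
    by (rule card_mono) (auto simp: N_def)
  also have "\<dots> = (\<Sum>s\<in>El M q. card {P\<in>Sy M p. s \<in> nrm P})" by (simp add: card_SigmaI)
  also have "\<dots> \<le> (\<Sum>s\<in>El M q. 2)" by (rule sum_mono) (rule N2)
  finally show ?thesis using n by (simp add: nS_def ac_simps)
qed

section \<open>The numerical test of subgroup orders\<close>

lemma sum_elements:
  assumes M: "sbg (M::j1 set)"
  shows "1 + 2 * nS M 3 + 4 * nS M 5 + 6 * nS M 7 + 10 * nS M 11 + 18 * nS M 19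
    + card (El M 15) + card (El M 6) + card (El M 2) \<le> card M"
proof -
  let ?K = "{1, 3, 5, 7, 11, 19, 15, 6, 2} :: nat set"
  have "(\<Sum>k\<in>?K. card (El M k)) = card (\<Union>k\<in>?K. El M k)"
    by (rule card_UN_disjoint [symmetric]) (auto simp: El_def)
  also have "\<dots> \<le> card M" by (rule card_mono) (auto simp: El_def)
  finally have "(\<Sum>k\<in>?K. card (El M k)) \<le> card M" .
  moreover have "El M 1 = {1}" using gord_eq_1_iff sbgD(1)[OF M] by (auto simp: El_def)
  ultimately show ?thesis using card_El_nS[OF M] prime_numerals by simp
qed

text \<open>The conditional summands count the forced elements of orders 15, 6 and 2. From
  \<open>normalizing_elements\<close> come 190 = 20 * 19 / 2 and 66 = 12 * 11 / 2 for involutions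
  and the condition with 380 for elements of order 3.\<close>

definition admissible :: "nat \<Rightarrow> nat \<times> nat \<Rightarrow> nat \<times> nat \<Rightarrow> nat \<times> nat \<Rightarrow> nat \<times> nat \<Rightarrow> nat \<times> nat \<Rightarrow> bool" where
  "admissible m x3 x5 x7 x11 x19 \<longleftrightarrow>
    (let c = (3 dvd snd x5 \<and> snd x5 > 0 \<or> 5 dvd snd x3 \<and> snd x3 > 0) in
      (c \<longrightarrow> fst x3 = fst x5) \<and>
      (fst x19 = 20 \<longrightarrow> 3 dvd snd x19 \<longrightarrow> 380 \<le> 2 * fst x3) \<and>
      1 + 2 * fst x3 + 4 * fst x5 + 6 * fst x7 + 10 * fst x11 + 18 * fst x19
        + (if c then 8 * fst x5 else 0) + (if 4 dvd snd x3 \<and> snd x3 > 0 then 2 * fst x3 else 0)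
        + (if fst x19 = 20 \<and> 2 dvd snd x19 then 190 else if fst x11 = 12 \<and> 2 dvd snd x11 then 66 else 0) \<le> m)"

lemma admissible_subgroup:
  assumes M: "sbg (M::j1 set)"
  shows "admissible (card M) (nS M 3, dS M 3) (nS M 5, dS M 5) (nS M 7, dS M 7) (nS M 11, dS M 11) (nS M 19, dS M 19)"
proof -
  let ?c = "3 dvd dS M 5 \<and> dS M 5 > 0 \<or> 5 dvd dS M 3 \<and> dS M 3 > 0"
  have 15: "?c \<longrightarrow> nS M 3 = nS M 5 \<and> 8 * nS M 5 \<le> card (El M 15)" using elements_of_order_15[OF M] by blast
  have 6: "4 dvd dS M 3 \<and> dS M 3 > 0 \<longrightarrow> 2 * nS M 3 \<le> card (El M 6)" using elements_of_order_6[OF M centralizing_involution[OF M]] by blast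
  have a: "nS M 19 = 20 \<longrightarrow> 2 dvd dS M 19 \<longrightarrow> 190 \<le> card (El M 2)"
    using normalizing_elements[OF M _ prime_numerals(1), of 19] not_commuting_19 by simp
  have b: "nS M 19 = 20 \<longrightarrow> 3 dvd dS M 19 \<longrightarrow> 380 \<le> 2 * nS M 3"
    using normalizing_elements[OF M _ prime_numerals(2), of 19] not_commuting_19 card_El_nS[OF M prime_numerals(2)] by simp
  have c: "nS M 11 = 12 \<longrightarrow> 2 dvd dS M 11 \<longrightarrow> 66 \<le> card (El M 2)"
    using normalizing_elements[OF M _ prime_numerals(1), of 11] not_commuting_11_2 by simp
  have e: "(if ?c then 8 * nS M 5 else 0) \<le> card (El M 15)"
    "(if 4 dvd dS M 3 \<and> dS M 3 > 0 then 2 * nS M 3 else 0) \<le> card (El M 6)"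
    "(if nS M 19 = 20 \<and> 2 dvd dS M 19 then 190 else if nS M 11 = 12 \<and> 2 dvd dS M 11 then 66 else 0) \<le> card (El M 2)"
    by (use 15 in auto, use 6 in auto, use a c in auto)
  show ?thesis
    unfolding admissible_def Let_def fst_conv snd_conv
  proof (intro conjI)
    show "?c \<longrightarrow> nS M 3 = nS M 5" using 15 by blast
    show "nS M 19 = 20 \<longrightarrow> 3 dvd dS M 19 \<longrightarrow> 380 \<le> 2 * nS M 3" by (rule b)
    show "1 + 2 * nS M 3 + 4 * nS M 5 + 6 * nS M 7 + 10 * nS M 11 + 18 * nS M 19
        + (if ?c then 8 * nS M 5 else 0) + (if 4 dvd dS M 3 \<and> dS M 3 > 0 then 2 * nS M 3 else 0)
        + (if nS M 19 = 20 \<and> 2 dvd dS M 19 then 190 else if nS M 11 = 12 \<and> 2 dvd dS M 11 then 66 else 0) \<le> card M"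
      by (rule order_trans[OF _ sum_elements[OF M]]) (intro add_mono order_refl e)
  qed
qed

text \<open>What the lower bound needs to know of a proper subgroup: the subgroups useful for orders
  19, 15, 11 and 7 are kept apart, those for 19 and 15 have only one Sylow 19- or 5-subgroup, and
  for 7 and 11 few enough cases remain to be embedded by hand.\<close>

definition feasible :: "nat \<Rightarrow> nat \<times> nat \<Rightarrow> nat \<times> nat \<Rightarrow> nat \<times> nat \<Rightarrow> nat \<times> nat \<Rightarrow> nat \<times> nat \<Rightarrow> bool" where
  "feasible m x3 x5 x7 x11 x19 \<longleftrightarrow>
    (19 dvd m \<longrightarrow> fst x19 = 1 \<and> \<not> 7 dvd m \<and> \<not> 11 dvd m \<and> \<not> 15 dvd m) \<and>
    (3 dvd snd x5 \<and> snd x5 > 0 \<or> 5 dvd snd x3 \<and> snd x3 > 0 \<longrightarrow> fst x5 = 1 \<and> \<not> 7 dvd m \<and> \<not> 11 dvd m) \<and>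
    (7 dvd m \<longrightarrow> \<not> 11 dvd m \<and> (fst x7 = 1 \<or> fst x7 = 8 \<and> (m = 56 \<or> m = 168 \<and> fst x3 = 28))) \<and>
    (11 dvd m \<longrightarrow> fst x11 = 1 \<or> fst x11 = 12 \<and> 5 dvd snd x11)"

text \<open>The orders 175560 and 87780 are exempt: they belong to the whole group and to index 2,
  which are handled by group theory.\<close>

definition all_feasible :: "nat \<Rightarrow> bool" where
  "all_feasible m \<longleftrightarrow> m = 175560 \<or> m = 87780 \<or> list_all (\<lambda>x3. list_all (\<lambda>x5. list_all (\<lambda>x7.
    list_all (\<lambda>x11. list_all (\<lambda>x19. admissible m x3 x5 x7 x11 x19 \<longrightarrow> feasible m x3 x5 x7 x11 x19)
    (opt m 19)) (opt m 11)) (opt m 7)) (opt m 5)) (opt m 3)"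

definition extend_divisors :: "nat \<Rightarrow> nat list \<Rightarrow> nat list" where
  "extend_divisors p ds = ds @ map ((*) p) ds"

lemma extend_divisors:
  assumes "m dvd p * a" "prime p" "\<And>k. k dvd a \<Longrightarrow> k \<in> set ds"
  shows "m \<in> set (extend_divisors p ds)"
proof (cases "p dvd m")
  case True
  then obtain k where k: "m = p * k" by (auto simp: dvd_def)
  then have "k dvd a" using assms(1,2) by (auto simp: prime_gt_0_nat)
  then show ?thesis using assms(3) k by (auto simp: extend_divisors_def)
next
  case False
  then show ?thesis using dvd_split[OF assms(1,2)] assms(3) by (auto simp: extend_divisors_def)
qed

definition divisors_175560 :: "nat list" where
  "divisors_175560 = extend_divisors 19 (extend_divisors 11 (extend_divisors 7 (extend_divisors 5 (extend_divisors 3 [1, 2, 4, 8]))))"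

lemma dvd_175560:
  assumes "m dvd 175560"
  shows "m \<in> set divisors_175560"
proof -
  have 8: "m dvd 8 \<Longrightarrow> m \<in> set [1, 2, 4, 8]" for m :: nat
    by (erule dvd_list) (simp_all add: upt_simps del: One_nat_def)
  have 3: "m dvd 24 \<Longrightarrow> m \<in> set (extend_divisors 3 [1, 2, 4, 8])" for m
    using extend_divisors[of m 3 8, OF _ prime_numerals(2) 8] by simp
  have 5: "m dvd 120 \<Longrightarrow> m \<in> set (extend_divisors 5 (extend_divisors 3 [1, 2, 4, 8]))" for m
    using extend_divisors[of m 5 24, OF _ prime_numerals(3) 3] by simp
  have 7: "m dvd 840 \<Longrightarrow> m \<in> set (extend_divisors 7 (extend_divisors 5 (extend_divisors 3 [1, 2, 4, 8])))" for m
    using extend_divisors[of m 7 120, OF _ prime_numerals(4) 5] by simp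
  have 11: "m dvd 9240 \<Longrightarrow> m \<in> set (extend_divisors 11 (extend_divisors 7 (extend_divisors 5 (extend_divisors 3 [1, 2, 4, 8]))))" for m
    using extend_divisors[of m 11 840, OF _ prime_numerals(5) 7] by simp
  show ?thesis
    unfolding divisors_175560_def using extend_divisors[of m 19 9240, OF _ prime_numerals(6) 11] assms by simp
qed

lemma opt_eval:
  "opt m 3 = (if 3 dvd m then filter (\<lambda>x. fst x mod 3 = 1) (map (\<lambda>d. (m div (3 * d), d)) (filter (\<lambda>d. 3 * d dvd m) [1, 2, 4, 5, 10, 20])) else [(0, 0)])"
  "opt m 5 = (if 5 dvd m then filter (\<lambda>x. fst x mod 5 = 1) (map (\<lambda>d. (m div (5 * d), d)) (filter (\<lambda>d. 5 * d dvd m) [1, 2, 3, 4, 6, 12])) else [(0, 0)])"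
  "opt m 7 = (if 7 dvd m then filter (\<lambda>x. fst x mod 7 = 1) (map (\<lambda>d. (m div (7 * d), d)) (filter (\<lambda>d. 7 * d dvd m) [1, 2, 3, 6])) else [(0, 0)])"
  "opt m 11 = (if 11 dvd m then filter (\<lambda>x. fst x mod 11 = 1) (map (\<lambda>d. (m div (11 * d), d)) (filter (\<lambda>d. 11 * d dvd m) [1, 2, 5, 10])) else [(0, 0)])"
  "opt m 19 = (if 19 dvd m then filter (\<lambda>x. fst x mod 19 = 1) (map (\<lambda>d. (m div (19 * d), d)) (filter (\<lambda>d. 19 * d dvd m) [1, 2, 3, 6])) else [(0, 0)])"
  by (simp_all add: opt_def dl_def)

text \<open>The test runs over all 128 divisors, with the five option lists expanded for
  each.\<close>

lemma all_feasible_divisors: "list_all all_feasible divisors_175560"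
  unfolding divisors_175560_def extend_divisors_def
  apply (simp del: One_nat_def)
  apply (intro conjI)
  apply (simp add: all_feasible_def opt_eval admissible_def feasible_def del: One_nat_def; fail)+
  done

text \<open>The complement of N0 in N has the size of N0 and is therefore the single coset of
  a.\<close>

lemma index_two:
  fixes N N0 :: "'a::{grp,finite} set"
  assumes N: "sbg N" "sbg N0" "N0 \<subseteq> N" "card N = 2 * card N0" and a: "a \<in> N" "a \<notin> N0" and b: "b \<in> N" "b \<notin> N0"
  shows "inverse a * b \<in> N0"
proof -
  have "card ((*) a ` N0) = card N0" by (rule card_image) (simp add: inj_on_def)
  moreover have "card (N - N0) = card N0" using N(3,4) by (simp add: card_Diff_subset)
  moreover have "(*) a ` N0 \<subseteq> N - N0"
    using sbg_mult_iff(2)[OF N(2)] sbgD(2)[OF N(1) a(1)] N(3) a(2) by auto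
  ultimately have "(*) a ` N0 = N - N0" by (intro card_subset_eq) auto
  then have "b \<in> (*) a ` N0" using b by blast
  then show ?thesis by auto
qed

lemma proper_feasible:
  assumes M: "sbg (M::j1 set)" "M \<noteq> UNIV"
  shows "feasible (card M) (nS M 3, dS M 3) (nS M 5, dS M 5) (nS M 7, dS M 7) (nS M 11, dS M 11) (nS M 19, dS M 19)"
proof -
  have 1: "card M \<noteq> 175560"
  proof
    assume "card M = 175560"
    then have "M = UNIV" by (intro card_subset_eq) (simp_all add: CARD_j1)
    then show False using M(2) by simp
  qed
  have 2: "card M \<noteq> 87780"
  proof
    assume c: "card M = 87780"
    \<comment> \<open>A subgroup of index 2 contains all squares, and the generators
      \<open>gY\<close> and \<open>gZ\<close> are squares because their orders are odd.\<close>
    have sq: "g * g \<in> M" for g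
    proof (cases "g \<in> M")
      case False
      then have "inverse (inverse g) * g \<in> M"
        by (intro index_two[OF sbg_UNIV M(1)]) (simp_all add: CARD_j1 c sbg_inverse_iff[OF M(1)])
      then show ?thesis by simp
    qed (rule sbgD(2)[OF M(1)])
    have "gY ^ 8 \<in> M" "gZ ^ 6 \<in> M" using sq[of "gY ^ 4"] sq[of "gZ ^ 3"] by (simp_all add: power_add [symmetric])
    moreover have "gY ^ 8 = gY" "gZ ^ 6 = gZ" using pow_mod[OF gY7, of 8] pow_mod[OF gZ5, of 6] by simp_all
    ultimately have "gY \<in> M" "gZ \<in> M" by simp_all
    then have "M = UNIV" using generated_j1[of M] sbgD[OF M(1)] by auto
    then show False using M(2) by simp
  qed
  have "all_feasible (card M)"
    using all_feasible_divisors dvd_175560[OF CARD_dvd[OF M(1)]] by (simp add: list_all_iff)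
  then have "admissible (card M) x3 x5 x7 x11 x19 \<longrightarrow> feasible (card M) x3 x5 x7 x11 x19"
    if "x3 \<in> set (opt (card M) 3)" "x5 \<in> set (opt (card M) 5)" "x7 \<in> set (opt (card M) 7)"
      "x11 \<in> set (opt (card M) 11)" "x19 \<in> set (opt (card M) 19)" for x3 x5 x7 x11 x19
    using 1 2 that unfolding all_feasible_def list_all_iff by blast
  from this[OF opt_complete[OF M(1)] opt_complete[OF M(1)] opt_complete[OF M(1)] opt_complete[OF M(1)] opt_complete[OF M(1)]]
  show ?thesis using admissible_subgroup[OF M(1)] by simp
qed

subsection \<open>The two large conjugacy classes of subgroups\<close>

definition gK :: "j1 set" where
  "gK = nrm gE"

lemma sbg_gK: "sbg gK"
  unfolding gK_def by (rule sbg_nrm)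

lemma gK_elements: "gY \<in> gK" "gp \<in> gK" "ge \<in> gK"
  using gY_nrm_gE gp_nrm_gE subset_nrm[OF sbg_gE] by (auto simp: gK_def gE_def)

text \<open>The elements of \<open>gE\<close> fixed by an element of order q form a subgroup whose
  order is 1, 2, 4 or 8 and congruent to 8 modulo q, hence is 8. Then \<open>gE\<close> normalizes a
  group of order q, but 8 divides none of 60, 110 and 114.\<close>

lemma gK_not_dvd:
  assumes q: "prime q" "q \<in> {5, 11, 19}"
  shows "\<not> q dvd card gK"
proof
  assume "q dvd card gK"
  then obtain g where g: "g \<in> gK" "gord g = q" using cauchy_sbg[OF sbg_gK q(1)] by metis
  have Q: "cyc g \<in> Sy UNIV q" using g(2) by (intro cyc_in_Sy sbg_UNIV) (simp add: El_def)
  let ?f = "\<lambda>a b. a * b * inverse a"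
  have act: "acts (cyc g) ?f" by (simp add: acts_def mult.assoc)
  have cn: "?f a b \<in> gE" if "a \<in> cyc g" "b \<in> gE" for a b
  proof -
    have "a \<in> nrm gE" using that(1) cyc_subset[OF sbg_gK g(1)] by (auto simp: gK_def)
    then show ?thesis using that(2) by (auto simp: nrm_def cj_def)
  qed
  let ?F = "{b\<in>gE. \<forall>a\<in>cyc g. ?f a b = b}"
  have "[card gE = card ?F] (mod q)"
    by (rule fixed_points_mod[OF sbg_cyc, of g q 1]) (use g q act cn in \<open>simp_all add: gord_def\<close>)
  moreover have "sbg ?F"
  proof (rule sbgI)
    fix b c assume bc: "b \<in> ?F" "c \<in> ?F"
    have "?f a (b * c) = ?f a b * ?f a c" for a by (simp add: mult.assoc)
    then show "b * c \<in> ?F" using bc sbgD(2)[OF sbg_gE] by simp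
  next
    fix b assume b: "b \<in> ?F"
    have "?f a (inverse b) = inverse b" if a: "a \<in> cyc g" for a
    proof -
      have "?f a (inverse b) = inverse (?f a b)" by (simp add: mult.assoc)
      also have "?f a b = b" using a b by blast
      finally show ?thesis .
    qed
    then show "inverse b \<in> ?F" using b sbgD(3)[OF sbg_gE] by blast
  qed (simp add: sbgD(1)[OF sbg_gE])
  then have "card ?F dvd 8" using lagrange_sbg[of ?F gE] sbg_gE card_gE by auto
  then have F: "card ?F \<in> {1, 2, 4, 8}"
    by (rule dvd_list) (simp_all add: upt_simps del: One_nat_def)
  ultimately have "card ?F = card gE" using q(2) card_gE by (auto simp: cong_def)
  then have "?F = gE" by (intro card_subset_eq) auto
  then have "b \<in> nrm (cyc g)" if "b \<in> gE" for b
  proof -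
    have "?f g b = b" using that \<open>?F = gE\<close> self_in_cyc[of g] by blast
    then have "g * b * inverse g * g = b * g" by simp
    then have "b * g = g ^ 1 * b" by (simp add: mult.assoc)
    then show ?thesis by (rule cyc_nrmI)
  qed
  then have "card gE dvd card (nrm (cyc g))" by (intro lagrange_sbg sbg_gE sbg_nrm) auto
  then have "8 dvd NN q" using NN_eq[OF Q] q(2) card_gE by auto
  then show False using q(2) by (auto simp: NN_5 NN_11 NN_19)
qed

lemma card_gK: "card gK = 168"
proof -
  have "card gE dvd card gK" by (intro lagrange_sbg sbg_gE sbg_gK) (use subset_nrm[OF sbg_gE] gK_def in simp)
  then have "8 * 3 * 7 dvd card gK"
    using card_gE gord_dvd_card[OF sbg_gK gK_elements(1)] gord_dvd_card[OF sbg_gK gK_elements(2)]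
    by (intro divides_mult) (simp_all add: coprime_iff_gcd_eq_1 gcd_non_0_nat gords gord_gp)
  then have "168 dvd card gK" by simp
  then obtain k where k: "card gK = 168 * k" by (auto simp: dvd_def)
  have "168 * k dvd 168 * 1045" using CARD_dvd[OF sbg_gK] k by simp
  then have "k dvd 1045" by (simp only: dvd_mult_cancel1 zero_less_numeral nat_mult_dvd_cancel1)
  moreover have "\<not> q dvd k" if "prime q" "q \<in> {5, 11, 19}" for q
    using gK_not_dvd[OF that] k by auto
  ultimately have "k dvd 1"
    using dvd_split[of k 11 95] dvd_split[of k 5 19] dvd_split[of k 19 1] by simp
  then show ?thesis using k by simp
qed

lemma card_2_group:
  assumes "sbg (T::j1 set)" "card T = 8"
  obtains g where "T = cj g gE"
proof -
  have "\<not> 2 dvd (21945::nat)" by simp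
  then obtain g where "T \<subseteq> cj g gE"
    using sylow_conj[OF sbg_UNIV sbg_gE, of 21945 2 T 3] assms by (auto simp: CARD_j1 card_gE)
  then have "T = cj g gE" using assms(2) card_gE by (intro card_subset_eq) simp_all
  then show thesis by (rule that)
qed

text \<open>A Sylow 2-subgroup of M already accounts for eight elements of order dividing 8. If
  there are no more, it is unique, hence normal in M.\<close>

lemma two_part:
  assumes M: "sbg (M::j1 set)" "8 dvd card M" and T: "{a\<in>M. gord a dvd 8} \<subseteq> S" "card S \<le> 8"
  obtains g where "M \<subseteq> cj g gK"
proof -
  obtain T where T': "sbg T" "T \<subseteq> M" "card T = 2 ^ 3"
    using sylow_exists[OF M(1) prime_numerals(1), of 3] M(2) by auto
  have uniq: "T' = S" if "sbg T'" "T' \<subseteq> M" "card T' = 8" for T'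
  proof -
    have "T' \<subseteq> S" using gord_dvd_card[OF that(1)] that T(1) by auto
    then show ?thesis using T(2) that(3) card_mono[of S T'] by (intro card_subset_eq) auto
  qed
  obtain g where g: "T = cj g gE" using card_2_group[OF T'(1)] T'(3) by auto
  have "M \<subseteq> nrm T"
  proof
    fix m assume m: "m \<in> M"
    have "cj m T = S" using uniq[of "cj m T"] sbg_cj[OF T'(1)] cj_subset_self[OF M(1) T'(2) m] T'(3) by simp
    moreover have "T = S" using uniq T' by simp
    ultimately show "m \<in> nrm T" by (simp add: nrm_def)
  qed
  then show thesis using that[of g] g by (simp add: nrm_cj gK_def)
qed

text \<open>For order 56, only eight elements are left besides the 48 of order 7. For order 168, an
  involution commuting with an element of order 3 yields 56 elements of order 6, and again at most
  eight are left. Without such an involution a count forces nine Sylow 2-subgroups, but 9 does not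
  divide 168.\<close>

lemma proper_7:
  assumes M: "sbg (M::j1 set)" "nS M 7 = 8" "card M = 56 \<or> card M = 168 \<and> nS M 3 = 28"
  obtains g where "M \<subseteq> cj g gK"
  using M(3)
proof
  assume c: "card M = 56"
  let ?S = "M - El M 7"
  have "card ?S = 8"
    using c card_El_nS[OF M(1) prime_numerals(4)] M(2) by (simp add: card_Diff_subset El_def)
  moreover have "{a\<in>M. gord a dvd 8} \<subseteq> ?S" by (auto simp: El_def)
  ultimately show thesis using two_part[OF M(1), of ?S] c that by auto
next
  assume c: "card M = 168 \<and> nS M 3 = 28"
  have n3: "card (El M 3) = 56" "card (El M 7) = 48"
    using card_El_nS[OF M(1) prime_numerals(2)] card_El_nS[OF M(1) prime_numerals(4)] M(2) c by simp_all
  show thesis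
  proof (cases "\<exists>b t. b \<in> El M 3 \<and> t \<in> M \<and> gord t = 2 \<and> t * b = b * t")
    case True
    then obtain b t where bt: "b \<in> El M 3" "t \<in> M" "gord t = 2" "t * b = b * t" by blast
    have "\<exists>t. t \<in> M \<and> gord t = 2 \<and> t * a = a * t" if a: "a \<in> El M 3" for a
    proof -
      have "cyc b \<in> Sy M 3" "cyc a \<in> Sy M 3" using cyc_in_Sy[OF M(1)] a bt(1) by auto
      then obtain g where g: "g \<in> M" "cyc a = cj g (cyc b)" using Sy_facts(7)[OF M(1), of 3 "cyc b"] by auto
      have "a \<in> cj g (cyc b)" using g self_in_cyc[of a] by simp
      then obtain r where r: "r \<in> cyc b" "a = g * r * inverse g" by (auto simp: cj_def)
      have "t * r = r * t" using commute_cyc[OF bt(4) self_in_cyc r(1)] .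
      then have "g * (t * r) * inverse g = g * (r * t) * inverse g" by simp
      then have "(g * t * inverse g) * a = a * (g * t * inverse g)" by (simp add: r(2) mult.assoc)
      moreover have "g * t * inverse g \<in> M" by (intro sbgD(2,3)[OF M(1)] g bt)
      ultimately show ?thesis using bt(3) gord_conj[of g t] by metis
    qed
    then have 6: "56 \<le> card (El M 6)" using elements_of_order_6[OF M(1)] c by simp
    let ?S = "M - (El M 7 \<union> El M 3 \<union> El M 6)"
    have "card (El M 7 \<union> El M 3 \<union> El M 6) = card (El M 7) + card (El M 3) + card (El M 6)"
      by (subst card_Un_disjoint; (subst card_Un_disjoint)?) (auto simp: El_def)
    moreover have "El M 7 \<union> El M 3 \<union> El M 6 \<subseteq> M" by (auto simp: El_def)
    ultimately have "card ?S \<le> 8" using c n3 6 by (simp add: card_Diff_subset)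
    moreover have "{a\<in>M. gord a dvd 8} \<subseteq> ?S" by (auto simp: El_def)
    ultimately show thesis using two_part[OF M(1), of ?S] c that by auto
  next
    case False
    have no: "\<not> (t * b = b * t)" if "t \<in> M" "gord t = 2" "b \<in> M" "gord b = 3" for t b
      using False that by (auto simp: El_def)
    have "2 ^ 3 dvd card M" using c by simp
    then obtain T0 where "sbg T0" "T0 \<subseteq> M" "card T0 = 2 ^ 3"
      by (rule sylow_exists[OF M(1) prime_numerals(1)])
    then have "T0 \<in> Sy M 8" by (simp add: Sy_iff)
    then have S8: "Sy M 8 \<noteq> {}" by blast
    have T: "El T 2 = T - {1}" "card (T - {1}) = 7" "\<And>a b. a \<in> T \<Longrightarrow> b \<in> T \<Longrightarrow> a * b = b * a" if "T \<in> Sy M 8" for T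
    proof -
      have T: "sbg T" "card T = 8" using that by (auto simp: Sy_iff)
      have sq: "a * a = 1" if "a \<in> T" for a
        using El_2_square[of a 3] gord_dvd_card[OF T(1) that] T(2) by (simp add: pow_eq_1_iff)
      have "gord a = 2" if "a \<in> T" "a \<noteq> 1" for a
        using gord_prime[of a 2] sq[OF that(1)] that by (simp add: power2_eq_square)
      moreover have "gord (1::j1) \<noteq> 2" using gord_eq_1_iff[of "1::j1"] by simp
      ultimately show "El T 2 = T - {1}" by (auto simp: El_def)
      show "card (T - {1}) = 7" using T sbgD(1)[OF T(1)] by (simp add: card_Diff_singleton)
      fix a b assume ab: "a \<in> T" "b \<in> T"
      have "a * (a * b * (a * b)) * b = a * 1 * b" using sq[OF sbgD(2)[OF T(1) ab]] by simp
      moreover have "a * (a * b * (a * b)) * b = (a * a) * (b * a) * (b * b)" by (simp add: mult.assoc)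
      ultimately show "a * b = b * a" using sq ab by simp
    qed
    \<comment> \<open>Neither 3 nor 7 divides the order of the centralizer of an involution here, so
      it is a 2-group. Consequently different Sylow 2-subgroups meet trivially.\<close>
    have cent: "T = {m\<in>M. m * t = t * m}" if T8: "T \<in> Sy M 8" and t: "t \<in> T" "t \<noteq> 1" for T t
    proof (rule card_subset_eq)
      let ?C = "{m\<in>M. m * t = t * m}"
      have TM: "sbg T" "T \<subseteq> M" "card T = 8" using T8 by (auto simp: Sy_iff)
      have t2: "gord t = 2" using T(1)[OF T8] t by (auto simp: El_def)
      show sub: "T \<subseteq> ?C" using TM T(3)[OF T8] t by auto
      have C: "sbg ?C"
      proof (rule sbgI)
        fix a b assume "a \<in> ?C" "b \<in> ?C"
        then have ab: "a \<in> M" "b \<in> M" "a * t = t * a" "b * t = t * b" by auto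
        have "a * b * t = a * (b * t)" by (simp add: mult.assoc)
        also have "\<dots> = (a * t) * b" by (simp only: ab(4) mult.assoc)
        also have "\<dots> = t * (a * b)" by (simp only: ab(3) mult.assoc)
        finally show "a * b \<in> ?C" using ab sbgD(2)[OF M(1)] by simp
      next
        fix a assume "a \<in> ?C"
        then have a: "a \<in> M" "a * t = t * a" by auto
        have "inverse a * (a * t) * inverse a = inverse a * (t * a) * inverse a" using a by simp
        then have "t * inverse a = inverse a * t" by (simp add: mult.assoc)
        then show "inverse a \<in> ?C" using a(1) sbgD(3)[OF M(1)] by simp
      qed (simp add: sbgD(1)[OF M(1)])
      have "\<not> 3 dvd card ?C"
      proof
        assume "3 dvd card ?C"
        then obtain b where "b \<in> ?C" "gord b = 3" using cauchy_sbg[OF C prime_numerals(2)] by metis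
        then show False using no[of t b] t(1) TM(2) t2 by auto
      qed
      moreover have "\<not> 7 dvd card ?C"
      proof
        assume "7 dvd card ?C"
        then obtain b where "b \<in> ?C" "gord b = 7" using cauchy_sbg[OF C prime_numerals(4)] by metis
        then have "commuting 7 2" using t2 by (auto simp: commuting_orders_def)
        then show False using not_commuting_7 by simp
      qed
      moreover have "card ?C dvd 168" using lagrange_sbg[OF C M(1)] c by auto
      ultimately have "card ?C dvd 8"
        using dvd_split[of "card ?C" 7 24] dvd_split[of "card ?C" 3 8] by simp
      then have "card ?C \<le> 8" by (intro dvd_imp_le) auto
      then show "card T = card ?C" using card_mono[OF _ sub] TM(3) by simp
    qed simp
    have inv: "El M 2 = (\<Union>T\<in>Sy M 8. T - {1})"
    proof
      show "El M 2 \<subseteq> (\<Union>T\<in>Sy M 8. T - {1})"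
      proof
        fix t assume t: "t \<in> El M 2"
        obtain T where TM: "T \<in> Sy M 8" using S8 by auto
        then have TM': "sbg T" "T \<subseteq> M" "card T = 8" by (auto simp: Sy_iff)
        have "cyc t \<in> Sy M 2" by (rule cyc_in_Sy[OF M(1) t])
        moreover have "\<not> 2 dvd (21::nat)" by simp
        ultimately obtain g where g: "g \<in> M" "cyc t \<subseteq> cj g T"
          using sylow_conj[OF M(1) TM'(1,2), of 21 2 "cyc t" 1] TM' c by (auto simp: Sy_iff)
        have "t \<noteq> 1" using t gord_eq_1_iff[of t] by (auto simp: El_def)
        then show "t \<in> (\<Union>T\<in>Sy M 8. T - {1})"
          using g self_in_cyc[of t] cj_Sy[OF M(1) g(1) TM] by auto
      qed
      show "(\<Union>T\<in>Sy M 8. T - {1}) \<subseteq> El M 2"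
      proof
        fix t assume "t \<in> (\<Union>T\<in>Sy M 8. T - {1})"
        then obtain U where U: "U \<in> Sy M 8" "t \<in> U - {1}" by auto
        then have "t \<in> El U 2" using T(1) by simp
        then show "t \<in> El M 2" using U(1) by (auto simp: El_def Sy_iff)
      qed
    qed
    have "card (El M 2) = (\<Sum>T\<in>Sy M 8. card (T - {1}))"
      unfolding inv
    proof (rule card_UN_disjoint)
      show "\<forall>T\<in>Sy M 8. \<forall>U\<in>Sy M 8. T \<noteq> U \<longrightarrow> (T - {1}) \<inter> (U - {1}) = {}"
      proof (intro ballI impI)
        fix T U assume TU: "T \<in> Sy M 8" "U \<in> Sy M 8" "T \<noteq> U"
        show "(T - {1}) \<inter> (U - {1}) = {}"
        proof (rule ccontr)
          assume "(T - {1}) \<inter> (U - {1}) \<noteq> {}"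
          then obtain t where t: "t \<in> T" "t \<in> U" "t \<noteq> 1" by blast
          show False using cent[OF TU(1) t(1,3)] cent[OF TU(2) t(2,3)] TU(3) by simp
        qed
      qed
    qed simp_all
    then have E2: "card (El M 2) = 7 * card (Sy M 8)" using T(2) by simp
    \<comment> \<open>No two different primes divide the order of one element, and 2-elements are
      involutions. With n Sylow 2-subgroups this gives 1 + 7 n + 56 + 48 = 168, that is n =
      9.\<close>
    have "M = El M 1 \<union> El M 2 \<union> El M 3 \<union> El M 7"
    proof
      show "M \<subseteq> El M 1 \<union> El M 2 \<union> El M 3 \<union> El M 7"
      proof
        fix a assume a: "a \<in> M"
        have pw: "gord (a ^ (gord a div q)) = q" "a ^ (gord a div q) \<in> M" if "prime q" "q dvd gord a" for q
          using gord_pow_prime[OF that] sbg_pow[OF M(1) a] by auto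
        have pc: "a ^ i * a ^ j = a ^ j * a ^ i" for i j by (simp add: power_add [symmetric] add.commute)
        have "\<not> (2 dvd gord a \<and> 3 dvd gord a)"
          using no[of "a ^ (gord a div 2)" "a ^ (gord a div 3)"] pw[OF prime_numerals(1)] pw[OF prime_numerals(2)] pc by blast
        moreover have "\<not> (7 dvd gord a \<and> 3 dvd gord a)"
          using not_commuting_7(1) pw(1)[OF prime_numerals(4)] pw(1)[OF prime_numerals(2)] pc by (auto simp: commuting_orders_def)
        moreover have "\<not> (7 dvd gord a \<and> 2 dvd gord a)"
          using not_commuting_7(2) pw(1)[OF prime_numerals(4)] pw(1)[OF prime_numerals(1)] pc by (auto simp: commuting_orders_def)
        moreover have "gord a dvd 8 \<longrightarrow> gord a dvd 2"
          using El_2_square[of a 3] by (simp add: pow_eq_1_iff [symmetric] power2_eq_square)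
        moreover have "gord a dvd 168" using gord_dvd_card[OF M(1) a] c by simp
        moreover have "n dvd 168 \<Longrightarrow> \<not> (2 dvd n \<and> 3 dvd n) \<longrightarrow> \<not> (7 dvd n \<and> 3 dvd n) \<longrightarrow> \<not> (7 dvd n \<and> 2 dvd n) \<longrightarrow>
            (n dvd 8 \<longrightarrow> n dvd 2) \<longrightarrow> n = 1 \<or> n = 2 \<or> n = 3 \<or> n = 7" for n :: nat
          by (erule dvd_list) (simp_all add: upt_simps del: One_nat_def)
        ultimately have "gord a = 1 \<or> gord a = 2 \<or> gord a = 3 \<or> gord a = 7" by blast
        then show "a \<in> El M 1 \<union> El M 2 \<union> El M 3 \<union> El M 7" using a by (auto simp: El_def)
      qed
    qed (auto simp: El_def)
    then have "168 = card (El M 1 \<union> El M 2 \<union> El M 3 \<union> El M 7)" using c by simp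
    also have "\<dots> = card (El M 1) + card (El M 2) + card (El M 3) + card (El M 7)"
    proof -
      have "(El M 1 \<union> El M 2 \<union> El M 3) \<inter> El M 7 = {}" "(El M 1 \<union> El M 2) \<inter> El M 3 = {}" "El M 1 \<inter> El M 2 = {}"
        by (auto simp: El_def)
      then show ?thesis by (simp add: card_Un_disjoint)
    qed
    also have "El M 1 = {1}" using gord_eq_1_iff sbgD(1)[OF M(1)] by (auto simp: El_def)
    finally have 9: "card (Sy M 8) = 9" using E2 n3 by simp
    obtain T where TM: "T \<in> Sy M 8" using S8 by auto
    have "card M = 8 * 21" "(8::nat) = 2 ^ 3" "\<not> 2 dvd (21::nat)" using c by simp_all
    from card_Sy[OF M(1) this(1) prime_numerals(1) this(2,3) TM]
    have "9 * card (nrm T \<inter> M) = 168" using 9 c by (simp only:)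
    then show thesis by presburger
  qed
qed

lemma Sy_cj_subset: "M \<subseteq> cj g H \<Longrightarrow> Sy M p \<subseteq> Sy (cj g H) p"
  unfolding Sy_def by blast

lemma Sylow_7_in_gK:
  assumes M: "sbg (M::j1 set)" "M \<noteq> UNIV" "7 dvd card M"
  obtains g where "Sy M 7 \<subseteq> Sy (cj g gK) 7"
proof -
  consider "nS M 7 = 1" | "nS M 7 = 8" "card M = 56 \<or> card M = 168 \<and> nS M 3 = 28"
    using proper_feasible[OF M(1,2)] M(3) by (auto simp: feasible_def)
  then show thesis
  proof cases
    case 1
    then obtain P where P: "Sy M 7 = {P}" by (auto simp: nS_def card_1_singleton_iff)
    then have PU: "P \<in> Sy UNIV 7" using Sy_UNIV_I[of P M 7] by simp
    then obtain g where g: "P = cj g (sy 7)" using Sy_UNIV_conj[OF exact_primes(3) sy_in_Sy[of 7]] by auto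
    have "sy 7 \<subseteq> gK" unfolding sy_simps by (rule cyc_subset[OF sbg_gK gK_elements(1)])
    then have "P \<subseteq> cj g gK" using g by (simp add: cj_mono_iff)
    then have "Sy M 7 \<subseteq> Sy (cj g gK) 7" using P PU by (simp add: Sy_iff)
    then show thesis by (rule that)
  next
    case 2
    then show thesis using proper_7[OF M(1)] Sy_cj_subset that by metis
  qed
qed

lemma Sy_cj: "Sy (cj k M) p = cj k ` Sy M p"
proof -
  have sub: "cj k ` Sy M p \<subseteq> Sy (cj k M) p" for k and M :: "'a set"
    by (auto simp: Sy_iff sbg_cj cj_mono_iff)
  have "R \<in> cj k ` Sy M p" if "R \<in> Sy (cj k M) p" for R
  proof -
    have "cj (inverse k) R \<in> Sy M p" using sub[of "inverse k" "cj k M"] that by auto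
    then have "cj k (cj (inverse k) R) \<in> cj k ` Sy M p" by blast
    then show ?thesis by simp
  qed
  then show ?thesis using sub[of k M] by blast
qed

lemma nS_cj: "nS (cj k M) p = nS M p"
  unfolding nS_def Sy_cj by (rule card_image) (simp add: inj_on_def cj_inj)

section \<open>Sylow 11-subgroups of proper subgroups\<close>

lemma five_conj:
  assumes "s \<in> nrm (cyc gx)" "gord s = 5"
  obtains n where "n \<in> nrm (cyc gx)" "cyc gZ = cj n (cyc s)"
proof -
  let ?N = "nrm (cyc gx)"
  have "cyc s \<in> Sy ?N 5" "cyc gZ \<in> Sy ?N 5"
    using assms nrm_cyc_elements by (auto intro!: cyc_in_Sy sbg_nrm simp: El_def gords)
  moreover have "card ?N = 5 * 22" using NN_11 by (simp add: NN_def sy_simps)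
  moreover have "\<not> 5 dvd (22::nat)" by simp
  ultimately have "cyc gZ \<in> (\<lambda>g. cj g (cyc s)) ` ?N"
    using Sy_eq_conj[OF sbg_nrm, of "cyc gx" 5 22 5 1 "cyc s"] by simp
  then show thesis using that by blast
qed

text \<open>\<open>gZ\<close> and \<open>gt\<close> make the stabilizer of \<open>cyc gx\<close> in
  this group of order 60 have order at least 10, so the orbit has at most six members; the powers of
  \<open>gw * gt\<close> provide six different ones.\<close>

lemma orbit_gx:
  assumes v: "v \<in> nrm (cyc gZ)"
  obtains i where "i < 6" "cj v (cyc gx) = cj ((gw * gt) ^ i) (cyc gx)"
proof -
  let ?N = "nrm (cyc gZ)" and ?P = "cyc gx" and ?a = "gw * gt"
  let ?O = "(\<lambda>g. cj g ?P) ` ?N" and ?S = "{g\<in>?N. cj g ?P = ?P}"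
  have S: "?S = ?N \<inter> nrm ?P" by (auto simp: nrm_def)
  have sS: "sbg ?S" unfolding S by (intro sbg_Int sbg_nrm)
  have gZ: "gZ \<in> ?N" using subset_nrm[OF sbg_cyc] self_in_cyc by blast
  have "gZ \<in> ?S" "gt \<in> ?S" unfolding S using gZ nrm_cyc_elements by auto
  then have "2 * 5 dvd card ?S"
    using gord_dvd_card[OF sS, of gZ] gord_dvd_card[OF sS, of gt]
    by (intro divides_mult) (simp_all add: gords coprime_iff_gcd_eq_1 gcd_non_0_nat)
  then have "10 \<le> card ?S" using card_sbg_pos[OF sS] by (intro dvd_imp_le) auto
  moreover have "card ?O * card ?S = 60"
    using orbit_stab[OF sbg_nrm[of "cyc gZ"] acts_cj, of ?P] NN_5 by (simp add: NN_def sy_simps)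
  ultimately have O: "card ?O \<le> 6"
    using mult_le_mono2[of 10 "card ?S" "card ?O"] by linarith
  have N60: "60 dvd card H" if "sbg H" "gw \<in> H" "gt \<in> H" "gZ \<in> H" for H using sixty_dvd that .
  have a: "?a \<in> ?N" by (rule sbgD(2)[OF sbg_nrm nrm_cyc_elements(6,7)])
  have card110: "card (nrm ?P) = 110" using NN_11 by (simp add: NN_def sy_simps)
  \<comment> \<open>A nontrivial power of \<open>gw * gt\<close> in the normalizer of order 110
    would produce there an element of order 3 or, for the third power together with
    \<open>gt\<close>, a four-group.\<close>
  have notin: "?a ^ k \<notin> nrm ?P" if k: "0 < k" "k < 6" for k
  proof
    assume ak: "?a ^ k \<in> nrm ?P"
    have m: "?a ^ ((k * j) mod 6) \<in> nrm ?P" for j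
      using sbg_pow[OF sbg_nrm ak, of j] pow_mod[of ?a 6 "k * j"] pow_gord[of ?a] by (simp add: power_mult gwgt_order)
    have k3: "k = 3"
    proof (rule ccontr)
      assume "k \<noteq> 3"
      then have "k = 1 \<or> k = 2 \<or> k = 4 \<or> k = 5" using k by linarith
      then have "?a ^ 2 \<in> nrm ?P" using m[of 1] m[of 2] m[of 4] by auto
      then have "3 dvd card (nrm ?P)" using gord_dvd_card[OF sbg_nrm, of "?a ^ 2"] sy3_facts(1) by simp
      then show False using card110 by simp
    qed
    have "4 dvd card (nrm ?P)" using four_dvd[OF sbg_nrm] nrm_cyc_elements ak k3 by simp
    moreover have "\<not> 4 dvd (110::nat)" by simp
    ultimately show False using card110 by simp
  qed
  have inj: "inj_on (\<lambda>i. cj (?a ^ i) ?P) {..<6}"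
  proof (rule linorder_inj_onI)
    fix i j :: nat assume ij: "i < j" "i \<in> {..<6}" "j \<in> {..<6}"
    show "cj (?a ^ i) ?P \<noteq> cj (?a ^ j) ?P"
    proof
      assume "cj (?a ^ i) ?P = cj (?a ^ j) ?P"
      moreover have "?a ^ j = ?a ^ i * ?a ^ (j - i)" using ij by (simp add: power_add [symmetric])
      ultimately have "cj (?a ^ i) ?P = cj (?a ^ i) (cj (?a ^ (j - i)) ?P)" by (simp add: cj_mult)
      then have "?a ^ (j - i) \<in> nrm ?P" by (simp add: cj_inj nrm_def)
      then show False using notin[of "j - i"] ij by (simp add: less_imp_diff_less)
    qed
  qed auto
  have "(\<lambda>i. cj (?a ^ i) ?P) ` {..<6} = ?O"
    by (rule card_seteq) (use O card_image[OF inj] sbg_pow[OF sbg_nrm a] in auto)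
  then have "cj v ?P \<in> (\<lambda>i. cj (?a ^ i) ?P) ` {..<6}" using v by blast
  then show thesis using that by blast
qed

lemma Sy_subset_orbit:
  assumes M: "sbg (M::j1 set)" and p: "p \<in> primes5" and n: "nS M p = p + 1"
    and PQ: "P \<in> Sy M p" "Q \<in> Sy M p" "P \<noteq> Q" and H: "sbg H" "P \<subseteq> H" "Q \<subseteq> H"
  shows "Sy M p \<subseteq> Sy H p"
proof
  fix R assume R: "R \<in> Sy M p"
  then have "R = P \<or> R \<in> (\<lambda>y. cj y Q) ` P" using Sy_orbit(2)[OF M p n PQ] by blast
  then have "R \<subseteq> H" using H cj_subset_self[OF H(1,3)] by blast
  then show "R \<in> Sy H p" using R by (simp add: Sy_iff)
qed

lemma cyc_gx_in_gL: "cyc gx \<subseteq> gL"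
  by (rule cyc_subset[OF sbg_gL gen_in_gL(1)])

lemma conj_in_cj: "x \<in> H \<Longrightarrow> g * x * inverse g \<in> cj g H"
  by (auto simp: cj_def)

text \<open>Of the 12 Sylow 11-subgroups, the number fixed by \<open>gZ\<close> is 2 modulo 5, so a
  second one Q is fixed besides \<open>cyc gx\<close>. By \<open>orbit_gx\<close> there are five
  candidates for Q. Three of them yield elements of order 7 in M, whose order is not divisible by 7;
  each of the other two lies together with \<open>cyc gx\<close> in \<open>gL\<close> or in its
  conjugate by \<open>gt\<close>.\<close>

lemma Sylow_11_normalized:
  assumes M: "sbg (M::j1 set)" "M \<noteq> UNIV" "11 dvd card M" and n: "nS M 11 = 12" and g: "gx \<in> M" "gZ \<in> M"
  obtains g where "Sy M 11 \<subseteq> Sy (cj g gL) 11"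
proof -
  let ?P = "cyc gx" and ?a = "gw * gt"
  have P: "?P \<in> Sy M 11" by (rule cyc_in_Sy[OF M(1)]) (simp add: El_def gords g)
  have gZP: "gZ \<in> nrm ?P" using nrm_cyc_elements by simp
  have cZ: "cyc gZ \<subseteq> M" "cyc gZ \<subseteq> nrm ?P" using cyc_subset[OF M(1) g(2)] cyc_subset[OF sbg_nrm gZP] by auto
  let ?F = "{Q\<in>Sy M 11. \<forall>g\<in>cyc gZ. cj g Q = Q}"
  have "[card (Sy M 11) = card ?F] (mod 5)"
    by (rule fixed_points_mod[OF sbg_cyc, of gZ 5 1])
      (use gords(2) acts_cj cj_Sy[OF M(1)] cZ in \<open>auto simp: gord_def\<close>)
  then have c2: "card ?F mod 5 = 2" using n by (simp add: cong_def nS_def)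
  have "?F \<noteq> {?P}"
  proof
    assume "?F = {?P}"
    then have "card ?F = 1" by simp
    then show False using c2 by simp
  qed
  moreover have "?P \<in> ?F" using P cZ by (auto simp: nrm_def)
  ultimately obtain Q where Q: "Q \<in> Sy M 11" "Q \<noteq> ?P" "\<forall>g\<in>cyc gZ. cj g Q = Q" by blast
  have "gZ \<in> nrm Q" using Q(3) self_in_cyc[of gZ] by (simp add: nrm_def)
  obtain k where k: "Q = cj k ?P"
    using Sy_UNIV_conj[OF exact_primes(4) Sy_UNIV_I[OF P] Sy_UNIV_I[OF Q(1)]] by auto
  \<comment> \<open>The conjugating element k need not normalize \<open>cyc gZ\<close>. Correcting
    it by an element of the normalizer of \<open>cyc gx\<close> achieves this and still yields
    Q.\<close>
  let ?z = "inverse k * gZ * k"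
  have z: "?z \<in> nrm ?P" using \<open>gZ \<in> nrm Q\<close> unfolding k nrm_cj by (simp add: cj_iff)
  have "gord ?z = 5" using gord_conj[of "inverse k" gZ] by (simp add: gords)
  then obtain n where n': "n \<in> nrm ?P" "cyc gZ = cj n (cyc ?z)" using five_conj[OF z] by blast
  have "cyc gZ = cj k (cyc ?z)" using cyc_conj[of k ?z] by (simp add: mult.assoc)
  moreover have "cyc ?z = cj (inverse n) (cyc gZ)" using n'(2) by simp
  ultimately have v: "k * inverse n \<in> nrm (cyc gZ)" by (simp add: nrm_def cj_mult)
  have "inverse n \<in> nrm ?P" using n'(1) sbgD(3)[OF sbg_nrm] by blast
  then have "cj (k * inverse n) ?P = Q" using k by (simp add: cj_mult nrm_def)
  then obtain i where i: "i < 6" "Q = cj (?a ^ i) ?P" using orbit_gx[OF v] by metis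
  have i0: "i \<noteq> 0" using i(2) Q(2) by auto
  have no7: "\<not> 7 dvd card M" using proper_feasible[OF M(1,2)] M(3) by (auto simp: feasible_def)
  have no_order_7: False if q: "q * q * q * (q * q * q) * q = 1" "q \<noteq> 1" "q = gx ^ r * (?a ^ i * gx ^ s * inverse (?a ^ i))" for q r s
  proof -
    have "q ^ 7 = 1" using q(1) by (simp add: numeral_eq_Suc mult.assoc)
    then have "gord q = 7" using q(2) by (intro gord_prime) simp_all
    have c: "?a ^ i * gx ^ s * inverse (?a ^ i) \<in> M"
      using conj_in_cj[OF sbg_pow[OF sbg_cyc self_in_cyc], of "?a ^ i" gx s] i(2) Q(1) by (auto simp: Sy_iff)
    have "q \<in> M" using sbgD(2)[OF M(1) sbg_pow[OF M(1) g(1)] c, of r] by (simp only: q(3))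
    then show False using gord_dvd_card[OF M(1), of q] \<open>gord q = 7\<close> no7 by simp
  qed
  have inv: "inverse (?a ^ i) = (gt * gw) ^ i" by (rule gwgt_inverse)
  have "i \<noteq> 2"
  proof
    assume "i = 2"
    then show False
      using no_order_7[OF rel_gq2, of 1 5] inv by (simp add: gq2_def power2_eq_square mult.assoc)
  qed
  moreover have "i \<noteq> 3"
  proof
    assume "i = 3"
    then show False
      using no_order_7[OF rel_gq3, of 2 4] inv by (simp add: gq3_def power3_eq_cube mult.assoc)
  qed
  moreover have "i \<noteq> 4"
  proof
    assume "i = 4"
    moreover have "x ^ 4 = x * x * x * x" for x :: j1 by (simp add: numeral_eq_Suc mult.assoc)
    ultimately show False
      using no_order_7[OF rel_gq4, of 1 5] inv by (simp add: gq4_def mult.assoc)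
  qed
  ultimately have "i = 1 \<or> i = 5" using i(1) i0 by linarith
  have Pt: "cj gt ?P = ?P" using nrm_cyc_elements(2) by (simp add: nrm_def)
  have wPL: "cj gw ?P \<subseteq> gL" by (rule cj_subset_self[OF sbg_gL cyc_gx_in_gL gen_in_gL(3)])
  note sub = Sy_subset_orbit[OF M(1) _ _ P Q(1) Q(2)[symmetric]]
  from \<open>i = 1 \<or> i = 5\<close> show thesis
  proof
    assume "i = 1"
    then have "Q = cj gw ?P" using i(2) Pt by (simp add: cj_mult)
    then have "Sy M 11 \<subseteq> Sy (cj 1 gL) 11" using sub[of gL] n sbg_gL cyc_gx_in_gL wPL by simp
    then show thesis by (rule that)
  next
    assume "i = 5"
    have "?a ^ 5 * ?a = 1" using pow_gord[of ?a] by (simp add: gwgt_order power_add [symmetric] flip: power_Suc2)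
    then have "inverse (?a ^ 5) = ?a" by (simp add: mult_eq_one_inv)
    then have "?a ^ 5 = inverse ?a" by (metis inv_cancel(5))
    then have "Q = cj gt (cj gw ?P)" using i(2) \<open>i = 5\<close> by (simp add: cj_mult [symmetric] gw_gt_inv)
    then have "Q \<subseteq> cj gt gL" using wPL by (simp add: cj_mono_iff)
    moreover have "?P \<subseteq> cj gt gL" using cyc_gx_in_gL cj_mono_iff[of gt ?P gL] Pt by simp
    ultimately have "Sy M 11 \<subseteq> Sy (cj gt gL) 11" using sub[of "cj gt gL"] n sbg_cj[OF sbg_gL] by simp
    then show thesis by (rule that)
  qed
qed

text \<open>In the case of 12 Sylow subgroups, one of them is normalized by an element of M of order
  5, and a conjugation moves this pair to \<open>cyc gx\<close> and \<open>cyc gZ\<close>.\<close>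

lemma Sylow_11_in_gL:
  assumes M: "sbg (M::j1 set)" "M \<noteq> UNIV" "11 dvd card M"
  obtains g where "Sy M 11 \<subseteq> Sy (cj g gL) 11"
proof -
  consider "nS M 11 = 1" | "nS M 11 = 12" "5 dvd dS M 11"
    using proper_feasible[OF M(1,2)] M(3) by (auto simp: feasible_def)
  then show thesis
  proof cases
    case 1
    then obtain P where P: "Sy M 11 = {P}" by (auto simp: nS_def card_1_singleton_iff)
    then have PU: "P \<in> Sy UNIV 11" using Sy_UNIV_I[of P M 11] by simp
    then obtain g where g: "P = cj g (sy 11)" using Sy_UNIV_conj[OF exact_primes(4) sy_in_Sy[of 11]] by auto
    then have "P \<subseteq> cj g gL" using cyc_gx_in_gL by (simp add: cj_mono_iff sy_simps)
    then have "Sy M 11 \<subseteq> Sy (cj g gL) 11" using P PU by (simp add: Sy_iff)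
    then show thesis by (rule that)
  next
    case 2
    obtain P where P: "P \<in> Sy M 11" using Sy_exists[OF M(1) _ M(3)] by auto
    have "5 dvd card (nrm P \<inter> M)" using Sy_facts(1)[OF M(1) _ P] 2(2) by simp
    then obtain s where s: "s \<in> nrm P" "s \<in> M" "gord s = 5"
      using cauchy_sbg[OF sbg_Int[OF sbg_nrm M(1)] prime_numerals(3)] by (metis IntE)
    obtain h where h: "cyc gx = cj h P"
      using Sy_UNIV_conj[OF exact_primes(4) Sy_UNIV_I[OF P] sy_in_Sy[of 11]] by (auto simp: sy_simps)
    let ?s = "h * s * inverse h"
    have "?s \<in> nrm (cyc gx)" unfolding h nrm_cj using s(1) by (rule conj_in_cj)
    moreover have "gord ?s = 5" using s(3) by (simp add: gord_conj)
    ultimately obtain n where n: "n \<in> nrm (cyc gx)" "cyc gZ = cj n (cyc ?s)" by (rule five_conj)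
    define k where "k = n * h"
    have kP: "cyc gx = cj k P" using n(1) h by (simp add: k_def cj_mult nrm_def)
    have kZ: "cyc gZ = cj k (cyc s)" using n(2) cyc_conj[of h s] by (simp add: k_def cj_mult)
    have "cyc s \<subseteq> M" "P \<subseteq> M" using cyc_subset[OF M(1) s(2)] P by (auto simp: Sy_iff)
    then have "gx \<in> cj k M" "gZ \<in> cj k M"
      using kP kZ self_in_cyc[of gx] self_in_cyc[of gZ] cj_mono_iff[of k] by blast+
    moreover have "cj k M \<noteq> UNIV"
    proof
      assume "cj k M = UNIV"
      then have "card M = CARD(j1)" using card_cj[of k M] by simp
      then have "M = UNIV" by (intro card_subset_eq) simp_all
      then show False using M(2) by simp
    qed
    ultimately obtain g where g: "Sy (cj k M) 11 \<subseteq> Sy (cj g gL) 11"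
      using Sylow_11_normalized[of "cj k M"] sbg_cj[OF M(1)] M(3) nS_cj[of k M 11] 2(1) by auto
    have "Sy M 11 \<subseteq> Sy (cj (inverse k * g) gL) 11"
    proof
      fix R assume R: "R \<in> Sy M 11"
      then have "cj k R \<in> Sy (cj g gL) 11" using g Sy_cj[of k M 11] by blast
      then have "cj k R \<subseteq> cj g gL" by (simp add: Sy_iff)
      then have "cj (inverse k) (cj k R) \<subseteq> cj (inverse k) (cj g gL)" by (simp only: cj_mono_iff)
      then show "R \<in> Sy (cj (inverse k * g) gL) 11" using R by (simp add: Sy_iff cj_mult)
    qed
    then show thesis by (rule that)
  qed
qed

subsection \<open>Counting members of a cover\<close>

text \<open>The Sylow p-subgroups of H are conjugate in H, so each coset of an admissible g contains
  an element of the normalizer N of \<open>sy p\<close>. If N meets H in index at most 2, these are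
  the coset of z and H itself.\<close>

lemma two_cosets:
  assumes p: "p \<in> primes5" and H: "sbg (H::j1 set)" "sy p \<subseteq> H"
    and N: "NN p \<le> 2 * card (nrm (sy p) \<inter> H)"
    and z: "sy p \<subseteq> cj z H" "z \<notin> H" and g: "sy p \<subseteq> cj g H" "g \<notin> H"
  shows "inverse z * g \<in> H"
proof -
  let ?N = "nrm (sy p)"
  have S: "sbg (sy p)" "card (sy p) = p" using sy_in_Sy[OF p] by (auto simp: Sy_iff)
  have syH: "sy p \<in> Sy H p" using S H(2) by (simp add: Sy_iff)
  have ex: "\<exists>n\<in>?N. inverse n * g \<in> H" if g: "sy p \<subseteq> cj g H" for g
  proof -
    have "cj (inverse g) (sy p) \<subseteq> cj (inverse g) (cj g H)" using g by (simp only: cj_mono_iff)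
    then have "cj (inverse g) (sy p) \<in> Sy H p" using S by (simp add: Sy_iff sbg_cj)
    then obtain h where h: "h \<in> H" "cj (inverse g) (sy p) = cj h (sy p)"
      using Sy_facts(7)[OF H(1) p syH] by auto
    have "cj g (cj (inverse g) (sy p)) = cj g (cj h (sy p))" using h(2) by simp
    then have "g * h \<in> ?N" by (simp add: nrm_def cj_mult)
    moreover have "inverse (g * h) * g \<in> H" using h(1) sbgD(3)[OF H(1)] by (simp add: mult.assoc)
    ultimately show ?thesis by blast
  qed
  obtain n where n: "n \<in> ?N" "inverse n * z \<in> H" using ex[OF z(1)] by blast
  obtain m where m: "m \<in> ?N" "inverse m * g \<in> H" using ex[OF g(1)] by blast
  have nH: "n \<notin> H" using n(2) z(2) sbg_mult_iff(1)[OF H(1), of "inverse n" z] sbg_inverse_iff[OF H(1), of n] by blast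
  have mH: "m \<notin> H" using m(2) g(2) sbg_mult_iff(1)[OF H(1), of "inverse m" g] sbg_inverse_iff[OF H(1), of m] by blast
  define N0 where "N0 = ?N \<inter> H"
  have N0: "sbg N0" "N0 \<subseteq> ?N" unfolding N0_def by (intro sbg_Int sbg_nrm H) blast
  have nN: "n \<notin> N0" "m \<notin> N0" using nH mH by (simp_all add: N0_def)
  obtain k where k: "card ?N = card N0 * k" using lagrange_sbg[OF N0(1) sbg_nrm N0(2)] by (auto simp: dvd_def)
  have "card N0 \<noteq> card ?N"
  proof
    assume "card N0 = card ?N"
    then have "N0 = ?N" by (intro card_subset_eq N0(2)) simp_all
    then show False using n(1) nN by blast
  qed
  then have "k \<noteq> 1" using k by auto
  moreover have "card N0 * k \<le> card N0 * 2" using k N unfolding NN_def N0_def [symmetric] by linarith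
  then have "k \<le> 2" using card_sbg_pos[OF N0(1)] by simp
  moreover have "k \<noteq> 0" using k card_sbg_pos[OF sbg_nrm, of "sy p"] by (metis mult_0_right less_irrefl)
  ultimately have "k = 2" by linarith
  then have "card ?N = 2 * card N0" using k by simp
  \<comment> \<open>Both elements lie in the only nontrivial coset of N0 in the normalizer.\<close>
  then have "inverse n * m \<in> N0"
    by (rule index_two[OF sbg_nrm N0 _ n(1) nN(1) m(1) nN(2)])
  then have 1: "inverse n * m \<in> H" by (simp add: N0_def)
  have 2: "inverse z * n \<in> H" using sbgD(3)[OF H(1) n(2)] by simp
  have "(inverse z * n) * (inverse n * m) * (inverse m * g) \<in> H"
    by (intro sbgD(2)[OF H(1)] 1 2 m(2))
  then show ?thesis by (simp add: mult.assoc)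
qed

lemma generator_sy: "p \<in> primes5 \<Longrightarrow> \<exists>y. sy p = cyc y"
  by (auto simp: sy_def)

text \<open>Each member of the cover whose order is divisible by p is charged to one coset of H
  whose conjugate contains all its Sylow p-subgroups. The conjugate of \<open>sy p\<close> by g lies
  only in the conjugates of H by g and by \<open>g * z\<close>, so one of these two cosets is
  charged: A is a vertex cover of the graph joining them.\<close>

lemma assigned_cosets:
  fixes C :: "j1 set set"
  assumes C: "\<And>M. M \<in> C \<Longrightarrow> sbg M \<and> M \<noteq> UNIV" "\<Union>C = UNIV"
    and p: "p \<in> primes5" and H: "sbg H"
    and types: "\<And>M. sbg M \<Longrightarrow> M \<noteq> UNIV \<Longrightarrow> p dvd card M \<Longrightarrow> \<exists>g. Sy M p \<subseteq> Sy (cj g H) p"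
    and two: "\<And>g. sy p \<subseteq> cj g H \<Longrightarrow> g \<in> H \<or> inverse z * g \<in> H"
  obtains A where "card A \<le> card {M\<in>C. p dvd card M} * card H"
    "\<And>g h. g \<in> A \<Longrightarrow> h \<in> H \<Longrightarrow> g * h \<in> A" "\<And>g. g \<in> A \<or> g * z \<in> A"
proof -
  let ?C = "{M\<in>C. p dvd card M}"
  have "\<forall>M\<in>?C. \<exists>g. Sy M p \<subseteq> Sy (cj g H) p" using C types by blast
  then obtain f where f: "\<And>M. M \<in> ?C \<Longrightarrow> Sy M p \<subseteq> Sy (cj (f M) H) p" by metis
  obtain y where y: "sy p = cyc y" using generator_sy[OF p] by blast
  have S: "sbg (sy p)" "card (sy p) = p" using sy_in_Sy[OF p] by (auto simp: Sy_iff)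
  define A where "A = (\<Union>M\<in>?C. (*) (f M) ` H)"
  have "card A \<le> (\<Sum>M\<in>?C. card ((*) (f M) ` H))" unfolding A_def by (rule card_UN_le) simp
  also have "\<dots> \<le> (\<Sum>M\<in>?C. card H)" by (rule sum_mono) (rule card_image_le, simp)
  finally have 1: "card A \<le> card ?C * card H" by simp
  have 2: "g * h \<in> A" if gh: "g \<in> A" "h \<in> H" for g h
  proof -
    obtain M h' where h': "M \<in> ?C" "h' \<in> H" "g = f M * h'" using gh(1) unfolding A_def by blast
    have "g * h = f M * (h' * h)" using h'(3) by (simp add: mult.assoc)
    then show ?thesis using h'(1) sbgD(2)[OF H h'(2) gh(2)] unfolding A_def by blast
  qed
  have 3: "g \<in> A \<or> g * z \<in> A" for g
  proof -
    let ?x = "g * y * inverse g"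
    have "?x \<in> \<Union>C" using C(2) by simp
    then obtain M where M: "M \<in> C" "?x \<in> M" by (rule UnionE)
    have sM: "sbg M" using C(1)[OF M(1)] by simp
    have "cj g (sy p) \<subseteq> M" using cyc_subset[OF sM M(2)] by (simp add: cyc_conj y)
    then have P: "cj g (sy p) \<in> Sy M p" using S by (simp add: Sy_iff sbg_cj)
    then have "p dvd card M" using lagrange_sbg[OF sbg_cj[OF S(1)] sM, of g] S(2) by (simp add: Sy_iff)
    then have MC: "M \<in> ?C" using M by simp
    then have "cj g (sy p) \<in> Sy (cj (f M) H) p" using f[OF MC] P by blast
    then have "cj g (sy p) \<subseteq> cj (f M) H" by (simp only: Sy_iff)
    then have "cj (inverse g) (cj g (sy p)) \<subseteq> cj (inverse g) (cj (f M) H)" by (simp only: cj_mono_iff)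
    then have "sy p \<subseteq> cj (inverse g * f M) H" by (simp add: cj_mult)
    then have "inverse g * f M \<in> H \<or> inverse z * (inverse g * f M) \<in> H" by (rule two)
    then have "inverse (inverse g * f M) \<in> H \<or> inverse (inverse z * (inverse g * f M)) \<in> H"
      using sbgD(3)[OF H] by blast
    then have "f M * inverse (inverse g * f M) \<in> A \<or> f M * inverse (inverse z * (inverse g * f M)) \<in> A"
      using MC unfolding A_def by blast
    then show ?thesis by (simp add: mult.assoc)
  qed
  show thesis by (rule that[OF 1 2 3])
qed

subsection \<open>The action on the cosets of the subgroup of order 660\<close>

definition gL_inv :: "(j1 \<Rightarrow> real) \<Rightarrow> bool" where
  "gL_inv u \<longleftrightarrow> (\<forall>g. \<forall>l\<in>gL. u (g * l) = u g)"

text \<open>Summing over group elements avoids a choice of coset representatives. Each coset at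
  relation k is counted 660 / \<open>subdeg k\<close> times, which is 55 for k = 1.\<close>

definition hecke :: "nat \<Rightarrow> (j1 \<Rightarrow> real) \<Rightarrow> j1 \<Rightarrow> real" where
  "hecke k u g = (\<Sum>l\<in>gL. u (g * l * dcr k))"

text \<open>
  On functions that are constant on the left cosets of \<open>gL\<close>, this is the adjacency operator of the
  graph of degree 12 in which the cosets of \<open>g\<close> and \<open>g * gt\<close> are adjacent.
\<close>

definition adj :: "(j1 \<Rightarrow> real) \<Rightarrow> j1 \<Rightarrow> real" where
  "adj u g = hecke 1 u g / 55"

lemma gL_inv_hecke: "gL_inv (hecke k u)"
  unfolding gL_inv_def
proof (intro allI ballI)
  fix g l assume l: "l \<in> gL"
  show "hecke k u (g * l) = hecke k u g"
    unfolding hecke_def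
    by (rule sum.reindex_bij_witness[of _ "\<lambda>m. inverse l * m" "\<lambda>m. l * m"])
      (use l sbgD(2,3)[OF sbg_gL] in \<open>simp_all add: mult.assoc\<close>)
qed

lemma gL_inv_adj: "gL_inv (adj u)"
  using gL_inv_hecke[of 1 u] by (simp add: gL_inv_def adj_def)

lemma hecke_dcos:
  assumes u: "gL_inv u" and x: "x \<in> dcos k"
  shows "(\<Sum>l\<in>gL. u (g * l * x)) = hecke k u g"
proof -
  obtain a b where ab: "a \<in> gL" "b \<in> gL" "x = a * dcr k * b" using x by (auto simp: dcos_def)
  have "u (g * l * x) = u (g * (l * a) * dcr k)" for l
  proof -
    have "u (g * l * x) = u ((g * (l * a) * dcr k) * b)" by (simp add: ab(3) mult.assoc)
    then show ?thesis using u ab(2) by (simp add: gL_inv_def)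
  qed
  then have "(\<Sum>l\<in>gL. u (g * l * x)) = (\<Sum>l\<in>gL. u (g * (l * a) * dcr k))" by simp
  also have "\<dots> = hecke k u g"
    unfolding hecke_def
    by (rule sum.reindex_bij_witness[of _ "\<lambda>m. m * inverse a" "\<lambda>m. m * a"])
      (use ab(1) sbgD(2,3)[OF sbg_gL] in \<open>simp_all add: mult.assoc\<close>)
  finally show ?thesis .
qed

lemma sum_gL:
  fixes f :: "j1 \<Rightarrow> real"
  assumes "\<And>i b. i < 12 \<Longrightarrow> b \<in> gB \<Longrightarrow> f (nbr i * b) = f (nbr i)"
  shows "(\<Sum>l\<in>gL. f l) = 55 * (\<Sum>i<12. f (nbr i))"
proof -
  let ?h = "\<lambda>(i, b). nbr i * b" and ?D = "{..<12} \<times> gB"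
  have im: "?h ` ?D = gL"
  proof
    show "gL \<subseteq> ?h ` ?D"
    proof
      fix l assume "l \<in> gL"
      then obtain i b where "i < 12" "b \<in> gB" "l = nbr i * b" by (rule nbr_decomp)
      then show "l \<in> ?h ` ?D" by (intro image_eqI[of _ _ "(i, b)"]) auto
    qed
    show "?h ` ?D \<subseteq> gL" using nbr_in_gL gB_gL gL_mult by auto
  qed
  have "inj_on ?h ?D" by (rule eq_card_imp_inj_on) (simp_all add: im card_gL card_gB card_cartesian_product)
  then have "(\<Sum>l\<in>gL. f l) = (\<Sum>x\<in>?D. f (?h x))" using sum.reindex[of ?h ?D f] im by (simp add: o_def)
  also have "\<dots> = (\<Sum>i<12. \<Sum>b\<in>gB. f (nbr i * b))" by (simp add: sum.cartesian_product case_prod_beta)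
  also have "\<dots> = (\<Sum>i<12. 55 * f (nbr i))" by (rule sum.cong) (simp_all add: assms card_gB)
  finally show ?thesis by (simp add: sum_distrib_left)
qed

lemma hecke_adj:
  assumes k: "k < 5" and u: "gL_inv u"
  shows "hecke k (adj u) g = (\<Sum>i<12. hecke (nbr_type ! k ! i) u g)"
proof -
  have d1: "dcr (Suc 0) = gt" by (simp add: dcr_def)
  have "adj u x = (\<Sum>i<12. u (x * nbr i * gt))" for x
  proof -
    have "(\<Sum>l\<in>gL. u (x * l * gt)) = 55 * (\<Sum>i<12. u (x * nbr i * gt))"
    proof (rule sum_gL)
      fix i b assume "i < (12::nat)" and b: "b \<in> gB"
      obtain b' where b': "b' \<in> gB" "b * gt = gt * b'" by (rule gB_gt'[OF b])
      have "x * (nbr i * b) * gt = x * nbr i * (b * gt)" by (simp add: mult.assoc)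
      also have "\<dots> = x * nbr i * gt * b'" by (simp add: b'(2) mult.assoc)
      finally show "u (x * (nbr i * b) * gt) = u (x * nbr i * gt)"
        using u b'(1) gB_gL by (auto simp: gL_inv_def)
    qed
    then show ?thesis by (simp add: adj_def hecke_def d1)
  qed
  then have "hecke k (adj u) g = (\<Sum>l\<in>gL. \<Sum>i<12. u (g * l * (dcr k * nbr i * gt)))"
    by (simp add: hecke_def mult.assoc)
  also have "\<dots> = (\<Sum>i<12. \<Sum>l\<in>gL. u (g * l * (dcr k * nbr i * gt)))" by (rule sum.swap)
  also have "\<dots> = (\<Sum>i<12. hecke (nbr_type ! k ! i) u g)"
    by (rule sum.cong) (use hecke_dcos[OF u nbr_types[OF k]] in simp_all)
  finally show ?thesis .
qed

lemma sum_12: "(\<Sum>i<12. f i) = f 0 + f 1 + f 2 + f 3 + f 4 + f 5 + f 6 + f 7 + f 8 + f 9 + f 10 + f (11::nat)"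
  for f :: "nat \<Rightarrow> real"
  by (simp add: numeral_eq_Suc)

text \<open>The coefficients are the multiplicities in the rows of \<open>nbr_type\<close>, the
  intersection numbers of the graph.\<close>

lemma hecke_adj_values:
  assumes "gL_inv u"
  shows "hecke 0 (adj u) g = 12 * hecke 1 u g" "hecke 1 (adj u) g = hecke 0 u g + 11 * hecke 2 u g"
    "hecke 2 (adj u) g = hecke 1 u g + 5 * hecke 2 u g + 5 * hecke 3 u g + hecke 4 u g"
    "hecke 3 (adj u) g = 6 * hecke 2 u g + 6 * hecke 3 u g" "hecke 4 (adj u) g = 12 * hecke 2 u g"
  using hecke_adj[OF _ assms, of 0] hecke_adj[OF _ assms, of 1] hecke_adj[OF _ assms, of 2]
    hecke_adj[OF _ assms, of 3] hecke_adj[OF _ assms, of 4]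
  by (simp_all add: sum_12 nbr_type_def)

lemma sum_left_mult: "(\<Sum>x\<in>UNIV. u (g * x)) = (\<Sum>x\<in>UNIV. u (x::j1))" for u :: "j1 \<Rightarrow> real"
  by (rule sum.reindex_bij_witness[of _ "\<lambda>x. inverse g * x" "\<lambda>x. g * x"]) simp_all

lemma sum_right_mult: "(\<Sum>x\<in>UNIV. u (x * g)) = (\<Sum>x\<in>UNIV. u (x::j1))" for u :: "j1 \<Rightarrow> real"
  by (rule sum.reindex_bij_witness[of _ "\<lambda>x. x * inverse g" "\<lambda>x. x * g"]) (simp_all add: mult.assoc)

text \<open>The upper bounds on the five double cosets add up to the order of the group, so every
  bound is attained and nothing is counted twice.\<close>

lemma card_dcos_eq: "k < 5 \<Longrightarrow> card (dcos k) = 660 * subdeg k"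
  and dcos_unique: "card {k. k < 5 \<and> x \<in> dcos k} = 1"
proof -
  have le: "card (dcos k) \<le> 660 * subdeg k" if "k < 5" for k
    using card_dcos_le[OF that] by linarith
  let ?w = "\<lambda>x. card {k. k < 5 \<and> x \<in> dcos k}"
  have w: "1 \<le> ?w x" for x
  proof -
    obtain k where "k < 5" "x \<in> dcos k" using Un_dcos by blast
    then have "{k. k < 5 \<and> x \<in> dcos k} \<noteq> {}" by blast
    then show ?thesis by (simp add: Suc_le_eq card_gt_0_iff)
  qed
  have "(\<Sum>k<5. card (dcos k)) = card (Sigma {..<5} dcos)" by (simp add: card_SigmaI)
  also have "\<dots> = card ((\<lambda>(k, x). (x, k)) ` Sigma {..<5} dcos)"
    by (rule card_image [symmetric]) (auto simp: inj_on_def)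
  also have "(\<lambda>(k, x). (x, k)) ` Sigma {..<5} dcos = Sigma UNIV (\<lambda>x. {k. k < 5 \<and> x \<in> dcos k})" by auto
  also have "card \<dots> = (\<Sum>x\<in>UNIV. ?w x)" by (simp add: card_SigmaI)
  finally have s: "(\<Sum>k<5. card (dcos k)) = (\<Sum>x\<in>UNIV. ?w x)" .
  have t: "(\<Sum>k<5. 660 * subdeg k) = 175560" by (simp add: sum_5 subdeg_def)
  have "(\<Sum>k<5. card (dcos k)) \<le> (\<Sum>k<5. 660 * subdeg k)" by (rule sum_mono) (use le in simp)
  moreover have "(\<Sum>x\<in>(UNIV::j1 set). 1) \<le> (\<Sum>x\<in>UNIV. ?w x)" by (rule sum_mono) (use w in simp)
  ultimately have e: "(\<Sum>k<5. card (dcos k)) = (\<Sum>k<5. 660 * subdeg k)" "(\<Sum>x\<in>UNIV. ?w x) = (\<Sum>x\<in>(UNIV::j1 set). 1)"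
    using s t CARD_j1 by simp_all
  show "card (dcos k) = 660 * subdeg k" if "k < 5"
    using sum_mono_inv[OF e(1), of k] le that by simp
  show "?w x = 1" using sum_mono_inv[OF e(2)[symmetric], of x] w by simp
qed

text \<open>The weight \<open>subdeg k\<close> cancels the multiplicity with which the Hecke sum
  counts, so every element of the group is counted once.\<close>

lemma hecke_total:
  assumes u: "gL_inv u"
  shows "(\<Sum>k<5. real (subdeg k) * hecke k u g) = (\<Sum>x\<in>UNIV. u x)"
proof -
  have D: "(\<Sum>x\<in>dcos k. u (g * x)) = real (subdeg k) * hecke k u g" if k: "k < 5" for k
  proof -
    have tr: "(\<Sum>x\<in>dcos k. u (g * l * x)) = (\<Sum>x\<in>dcos k. u (g * x))" if l: "l \<in> gL" for l
      by (rule sum.reindex_bij_witness[of _ "\<lambda>x. inverse l * x" "\<lambda>x. l * x"])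
        (use dcos_left l sbgD(3)[OF sbg_gL l] in \<open>simp_all add: mult.assoc\<close>)
    have "660 * (\<Sum>x\<in>dcos k. u (g * x)) = (\<Sum>l\<in>gL. \<Sum>x\<in>dcos k. u (g * l * x))"
      using tr by (simp add: card_gL)
    also have "\<dots> = (\<Sum>x\<in>dcos k. \<Sum>l\<in>gL. u (g * l * x))" by (rule sum.swap)
    also have "\<dots> = (\<Sum>x\<in>dcos k. hecke k u g)" by (rule sum.cong) (simp_all add: hecke_dcos[OF u])
    finally show ?thesis by (simp add: card_dcos_eq[OF k])
  qed
  have "(\<Sum>k<5. real (subdeg k) * hecke k u g) = (\<Sum>k<5. \<Sum>x\<in>UNIV. if x \<in> dcos k then u (g * x) else 0)"
    by (rule sum.cong) (simp_all add: D sum.If_cases)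
  also have "\<dots> = (\<Sum>x\<in>UNIV. \<Sum>k<5. if x \<in> dcos k then u (g * x) else 0)" by (rule sum.swap)
  also have "\<dots> = (\<Sum>x\<in>UNIV. u (g * x))"
  proof (rule sum.cong)
    fix x
    have "{..<5} \<inter> {k. x \<in> dcos k} = {k. k < 5 \<and> x \<in> dcos k}" by auto
    then show "(\<Sum>k<5. if x \<in> dcos k then u (g * x) else 0) = u (g * x)"
      using dcos_unique[of x] by (simp add: sum.If_cases)
  qed simp
  also have "\<dots> = (\<Sum>x\<in>UNIV. u x)" by (rule sum_left_mult)
  finally show ?thesis .
qed

lemma hecke_0: "gL_inv u \<Longrightarrow> hecke 0 u g = 660 * u g"
  by (simp add: hecke_def dcr_def gL_inv_def card_gL)

text \<open>The polynomial is (A - 4) (A + 2) (A^2 + 3 A - 9), the characteristic polynomial of the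
  intersection matrix without the factor A - 12 of the constant functions. Its smallest root (-3 - 3
  sqrt 5)/2 lies slightly above -5.\<close>

lemma adj_annihilated:
  assumes u: "gL_inv u" and z: "(\<Sum>x\<in>UNIV. u x) = 0"
  shows "adj (adj (adj (adj u))) g + adj (adj (adj u)) g - 23 * adj (adj u) g - 6 * adj u g + 72 * u g = 0"
proof -
  have "(\<Sum>k<5. real (subdeg k) * hecke k u g) = 0" using hecke_total[OF u] z by simp
  then have t: "hecke 0 u g + 12 * hecke 1 u g + 132 * hecke 2 u g + 110 * hecke 3 u g + 11 * hecke 4 u g = 0"
    by (simp add: sum_5 subdeg_def)
  have "660 * (adj (adj (adj (adj u))) g + adj (adj (adj u)) g - 23 * adj (adj u) g - 6 * adj u g + 72 * u g)
    = hecke 0 (adj (adj (adj (adj u)))) g + hecke 0 (adj (adj (adj u))) g - 23 * hecke 0 (adj (adj u)) g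
      - 6 * hecke 0 (adj u) g + 72 * hecke 0 u g"
    by (simp add: hecke_0 u gL_inv_adj)
  also have "\<dots> = 72 * (hecke 0 u g + 12 * hecke 1 u g + 132 * hecke 2 u g + 110 * hecke 3 u g + 11 * hecke 4 u g)"
    by (simp add: hecke_adj_values u gL_inv_adj del: One_nat_def)
  finally show ?thesis using t by simp
qed

definition ip :: "(j1 \<Rightarrow> real) \<Rightarrow> (j1 \<Rightarrow> real) \<Rightarrow> real" where
  "ip u v = (\<Sum>g\<in>UNIV. u g * v g)"

text \<open>Since v is constant on cosets, the 660 translates contribute equally, and 660 / 55 =
  12.\<close>

lemma ip_adj:
  assumes v: "gL_inv v"
  shows "ip (adj u) v = 12 * (\<Sum>g\<in>UNIV. u (g * gt) * v g)"
proof -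
  have d1: "dcr (Suc 0) = gt" by (simp add: dcr_def)
  have "55 * (adj u g * v g) = (\<Sum>l\<in>gL. u (g * l * gt) * v g)" for g
    by (simp add: adj_def hecke_def d1 sum_distrib_right)
  then have "55 * ip (adj u) v = (\<Sum>g\<in>UNIV. \<Sum>l\<in>gL. u (g * l * gt) * v g)"
    unfolding ip_def sum_distrib_left by simp
  also have "\<dots> = (\<Sum>l\<in>gL. \<Sum>g\<in>UNIV. u (g * l * gt) * v g)" by (rule sum.swap)
  also have "\<dots> = (\<Sum>l\<in>gL. \<Sum>g\<in>UNIV. u (g * gt) * v g)"
  proof (rule sum.cong)
    fix l assume l: "l \<in> gL"
    have "(\<Sum>g\<in>UNIV. u (g * l * gt) * v g) = (\<Sum>g\<in>UNIV. u (g * l * gt) * v (g * l))"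
      using v l by (simp add: gL_inv_def)
    also have "\<dots> = (\<Sum>g\<in>UNIV. u (g * gt) * v g)" by (rule sum_right_mult[of "\<lambda>g. u (g * gt) * v g" l])
    finally show "(\<Sum>g\<in>UNIV. u (g * l * gt) * v g) = (\<Sum>g\<in>UNIV. u (g * gt) * v g)" .
  qed simp
  finally show ?thesis by (simp add: card_gL)
qed

lemma ip_adj_sym:
  assumes "gL_inv u" "gL_inv v"
  shows "ip (adj u) v = ip u (adj v)"
proof -
  have tt: "g * gt * gt = g" for g :: j1 using gw_gt_inv(2) by (metis inv_cancel(2) mult.assoc mult.right_neutral)
  have "(\<Sum>g\<in>UNIV. u (g * gt) * v g) = (\<Sum>g\<in>UNIV. u (g * gt * gt) * v (g * gt))"
    by (rule sum_right_mult[of "\<lambda>g. u (g * gt) * v g" gt, symmetric])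
  then have "ip (adj u) v = ip (adj v) u" using assms by (simp add: ip_adj tt mult.commute)
  then show ?thesis by (simp add: ip_def mult.commute)
qed

text \<open>
  With \<open>A\<close> the adjacency operator and \<open>m(A) = A\<^sup>4 + A\<^sup>3 - 23 A\<^sup>2 - 6 A + 72\<close>, the operator
  \<open>500 A + 2500 + 3 m(A)\<close> is a sum of squares.
\<close>

lemma adj_lower_bound:
  assumes u: "gL_inv u" and z: "(\<Sum>x\<in>UNIV. u x) = 0"
  shows "- 5 * ip u u \<le> ip (adj u) u"
proof -
  define v where "v = adj u"
  define w where "w = adj v"
  note inv = u gL_inv_adj[of u, folded v_def] gL_inv_adj[of v, folded w_def] gL_inv_adj
  have m: "adj (adj w) g = 23 * w g + 6 * v g - 72 * u g - adj w g" for g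
    using adj_annihilated[OF u z, of g] by (simp add: v_def w_def)
  have 1: "ip w u = ip v v" using ip_adj_sym[of v u] inv by (simp add: v_def w_def)
  have 2: "ip (adj w) u = ip w v" using ip_adj_sym[of w u] inv by (simp add: v_def)
  have 3: "ip (adj (adj w)) u = ip w w"
    using ip_adj_sym[of "adj w" u] ip_adj_sym[of w v] inv by (simp add: v_def w_def)
  have "ip (adj (adj w)) u = (\<Sum>g\<in>UNIV. 23 * (w g * u g) + 6 * (v g * u g) - 72 * (u g * u g) - adj w g * u g)"
    by (simp add: ip_def m algebra_simps)
  then have "ip (adj (adj w)) u = 23 * ip w u + 6 * ip v u - 72 * ip u u - ip (adj w) u"
    by (simp add: ip_def sum.distrib sum_subtractf sum_distrib_left)
  then have Z: "ip w w = 23 * ip v v + 6 * ip v u - 72 * ip u u - ip w v" using 1 2 3 by simp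
  \<comment> \<open>Three quarters of this square remove the terms of degree 4 and 3 from the
    polynomial and leave (201 A^2 + 2168 A + 6064) / 4.\<close>
  have "0 \<le> (\<Sum>g\<in>UNIV. (2 * w g + v g - 40 * u g)\<^sup>2)" by (rule sum_nonneg) simp
  also have "\<dots> = (\<Sum>g\<in>UNIV. 4 * (w g * w g) + v g * v g + 1600 * (u g * u g) + 4 * (w g * v g)
      - 160 * (w g * u g) - 80 * (v g * u g))"
    by (simp add: power2_eq_square algebra_simps)
  also have "\<dots> = 4 * ip w w + ip v v + 1600 * ip u u + 4 * ip w v - 160 * ip w u - 80 * ip v u"
    by (simp add: ip_def sum.distrib sum_subtractf sum_distrib_left)
  finally have S1: "0 \<le> 4 * ip w w + ip v v + 1600 * ip u u + 4 * ip w v - 160 * ip v v - 80 * ip v u" using 1 by simp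
  \<comment> \<open>This completes the square in the remaining quadratic; a positive constant is
    left over because 201 * 6064 exceeds 1084^2.\<close>
  have "0 \<le> (\<Sum>g\<in>UNIV. (201 * v g + 1084 * u g)\<^sup>2)" by (rule sum_nonneg) simp
  also have "\<dots> = (\<Sum>g\<in>UNIV. 40401 * (v g * v g) + 435768 * (v g * u g) + 1175056 * (u g * u g))"
    by (simp add: power2_eq_square algebra_simps)
  also have "\<dots> = 40401 * ip v v + 435768 * ip v u + 1175056 * ip u u"
    by (simp add: ip_def sum.distrib sum_distrib_left)
  finally have S2: "0 \<le> 40401 * ip v v + 435768 * ip v u + 1175056 * ip u u" .
  have S3: "0 \<le> ip u u" unfolding ip_def by (rule sum_nonneg) simp
  have "- 5 * ip u u \<le> ip v u" using Z S1 S2 S3 by linarith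
  then show ?thesis by (simp add: v_def)
qed

text \<open>Hoffman's ratio bound. The function u is the indicator of S minus its mean c.
  Independence gives the inner product -12 c n of \<open>adj u\<close> with u, while the square norm
  of u is n - c n; so the eigenvalue estimate -5 yields 17 c \<le> 5.\<close>

lemma card_independent:
  assumes S: "\<And>g l. g \<in> S \<Longrightarrow> l \<in> gL \<Longrightarrow> g * l \<in> S" "\<And>g. g \<in> S \<Longrightarrow> g * gt \<notin> S"
  shows "17 * card S \<le> 877800"
proof -
  define n where "n = real (card S)"
  define c where "c = n / 175560"
  define f :: "j1 \<Rightarrow> real" where "f g = (if g \<in> S then 1 else 0)" for g
  define u where "u g = f g - c" for g
  have nc: "n = 175560 * c" by (simp add: c_def)
  have iff: "g * l \<in> S \<longleftrightarrow> g \<in> S" if "l \<in> gL" for g l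
    using S(1)[of g l] S(1)[of "g * l" "inverse l"] that sbgD(3)[OF sbg_gL that] by (auto simp: mult.assoc)
  then have u: "gL_inv u" by (simp add: gL_inv_def u_def f_def)
  have f: "(\<Sum>g\<in>UNIV. f g) = n" by (simp add: f_def n_def sum.If_cases)
  have ft: "(\<Sum>g\<in>UNIV. f (g * gt)) = n" using sum_right_mult[of f gt] f by simp
  have z: "(\<Sum>g\<in>UNIV. u g) = 0" by (simp add: u_def sum_subtractf f CARD_j1 nc)
  have ff: "f g * f g = f g" "f (g * gt) * f g = 0" for g using S(2) by (auto simp: f_def)
  have "ip u u = (\<Sum>g\<in>UNIV. f g * f g - 2 * c * f g + c * c)"
    by (simp add: ip_def u_def algebra_simps)
  also have "\<dots> = n - 2 * c * n + 175560 * (c * c)"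
    unfolding ff by (simp add: sum.distrib sum_subtractf sum_distrib_left [symmetric] f CARD_j1)
  finally have uu: "ip u u = n - c * n" by (simp add: nc)
  have "(\<Sum>g\<in>UNIV. u (g * gt) * u g) = (\<Sum>g\<in>UNIV. f (g * gt) * f g - c * f (g * gt) - c * f g + c * c)"
    by (simp add: u_def algebra_simps)
  also have "\<dots> = - 2 * c * n + 175560 * (c * c)"
    unfolding ff by (simp add: sum.distrib sum_subtractf sum_negf sum_distrib_left [symmetric] f ft CARD_j1)
  finally have "ip (adj u) u = - 12 * (c * n)" using ip_adj[OF u, of u] by (simp add: nc)
  then have "17 * (c * n) \<le> 5 * n" using adj_lower_bound[OF u z] uu by simp
  then have "17 * (175560 * c) * n \<le> 877800 * n" by simp
  then have "17 * n * n \<le> 877800 * n" by (simp only: nc [symmetric])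
  then have "17 * n \<le> 877800" if "n \<noteq> 0" using that by (auto simp: mult_le_cancel_right n_def)
  then have "17 * n \<le> 877800" by (cases "n = 0") simp_all
  then show ?thesis by (simp add: n_def)
qed

subsection \<open>Independent sets of cosets\<close>

definition act :: "j1 \<Rightarrow> 11 ^ 7 \<Rightarrow> 11 ^ 7" where
  "act g u = Rep_j1 g *v u"

lemma act_mult: "act (g * h) u = act g (act h u)"
  by (simp add: act_def times_j1.rep_eq matrix_vector_mul_assoc)

lemma act_one: "act 1 u = u"
  by (simp add: act_def one_j1.rep_eq)

lemma act_scale: "act g (c *s u) = c *s act g u"
  by (simp add: act_def mv_linear)

lemma act_cyc: "act y u = u \<Longrightarrow> c \<in> cyc y \<Longrightarrow> act c u = u"
proof -
  assume "act y u = u"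
  then have "act (y ^ n) u = u" for n by (induction n) (simp_all add: act_one act_mult)
  then show "c \<in> cyc y \<Longrightarrow> act c u = u" by (auto simp: cyc_def)
qed

text \<open>The line of vectors fixed by y depends only on \<open>cyc y\<close>, so the normalizer
  preserves it.\<close>

lemma nrm_act:
  assumes v: "act y v = v" "v \<noteq> 0" "\<And>u. act y u = u \<Longrightarrow> \<exists>c. u = c *s v" and a: "a \<in> nrm (cyc y)"
  obtains c where "c \<noteq> 0" "act a v = c *s v"
proof -
  have "cj a (cyc y) = cyc y" using a by (simp add: nrm_def)
  then have "y \<in> cj a (cyc y)" using self_in_cyc[of y] by simp
  then have "inverse a * y * a \<in> cyc y" by (simp only: cj_iff)
  then have "act (inverse a * y * a) v = v" by (rule act_cyc[OF v(1)])
  then have "act a (act (inverse a * y * a) v) = act a v" by simp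
  then have "act y (act a v) = act a v" by (simp add: act_mult [symmetric] mult.assoc)
  then obtain c where c: "act a v = c *s v" using v(3) by blast
  have "c \<noteq> 0"
  proof
    assume "c = 0"
    then have "act (inverse a) (act a v) = act (inverse a) (0 *s v)" using c by simp
    then have "v = 0 *s act (inverse a) v" unfolding act_scale by (simp add: act_mult [symmetric] act_one)
    then show False using v(2) by simp
  qed
  then show thesis using c that by blast
qed

text \<open>
  The Sylow \<open>p\<close>-subgroups of \<open>H\<close> are the conjugates of \<open>cyc y\<close> by \<open>b k\<close>, and a conjugate of \<open>cyc y\<close>
  is recognized by the line of its fixed vectors.  An invariant \<open>key\<close> of lines that separates the orbits
  of \<open>gY\<close> on the lines belonging to the cosets of the \<open>r i\<close> proves that the translates of these cosets by
  powers of \<open>gY\<close> pairwise have no Sylow subgroup in common.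
\<close>

locale separated_cosets =
  fixes p :: nat and y :: j1 and H :: "j1 set" and v :: "11 ^ 7" and z :: j1
    and r b :: "nat \<Rightarrow> j1" and n m :: nat and key :: "11 ^ 7 \<Rightarrow> nat"
  assumes p: "p \<in> primes5" "sy p = cyc y"
    and H: "sbg H" "\<And>P. P \<in> Sy H p \<Longrightarrow> \<exists>k<m. P = cj (b k) (cyc y)" "\<And>k. k < m \<Longrightarrow> b k \<in> H" "y \<in> H" "m > 0"
    and v: "act y v = v" "v \<noteq> 0" "\<And>u. act y u = u \<Longrightarrow> \<exists>c. u = c *s v"
    and z: "cyc y \<subseteq> cj z H" "z \<notin> H"
    and key: "\<And>u. key (act gY u) = key u" "\<And>c u. c \<noteq> 0 \<Longrightarrow> key (c *s u) = key u"
    and sep: "inj_on (\<lambda>(i, k). key (act (r i * b k) v)) ({..<n} \<times> {..<m})"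
    and free: "\<And>i k. i < n \<Longrightarrow> k < m \<Longrightarrow> gY \<notin> nrm (cj (r i * b k) (cyc y))"
begin

lemma key_cyc: "c \<in> cyc gY \<Longrightarrow> key (act c u) = key u"
proof -
  have "key (act (gY ^ n) u) = key u" for n by (induction n) (simp_all add: act_one act_mult key(1))
  then show "c \<in> cyc gY \<Longrightarrow> key (act c u) = key u" by (auto simp: cyc_def)
qed

lemma key_conj:
  assumes "cj g (cyc y) = cj g' (cyc y)"
  shows "key (act g v) = key (act g' v)"
proof -
  have "cj (inverse g) (cj g (cyc y)) = cj (inverse g) (cj g' (cyc y))" using assms by simp
  then have a: "inverse g * g' \<in> nrm (cyc y)" by (simp add: nrm_def cj_mult)
  obtain c where c: "c \<noteq> 0" "act (inverse g * g') v = c *s v" by (rule nrm_act[OF v a])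
  have "act g (act (inverse g * g') v) = c *s act g v" unfolding c(2) act_scale ..
  then have "act g' v = c *s act g v" by (simp add: act_mult [symmetric])
  then show ?thesis using key(2)[OF c(1)] by simp
qed

text \<open>Equal conjugates have equal keys, which by \<open>sep\<close> determine i and k. The
  quotient of c and c' then normalizes that conjugate; were it nontrivial, it would generate the
  group of \<open>gY\<close>, against \<open>free\<close>.\<close>

lemma same_Sylow:
  assumes c: "c \<in> cyc gY" "c' \<in> cyc gY" and i: "i < n" "i' < n" and k: "k < m" "k' < m"
    and e: "cj (c * (r i * b k)) (cyc y) = cj (c' * (r i' * b k')) (cyc y)"
  shows "i = i' \<and> c = c'"
proof -
  have "key (act (r i * b k) v) = key (act (r i' * b k') v)"
    using key_conj[OF e] key_cyc c by (simp add: act_mult)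
  then have ik: "i = i'" "k = k'" using inj_onD[OF sep, of "(i, k)" "(i', k')"] i k by auto
  let ?Q = "cj (r i * b k) (cyc y)"
  have "cj (inverse c) (cj c ?Q) = cj (inverse c) (cj c' ?Q)" using e ik by (simp add: cj_mult)
  then have q: "inverse c * c' \<in> nrm ?Q" by (simp add: nrm_def cj_mult)
  have "c = c'"
  proof (rule ccontr)
    assume ne: "c \<noteq> c'"
    let ?d = "inverse c * c'"
    have d: "?d \<in> cyc gY" by (rule sbgD(2)[OF sbg_cyc sbgD(3)[OF sbg_cyc c(1)] c(2)])
    have "?d \<noteq> 1" using ne by (auto simp: mult_eq_one_inv inv_eq_iff)
    then have "cyc ?d = cyc gY"
      using cyc_prime_card(1)[OF sbg_cyc _ _ d] gords(3) prime_numerals(4) by (simp add: gord_def)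
    then have "gY \<in> cyc ?d" using self_in_cyc[of gY] by simp
    then have "gY \<in> nrm ?Q" using cyc_subset[OF sbg_nrm q] by blast
    then show False using free[OF i(1) k(1)] by simp
  qed
  then show ?thesis using ik by simp
qed

definition S :: "j1 set" where
  "S = (\<Union>i<n. \<Union>c\<in>cyc gY. (*) (c * r i) ` H)"

lemma Sylow_S:
  assumes P: "P \<in> Sy UNIV p" and g: "P \<subseteq> cj (c * r i * h) H" "h \<in> H"
  obtains k where "k < m" "P = cj (c * (r i * b k)) (cyc y)"
proof -
  define d where "d = c * r i"
  have "cj h H = H" using g(2) subset_nrm[OF H(1)] by (auto simp: nrm_def)
  then have "P \<subseteq> cj d H" using g(1) by (simp add: cj_mult d_def)
  then have "cj (inverse d) P \<subseteq> cj (inverse d) (cj d H)" by (simp only: cj_mono_iff)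
  then have "cj (inverse d) P \<in> Sy H p" using P by (simp add: Sy_iff sbg_cj)
  then obtain k where k: "k < m" "cj (inverse d) P = cj (b k) (cyc y)" using H(2) by blast
  have "cj d (cj (inverse d) P) = cj d (cj (b k) (cyc y))" using k(2) by simp
  then have "P = cj (c * (r i * b k)) (cyc y)" by (simp add: cj_mult [symmetric] mult.assoc d_def)
  then show thesis using k(1) that by blast
qed

lemma S_common:
  assumes P: "P \<in> Sy UNIV p" and g: "g \<in> S" "P \<subseteq> cj g H" and g': "g' \<in> S" "P \<subseteq> cj g' H"
  shows "inverse g * g' \<in> H"
proof -
  obtain i c h where 1: "i < n" "c \<in> cyc gY" "h \<in> H" "g = c * r i * h" using g(1) by (auto simp: S_def)
  obtain i' c' h' where 2: "i' < n" "c' \<in> cyc gY" "h' \<in> H" "g' = c' * r i' * h'" using g'(1) by (auto simp: S_def)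
  obtain k where k: "k < m" "P = cj (c * (r i * b k)) (cyc y)" using Sylow_S[OF P] g(2) 1 by metis
  obtain k' where k': "k' < m" "P = cj (c' * (r i' * b k')) (cyc y)" using Sylow_S[OF P] g'(2) 2 by metis
  have "i = i' \<and> c = c'" by (rule same_Sylow[OF 1(2) 2(2) 1(1) 2(1) k(1) k'(1) trans[OF k(2) [symmetric] k'(2)]])
  then have "inverse g * g' = inverse h * h'" using 1 2 by (simp add: mult.assoc)
  then show ?thesis using 1(3) 2(3) sbgD[OF H(1)] by simp
qed

text \<open>The conjugates of H by g and by \<open>g * z\<close> share the conjugate of
  \<open>cyc y\<close> by g, and by \<open>S_common\<close> only one coset in S can serve a given
  Sylow subgroup.\<close>

lemma S_independent: "g \<notin> S \<or> g * z \<notin> S"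
proof (rule ccontr)
  assume "\<not> ?thesis"
  then have g: "g \<in> S" "g * z \<in> S" by auto
  have P: "cj g (cyc y) \<in> Sy UNIV p" using sy_in_Sy[OF p(1)] p(2) by (simp add: Sy_iff sbg_cj)
  have "cj g (cyc y) \<subseteq> cj g H" using cyc_subset[OF H(1,4)] by (simp only: cj_mono_iff)
  moreover have "cj g (cyc y) \<subseteq> cj (g * z) H" using z(1) by (simp add: cj_mult cj_mono_iff)
  ultimately have "inverse g * (g * z) \<in> H" using S_common[OF P g(1) _ g(2)] by blast
  then show False using z(2) by simp
qed

lemma S_mult: "g \<in> S \<Longrightarrow> h \<in> H \<Longrightarrow> g * h \<in> S"
  using sbgD(2)[OF H(1)] by (fastforce simp: S_def mult.assoc)

lemma S_coset: "g \<in> S \<Longrightarrow> (*) g ` H \<subseteq> S"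
  using S_mult by auto

lemma card_S: "card S = 7 * n * card H"
proof -
  let ?D = "({..<n} \<times> cyc gY) \<times> H" and ?h = "\<lambda>((i, c), h). c * r i * h"
  have "S = ?h ` ?D" by (force simp: S_def)
  moreover have "inj_on ?h ?D"
  proof (rule inj_onI)
    fix x x' assume x: "x \<in> ?D" "x' \<in> ?D" "?h x = ?h x'"
    obtain i c h i' c' h' where e: "x = ((i, c), h)" "x' = ((i', c'), h')" by (metis surj_pair)
    have m: "i < n" "c \<in> cyc gY" "h \<in> H" "i' < n" "c' \<in> cyc gY" "h' \<in> H" "c * r i * h = c' * r i' * h'" using x e by auto
    let ?g = "c * r i * h"
    have P: "cj ?g (cyc y) \<in> Sy UNIV p" using sy_in_Sy[OF p(1)] p(2) by (simp add: Sy_iff sbg_cj)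
    have sub: "cj ?g (cyc y) \<subseteq> cj ?g H" using cyc_subset[OF H(1,4)] by (simp only: cj_mono_iff)
    obtain k where k: "k < m" "cj ?g (cyc y) = cj (c * (r i * b k)) (cyc y)" using Sylow_S[OF P sub m(3)] .
    obtain k' where k': "k' < m" "cj (c' * r i' * h') (cyc y) = cj (c' * (r i' * b k')) (cyc y)"
      using Sylow_S[OF P[unfolded m(7)] sub[unfolded m(7)] m(6)] .
    have "i = i' \<and> c = c'"
      by (rule same_Sylow[OF m(2,5,1,4) k(1) k'(1)
        trans[OF k(2) [symmetric] trans[OF arg_cong[OF m(7), of "\<lambda>x. cj x (cyc y)"] k'(2)]]])
    then show "x = x'" using m(7) e by simp
  qed
  ultimately have "card S = card ?D" by (simp add: card_image)
  then show ?thesis using gords(3) by (simp add: card_cartesian_product gord_def)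
qed

text \<open>C consists of the conjugates of H that belong to the cosets outside S, so there are at
  most as many as cosets. Independence of S leaves every conjugate of \<open>cyc y\<close> in one of
  them.\<close>

lemma complement_cosets:
  obtains C where "card C * card H + 7 * n * card H \<le> 175560" "\<And>M. M \<in> C \<Longrightarrow> \<exists>g. M = cj g H"
    "\<And>g x. x \<in> cj g (cyc y) \<Longrightarrow> \<exists>M\<in>C. x \<in> M"
proof -
  let ?f = "\<lambda>g. (*) g ` H" and ?h = "\<lambda>g. cj g H" and ?S = "- S"
  have fh: "?h a = ?h c" if e: "?f a = ?f c" for a c
  proof -
    have "inverse a * c \<in> H" using e coset_eq_iff[OF H(1), of a c] by simp
    then have "cj (inverse a * c) H = H" using subset_nrm[OF H(1)] by (auto simp: nrm_def)
    then have "cj a (cj (inverse a * c) H) = cj a H" by simp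
    then show ?thesis by (simp add: cj_mult)
  qed
  have "?h ` ?S \<subseteq> (\<lambda>A. ?h (inv_into ?S ?f A)) ` ?f ` ?S"
  proof
    fix B assume "B \<in> ?h ` ?S"
    then obtain a where a: "a \<in> ?S" "B = ?h a" by auto
    have "?f (inv_into ?S ?f (?f a)) = ?f a" by (rule f_inv_into_f) (use a(1) in blast)
    then have "B = ?h (inv_into ?S ?f (?f a))" using fh a(2) by metis
    then show "B \<in> (\<lambda>A. ?h (inv_into ?S ?f A)) ` ?f ` ?S" using a(1) by blast
  qed
  then have "card (?h ` ?S) \<le> card ((\<lambda>A. ?h (inv_into ?S ?f A)) ` ?f ` ?S)" by (rule card_mono[rotated]) simp
  also have "\<dots> \<le> card (?f ` ?S)" by (rule card_image_le) simp
  finally have le: "card (?h ` ?S) * card H \<le> card (?f ` ?S) * card H" by simp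
  have "card H * card (?f ` ?S) = card (\<Union>(?f ` ?S))"
  proof (rule card_partition)
    show "card c = card H" if "c \<in> ?f ` ?S" for c using that by (auto simp: card_image inj_on_def)
    fix A B assume AB: "A \<in> ?f ` ?S" "B \<in> ?f ` ?S" "A \<noteq> B"
    obtain a c where ac: "A = ?f a" "B = ?f c" using AB by blast
    show "A \<inter> B = {}"
    proof (rule ccontr)
      assume "A \<inter> B \<noteq> {}"
      then obtain h h' where h: "h \<in> H" "h' \<in> H" "a * h = c * h'" unfolding ac by auto
      have "inverse a * (a * h) * inverse h' = inverse a * (c * h') * inverse h'" using h(3) by simp
      then have "inverse a * c = h * inverse h'" by (simp add: mult.assoc)
      then have "inverse a * c \<in> H" using h sbgD[OF H(1)] by simp
      then show False using AB(3) ac coset_eq_iff[OF H(1), of a c] by simp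
    qed
  qed simp_all
  moreover have "\<Union>(?f ` ?S) \<subseteq> ?S"
  proof
    fix x assume "x \<in> \<Union>(?f ` ?S)"
    then obtain a h where x: "a \<notin> S" "h \<in> H" "x = a * h" by auto
    have "x \<notin> S" using S_mult[of x "inverse h"] x sbgD(3)[OF H(1)] by (auto simp: mult.assoc)
    then show "x \<in> ?S" by simp
  qed
  then have "card (\<Union>(?f ` ?S)) \<le> card ?S" by (intro card_mono) simp_all
  moreover have "card ?S = 175560 - card S" by (simp add: Compl_eq_Diff_UNIV card_Diff_subset CARD_j1)
  moreover have "card S \<le> 175560" using card_mono[of UNIV S] CARD_j1 by simp
  ultimately have 1: "card (?h ` ?S) * card H + 7 * n * card H \<le> 175560"
    using le card_S unfolding mult.commute[of "card H"] by linarith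
  have 2: "\<exists>M\<in>?h ` ?S. x \<in> M" if x: "x \<in> cj g (cyc y)" for g x
  proof -
    have "cj g (cyc y) \<subseteq> cj g H" using cyc_subset[OF H(1,4)] by (simp only: cj_mono_iff)
    moreover have "cj g (cyc y) \<subseteq> cj (g * z) H" using z(1) by (simp add: cj_mult cj_mono_iff)
    ultimately show ?thesis using x S_independent[of g] by blast
  qed
  show thesis by (rule that[OF 1 _ 2]) auto
qed

end

subsection \<open>Invariants of lines\<close>

primrec dot :: "11 list \<Rightarrow> 11 list \<Rightarrow> 11" where
  "dot [] v = 0"
| "dot (a # r) v = a * hd v + dot r (tl v)"

definition mvl :: "11 list list \<Rightarrow> 11 list \<Rightarrow> 11 list" where
  "mvl A v = map (\<lambda>r. dot r v) A"

definition vl :: "11 ^ 7 \<Rightarrow> 11 list" where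
  "vl u = map (\<lambda>i. u $ i) [1, 2, 3, 4, 5, 6, 7]"

primrec times_list :: "11 list \<Rightarrow> 11 list \<Rightarrow> 11 list" where
  "times_list [] v = []"
| "times_list (a # r) v = a * hd v # times_list r (tl v)"

definition code_11 :: "11 \<Rightarrow> nat" where
  "code_11 x = (if x = 0 then 0 else if x = 1 then 1 else if x = f2 then 2 else if x = f3 then 3 else if x = f4 then 4
    else if x = f5 then 5 else if x = f6 then 6 else if x = f7 then 7 else if x = f8 then 8 else if x = f9 then 9 else 10)"

lemma code_11_simps: "code_11 0 = 0" "code_11 1 = 1" "code_11 f2 = 2" "code_11 f3 = 3" "code_11 f4 = 4" "code_11 f5 = 5"
  "code_11 f6 = 6" "code_11 f7 = 7" "code_11 f8 = 8" "code_11 f9 = 9" "code_11 f10 = 10"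
  by (simp_all only: code_11_def f_neq simp_thms if_True if_False)

text \<open>Six residues become the digits of a number in base 11, so keys are below 11^6 and can be
  sorted.\<close>

definition encode :: "11 \<Rightarrow> 11 \<Rightarrow> 11 \<Rightarrow> 11 \<Rightarrow> 11 \<Rightarrow> 11 \<Rightarrow> nat" where
  "encode a b c d e f = code_11 f + 11 * (code_11 e + 11 * (code_11 d + 11 * (code_11 c + 11 * (code_11 b + 11 * code_11 a))))"

definition monomials :: "11 \<Rightarrow> 11 \<Rightarrow> 11 \<Rightarrow> 11 \<Rightarrow> 11 \<Rightarrow> nat" where
  "monomials q1 q3 c d g = encode (q1 * q1 * (q3 * q3 * q3)) (c * c * d) (c * g * (q3 * q3)) (g * g * (q1 * q1))
    (d * (g * g)) (c * c * (q1 * q3))"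

definition rot :: "11 list \<Rightarrow> 11 list" where
  "rot v = tl v @ [hd v]"

definition forms :: "11 list \<Rightarrow> 11 list \<Rightarrow> 11 list \<Rightarrow> 11 list \<Rightarrow> nat" where
  "forms u u1 u2 u3 = monomials (dot u u1) (dot u u3) (dot (times_list u u) u3)
    (dot (times_list u u) (times_list u1 u1)) (dot u (times_list u2 u3))"

text \<open>
  The forms have degrees 2, 2, 3, 4 and 3 and are invariant under cyclic shifts; the monomials in them have
  degree 10, so that their values depend only on the line spanned by \<open>u\<close>.
\<close>

definition list_key :: "11 list \<Rightarrow> nat" where
  "list_key u = forms u (rot u) (rot (rot u)) (rot (rot (rot u)))"

definition line_key :: "11 ^ 7 \<Rightarrow> nat" where
  "line_key u = list_key (vl u)"

lemma vl_act: "vl (act g u) = mvl (mt g) (vl u)"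
  by (simp add: vl_def act_def mvl_def mt_def rows_def matrix_vector_mult_def sum_7 add.assoc)

lemma vl_list: "vl u = [u $ 1, u $ 2, u $ 3, u $ 4, u $ 5, u $ 6, u $ 7]"
  by (simp add: vl_def)

lemma vl_inj: "vl u = vl w \<longleftrightarrow> u = w"
  by (simp add: vl_list vec_eq_iff all_7 conj_assoc)

lemma mvl_Y: "mvl (mt gY) [a, b, c, d, e, f, g] = [b, c, d, e, f, g, a]"
  by (simp add: mvl_def mt_Y)

lemma mvl_inverse_Y: "mvl (mt (inverse gY)) [a, b, c, d, e, f, g] = [g, a, b, c, d, e, f]"
  by (simp add: mvl_def mt_inverse_Y)

lemmas rot_eval = rot_def list.sel append_Nil append_Cons

lemmas key_defs = list_key_def forms_def rot_eval dot.simps times_list.simps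

lemma list_key_shift: "list_key [b, c, d, e, f, g, a] = list_key [a, b, c, d, e, f, g]"
proof -
  have "dot [b, c, d, e, f, g, a] [c, d, e, f, g, a, b] = dot [a, b, c, d, e, f, g] [b, c, d, e, f, g, a]"
    "dot [b, c, d, e, f, g, a] [e, f, g, a, b, c, d] = dot [a, b, c, d, e, f, g] [d, e, f, g, a, b, c]"
    "dot (times_list [b, c, d, e, f, g, a] [b, c, d, e, f, g, a]) [e, f, g, a, b, c, d] =
      dot (times_list [a, b, c, d, e, f, g] [a, b, c, d, e, f, g]) [d, e, f, g, a, b, c]"
    "dot (times_list [b, c, d, e, f, g, a] [b, c, d, e, f, g, a]) (times_list [c, d, e, f, g, a, b] [c, d, e, f, g, a, b]) =
      dot (times_list [a, b, c, d, e, f, g] [a, b, c, d, e, f, g]) (times_list [b, c, d, e, f, g, a] [b, c, d, e, f, g, a])"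
    "dot [b, c, d, e, f, g, a] (times_list [d, e, f, g, a, b, c] [e, f, g, a, b, c, d]) =
      dot [a, b, c, d, e, f, g] (times_list [c, d, e, f, g, a, b] [d, e, f, g, a, b, c])"
    by (simp_all add: ac_simps)
  then show ?thesis by (simp only: list_key_def forms_def rot_eval)
qed

lemma line_key_Y: "line_key (act gY u) = line_key u"
  by (simp only: line_key_def vl_act) (simp only: vl_list mvl_Y list_key_shift)

lemma power_10_11: "\<forall>c::11. c \<noteq> 0 \<longrightarrow> c * c * (c * c) * (c * c) * (c * c) * (c * c) = 1"
  by (simp only: all_11 f_mult f_neq simp_thms mult_1_left mult_1_right)

lemma line_key_scale: "line_key (c *s u) = line_key u" if c: "c \<noteq> 0"
proof -
  have c10: "c ^ 10 = 1" using power_10_11 c by (simp add: numeral_eq_Suc mult.assoc)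
  have "monomials (c ^ 2 * q1) (c ^ 2 * q3) (c ^ 3 * x) (c ^ 4 * d) (c ^ 3 * g) = monomials q1 q3 x d g" for q1 q3 x d g
  proof -
    have "c ^ 2 * q1 * (c ^ 2 * q1) * (c ^ 2 * q3 * (c ^ 2 * q3) * (c ^ 2 * q3)) = c ^ 10 * (q1 * q1 * (q3 * q3 * q3))"
      "c ^ 3 * x * (c ^ 3 * x) * (c ^ 4 * d) = c ^ 10 * (x * x * d)"
      "c ^ 3 * x * (c ^ 3 * g) * (c ^ 2 * q3 * (c ^ 2 * q3)) = c ^ 10 * (x * g * (q3 * q3))"
      "c ^ 3 * g * (c ^ 3 * g) * (c ^ 2 * q1 * (c ^ 2 * q1)) = c ^ 10 * (g * g * (q1 * q1))"
      "c ^ 4 * d * (c ^ 3 * g * (c ^ 3 * g)) = c ^ 10 * (d * (g * g))"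
      "c ^ 3 * x * (c ^ 3 * x) * (c ^ 2 * q1 * (c ^ 2 * q3)) = c ^ 10 * (x * x * (q1 * q3))"
      by (simp_all add: numeral_eq_Suc ac_simps)
    then show ?thesis by (simp only: monomials_def c10 mult_1_left)
  qed
  note m = this
  let ?t = "times_list"
  have "list_key [c * x1, c * x2, c * x3, c * x4, c * x5, c * x6, c * x7] = list_key [x1, x2, x3, x4, x5, x6, x7]"
    for x1 x2 x3 x4 x5 x6 x7
  proof -
    have d2: "dot [c * a1, c * a2, c * a3, c * a4, c * a5, c * a6, c * a7] [c * b1, c * b2, c * b3, c * b4, c * b5, c * b6, c * b7]
      = c ^ 2 * dot [a1, a2, a3, a4, a5, a6, a7] [b1, b2, b3, b4, b5, b6, b7]" for a1 a2 a3 a4 a5 a6 a7 b1 b2 b3 b4 b5 b6 b7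
      by (simp add: power2_eq_square algebra_simps)
    have d3: "dot (?t [c * a1, c * a2, c * a3, c * a4, c * a5, c * a6, c * a7] [c * a1, c * a2, c * a3, c * a4, c * a5, c * a6, c * a7])
        [c * b1, c * b2, c * b3, c * b4, c * b5, c * b6, c * b7]
      = c ^ 3 * dot (?t [a1, a2, a3, a4, a5, a6, a7] [a1, a2, a3, a4, a5, a6, a7]) [b1, b2, b3, b4, b5, b6, b7]"
      for a1 a2 a3 a4 a5 a6 a7 b1 b2 b3 b4 b5 b6 b7
      by (simp add: power3_eq_cube algebra_simps)
    have d4: "dot (?t [c * a1, c * a2, c * a3, c * a4, c * a5, c * a6, c * a7] [c * a1, c * a2, c * a3, c * a4, c * a5, c * a6, c * a7])
        (?t [c * b1, c * b2, c * b3, c * b4, c * b5, c * b6, c * b7] [c * b1, c * b2, c * b3, c * b4, c * b5, c * b6, c * b7])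
      = c ^ 4 * dot (?t [a1, a2, a3, a4, a5, a6, a7] [a1, a2, a3, a4, a5, a6, a7])
          (?t [b1, b2, b3, b4, b5, b6, b7] [b1, b2, b3, b4, b5, b6, b7])"
      for a1 a2 a3 a4 a5 a6 a7 b1 b2 b3 b4 b5 b6 b7
      by (simp add: power4_eq_xxxx algebra_simps)
    have d5: "dot [c * a1, c * a2, c * a3, c * a4, c * a5, c * a6, c * a7]
        (?t [c * b1, c * b2, c * b3, c * b4, c * b5, c * b6, c * b7] [c * e1, c * e2, c * e3, c * e4, c * e5, c * e6, c * e7])
      = c ^ 3 * dot [a1, a2, a3, a4, a5, a6, a7] (?t [b1, b2, b3, b4, b5, b6, b7] [e1, e2, e3, e4, e5, e6, e7])"
      for a1 a2 a3 a4 a5 a6 a7 b1 b2 b3 b4 b5 b6 b7 e1 e2 e3 e4 e5 e6 e7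
      by (simp add: power3_eq_cube algebra_simps)
    show ?thesis by (simp only: list_key_def forms_def rot_eval d2 d3 d4 d5 m)
  qed
  then show ?thesis by (simp add: line_key_def vl_list)
qed

text \<open>Sorting reduces the distinctness of a long list to comparisons of neighbours. The
  argument k is a key that must not occur.\<close>

fun chain :: "nat \<Rightarrow> nat list \<Rightarrow> bool" where
  "chain k (x # y # zs) \<longleftrightarrow> x < y \<and> x \<noteq> k \<and> chain k (y # zs)"
| "chain k [x] \<longleftrightarrow> x \<noteq> k"
| "chain k [] \<longleftrightarrow> True"

lemma chain_facts: "chain k xs \<Longrightarrow> sorted_wrt (<) xs \<and> k \<notin> set xs"
proof (induction k xs rule: chain.induct)
  case (1 k x y zs)
  then have "sorted_wrt (<) (y # zs)" "k \<notin> set (y # zs)" "x < y" "x \<noteq> k" by auto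
  moreover from this have "\<forall>z\<in>set (y # zs). x < z" by auto
  ultimately show ?case by auto
qed auto

text \<open>The list of pairs may come in any order: n m pairs in range with different keys exhaust
  the index set.\<close>

lemma chain_inj:
  assumes c: "chain k (map f ps)" and l: "length ps = n * m" and s: "list_all (\<lambda>(i, j). i < n \<and> j < m) ps"
  shows "inj_on f ({..<n} \<times> {..<m})" "\<And>x. x \<in> {..<n} \<times> {..<m} \<Longrightarrow> f x \<noteq> k"
proof -
  have d: "distinct (map f ps)" using chain_facts[OF c] strict_sorted_iff by blast
  have "set ps \<subseteq> {..<n} \<times> {..<m}" using s by (auto simp: list_all_iff)
  moreover have "card (set ps) = card ({..<n} \<times> {..<m})"
    using d l distinct_card[of ps] by (simp add: distinct_map card_cartesian_product)
  ultimately have e: "set ps = {..<n} \<times> {..<m}" by (intro card_subset_eq) auto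
  show "inj_on f ({..<n} \<times> {..<m})" using d by (simp add: distinct_map e)
  show "f x \<noteq> k" if "x \<in> {..<n} \<times> {..<m}" for x
    using chain_facts[OF c] that by (auto simp: e)
qed

subsection \<open>Two families of cosets\<close>

datatype letter = LY | LZ | Ly | Lz

primrec letter_value :: "letter \<Rightarrow> j1" where
  "letter_value LY = gY" | "letter_value LZ = gZ" | "letter_value Ly = inverse gY" | "letter_value Lz = inverse gZ"

primrec word_value :: "letter list \<Rightarrow> j1" where
  "word_value [] = 1"
| "word_value (a # w) = letter_value a * word_value w"

definition word_act :: "letter list \<Rightarrow> 11 list \<Rightarrow> 11 list" where
  "word_act w l = foldr (\<lambda>a. mvl (mt (letter_value a))) w l"

lemma vl_word: "vl (act (word_value w) u) = word_act w (vl u)"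
  by (induction w) (simp_all add: word_act_def act_one act_mult vl_act)

lemmas word_eval = word_act_def foldr.simps comp_apply id_apply letter_value.simps mvl_Y mvl_inverse_Y mt_Z mt_inverse_Z

lemma mvl_simps: "mvl [] v = []" "mvl (r # A) v = dot r v # mvl A v"
  by (simp_all add: mvl_def)

lemmas dot_eval = mvl_simps dot.simps list.sel f_arith

text \<open>Representatives of ten orbits of \<open>gY\<close>, each of seven cosets, that together
  form an independent set of 70.\<close>

definition words_L :: "letter list list" where
  "words_L = [[LZ, LZ, LY, LY], [Lz, Lz, LY], [LZ, LY, LZ, LY, LY], [LZ, LZ, LY, LZ, LY], [Lz, LY], [Lz, Lz, Ly],
    [LZ, LY, Lz, Lz, LY], [LZ, LY, LZ, LZ, Ly], [Lz, Ly, Lz, LY], [LZ, Ly, Lz, Lz, LY]]"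

text \<open>Vectors fixed by the twelve Sylow 11-subgroups of \<open>gL\<close>.\<close>

definition base_L :: "11 list list" where
  "base_L = [[0, 1, f8, f3, 0, f3, f7], [f10, f5, 1, 0, 0, f7, f10], [f4, 0, f7, f6, 1, f9, f2],
    [f9, f7, 0, f2, f6, f10, f4], [f5, f2, f6, f5, f9, 1, f2], [f7, f3, f7, f6, f3, f8, f2],
    [f4, f6, f3, f2, f2, f6, f4], [f8, f7, f3, 0, f8, f3, f6], [f4, 0, 0, f4, 0, f8, f5],
    [f10, f6, f7, f7, 0, f4, f6], [f5, 1, 0, f10, f7, f3, f6], [0, f7, f10, f2, f8, f7, f8]]"

definition index_L :: "(nat \<times> nat) list" where
  "index_L = [(0, 6), (9, 9), (3, 2), (0, 11), (2, 3), (6, 9), (2, 6), (4, 5), (6, 3), (6, 1), (5, 7), (3, 0), (9, 1), (4, 7),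
    (0, 8), (2, 2), (4, 11), (5, 9), (2, 4), (9, 6), (6, 0), (9, 5), (5, 6), (0, 1), (4, 4), (2, 10), (3, 4), (3, 10),
    (3, 9), (5, 5), (7, 4), (1, 1), (8, 8), (3, 3), (8, 10), (2, 7), (1, 9), (0, 3), (7, 0), (0, 7), (4, 8), (4, 1),
    (2, 5), (9, 4), (9, 2), (3, 5), (0, 9), (3, 8), (6, 10), (1, 4), (9, 11), (7, 7), (7, 11), (3, 7), (1, 0), (7, 9),
    (1, 10), (6, 2), (4, 9), (6, 11), (8, 9), (1, 8), (0, 2), (7, 5), (7, 8), (7, 10), (2, 0), (1, 11), (9, 7), (1, 6),
    (8, 11), (8, 6), (4, 2), (9, 3), (0, 5), (4, 10), (8, 5), (0, 10), (2, 9), (1, 2), (3, 1), (7, 2), (5, 10), (5, 3),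
    (5, 1), (6, 8), (3, 11), (6, 5), (6, 7), (6, 6), (2, 1), (7, 6), (7, 1), (5, 4), (5, 2), (1, 5), (5, 8), (1, 7),
    (4, 3), (2, 11), (9, 8), (6, 4), (4, 0), (5, 11), (8, 2), (8, 3), (0, 0), (8, 1), (1, 3), (8, 0), (2, 8), (8, 4),
    (7, 3), (9, 10), (3, 6), (9, 0), (0, 4), (8, 7), (5, 0), (4, 6)]"

text \<open>Representatives of 42 orbits of \<open>gY\<close>, giving the independent set of 294
  cosets.\<close>

definition words_K :: "letter list list" where
  "words_K = [[LZ], [LZ, LY, LZ, LY, LZ], [LZ, LZ, LY, LZ, LZ], [Lz, Lz, Ly, Lz, Lz], [LZ, LY, LY, LZ, LY, LZ], [LZ, LZ, LY, LY, LZ, LZ],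
    [LZ, LZ, LY, LZ, LY, LY, LZ], [Lz, Ly, Lz, Ly, LZ, LZ], [LZ, LY, LY, LZ, LZ, LY, LZ], [LZ, LY, LZ, LZ, LY, LZ, LZ], [Lz, LY, LZ, LZ], [Lz, LY, LY, Lz, Lz],
    [LZ, LZ, Ly, LZ, LY, LZ, LZ], [LZ, Ly, LZ, Ly, LZ], [LZ, Ly, LZ, LY, LY, LZ], [LZ, LZ, LY, LZ, LY, LZ, LY, LZ], [Lz, Lz, LY, LY, LY, LZ, LZ], [LZ, LY, LZ, LZ, LY, LY, LZ, LZ],
    [LZ, LZ, Ly, LZ], [LZ, LZ, LY, Lz, Ly, LZ, LZ], [Lz, Lz, Ly, LZ, LY, LZ, LZ], [Lz, LY, Lz, LY, Lz, Lz], [LZ, LY, LZ, Ly, LZ], [LZ, Ly, LZ, Ly, Ly, LZ, LZ],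
    [LZ, Ly, Ly, LZ, LY, LZ, Ly, LZ], [LZ, Ly, Ly, LZ, LY, LY, LZ], [Lz, Ly, Lz, Ly, Lz, Ly, Lz, Lz], [Lz, Lz, LY, Lz, Lz, LY, LZ], [LZ, LY, LY, LZ, Ly, Ly, LZ], [Lz, Lz, Ly, Lz, LY, LZ, LZ],
    [LZ, LZ, LY, LY, LZ, LZ, LY, LZ, LZ], [Lz, Lz, LY, LZ, LZ, Ly, LZ], [LZ, LY, LZ, LZ, Ly, Ly, LZ], [Lz, LY, Lz, Ly, Lz, Lz], [LZ, Ly, LZ, LY, LZ, Ly, LZ], [LZ, Ly, LZ, Ly, LZ, LZ, Ly, LZ],
    [Lz, LY, LZ, LZ, LY, LZ, LZ], [Lz, LY, Lz, Lz, LY, LZ, LZ], [Lz, LY, LY, Lz, Lz, Ly, Ly, LZ, LZ], [Lz, Lz, Ly, LZ, LZ, Ly, LZ], [LZ, Ly, Ly, LZ, Ly, Ly, LZ], [LZ, LZ, LY, LZ, Ly, LZ, LZ, LY, LZ]]"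

text \<open>Vectors fixed by the eight Sylow 7-subgroups of \<open>gK\<close>: the diagonal group
  \<open>gE\<close> changes signs in the all-ones vector, and \<open>f10\<close> is -1.\<close>

definition base_K :: "11 list list" where
  "base_K = [[1, 1, 1, 1, 1, 1, 1], [f10, f10, f10, 1, 1, f10, 1], [f10, f10, 1, 1, f10, 1, f10],
    [f10, 1, 1, f10, 1, f10, f10], [1, 1, f10, 1, f10, f10, f10], [1, f10, f10, f10, 1, 1, f10],
    [1, f10, 1, f10, f10, f10, 1], [f10, 1, f10, f10, f10, 1, 1]]"

definition index_K :: "(nat \<times> nat) list" where
  "index_K = [(31, 4), (33, 1), (10, 1), (10, 5), (23, 3), (16, 1), (11, 4), (2, 3), (28, 2), (4, 7), (1, 4), (22, 5), (22, 4), (21, 6),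
    (20, 4), (29, 3), (15, 1), (26, 1), (19, 3), (32, 5), (28, 7), (32, 3), (39, 5), (6, 1), (6, 3), (17, 3), (28, 1), (34, 0),
    (40, 3), (8, 1), (26, 2), (25, 2), (16, 2), (7, 4), (25, 7), (15, 4), (5, 3), (34, 6), (34, 5), (36, 0), (31, 3), (35, 3),
    (24, 6), (2, 4), (25, 6), (4, 0), (23, 5), (38, 5), (32, 7), (1, 2), (26, 0), (41, 6), (31, 6), (16, 6), (12, 1), (7, 5),
    (29, 7), (33, 0), (33, 5), (1, 0), (31, 7), (37, 7), (31, 2), (23, 7), (35, 6), (11, 2), (13, 1), (40, 6), (6, 5), (8, 7),
    (3, 5), (12, 3), (40, 0), (8, 4), (40, 2), (21, 2), (14, 6), (33, 6), (37, 0), (12, 7), (0, 1), (11, 3), (30, 4), (13, 5),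
    (30, 1), (10, 0), (28, 5), (30, 7), (29, 2), (37, 5), (30, 5), (9, 2), (41, 0), (24, 1), (36, 7), (39, 6), (41, 4), (23, 6),
    (5, 0), (1, 3), (15, 7), (18, 3), (25, 1), (1, 7), (11, 7), (2, 1), (18, 0), (14, 3), (17, 4), (3, 3), (32, 6), (6, 6),
    (24, 7), (8, 3), (6, 2), (32, 0), (28, 6), (0, 6), (13, 2), (35, 5), (0, 4), (16, 7), (8, 0), (37, 4), (39, 0), (22, 2),
    (16, 0), (38, 4), (35, 7), (20, 0), (19, 7), (33, 2), (4, 2), (37, 6), (11, 0), (26, 6), (24, 3), (21, 5), (7, 7), (30, 3),
    (41, 7), (5, 6), (10, 4), (29, 0), (19, 2), (35, 1), (28, 0), (20, 5), (18, 1), (19, 6), (38, 0), (15, 5), (21, 1), (27, 7),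
    (30, 2), (26, 4), (28, 4), (15, 3), (20, 1), (39, 1), (36, 3), (39, 4), (13, 0), (23, 1), (17, 0), (13, 6), (24, 5), (9, 0),
    (9, 4), (22, 3), (21, 7), (27, 3), (7, 1), (20, 7), (38, 7), (19, 0), (14, 4), (41, 2), (22, 7), (5, 2), (34, 3), (25, 0),
    (9, 1), (0, 3), (4, 3), (30, 6), (16, 4), (30, 0), (36, 6), (18, 6), (11, 6), (5, 4), (17, 6), (18, 7), (17, 7), (3, 7),
    (27, 6), (20, 2), (2, 0), (25, 3), (8, 6), (29, 1), (37, 3), (9, 5), (12, 5), (26, 5), (21, 3), (32, 4), (13, 4), (19, 5),
    (10, 7), (38, 1), (29, 4), (2, 2), (40, 7), (2, 5), (22, 6), (40, 4), (21, 4), (31, 0), (15, 6), (9, 3), (3, 0), (13, 3),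
    (27, 0), (1, 5), (25, 4), (4, 5), (6, 7), (39, 3), (24, 4), (5, 7), (3, 1), (12, 6), (18, 2), (20, 3), (26, 7), (22, 1),
    (39, 2), (5, 1), (19, 4), (24, 0), (37, 2), (3, 6), (6, 0), (38, 3), (7, 3), (35, 0), (22, 0), (14, 7), (33, 7), (34, 2),
    (18, 4), (16, 5), (39, 7), (36, 4), (7, 0), (12, 2), (11, 1), (23, 0), (0, 5), (36, 5), (10, 3), (14, 5), (8, 2), (18, 5),
    (27, 2), (0, 2), (16, 3), (36, 1), (4, 4), (23, 2), (9, 7), (15, 0), (7, 2), (40, 5), (17, 1), (41, 3), (41, 1), (38, 2),
    (40, 1), (29, 6), (34, 4), (28, 3), (8, 5), (17, 2), (41, 5), (14, 1), (12, 0), (32, 1), (9, 6), (24, 2), (6, 4), (29, 5),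
    (33, 3), (2, 6), (5, 5), (17, 5), (27, 5), (20, 6), (1, 6), (34, 1), (4, 6), (7, 6), (19, 1), (14, 2), (14, 0), (38, 6),
    (27, 1), (11, 5), (25, 5), (33, 4), (34, 7), (13, 7), (4, 1), (21, 0), (3, 2), (35, 4), (27, 4), (10, 2), (12, 4), (2, 7),
    (35, 2), (36, 2), (26, 3), (23, 4), (0, 0), (31, 1), (0, 7), (10, 6), (1, 1), (3, 4), (32, 2), (37, 1), (31, 5), (15, 2)]"

text \<open>The pairs in \<open>index_L\<close> and \<open>index_K\<close> are sorted by their keys.\<close>

lemma chain_L: "chain 1771561 (map (\<lambda>(i, k). list_key (word_act (words_L ! i) (base_L ! k))) index_L)"
  \<comment> \<open>The number 1771561 is 11^6, larger than every key, so no key is excluded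
    here.\<close>
  apply (simp add: words_L_def base_L_def index_L_def del: chain.simps)
  apply (simp only: word_eval dot_eval key_defs monomials_def)
  apply (simp add: encode_def code_11_simps)
  done

text \<open>The excluded number 1644173 is the key of the all-ones vector. Avoiding it keeps
  \<open>cyc gY\<close>, which \<open>gY\<close> itself normalizes, from being one of the Sylow
  subgroups concerned.\<close>

lemma chain_K: "chain 1644173 (map (\<lambda>(i, k). list_key (word_act (words_K ! i) (base_K ! k))) index_K)"
  apply (simp add: words_K_def base_K_def index_K_def del: chain.simps)
  apply (simp only: word_eval dot_eval key_defs monomials_def)
  apply (simp add: encode_def code_11_simps)
  done

subsection \<open>The lower bound\<close>

lemma commute_power_mult:
  fixes a b :: "'a::monoid_mult"
  assumes "a * b = b * a"
  shows "(a * b) ^ n = a ^ n * b ^ n"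
proof (induction n)
  case (Suc n)
  have "(a * b) ^ Suc n = a * (b * a ^ n) * b ^ n" using Suc by (simp add: mult.assoc)
  also have "b * a ^ n = a ^ n * b" using power_commuting_commutes[OF assms, of n] by simp
  finally show ?case by (simp add: mult.assoc)
qed simp

lemma Sylow_generator:
  assumes "P \<in> Sy (UNIV::j1 set) p" "prime p"
  obtains a where "gord a = p" "cyc a = P"
proof -
  have P: "sbg P" "card P = p" using assms(1) by (auto simp: Sy_iff)
  then obtain a where a: "a \<in> P" "gord a = p" using cauchy_sbg[OF P(1) assms(2)] by auto
  then have "a \<noteq> 1" using gord_eq_1_iff[of a] assms(2) by auto
  then have "cyc a = P" by (rule cyc_prime_card(1)[OF P assms(2) a(1)])
  then show thesis using a(2) that by blast
qed

text \<open>A member with only one Sylow subgroup can be chosen for only one P, so the choice is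
  injective.\<close>

lemma unique_Sylow_count:
  fixes C :: "j1 set set"
  assumes ex: "\<And>P. P \<in> Sy UNIV p \<Longrightarrow> \<exists>M\<in>C. Q M \<and> P \<subseteq> M" and u: "\<And>M. M \<in> C \<Longrightarrow> Q M \<Longrightarrow> nS M p = 1"
  shows "card (Sy (UNIV::j1 set) p) \<le> card {M\<in>C. Q M}"
proof -
  obtain f where f: "\<And>P. P \<in> Sy UNIV p \<Longrightarrow> f P \<in> C \<and> Q (f P) \<and> P \<subseteq> f P" using ex by metis
  have "inj_on f (Sy UNIV p)"
  proof (rule inj_onI)
    fix P R assume P: "P \<in> Sy UNIV p" and R: "R \<in> Sy UNIV p" and e: "f P = f R"
    have "card (Sy (f P) p) = 1" using u[of "f P"] f[OF P] by (simp add: nS_def)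
    then obtain T where T: "Sy (f P) p = {T}" by (auto simp: card_1_singleton_iff)
    have "P \<in> Sy (f P) p" using f[OF P] P by (simp add: Sy_iff)
    moreover have "R \<in> Sy (f P) p" using f[OF R] R e by (simp add: Sy_iff)
    ultimately show "P = R" using T by simp
  qed
  moreover have "f ` Sy UNIV p \<subseteq> {M\<in>C. Q M}" using f by auto
  ultimately show ?thesis by (rule card_inj_on_le) simp
qed

lemma gt_notin_gL: "gt \<notin> gL"
proof
  assume "gt \<in> gL"
  then have "gL = UNIV" using generated_gL_gt[of gL] sbgD[OF sbg_gL] by auto
  then show False using card_gL CARD_j1 by simp
qed

lemma sy_11_conj: "sy 11 \<subseteq> cj gt gL"
proof -
  have "cj gt (cyc gx) = cyc gx" using nrm_cyc_elements(2) by (simp add: nrm_def)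
  then show ?thesis using cyc_gx_in_gL cj_mono_iff[of gt "cyc gx" gL] by (simp add: sy_simps)
qed

text \<open>\<open>gL\<close> contains at least 55 of the 110 elements of the normalizer of
  \<open>sy 11\<close>.\<close>

lemma gL_cosets: "sy 11 \<subseteq> cj g gL \<Longrightarrow> g \<in> gL \<or> inverse gt * g \<in> gL"
proof -
  assume g: "sy 11 \<subseteq> cj g gL"
  let ?I = "nrm (sy 11) \<inter> gL"
  have I: "sbg ?I" by (intro sbg_Int sbg_nrm sbg_gL)
  have "gx \<in> nrm (sy 11)" using subset_nrm[OF sbg_cyc, of gx] self_in_cyc[of gx] by (auto simp: sy_simps)
  then have "gx \<in> ?I" "gZ \<in> ?I" using nrm_sy_elements gen_in_gL by auto
  then have "55 dvd card ?I" using gord_dvd_card[OF I] by (intro dvd_55) (metis gords(1), metis gords(2))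
  then have "55 \<le> card ?I" using card_sbg_pos[OF I] by (intro dvd_imp_le) auto
  then have N: "NN 11 \<le> 2 * card ?I" by (simp add: NN_11)
  have s: "sy 11 \<subseteq> gL" using cyc_gx_in_gL by (simp add: sy_simps)
  show ?thesis using two_cosets[OF _ sbg_gL s N sy_11_conj gt_notin_gL g] by auto
qed

lemma gZ_notin_gK: "inverse gZ \<notin> gK"
proof
  assume "inverse gZ \<in> gK"
  then have "gZ \<in> gK" using sbg_inverse_iff[OF sbg_gK] by blast
  then show False using gord_dvd_card[OF sbg_gK, of gZ] by (simp add: gords card_gK)
qed

lemma cyc_gY_in_gK: "cyc gY \<subseteq> gK"
  by (rule cyc_subset[OF sbg_gK gK_elements(1)])

lemma cyc_gY_conj: "cyc gY \<subseteq> cj (inverse gZ) gK"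
proof (rule cyc_subset[OF sbg_cj[OF sbg_gK]])
  have "ge * gY ^ 6 \<in> gK" by (rule sbgD(2)[OF sbg_gK gK_elements(3) sbg_pow[OF sbg_gK gK_elements(1)]])
  then show "gY \<in> cj (inverse gZ) gK" using rel_E(4) by (simp only: cj_iff inv_cancel(5))
qed

text \<open>\<open>gK\<close> contains at least 21 of the 42 elements of the normalizer of
  \<open>sy 7\<close>.\<close>

lemma gK_cosets: "sy 7 \<subseteq> cj g gK \<Longrightarrow> g \<in> gK \<or> inverse (inverse gZ) * g \<in> gK"
proof -
  assume g: "sy 7 \<subseteq> cj g gK"
  let ?I = "nrm (sy 7) \<inter> gK"
  have I: "sbg ?I" by (intro sbg_Int sbg_nrm sbg_gK)
  have "gY \<in> nrm (sy 7)" using subset_nrm[OF sbg_cyc, of gY] self_in_cyc[of gY] by (auto simp: sy_simps)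
  then have e: "gY \<in> ?I" "gp \<in> ?I" using nrm_sy_elements gK_elements by auto
  have "7 * 3 dvd card ?I"
    using gord_dvd_card[OF I e(1)] gord_dvd_card[OF I e(2)]
    by (intro divides_mult) (simp_all add: gords gord_gp coprime_iff_gcd_eq_1 gcd_non_0_nat)
  then have "21 \<le> card ?I" using card_sbg_pos[OF I] by (auto dest: dvd_imp_le)
  then have N: "NN 7 \<le> 2 * card ?I" by (simp add: NN_7)
  have s: "sy 7 \<subseteq> gK" "sy 7 \<subseteq> cj (inverse gZ) gK" using cyc_gY_in_gK cyc_gY_conj by (simp_all add: sy_simps)
  show ?thesis using two_cosets[OF _ sbg_gK s(1) N s(2) gZ_notin_gK g] by auto
qed

text \<open>
  The cosets of \<open>g\<close>, \<open>g * inverse gZ\<close>, \<dots> form a pentagon in the graph of the cosets of \<open>gK\<close>, and at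
  least three of its vertices are needed to meet all edges.
\<close>

lemma pentagon_count:
  assumes A: "\<And>g. g \<in> A \<or> g * inverse gZ \<in> (A :: j1 set)"
  shows "3 * 175560 \<le> 5 * card A"
proof -
  define f where "f g = (if g \<in> A then 1 else 0 :: nat)" for g
  let ?r = "inverse gZ"
  have inv: "(\<Sum>g\<in>UNIV. f (g * h)) = card A" for h
  proof -
    have "(\<Sum>g\<in>UNIV. f (g * h)) = (\<Sum>g\<in>UNIV. f g)"
      by (rule sum.reindex_bij_witness[of _ "\<lambda>g. g * inverse h" "\<lambda>g. g * h"]) (simp_all add: mult.assoc)
    then show ?thesis by (simp add: f_def sum.If_cases)
  qed
  \<comment> \<open>The step \<open>inverse gZ\<close> has order 5, which closes the walk to a
    pentagon.\<close>
  have r5: "?r ^ 4 * ?r = 1"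
  proof -
    have "gZ * gZ ^ 4 = 1" using gZ5 by (simp add: numeral_eq_Suc)
    then have "?r = gZ ^ 4" by (simp add: mult_eq_one_inv)
    then have "?r ^ 4 * ?r = gZ ^ 20" by (simp add: power_mult [symmetric] power_add [symmetric])
    then show ?thesis using pow_mod[OF gZ5, of 20] by simp
  qed
  have pt: "3 \<le> f g + f (g * ?r) + f (g * ?r ^ 2) + f (g * ?r ^ 3) + f (g * ?r ^ 4)" for g
  proof -
    have "g * ?r ^ 4 * ?r = g" using r5 by (simp add: mult.assoc)
    then have "g * ?r ^ 4 \<in> A \<or> g \<in> A" using A[of "g * ?r ^ 4"] by simp
    moreover have "g \<in> A \<or> g * ?r \<in> A" by (rule A)
    moreover have "g * ?r \<in> A \<or> g * ?r ^ 2 \<in> A" using A[of "g * ?r"] by (simp add: power2_eq_square mult.assoc)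
    moreover have "g * ?r ^ 2 \<in> A \<or> g * ?r ^ 3 \<in> A" using A[of "g * ?r ^ 2"] by (simp add: numeral_eq_Suc mult.assoc)
    moreover have "g * ?r ^ 3 \<in> A \<or> g * ?r ^ 4 \<in> A" using A[of "g * ?r ^ 3"] by (simp add: numeral_eq_Suc mult.assoc)
    ultimately show ?thesis unfolding f_def by auto
  qed
  have "3 * 175560 = (\<Sum>g\<in>(UNIV::j1 set). 3 :: nat)" by (simp add: CARD_j1)
  also have "\<dots> \<le> (\<Sum>g\<in>UNIV. f g + f (g * ?r) + f (g * ?r ^ 2) + f (g * ?r ^ 3) + f (g * ?r ^ 4))"
    by (rule sum_mono) (rule pt)
  also have "\<dots> = 5 * card A" using inv inv[of 1] by (simp add: sum.distrib)
  finally show ?thesis .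
qed

lemma cover_lower_bound:
  fixes C :: "j1 set set"
  assumes C: "\<And>M. M \<in> C \<Longrightarrow> sbg M \<and> M \<noteq> UNIV" "\<Union>C = UNIV"
  shows "5281 \<le> card C"
proof -
  \<comment> \<open>Divisibility of the order by 15 would be too weak, since it also holds for the
    conjugates of \<open>gL\<close>. The condition says that 3 divides the index of a Sylow
    5-subgroup in its normalizer in M.\<close>
  let ?Q15 = "\<lambda>M. 3 dvd dS M 5 \<and> dS M 5 > 0"
  let ?C19 = "{M\<in>C. 19 dvd card M}" and ?C15 = "{M\<in>C. ?Q15 M}" and ?C11 = "{M\<in>C. 11 dvd card M}"
    and ?C7 = "{M\<in>C. 7 dvd card M}"
  have feas: "feasible (card M) (nS M 3, dS M 3) (nS M 5, dS M 5) (nS M 7, dS M 7) (nS M 11, dS M 11) (nS M 19, dS M 19)"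
    if "M \<in> C" for M using proper_feasible C(1)[OF that] by blast
  have mem: "\<exists>M\<in>C. x \<in> M" for x using C(2) by blast
  have "card (Sy (UNIV::j1 set) 19) \<le> card ?C19"
  proof (rule unique_Sylow_count)
    fix P assume "P \<in> Sy (UNIV::j1 set) 19"
    then obtain a where a: "gord a = 19" "cyc a = P" by (rule Sylow_generator) simp
    obtain M where M: "M \<in> C" "a \<in> M" using mem by blast
    have "sbg M" using C(1)[OF M(1)] by simp
    then have "cyc a \<subseteq> M" "19 dvd card M" using cyc_subset M(2) gord_dvd_card[of M a] a(1) by auto
    then show "\<exists>M\<in>C. 19 dvd card M \<and> P \<subseteq> M" using M(1) a(2) by blast
  next
    fix M assume "M \<in> C" "19 dvd card M"
    then show "nS M 19 = 1" using feas by (simp add: feasible_def)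
  qed
  then have c19: "1540 \<le> card ?C19" using Sy_NN[of 19] by (simp add: NN_19)
  have Q15: "5 dvd card M \<and> 3 dvd card M" if M: "sbg M" and q: "?Q15 M" for M
  proof -
    obtain P where P: "P \<in> Sy M 5" using Sy_dS_exists[OF M, of 5] q by auto
    note f = Sy_facts(2)[OF M _ P]
    show ?thesis using f q by (metis dvd_mult dvd_mult2 dvd_triv_left insertI1 insertI2)
  qed
  \<comment> \<open>A product of a generator of P with a commuting element of order 3 lies in some
    member. Both factors are powers of it and lie there too, so this member contains P and satisfies
    the condition.\<close>
  have "card (Sy (UNIV::j1 set) 5) \<le> card ?C15"
  proof (rule unique_Sylow_count)
    fix P assume P: "P \<in> Sy (UNIV::j1 set) 5"
    then obtain a where a: "gord a = 5" "cyc a = P" by (rule Sylow_generator) simp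
    have "3 dvd card (nrm P)" using NN_eq[OF P] by (simp add: NN_5)
    then obtain b where b: "b \<in> nrm P" "gord b = 3" using cauchy_sbg[OF sbg_nrm prime_numerals(2)] by blast
    have P': "sbg P" "card P = 5" using P by (auto simp: Sy_iff)
    have aP: "a \<in> P" using self_in_cyc[of a] a(2) by simp
    have ab: "a * b = b * a"
      by (rule norm_imp_commute[OF P' prime_numerals(3) sbg_cyc b(2)[unfolded gord_def] prime_numerals(2)
            cyc_subset[OF sbg_nrm b(1)] _ aP self_in_cyc]) simp
    have a5: "a ^ 5 = 1" and b3: "b ^ 3 = 1" using pow_gord[of a] pow_gord[of b] a b by simp_all
    have p6: "(a * b) ^ 6 = a" "(a * b) ^ 10 = b"
      unfolding commute_power_mult[OF ab] using pow_mod[OF a5, of 6] pow_mod[OF b3, of 6] pow_mod[OF a5, of 10] pow_mod[OF b3, of 10]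
      by simp_all
    obtain M where M: "M \<in> C" "a * b \<in> M" using mem by blast
    have sM: "sbg M" using C(1)[OF M(1)] by simp
    have abM: "a \<in> M" "b \<in> M" using sbg_pow[OF sM M(2), of 6] sbg_pow[OF sM M(2), of 10] p6 by simp_all
    have PM: "P \<in> Sy M 5" using cyc_subset[OF sM abM(1)] P' a(2) by (simp add: Sy_iff)
    have "3 dvd card (nrm P \<inter> M)" using gord_dvd_card[OF sbg_Int[OF sbg_nrm sM], of b P] b abM by simp
    then have "3 dvd 5 * dS M 5" using Sy_facts(1)[OF sM _ PM] by simp
    then have "3 dvd dS M 5" by presburger
    then show "\<exists>M\<in>C. ?Q15 M \<and> P \<subseteq> M" using M(1) Sy_facts(6)[OF sM _ PM] PM by (auto simp: Sy_iff)
  next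
    fix M assume "M \<in> C" "?Q15 M"
    then show "nS M 5 = 1" using feas by (simp add: feasible_def)
  qed
  then have c15: "2926 \<le> card ?C15" using Sy_NN[of 5] by (simp add: NN_5)
  have p: "7 \<in> primes5" "11 \<in> primes5" by simp_all
  obtain A where A: "card A \<le> card ?C11 * card gL" "\<And>g h. g \<in> A \<Longrightarrow> h \<in> gL \<Longrightarrow> g * h \<in> A" "\<And>g. g \<in> A \<or> g * gt \<in> A"
    by (rule assigned_cosets[OF C p(2) sbg_gL _ gL_cosets]) (metis Sylow_11_in_gL)+
  have "17 * card (- A) \<le> 877800"
  proof (rule card_independent)
    fix g l assume g: "g \<in> - A" "l \<in> gL"
    show "g * l \<in> - A"
    proof
      assume "g * l \<in> A"
      then have "g * l * inverse l \<in> A" by (rule A(2)[OF _ sbgD(3)[OF sbg_gL g(2)]])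
      then show False using g(1) by (simp add: mult.assoc)
    qed
  next
    fix g assume "g \<in> - A"
    then show "g * gt \<notin> - A" using A(3)[of g] by simp
  qed
  moreover have "card (- A) = 175560 - card A" by (simp add: Compl_eq_Diff_UNIV card_Diff_subset CARD_j1)
  ultimately have c11: "188 \<le> card ?C11" using A(1) by (simp add: card_gL)
  obtain B where B: "card B \<le> card ?C7 * card gK" "\<And>g h. g \<in> B \<Longrightarrow> h \<in> gK \<Longrightarrow> g * h \<in> B" "\<And>g. g \<in> B \<or> g * inverse gZ \<in> B"
    by (rule assigned_cosets[OF C p(1) sbg_gK _ gK_cosets]) (metis Sylow_7_in_gK)+
  have c7: "627 \<le> card ?C7" using pentagon_count[OF B(3)] B(1) by (simp add: card_gK)
  \<comment> \<open>The four kinds of members exclude each other by \<open>feasible\<close>, so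
    their numbers may be added.\<close>
  have "?C19 \<inter> ?C15 = {}"
  proof (rule ccontr)
    assume "?C19 \<inter> ?C15 \<noteq> {}"
    then obtain M where M: "M \<in> C" "19 dvd card M" "?Q15 M" by blast
    have "5 dvd card M" "3 dvd card M" using Q15[OF _ M(3)] C(1)[OF M(1)] by auto
    then have "5 * 3 dvd card M" by (intro divides_mult) (simp_all add: coprime_iff_gcd_eq_1 gcd_non_0_nat)
    then show False using feas[OF M(1)] M(2) by (simp add: feasible_def)
  qed
  moreover have "(?C19 \<union> ?C15) \<inter> ?C11 = {}" "(?C19 \<union> ?C15 \<union> ?C11) \<inter> ?C7 = {}"
    using feas unfolding feasible_def fst_conv snd_conv by blast+
  ultimately have "card (?C19 \<union> ?C15 \<union> ?C11 \<union> ?C7) = card ?C19 + card ?C15 + card ?C11 + card ?C7"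
    by (simp add: card_Un_disjoint)
  moreover have "card (?C19 \<union> ?C15 \<union> ?C11 \<union> ?C7) \<le> card C" by (rule card_mono) auto
  ultimately show ?thesis using c19 c15 c11 c7 by linarith
qed

section \<open>Verification of the two separated families\<close>

definition ones :: "11 ^ 7" where
  "ones = vector [1, 1, 1, 1, 1, 1, 1]"

lemma vl_ones: "vl ones = [1, 1, 1, 1, 1, 1, 1]"
  by (simp add: vl_list ones_def vector_7)

lemma vl_fix_vec: "vl fix_vec = [0, 1, f8, f3, 0, f3, f7]"
  by (simp add: vl_list fix_vec_def vector_7)

lemma act_gY_ones: "act gY ones = ones"
proof -
  have "vl (act gY ones) = vl ones" by (simp only: vl_act vl_ones mvl_Y)
  then show ?thesis by (simp only: vl_inj)
qed

lemma fixed_by_gY: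
  assumes "act gY u = u"
  shows "\<exists>c. u = c *s ones"
proof -
  have "vl (act gY u) = vl u" using assms by simp
  then have "mvl (mt gY) (vl u) = vl u" by (simp only: vl_act)
  then have "[u $ 2, u $ 3, u $ 4, u $ 5, u $ 6, u $ 7, u $ 1] = [u $ 1, u $ 2, u $ 3, u $ 4, u $ 5, u $ 6, u $ 7]"
    by (simp only: vl_list mvl_Y)
  then have e: "u $ 2 = u $ 1" "u $ 3 = u $ 2" "u $ 4 = u $ 3" "u $ 5 = u $ 4" "u $ 6 = u $ 5" "u $ 7 = u $ 6"
    unfolding list.inject by blast+
  have "u = (u $ 1) *s ones" by (simp add: vec_eq_iff all_7 ones_def vector_7 e)
  then show ?thesis by blast
qed

definition gE_list :: "j1 list" where
  "gE_list = [1, ge, e1, e2, ge * e1, ge * e2, e1 * e2, ge * (e1 * e2)]"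

lemma set_gE_list: "set gE_list = gE"
  by (simp add: gE_list_def gE_def)

lemma base_K_eq:
  assumes "k < 8"
  shows "vl (act (gE_list ! k) ones) = base_K ! k"
proof -
  have i: "inverse gY = gY ^ 6" "inverse (gY ^ 2) = gY ^ 5"
    using gY_inv_pow[of 1] gY_inv_pow[of 2] by simp_all
  have "map (\<lambda>g. mvl (mt g) (vl ones)) gE_list = base_K"
    by (simp only: gE_list_def base_K_def e1_def e2_def i mt_gen mt_named list.map vl_ones mvl_simps dot.simps list.sel f_arith)
  then have "map (\<lambda>g. mvl (mt g) (vl ones)) gE_list ! k = base_K ! k" by simp
  moreover have "length gE_list = 8" by (simp add: gE_list_def)
  ultimately show ?thesis using assms by (simp add: vl_act)
qed

lemma base_L_eq:
  assumes "k < 12"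
  shows "vl (act (nbr k) fix_vec) = base_L ! k"
proof -
  \<comment> \<open>From index 1 on, every vector is the image of its predecessor under
    \<open>gx\<close>; one list equation checks all ten steps.\<close>
  have c: "map (mvl (mt gx)) (butlast (tl base_L)) = tl (tl base_L)"
    by (simp only: base_L_def list.sel butlast.simps list.distinct if_False if_True simp_thms list.map mt_gx mvl_simps
        dot.simps f_arith)
  have l: "length base_L = 12" by (simp add: base_L_def)
  have s: "vl (act (nbr (Suc a)) fix_vec) = base_L ! Suc a" if "a < 11" for a
    using that
  proof (induction a)
    case 0
    have "vl (act (nbr (Suc 0)) fix_vec) = mvl (mt gw) (vl fix_vec)" by (simp add: nbr_def vl_act)
    also have "\<dots> = base_L ! Suc 0"
      by (simp only: vl_fix_vec mt_gw mvl_simps dot.simps list.sel f_arith base_L_def nth_Cons_0 nth_Cons_Suc)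
    finally show ?case .
  next
    case (Suc a)
    have "vl (act (nbr (Suc (Suc a))) fix_vec) = mvl (mt gx) (vl (act (nbr (Suc a)) fix_vec))"
      by (simp add: nbr_def act_mult vl_act mult.assoc)
    also have "\<dots> = mvl (mt gx) (butlast (tl base_L) ! a)" using Suc l by (simp add: nth_butlast nth_tl)
    also have "\<dots> = map (mvl (mt gx)) (butlast (tl base_L)) ! a" using Suc.prems l by simp
    also have "\<dots> = tl (tl base_L) ! a" by (simp only: c)
    also have "\<dots> = base_L ! Suc (Suc a)" using Suc.prems l by (simp add: nth_tl)
    finally show ?case .
  qed
  show ?thesis
  proof (cases k)
    case 0
    have "nbr 0 = 1" by (simp add: nbr_def)
    then have "vl (act (nbr 0) fix_vec) = vl fix_vec" by (simp add: act_one)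
    also have "\<dots> = base_L ! 0" by (simp only: vl_fix_vec base_L_def nth_Cons_0)
    finally show ?thesis using 0 by simp
  next
    case (Suc a)
    then show ?thesis using s[of a] assms by simp
  qed
qed

lemma word_key: "line_key (act (word_value w * g) u) = list_key (word_act w (vl (act g u)))"
  by (simp add: line_key_def act_mult vl_word)

lemma gL_Sylow_11:
  assumes "P \<in> Sy gL 11"
  shows "\<exists>k<12. P = cj (nbr k) (cyc gx)"
proof -
  have "cyc gx \<in> Sy gL 11" by (rule cyc_in_Sy[OF sbg_gL]) (simp add: El_def gords gen_in_gL)
  then obtain l where l: "l \<in> gL" "P = cj l (cyc gx)" using Sy_facts(7)[OF sbg_gL, of 11 "cyc gx"] assms by auto
  obtain i b where i: "i < 12" "b \<in> gB" "l = nbr i * b" using nbr_decomp[OF l(1)] .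
  obtain a c where ac: "b = gx ^ a * gZ ^ c" using gB_E[OF i(2)] .
  have "gx \<in> nrm (cyc gx)" using subset_nrm[OF sbg_cyc, of gx] self_in_cyc[of gx] by auto
  then have "b \<in> nrm (cyc gx)" unfolding ac using nrm_cyc_elements(1)
    by (intro sbgD(2)[OF sbg_nrm] sbg_pow[OF sbg_nrm])
  then have "cj b (cyc gx) = cyc gx" by (simp add: nrm_def)
  then have "P = cj (nbr i) (cyc gx)" using l(2) i(3) by (simp add: cj_mult)
  then show ?thesis using i(1) by blast
qed

text \<open>A stabilizer of order at least 21 leaves at most eight conjugates, and the elements of
  \<open>gE\<close> yield eight. If two of them gave the same one, an involution of
  \<open>gE\<close> would normalize \<open>cyc gY\<close>; its commutator with \<open>gY\<close>
  would lie in groups of orders 7 and 8, so the two would commute, which is excluded.\<close>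

lemma gK_Sylow_7:
  assumes "P \<in> Sy gK 7"
  shows "\<exists>k<8. P = cj (gE_list ! k) (cyc gY)"
proof -
  let ?P = "cyc gY" and ?O = "(\<lambda>g. cj g (cyc gY)) ` gK"
  have PK: "?P \<in> Sy gK 7" by (rule cyc_in_Sy[OF sbg_gK]) (simp add: El_def gords gK_elements)
  have PO: "P \<in> ?O" using Sy_facts(7)[OF sbg_gK _ PK] assms by auto
  let ?S = "{g\<in>gK. cj g ?P = ?P}"
  have S: "?S = gK \<inter> nrm ?P" by (auto simp: nrm_def)
  have sS: "sbg ?S" unfolding S by (intro sbg_Int sbg_nrm sbg_gK)
  have "gY \<in> nrm ?P" using subset_nrm[OF sbg_cyc, of gY] self_in_cyc[of gY] by auto
  then have e: "gY \<in> ?S" "gp \<in> ?S" unfolding S using nrm_cyc_elements gK_elements by auto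
  have "7 * 3 dvd card ?S"
    using gord_dvd_card[OF sS e(1)] gord_dvd_card[OF sS e(2)]
    by (intro divides_mult) (simp_all add: gords gord_gp coprime_iff_gcd_eq_1 gcd_non_0_nat)
  then have "21 \<le> card ?S" using card_sbg_pos[OF sS] by (auto dest: dvd_imp_le)
  moreover have "card ?O * card ?S = 168" using orbit_stab[OF sbg_gK acts_cj, of ?P] card_gK by simp
  ultimately have O8: "card ?O \<le> 8" using mult_le_mono2[of 21 "card ?S" "card ?O"] by linarith
  have "inj_on (\<lambda>e. cj e ?P) gE"
  proof (rule inj_onI)
    fix a b assume ab: "a \<in> gE" "b \<in> gE" "cj a ?P = cj b ?P"
    let ?f = "inverse a * b"
    have f: "?f \<in> gE" by (intro sbgD(2,3)[OF sbg_gE] ab)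
    have "cj (inverse a) (cj a ?P) = cj (inverse a) (cj b ?P)" using ab(3) by simp
    then have fn: "?f \<in> nrm ?P" by (simp add: nrm_def cj_mult)
    have "?f = 1"
    proof (rule ccontr)
      assume f1: "?f \<noteq> 1"
      then have g2: "gord ?f = 2" using gE_square[OF f] by (intro gord_prime) (simp_all add: power2_eq_square)
      let ?c = "?f * gY * inverse ?f * inverse gY"
      have "?f * gY * inverse ?f \<in> ?P" using conj_in_cj[OF self_in_cyc[of gY], of ?f] fn by (simp add: nrm_def)
      then have c1: "?c \<in> ?P" by (rule sbgD(2)[OF sbg_cyc _ sbgD(3)[OF sbg_cyc self_in_cyc]])
      have "gY * inverse ?f * inverse gY \<in> gE"
        using conj_in_cj[OF sbgD(3)[OF sbg_gE f], of gY] gY_nrm_gE by (simp add: nrm_def)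
      from sbgD(2)[OF sbg_gE f this] have c2: "?c \<in> gE" by (simp add: mult.assoc)
      have "gord ?c dvd 7" "gord ?c dvd 8"
        using gord_dvd_card[OF sbg_cyc c1] gord_dvd_card[OF sbg_gE c2] card_gE gords(3) by (simp_all add: gord_def)
      then have "gord ?c dvd gcd 7 8" by (rule gcd_greatest)
      also have "gcd 7 (8::nat) = 1" by (simp add: gcd_non_0_nat)
      finally have "?c = 1" using gord_eq_1_iff[of ?c] by simp
      then have "?c * gY * ?f = gY * ?f" by simp
      then have "?f * gY = gY * ?f" by (simp add: mult.assoc)
      then have "commuting 7 2" using g2 gords(3) by (metis commuting_orders_def)
      then show False using not_commuting_7 by simp
    qed
    then have "a * (inverse a * b) = a * 1" by simp
    then show "a = b" by simp
  qed
  then have "card ((\<lambda>e. cj e ?P) ` gE) = 8" by (simp add: card_image card_gE)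
  moreover have "gE \<subseteq> gK" using subset_nrm[OF sbg_gE] by (simp add: gK_def)
  then have "(\<lambda>e. cj e ?P) ` gE \<subseteq> ?O" by blast
  ultimately have "(\<lambda>e. cj e ?P) ` gE = ?O" using O8 by (intro card_seteq) simp_all
  then obtain e where e: "e \<in> set gE_list" "P = cj e ?P" using PO set_gE_list by blast
  from e(1) obtain k where "k < length gE_list" "e = gE_list ! k" by (metis in_set_conv_nth)
  moreover have "length gE_list = 8" by (simp add: gE_list_def)
  ultimately show ?thesis using e(2) by metis
qed

lemma Sylow_conj_UNIV: "p \<in> primes5 \<Longrightarrow> cj g (sy p) \<in> Sy UNIV p"
  using sy_in_Sy[of p] by (simp add: Sy_iff sbg_cj)

lemma separated_L: "separated_cosets 11 gx gL fix_vec gt (\<lambda>i. word_value (words_L ! i)) nbr 10 12 line_key"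
proof
  show "11 \<in> primes5" "sy 11 = cyc gx" "sbg gL" "gx \<in> gL" "gt \<notin> gL" "0 < (12::nat)"
    by (simp_all add: sy_simps sbg_gL gen_in_gL gt_notin_gL)
  show "\<And>P. P \<in> Sy gL 11 \<Longrightarrow> \<exists>k<12. P = cj (nbr k) (cyc gx)" by (rule gL_Sylow_11)
  show "\<And>k. k < 12 \<Longrightarrow> nbr k \<in> gL" by (rule nbr_in_gL)
  show "act gx fix_vec = fix_vec" using jordan_chain(1) by (simp add: column_1_jordan act_def)
  show "fix_vec \<noteq> 0"
  proof
    assume "fix_vec = 0"
    then have "fix_vec $ 2 = 0" by simp
    then show False using fix_vec_2 by simp
  qed
  show "\<And>u. act gx u = u \<Longrightarrow> \<exists>c. u = c *s fix_vec" unfolding act_def using fixed_by_gx by blast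
  show "cyc gx \<subseteq> cj gt gL" using sy_11_conj by (simp add: sy_simps)
  show "\<And>u. line_key (act gY u) = line_key u" by (rule line_key_Y)
  show "\<And>c u. c \<noteq> 0 \<Longrightarrow> line_key (c *s u) = line_key u" by (rule line_key_scale)
  have i: "inj_on (\<lambda>(i, k). list_key (word_act (words_L ! i) (base_L ! k))) ({..<10} \<times> {..<12})"
    by (rule chain_inj(1)[OF chain_L]) (simp_all add: index_L_def)
  have e: "inj_on (\<lambda>(i, k). line_key (act (word_value (words_L ! i) * nbr k) fix_vec)) ({..<10} \<times> {..<12})
      \<longleftrightarrow> inj_on (\<lambda>(i, k). list_key (word_act (words_L ! i) (base_L ! k))) ({..<10} \<times> {..<12})"
    by (rule inj_on_cong) (auto simp: word_key base_L_eq)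
  show "inj_on (\<lambda>(i, k). line_key (act (word_value (words_L ! i) * nbr k) fix_vec)) ({..<10} \<times> {..<12})"
    using i e by blast
  fix i k :: nat
  \<comment> \<open>7 does not divide 110, the order of the normalizer of a subgroup of order
    11.\<close>
  show "gY \<notin> nrm (cj (word_value (words_L ! i) * nbr k) (cyc gx))"
  proof
    let ?Q = "cj (word_value (words_L ! i) * nbr k) (cyc gx)"
    assume "gY \<in> nrm ?Q"
    then have "7 dvd card (nrm ?Q)" using gord_dvd_card[OF sbg_nrm, of gY ?Q] by (simp add: gords)
    moreover have "card (nrm ?Q) = NN 11"
      by (rule NN_eq) (use Sylow_conj_UNIV[of 11] in \<open>simp_all add: sy_simps\<close>)
    ultimately show False by (simp add: NN_11)
  qed
qed

lemma line_key_ones: "line_key ones = 1644173"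
  apply (simp only: line_key_def vl_ones dot_eval key_defs monomials_def)
  apply (simp add: encode_def code_11_simps)
  done

lemma separated_K: "separated_cosets 7 gY gK ones (inverse gZ) (\<lambda>i. word_value (words_K ! i)) ((!) gE_list) 42 8 line_key"
proof
  show "7 \<in> primes5" "sy 7 = cyc gY" "sbg gK" "gY \<in> gK" "inverse gZ \<notin> gK" "0 < (8::nat)"
    by (simp_all add: sy_simps sbg_gK gK_elements gZ_notin_gK)
  show "\<And>P. P \<in> Sy gK 7 \<Longrightarrow> \<exists>k<8. P = cj (gE_list ! k) (cyc gY)" by (rule gK_Sylow_7)
  show "gE_list ! k \<in> gK" if k: "k < 8" for k
  proof -
    have "length gE_list = 8" by (simp add: gE_list_def)
    then have "gE_list ! k \<in> set gE_list" using k by simp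
    then show ?thesis using set_gE_list subset_nrm[OF sbg_gE] by (auto simp: gK_def)
  qed
  show "act gY ones = ones" by (rule act_gY_ones)
  show "ones \<noteq> 0"
  proof
    assume "ones = 0"
    then have "ones $ 1 = 0" by simp
    then show False by (simp add: ones_def vector_7)
  qed
  show "\<And>u. act gY u = u \<Longrightarrow> \<exists>c. u = c *s ones" by (rule fixed_by_gY)
  show "cyc gY \<subseteq> cj (inverse gZ) gK" by (rule cyc_gY_conj)
  show "\<And>u. line_key (act gY u) = line_key u" by (rule line_key_Y)
  show "\<And>c u. c \<noteq> 0 \<Longrightarrow> line_key (c *s u) = line_key u" by (rule line_key_scale)
  have i: "inj_on (\<lambda>(i, k). list_key (word_act (words_K ! i) (base_K ! k))) ({..<42} \<times> {..<8})"
    by (rule chain_inj(1)[OF chain_K]) (simp_all add: index_K_def)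
  have e: "inj_on (\<lambda>(i, k). line_key (act (word_value (words_K ! i) * gE_list ! k) ones)) ({..<42} \<times> {..<8})
      \<longleftrightarrow> inj_on (\<lambda>(i, k). list_key (word_act (words_K ! i) (base_K ! k))) ({..<42} \<times> {..<8})"
    by (rule inj_on_cong) (auto simp: word_key base_K_eq)
  show "inj_on (\<lambda>(i, k). line_key (act (word_value (words_K ! i) * gE_list ! k) ones)) ({..<42} \<times> {..<8})"
    using i e by blast
  fix i k :: nat assume ik: "i < 42" "k < 8"
  let ?a = "word_value (words_K ! i) * gE_list ! k"
  \<comment> \<open>If \<open>gY\<close> normalizes a subgroup of order 7, that subgroup is
    \<open>cyc gY\<close>. Its fixed line is spanned by \<open>ones\<close>, whose key does not
    occur in \<open>chain_K\<close>.\<close>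
  show "gY \<notin> nrm (cj ?a (cyc gY))"
  proof
    assume "gY \<in> nrm (cj ?a (cyc gY))"
    then have n: "cyc gY \<subseteq> nrm (cj ?a (cyc gY))" by (rule cyc_subset[OF sbg_nrm])
    have S: "cyc gY \<in> Sy UNIV 7" "cj ?a (cyc gY) \<in> Sy UNIV 7"
      using Sylow_conj_UNIV[of 7] sy_in_Sy[of 7] by (simp_all add: sy_simps)
    note e = exact_primes(3)
    have "cyc gY = cj ?a (cyc gY)"
      using Sy_normal_unique[OF sbg_UNIV exact_primeD(2)[OF e] exact_primeD(1)[OF e], of 1 "cyc gY" "cj ?a (cyc gY)"]
        exact_primeD(3)[OF e] S n by simp
    then have an: "?a \<in> nrm (cyc gY)" by (simp add: nrm_def)
    obtain c where c: "c \<noteq> 0" "act ?a ones = c *s ones"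
      by (rule nrm_act[OF act_gY_ones \<open>ones \<noteq> 0\<close> fixed_by_gY an])
    have "line_key (act ?a ones) = 1644173" using line_key_scale[OF c(1)] c(2) line_key_ones by simp
    moreover have "(\<lambda>(i, k). list_key (word_act (words_K ! i) (base_K ! k))) (i, k) \<noteq> 1644173"
      by (rule chain_inj(2)[OF chain_K, of 42 8]) (use ik in \<open>simp_all add: index_K_def\<close>)
    ultimately show False using ik by (simp add: word_key base_K_eq)
  qed
qed

subsection \<open>The upper bound\<close>

lemma element_normalizes:
  fixes x :: j1
  assumes "prime q" "q dvd gord x"
  obtains a where "gord a = q" "x \<in> nrm (cyc a)" "cyc a \<in> Sy UNIV q"
proof -
  let ?a = "x ^ (gord x div q)"
  have g: "gord ?a = q" by (rule gord_pow_prime[OF assms])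
  have "x * ?a = ?a ^ 1 * x" by (simp add: power_commutes)
  then have "x \<in> nrm (cyc ?a)" by (rule cyc_nrmI)
  moreover have "cyc ?a \<in> Sy UNIV q" using g by (intro cyc_in_Sy sbg_UNIV) (simp add: El_def)
  ultimately show thesis using g that by blast
qed

lemma commuting_gord:
  fixes x :: j1
  assumes "prime p" "prime q" "p dvd gord x" "q dvd gord x"
  shows "commuting p q"
proof -
  have "x ^ i * x ^ j = x ^ j * x ^ i" for i j by (simp add: power_add [symmetric] add.commute)
  then show ?thesis
    unfolding commuting_orders_def using gord_pow_prime[OF assms(1,3)] gord_pow_prime[OF assms(2,4)] by blast
qed

lemma prime_order_element:
  fixes x :: j1
  assumes p: "p \<in> primes5" "p dvd gord x" and d: "\<And>n. n dvd NN p \<Longrightarrow> p dvd n \<Longrightarrow> gord x = n \<Longrightarrow> n = p"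
  obtains g where "x \<in> cj g (sy p)"
proof -
  have pp: "prime p" using p by auto
  obtain a where a: "gord a = p" "x \<in> nrm (cyc a)" "cyc a \<in> Sy UNIV p" by (rule element_normalizes[OF pp p(2)])
  have "gord x dvd NN p" using gord_dvd_card[OF sbg_nrm a(2)] NN_eq[OF a(3) p(1)] by simp
  then have x: "gord x = p" using d[OF _ p(2)] by simp
  have "cyc x \<in> Sy UNIV p" using x by (intro cyc_in_Sy sbg_UNIV) (simp add: El_def)
  moreover have "exact_prime p CARD(j1)" using p(1) exact_primes by auto
  ultimately obtain g where "cyc x = cj g (sy p)" using Sy_UNIV_conj[OF _ sy_in_Sy[OF p(1)]] by metis
  then show thesis using that[of g] self_in_cyc[of x] by simp
qed

text \<open>The orbit of \<open>ge\<close> under \<open>gY\<close> has 1 or 7 members, and 1 would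
  make \<open>gY\<close> commute with an involution. So \<open>gY\<close> permutes the seven
  involutions of \<open>gE\<close> transitively, and every involution is conjugate into
  \<open>gE\<close>.\<close>

lemma involutions_conj:
  assumes "gord (x::j1) = 2"
  obtains h where "x = h * ge * inverse h"
proof -
  let ?f = "\<lambda>a b. a * b * inverse a" and ?C = "cyc gY"
  have act: "acts ?C ?f" by (simp add: acts_def mult.assoc)
  have os: "card ((\<lambda>a. ?f a ge) ` ?C) * card {a\<in>?C. ?f a ge = ge} = 7"
    using orbit_stab[OF sbg_cyc act, of ge] gords(3) by (simp add: gord_def)
  have "gY \<notin> {a\<in>?C. ?f a ge = ge}"
  proof
    assume "gY \<in> {a\<in>?C. ?f a ge = ge}"
    then have "gY * ge * inverse gY * gY = ge * gY" by simp
    then have "gY * ge = ge * gY" by (simp add: mult.assoc)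
    then have "commuting 7 2" using gords by (metis commuting_orders_def)
    then show False using not_commuting_7 by simp
  qed
  then have "{a\<in>?C. ?f a ge = ge} \<noteq> ?C" using self_in_cyc[of gY] by blast
  then have "{a\<in>?C. ?f a ge = ge} \<subset> ?C" by blast
  then have "card {a\<in>?C. ?f a ge = ge} < card ?C" by (intro psubset_card_mono) auto
  then have "card {a\<in>?C. ?f a ge = ge} < 7" using gords(3) by (simp add: gord_def)
  moreover have "card {a\<in>?C. ?f a ge = ge} dvd 7" using os by (metis dvd_triv_right)
  then have "card {a\<in>?C. ?f a ge = ge} = 1 \<or> card {a\<in>?C. ?f a ge = ge} = 7"
    using prime_numerals(4) by (simp add: prime_nat_iff)
  ultimately have "card {a\<in>?C. ?f a ge = ge} = 1" by simp
  then have c7: "card ((\<lambda>a. ?f a ge) ` ?C) = 7" using os by simp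
  have sub: "(\<lambda>a. ?f a ge) ` ?C \<subseteq> gE - {1}"
  proof
    fix b assume "b \<in> (\<lambda>a. ?f a ge) ` ?C"
    then obtain a where a: "a \<in> ?C" "b = ?f a ge" by blast
    have "a \<in> nrm gE" using a(1) cyc_subset[OF sbg_nrm gY_nrm_gE] by blast
    moreover have "ge \<in> gE" by (simp add: gE_def)
    ultimately have "b \<in> gE" using conj_in_cj[of ge gE a] a(2) by (simp add: nrm_def)
    moreover have "gord b = 2" using a(2) by (simp add: gord_conj gords)
    then have "b \<noteq> 1" using gord_eq_1_iff[of b] by auto
    ultimately show "b \<in> gE - {1}" by simp
  qed
  have "card (gE - {1}) = 7" using sbgD(1)[OF sbg_gE] card_gE by (simp add: card_Diff_singleton)
  then have O: "(\<lambda>a. ?f a ge) ` ?C = gE - {1}" using sub c7 by (intro card_subset_eq) simp_all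
  have cx: "sbg (cyc x)" "cyc x \<subseteq> UNIV" "card (cyc x) = 2 ^ 1" using assms sbg_cyc by (simp_all add: gord_def)
  have c8: "CARD(j1) = card gE * 21945" by (simp add: CARD_j1 card_gE)
  have nd: "\<not> 2 dvd (21945::nat)" by simp
  obtain g where g: "cyc x \<subseteq> cj g gE"
    by (rule sylow_conj[OF sbg_UNIV sbg_gE subset_UNIV c8 prime_numerals(1) nd cx])
  have "x \<in> cj g gE" using g self_in_cyc[of x] by blast
  then obtain b where b: "b \<in> gE" "x = g * b * inverse g" by (auto simp: cj_def)
  have "b \<noteq> 1" using b(2) assms gord_eq_1_iff[of x] by auto
  then have "b \<in> (\<lambda>a. ?f a ge) ` ?C" using O b(1) by blast
  then obtain a where "b = a * ge * inverse a" by blast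
  then have "x = (g * a) * ge * inverse (g * a)" using b(2) by (simp add: mult.assoc)
  then show thesis by (rule that)
qed

lemma odd_part:
  fixes n :: nat
  assumes "n dvd 175560" "\<not> 3 dvd n" "\<not> 5 dvd n" "\<not> 7 dvd n" "\<not> 11 dvd n" "\<not> 19 dvd n"
  shows "n dvd 8"
proof -
  have "n dvd 3 * 58520" using assms(1) by simp
  then have "n dvd 5 * 11704" using dvd_split[of n 3 58520] assms by simp
  then have "n dvd 7 * 1672" using dvd_split[of n 5 11704] assms by simp
  then have "n dvd 11 * 152" using dvd_split[of n 7 1672] assms by simp
  then have "n dvd 19 * 8" using dvd_split[of n 11 152] assms by simp
  then show ?thesis using dvd_split[of n 19 8] assms by simp
qed

text \<open>If 3 divides the order of x, a power of x generates the required subgroup; if 5 does,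
  the partner subgroup serves. The remaining nontrivial elements are involutions, all conjugate to
  \<open>gt\<close>, which normalizes \<open>sy 3\<close>.\<close>

lemma normalizer_of_order_3:
  assumes x: "\<not> 7 dvd gord (x::j1)" "\<not> 11 dvd gord x" "\<not> 19 dvd gord x"
  shows "\<exists>P\<in>Sy UNIV 3. x \<in> nrm P"
proof -
  consider "3 dvd gord x" | "5 dvd gord x" | "\<not> 3 dvd gord x" "\<not> 5 dvd gord x" by blast
  then show ?thesis
  proof cases
    case 1
    obtain a where "gord a = 3" "x \<in> nrm (cyc a)" "cyc a \<in> Sy UNIV 3"
      by (rule element_normalizes[OF prime_numerals(2) 1])
    then show ?thesis by blast
  next
    case 2
    obtain a where a: "gord a = 5" "x \<in> nrm (cyc a)" "cyc a \<in> Sy UNIV 5"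
      by (rule element_normalizes[OF prime_numerals(3) 2])
    obtain g where "cyc a = cj g (sy 5)" using Sy_UNIV_conj[OF exact_primes(2) sy_in_Sy[of 5] a(3)] by auto
    then have "x \<in> nrm (cj g (sy 3))" using a(2) by (simp add: nrm_cj nrm_5_eq_nrm_3)
    then show ?thesis using Sylow_conj_UNIV[of 3 g] by auto
  next
    case 3
    have "gord x dvd 175560" using gord_dvd_card[OF sbg_UNIV, of x] CARD_j1 by simp
    then have "gord x dvd 2 ^ 3" using odd_part[of "gord x"] 3 x by simp
    then have "x ^ 2 ^ 3 = 1" by (simp only: pow_eq_1_iff)
    then have sq: "x * x = 1" by (rule El_2_square)
    show ?thesis
    proof (cases "x = 1")
      case True
      then show ?thesis using sbgD(1)[OF sbg_nrm] sy_in_Sy[of 3] by blast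
    next
      case False
      then have "gord x = 2" using sq by (intro gord_prime) (simp_all add: power2_eq_square)
      then obtain h where h: "x = h * ge * inverse h" by (rule involutions_conj)
      obtain k where k: "gt = k * ge * inverse k" by (rule involutions_conj[OF gords(5)])
      have "inverse k * gt * k = ge" unfolding k by (simp add: mult.assoc)
      then have "x = h * (inverse k * gt * k) * inverse h" using h by simp
      then have "x = (h * inverse k) * gt * inverse (h * inverse k)" by (simp add: mult.assoc)
      moreover have "(h * inverse k) * gt * inverse (h * inverse k) \<in> cj (h * inverse k) (nrm (sy 3))"
        by (rule conj_in_cj[OF nrm_sy_elements(9)])
      ultimately have "x \<in> nrm (cj (h * inverse k) (sy 3))" by (simp add: nrm_cj)
      then show ?thesis using Sylow_conj_UNIV[of 3] by blast
    qed
  qed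
qed

text \<open>Elements of order divisible by 7 or 11 have prime order, because the other primes in the
  normalizer orders are excluded by noncommutation. Hence they lie in Sylow subgroups, which the
  selected conjugates of \<open>gL\<close> and \<open>gK\<close> contain.\<close>

lemma cover_upper_bound:
  obtains C :: "j1 set set" where "card C \<le> 5413" "\<forall>M\<in>C. sbg M \<and> M \<noteq> UNIV" "\<Union>C = UNIV"
proof -
  obtain CL where CL: "card CL * card gL + 7 * 10 * card gL \<le> 175560" "\<And>M. M \<in> CL \<Longrightarrow> \<exists>g. M = cj g gL"
    "\<And>g x. x \<in> cj g (cyc gx) \<Longrightarrow> \<exists>M\<in>CL. x \<in> M"
    using separated_cosets.complement_cosets[OF separated_L] by blast
  obtain CK where CK: "card CK * card gK + 7 * 42 * card gK \<le> 175560" "\<And>M. M \<in> CK \<Longrightarrow> \<exists>g. M = cj g gK"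
    "\<And>g x. x \<in> cj g (cyc gY) \<Longrightarrow> \<exists>M\<in>CK. x \<in> M"
    using separated_cosets.complement_cosets[OF separated_K] by blast
  let ?N19 = "nrm ` Sy (UNIV::j1 set) 19" and ?N3 = "nrm ` Sy (UNIV::j1 set) 3"
  let ?C = "?N19 \<union> ?N3 \<union> CL \<union> CK"
  have "card ?N19 \<le> 1540" using card_image_le[of "Sy (UNIV::j1 set) 19" nrm] Sy_NN[of 19] by (simp add: NN_19)
  moreover have "card ?N3 \<le> 2926" using card_image_le[of "Sy (UNIV::j1 set) 3" nrm] Sy_NN[of 3] by (simp add: NN_3)
  moreover have "card CL \<le> 196" "card CK \<le> 751" using CL(1) CK(1) by (simp_all add: card_gL card_gK)
  moreover have "card ?C \<le> card ?N19 + card ?N3 + card CL + card CK"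
    by (meson add_le_mono card_Un_le le_trans order_refl)
  ultimately have 1: "card ?C \<le> 5413" by linarith
  have 2: "sbg M \<and> M \<noteq> UNIV" if M: "M \<in> ?C" for M
  proof -
    consider "M \<in> ?N19" | "M \<in> ?N3" | "M \<in> CL" | "M \<in> CK" using M by blast
    then have "sbg M \<and> card M \<noteq> 175560"
    proof cases
      case 1
      then obtain P where "P \<in> Sy UNIV 19" "M = nrm P" by blast
      then show ?thesis using NN_eq[of P 19] by (simp add: sbg_nrm NN_19)
    next
      case 2
      then obtain P where "P \<in> Sy UNIV 3" "M = nrm P" by blast
      then show ?thesis using NN_eq[of P 3] by (simp add: sbg_nrm NN_3)
    next
      case 3
      then obtain g where "M = cj g gL" using CL(2) by blast
      then show ?thesis by (simp add: sbg_cj sbg_gL card_gL)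
    next
      case 4
      then obtain g where "M = cj g gK" using CK(2) by blast
      then show ?thesis by (simp add: sbg_cj sbg_gK card_gK)
    qed
    then show ?thesis using CARD_j1 by auto
  qed
  have "x \<in> \<Union>?C" for x
  proof -
    consider "19 dvd gord x" | "7 dvd gord x" | "11 dvd gord x" | "\<not> 7 dvd gord x" "\<not> 11 dvd gord x" "\<not> 19 dvd gord x" by blast
    then show ?thesis
    proof cases
      case 1
      obtain a where "gord a = 19" "x \<in> nrm (cyc a)" "cyc a \<in> Sy UNIV 19"
        by (rule element_normalizes[OF prime_numerals(6) 1])
      then show ?thesis by blast
    next
      case 2
      have no: "\<not> 2 dvd gord x" "\<not> 3 dvd gord x"
        using commuting_gord[OF prime_numerals(4) prime_numerals(1) 2] commuting_gord[OF prime_numerals(4) prime_numerals(2) 2]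
          not_commuting_7 by blast+
      obtain g where "x \<in> cj g (sy 7)"
      proof (rule prime_order_element[OF _ 2])
        fix n assume n: "n dvd NN 7" "7 dvd n" "gord x = n"
        have "n dvd 2 * 21" using n(1) by (simp add: NN_7)
        then have "n dvd 3 * 7" using dvd_split[of n 2 21] no n(3) by simp
        then have "n dvd 7" using dvd_split[of n 3 7] no n(3) by simp
        then show "n = 7" using n(2) by (rule dvd_antisym)
      qed simp_all
      then show ?thesis using CK(3)[of x g] by (auto simp: sy_simps)
    next
      case 3
      have no: "\<not> 2 dvd gord x" "\<not> 5 dvd gord x"
        using commuting_gord[OF prime_numerals(5) prime_numerals(1) 3] commuting_gord[OF prime_numerals(5) prime_numerals(3) 3]
          not_commuting_11_2 not_commuting_11_5 by blast+
      obtain g where "x \<in> cj g (sy 11)"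
      proof (rule prime_order_element[OF _ 3])
        fix n assume n: "n dvd NN 11" "11 dvd n" "gord x = n"
        have "n dvd 2 * 55" using n(1) by (simp add: NN_11)
        then have "n dvd 5 * 11" using dvd_split[of n 2 55] no n(3) by simp
        then have "n dvd 11" using dvd_split[of n 5 11] no n(3) by simp
        then show "n = 11" using n(2) by (rule dvd_antisym)
      qed simp_all
      then show ?thesis using CL(3)[of x g] by (auto simp: sy_simps)
    next
      case 4
      then show ?thesis using normalizer_of_order_3[of x] by blast
    qed
  qed
  then have 3: "\<Union>?C = UNIV" by blast
  have "\<forall>M\<in>?C. sbg M \<and> M \<noteq> UNIV" using 2 by blast
  then show thesis by (rule that[OF 1 _ 3])
qed

section \<open>Transfer between covers of \<open>J1\<close> and covers of the type
  \<open>j1\<close>\<close>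

lemma is_cover_pullback:
  assumes C: "is_cover J1 C"
  shows "5281 \<le> card C"
proof -
  let ?f = "\<lambda>H. {g. Rep_j1 g \<in> H}"
  have H: "subgroup H J1" "H \<noteq> carrier J1" if "H \<in> C" for H using C that by (auto simp: is_cover_def)
  have "5281 \<le> card (?f ` C)"
  proof (rule cover_lower_bound)
    fix M assume "M \<in> ?f ` C"
    then obtain H where HC: "H \<in> C" "M = ?f H" by blast
    note s = H(1)[OF HC(1)]
    have "sbg M"
    proof (rule sbg_finiteI)
      show "1 \<in> M" using subgroup.one_closed[OF s] HC(2) by (simp add: one_j1.rep_eq J1_simps)
      fix a b assume "a \<in> M" "b \<in> M"
      then show "a * b \<in> M" using subgroup.m_closed[OF s, of "Rep_j1 a" "Rep_j1 b"] HC(2) by (simp add: times_j1.rep_eq J1_simps)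
    qed
    moreover have "M \<noteq> UNIV"
    proof
      assume "M = UNIV"
      then have all: "Rep_j1 g \<in> H" for g using HC(2) by auto
      have "carrier J1 \<subseteq> H"
      proof
        fix x assume "x \<in> carrier J1"
        then have "Rep_j1 (Abs_j1 x) = x" by (rule Abs_j1_inverse)
        then show "x \<in> H" using all[of "Abs_j1 x"] by simp
      qed
      then show False using H(2)[OF HC(1)] subgroup.subset[OF s] by blast
    qed
    ultimately show "sbg M \<and> M \<noteq> UNIV" by simp
  next
    have "g \<in> \<Union>(?f ` C)" for g
    proof -
      have "Rep_j1 g \<in> \<Union>C" using C Rep_j1[of g] by (simp add: is_cover_def)
      then show ?thesis by blast
    qed
    then show "\<Union>(?f ` C) = UNIV" by blast
  qed
  also have "card (?f ` C) \<le> card C" using C by (intro card_image_le) (simp add: is_cover_def)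
  finally show ?thesis .
qed

lemma is_cover_exists: "\<exists>C. is_cover J1 C \<and> card C \<le> 5413"
proof -
  obtain C :: "j1 set set" where C: "card C \<le> 5413" "\<forall>M\<in>C. sbg M \<and> M \<noteq> UNIV" "\<Union>C = UNIV"
    by (rule cover_upper_bound)
  let ?D = "(`) Rep_j1 ` C"
  have "is_cover J1 ?D"
    unfolding is_cover_def
  proof (intro conjI ballI)
    show "finite ?D" by simp
    fix H assume "H \<in> ?D"
    then obtain M where M: "M \<in> C" "H = Rep_j1 ` M" by blast
    have sM: "sbg M" "M \<noteq> UNIV" using bspec[OF C(2) M(1)] by auto
    show "subgroup H J1"
    proof (rule group.subgroupI[OF group_J1])
      show "H \<subseteq> carrier J1" using M(2) Rep_j1 by blast
      show "H \<noteq> {}" using M(2) sbgD(1)[OF sM(1)] by blast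
      fix a assume "a \<in> H"
      then obtain g where g: "g \<in> M" "a = Rep_j1 g" using M(2) by blast
      have "mult J1 (Rep_j1 (inverse g)) a = one J1"
        unfolding g(2) J1_simps times_j1.rep_eq [symmetric] one_j1.rep_eq [symmetric] by simp
      then have "m_inv J1 a = Rep_j1 (inverse g)"
        using group.inv_equality[OF group_J1, of "Rep_j1 (inverse g)" a] g(2) Rep_j1 by blast
      then show "m_inv J1 a \<in> H" using M(2) sbgD(3)[OF sM(1) g(1)] by blast
    next
      fix a b assume "a \<in> H" "b \<in> H"
      then obtain g h where g: "g \<in> M" "a = Rep_j1 g" "h \<in> M" "b = Rep_j1 h" using M(2) by blast
      have "mult J1 a b = Rep_j1 (g * h)" unfolding g J1_simps times_j1.rep_eq ..
      then show "mult J1 a b \<in> H" using M(2) sbgD(2)[OF sM(1) g(1,3)] by blast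
    qed
    show "H \<noteq> carrier J1"
    proof
      assume e: "H = carrier J1"
      have "g \<in> M" for g
      proof -
        have "Rep_j1 g \<in> Rep_j1 ` M" using e M(2) Rep_j1[of g] by simp
        then show ?thesis by (auto simp: Rep_j1_inject)
      qed
      then show False using sM(2) by blast
    qed
  next
    show "\<Union>?D = carrier J1"
    proof
      show "\<Union>?D \<subseteq> carrier J1" using Rep_j1 by blast
      show "carrier J1 \<subseteq> \<Union>?D"
      proof
        fix x assume "x \<in> carrier J1"
        then have x: "Rep_j1 (Abs_j1 x) = x" by (rule Abs_j1_inverse)
        have "Abs_j1 x \<in> \<Union>C" using C(3) by simp
        then obtain M where "M \<in> C" "Abs_j1 x \<in> M" by blast
        then show "x \<in> \<Union>?D" using x by (metis UN_iff image_eqI)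
      qed
    qed
  qed
  moreover have "card ?D \<le> 5413" using C(1) card_image_le[of C "(`) Rep_j1"] by simp
  ultimately show ?thesis by blast
qed

theorem theorem7p1:
  shows "5281 \<le> covering_number J1 \<and> covering_number J1 \<le> 5414"
proof
  show "5281 \<le> covering_number J1"
    unfolding covering_number_def
  proof (rule INF_greatest)
    fix C assume "C \<in> {C. is_cover J1 C}"
    then have "5281 \<le> card C" using is_cover_pullback by simp
    then show "5281 \<le> enat (card C)" by (simp add: numeral_eq_enat)
  qed
  obtain C where C: "is_cover J1 C" "card C \<le> 5413" using is_cover_exists by blast
  then have "enat (card C) \<le> 5414" by (simp add: numeral_eq_enat)
  then show "covering_number J1 \<le> 5414"
    unfolding covering_number_def using C(1) by (intro INF_lower2[of C]) simp_all
qed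

end
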